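(* Assume that: (A.1) the matrix $A$ is irreducible; (A.2) the subsystem $X_M$ has a periodic point for $\sigma$; (A.3) $\varphi:X\to\mathbb{R}$ is summable and satisfies $[\varphi]_{k+1}<\infty$ for some (from now on fixed) integer $k\ge 1$. Put $c_1:=[\varphi]_{k+1}\theta/(1-\theta)$. Then: (1) There exists a triplet $(\lambda,g,\nu)$ such that (i) $\lambda=\exp(P(\varphi|_{X_M}))$, and $\lambda$ is the positive spectral radius of both operators $\mathcal{L}_M:F^k_b(X)\to F^k_b(X)$ and $\mathcal{L}_M:C_b(X)\to C_b(X)$; (ii) $g\in\Lambda^k_{c_1}(X)$, $\|g\|_\infty=1$ and $\mathcal{L}_M g=\lambda g$; (iii) $\nu$ is a Borel probability measure on $X$ supported on $X_M$ and $\mathcal{L}_M^*\nu=\lambda\nu$. (2) If $X_A$ is not a finite single orbit, then the essential spectral radius $r_{\mathrm{ess}}(\mathcal{L}_M)$ of $\mathcal{L}_M:F^k_b(X)\to F^k_b(X)$ satisfies $\lambda\theta\le r_{\mathrm{ess}}(\mathcal{L}_M)<\lambda$. In particular, for every $r\in[0,\lambda\theta)$ except for at most countably many, every $p\in\mathbb{C}$ with $|p|=r$ is an eigenvalue of $\mathcal{L}_M:F^k_b(X)\to F^k_b(X)$ with infinite multiplicity. If $X_A$ is a finite single orbit, then $r_{\mathrm{ess}}(\mathcal{L}_M)=0$.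
   Context: Let $S$ be a countable set, $A=(A(ij))_{i,j\in S}$ a zero-one matrix, and $X=X_A=\{\omega=\omega_0\omega_1\cdots\in\prod_{n\ge0}S: A(\omega_i\omega_{i+1})=1 \text{ for all } i\ge 0\}$ with shift $(\sigma\omega)_n=\omega_{n+1}$. For $w\in S^n$, $[w]=\{\omega\in X:\omega_0\cdots\omega_{n-1}=w\}$. Fix $\theta\in(0,1)$ and the metric $d_\theta(\omega,\upsilon)=\theta^{\min\{n\ge0:\omega_n\ne\upsilon_n\}}$ for $\omega\ne\upsilon$, $d_\theta(\omega,\omega)=0$. For a function $f$ on $X$, $\mathrm{var}_n f=\sup\{|f(\omega)-f(\upsilon)|:\omega_i=\upsilon_i,\ 0\le i\le n-1\}$ and $[f]_k=\sup_{n\ge k}\mathrm{var}_nf/\theta^n$. $C(X)$ is the set of complex-valued continuous functions on $X$; $C_b(X)$ is the Banach space of bounded ones with norm $\|\cdot\|_\infty$; $F^k_b(X)$ is the Banach space of bounded $f\in C(X)$ with $[f]_k<\infty$, with norm $\|f\|_k=\|f\|_\infty+[f]_k$. $S_0\subset S$ is nonempty and $M=(M(ij))_{i,j\in S_0}$ is a zero-one matrix with $M(ij)\le A(ij)$; put $M(ij)=0$ if $i\notin S_0$ or $j\notin S_0$. $X_M=\{\omega\in\prod_{n\ge0}S_0: M(\omega_n\omega_{n+1})=1\ \forall n\ge0\}\subset X$. A zero-one matrix $B$ indexed by a set $T$ is irreducible if for all $a,b\in T$ there are $n\ge1$ and a word $w_1\cdots w_{n+1}$ with $w_1=a$, $w_{n+1}=b$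 and $B(w_iw_{i+1})=1$ for $1\le i\le n$. A function $\varphi:X\to\mathbb{R}$ is summable if $\sum_{s\in S:[s]\ne\emptyset}\exp(\sup_{[s]}\varphi)<\infty$. With $S_n\varphi=\sum_{i=0}^{n-1}\varphi\circ\sigma^i$, the topological pressure is $P(\varphi)=\lim_{n\to\infty}\frac1n\log\sum_{w\in S^n:[w]\neq\emptyset}\exp(\sup_{[w]}S_n\varphi)$, and $P(\varphi|_{X_M})$ is defined in the same way on $X_M$, i.e. with $[w]$ replaced by $[w]\cap X_M$. The operator $\mathcal{L}_M=\mathcal{L}_{M,\varphi}$ is $\mathcal{L}_Mf(\omega)=\sum_{a\in S:M(a\omega_0)=1}e^{\varphi(a\cdot\omega)}f(a\cdot\omega)$ for $f:X\to\mathbb{C}$, $\omega\in X$, where $a\cdot\omega=a\omega_0\omega_1\cdots$. It is bounded on $C_b(X)$ and on $F_b^k(X)$. $\mathcal{L}_M^*\nu=\lambda\nu$ means $\int\mathcal{L}_Mf\,d\nu=\lambda\int f\,d\nu$ for all $f\in C_b(X)$. For $c\ge0$, $\Lambda^k_c(X)=\{f\in C(X): f\ge0,\ f(\omega)\le e^{c\,d_\theta(\omega,\upsilon)}f(\upsilon)\text{ whenever }\omega\in[\upsilon_0\cdots\upsilon_{k-1}]\}$. The essential spectral radius is the infimum of $r\ge 0$ such that every spectral value of modulus $>r$ is an isolated eigenvalue of finite algebraic multiplicity. "$X_A$ is a finite single orbit" means $X_A=\{\omega,\sigma\omega,\dots,\sigma^{q-1}\omega\}$ for some $\omega$ and $q\geq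 1$. *)

theory Defs
  imports
    "HOL-Complex_Analysis.Complex_Analysis"
    "HOL-Library.Function_Algebras"
begin

section \<open>Symbolic spaces\<close>

definition zero_one_matrix :: "'s set \<Rightarrow> ('s \<Rightarrow> 's \<Rightarrow> nat) \<Rightarrow> bool" where
  "zero_one_matrix T B \<longleftrightarrow> (\<forall>a\<in>T. \<forall>b\<in>T. B a b \<in> {0, 1})"

definition irreducible_matrix :: "'s set \<Rightarrow> ('s \<Rightarrow> 's \<Rightarrow> nat) \<Rightarrow> bool" where
  "irreducible_matrix T B \<longleftrightarrow>
    (\<forall>a\<in>T. \<forall>b\<in>T. \<exists>n\<ge>1. \<exists>w :: nat \<Rightarrow> 's.
       (\<forall>i\<in>{1..n+1}. w i \<in> T) \<and> w 1 = a \<and> w (n+1) = b \<and>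
       (\<forall>i\<in>{1..n}. B (w i) (w (i+1)) = 1))"

definition markov_shift :: "'s set \<Rightarrow> ('s \<Rightarrow> 's \<Rightarrow> nat) \<Rightarrow> (nat \<Rightarrow> 's) set" where
  "markov_shift T B = {\<omega>. (\<forall>n. \<omega> n \<in> T) \<and> (\<forall>n. B (\<omega> n) (\<omega> (n+1)) = 1)}"

definition shift :: "(nat \<Rightarrow> 's) \<Rightarrow> (nat \<Rightarrow> 's)" where
  "shift \<omega> = (\<lambda>n. \<omega> (n+1))"

text \<open>The sequence \<open>a \<omega>\<^sub>0 \<omega>\<^sub>1 \<dots>\<close>.\<close>

definition prepend :: "'s \<Rightarrow> (nat \<Rightarrow> 's) \<Rightarrow> (nat \<Rightarrow> 's)" where
  "prepend a \<omega> = case_nat a \<omega>"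

text \<open>Since \<open>X\<^sub>M \<subseteq> X\<close>, the set \<open>[w] \<inter> X\<^sub>M\<close> is \<open>cylinder X\<^sub>M w\<close>.\<close>

definition cylinder :: "(nat \<Rightarrow> 's) set \<Rightarrow> 's list \<Rightarrow> (nat \<Rightarrow> 's) set" where
  "cylinder X w = {\<omega>\<in>X. \<forall>i<length w. \<omega> i = w ! i}"

definition has_periodic_point :: "(nat \<Rightarrow> 's) set \<Rightarrow> bool" where
  "has_periodic_point Y \<longleftrightarrow> (\<exists>\<omega>\<in>Y. \<exists>q\<ge>1. (shift ^^ q) \<omega> = \<omega>)"

definition finite_single_orbit :: "(nat \<Rightarrow> 's) set \<Rightarrow> bool" where
  "finite_single_orbit X \<longleftrightarrow> (\<exists>\<omega>. \<exists>q\<ge>1. X = {(shift ^^ i) \<omega> |i. i < q})"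

definition d_theta :: "real \<Rightarrow> (nat \<Rightarrow> 's) \<Rightarrow> (nat \<Rightarrow> 's) \<Rightarrow> real" where
  "d_theta \<theta> \<omega> \<upsilon> = (if \<omega> = \<upsilon> then 0 else \<theta> ^ (LEAST n. \<omega> n \<noteq> \<upsilon> n))"

lemma Metric_space_d_theta:
  assumes "0 < \<theta>" "\<theta> < 1"
  shows "Metric_space X (d_theta \<theta>)"
proof
  fix x y z :: "nat \<Rightarrow> 's"
  show "0 \<le> d_theta \<theta> x y" using assms by (simp add: d_theta_def)
  show "d_theta \<theta> x y = d_theta \<theta> y x"
  proof -
    have "(\<lambda>n. x n \<noteq> y n) = (\<lambda>n. y n \<noteq> x n)" by (rule ext) (rule neq_commute)
    then show ?thesis by (simp only: d_theta_def eq_commute[of x y])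
  qed
  show "d_theta \<theta> x y = 0 \<longleftrightarrow> x = y" using assms by (simp add: d_theta_def)
  show "d_theta \<theta> x z \<le> d_theta \<theta> x y + d_theta \<theta> y z"
  proof (cases "x = z \<or> x = y \<or> y = z")
    case True
    then show ?thesis using assms by (auto simp: d_theta_def)
  next
    case False
    define m where "m = (LEAST n. x n \<noteq> z n)"
    from False obtain n where "x n \<noteq> z n" by (auto simp: fun_eq_iff)
    then have "x m \<noteq> z m" unfolding m_def by (rule LeastI)
    then have "x m \<noteq> y m \<or> y m \<noteq> z m" by auto
    then have "(LEAST n. x n \<noteq> y n) \<le> m \<or> (LEAST n. y n \<noteq> z n) \<le> m"
      by (auto intro: Least_le)
    then have "\<theta> ^ m \<le> \<theta> ^ (LEAST n. x n \<noteq> y n) \<or> \<theta> ^ m \<le> \<theta> ^ (LEAST n. y n \<noteq> z n)"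
      using assms by (auto intro: power_decreasing)
    moreover have "0 \<le> \<theta> ^ (LEAST n. x n \<noteq> y n)" "0 \<le> \<theta> ^ (LEAST n. y n \<noteq> z n)"
      using assms by simp_all
    ultimately have "\<theta> ^ m \<le> \<theta> ^ (LEAST n. x n \<noteq> y n) + \<theta> ^ (LEAST n. y n \<noteq> z n)"
      by linarith
    then show ?thesis using False by (simp add: d_theta_def m_def)
  qed
qed

definition theta_topology :: "real \<Rightarrow> (nat \<Rightarrow> 's) set \<Rightarrow> (nat \<Rightarrow> 's) topology" where
  "theta_topology \<theta> X = Metric_space.mtopology X (d_theta \<theta>)"


section \<open>Function spaces\<close>

text \<open>The quantities \<open>var\<^sub>n f\<close> and \<open>[f]\<^sub>k\<close> are suprema that may be infinite, hence the
  values in \<^typ>\<open>ennreal\<close>.\<close>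

definition var :: "(nat \<Rightarrow> 's) set \<Rightarrow> nat \<Rightarrow> ((nat \<Rightarrow> 's) \<Rightarrow> 'b::real_normed_vector) \<Rightarrow> ennreal" where
  "var X n f =
    (SUP (\<omega>, \<upsilon>) \<in> {(\<omega>, \<upsilon>). \<omega> \<in> X \<and> \<upsilon> \<in> X \<and> (\<forall>i<n. \<omega> i = \<upsilon> i)}. ennreal (norm (f \<omega> - f \<upsilon>)))"

definition theta_seminorm ::
    "real \<Rightarrow> (nat \<Rightarrow> 's) set \<Rightarrow> nat \<Rightarrow> ((nat \<Rightarrow> 's) \<Rightarrow> 'b::real_normed_vector) \<Rightarrow> ennreal" where
  "theta_seminorm \<theta> X k f = (SUP n\<in>{k..}. var X n f / ennreal (\<theta> ^ n))"

text \<open>A complex function on \<open>X\<close> is represented by its extension by zero to all sequences, so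
  that equality of functions on \<open>X\<close> is equality in HOL and function spaces on \<open>X\<close> are linear
  subspaces of \<^typ>\<open>(nat \<Rightarrow> 's) \<Rightarrow> complex\<close>.\<close>

definition C_space :: "real \<Rightarrow> (nat \<Rightarrow> 's) set \<Rightarrow> ((nat \<Rightarrow> 's) \<Rightarrow> complex) set" where
  "C_space \<theta> X = {f. continuous_map (theta_topology \<theta> X) euclidean f \<and> (\<forall>\<omega>. \<omega> \<notin> X \<longrightarrow> f \<omega> = 0)}"

definition Cb_space :: "real \<Rightarrow> (nat \<Rightarrow> 's) set \<Rightarrow> ((nat \<Rightarrow> 's) \<Rightarrow> complex) set" where
  "Cb_space \<theta> X = {f \<in> C_space \<theta> X. bounded (f ` X)}"

definition sup_norm :: "(nat \<Rightarrow> 's) set \<Rightarrow> ((nat \<Rightarrow> 's) \<Rightarrow> complex) \<Rightarrow> real" where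
  "sup_norm X f = (SUP \<omega>\<in>X. cmod (f \<omega>))"

definition Fb_space :: "real \<Rightarrow> (nat \<Rightarrow> 's) set \<Rightarrow> nat \<Rightarrow> ((nat \<Rightarrow> 's) \<Rightarrow> complex) set" where
  "Fb_space \<theta> X k = {f \<in> Cb_space \<theta> X. theta_seminorm \<theta> X k f < \<infinity>}"

definition Fb_norm :: "real \<Rightarrow> (nat \<Rightarrow> 's) set \<Rightarrow> nat \<Rightarrow> ((nat \<Rightarrow> 's) \<Rightarrow> complex) \<Rightarrow> real" where
  "Fb_norm \<theta> X k f = sup_norm X f + enn2real (theta_seminorm \<theta> X k f)"

definition Lambda_cone ::
    "real \<Rightarrow> (nat \<Rightarrow> 's) set \<Rightarrow> nat \<Rightarrow> real \<Rightarrow> ((nat \<Rightarrow> 's) \<Rightarrow> complex) set" where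
  "Lambda_cone \<theta> X k c =
    {f \<in> C_space \<theta> X. (\<forall>\<omega>\<in>X. f \<omega> \<in> \<real>\<^sub>\<ge>\<^sub>0) \<and>
       (\<forall>\<upsilon>\<in>X. \<forall>\<omega>\<in>cylinder X (map \<upsilon> [0..<k]). Re (f \<omega>) \<le> exp (c * d_theta \<theta> \<omega> \<upsilon>) * Re (f \<upsilon>))}"


section \<open>Potentials, pressure and the transfer operator\<close>

text \<open>The real-valued supremum of an unbounded set is unspecified; the first conjunct excludes
  states with \<open>sup\<^bsub>[s]\<^esub> \<phi> = \<infinity>\<close>.\<close>

definition summable_potential ::
    "'s set \<Rightarrow> (nat \<Rightarrow> 's) set \<Rightarrow> ((nat \<Rightarrow> 's) \<Rightarrow> real) \<Rightarrow> bool" where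
  "summable_potential S X \<phi> \<longleftrightarrow>
    (\<forall>s\<in>S. bdd_above (\<phi> ` cylinder X [s])) \<and>
    (\<lambda>s. exp (SUP \<omega>\<in>cylinder X [s]. \<phi> \<omega>)) summable_on {s\<in>S. cylinder X [s] \<noteq> {}}"

definition birkhoff_sum :: "((nat \<Rightarrow> 's) \<Rightarrow> real) \<Rightarrow> nat \<Rightarrow> (nat \<Rightarrow> 's) \<Rightarrow> real" where
  "birkhoff_sum \<phi> n \<omega> = (\<Sum>i<n. \<phi> ((shift ^^ i) \<omega>))"

definition pressure :: "'s set \<Rightarrow> (nat \<Rightarrow> 's) set \<Rightarrow> ((nat \<Rightarrow> 's) \<Rightarrow> real) \<Rightarrow> real" where
  "pressure S Y \<phi> =
    lim (\<lambda>n. 1 / real n *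
      ln (\<Sum>\<^sub>\<infinity>w\<in>{w\<in>lists S. length w = n \<and> cylinder Y w \<noteq> {}}.
            exp (SUP \<omega>\<in>cylinder Y w. birkhoff_sum \<phi> n \<omega>)))"

definition transfer_op ::
    "'s set \<Rightarrow> (nat \<Rightarrow> 's) set \<Rightarrow> ('s \<Rightarrow> 's \<Rightarrow> nat) \<Rightarrow> ((nat \<Rightarrow> 's) \<Rightarrow> real) \<Rightarrow>
     ((nat \<Rightarrow> 's) \<Rightarrow> complex) \<Rightarrow> ((nat \<Rightarrow> 's) \<Rightarrow> complex)" where
  "transfer_op S X M \<phi> f =
    (\<lambda>\<omega>. if \<omega> \<in> X
         then \<Sum>\<^sub>\<infinity>a\<in>{a\<in>S. M a (\<omega> 0) = 1}. of_real (exp (\<phi> (prepend a \<omega>))) * f (prepend a \<omega>)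
         else 0)"

definition borel_probability ::
    "real \<Rightarrow> (nat \<Rightarrow> 's) set \<Rightarrow> (nat \<Rightarrow> 's) measure \<Rightarrow> bool" where
  "borel_probability \<theta> X \<nu> \<longleftrightarrow>
    space \<nu> = X \<and> sets \<nu> = sigma_sets X {U. openin (theta_topology \<theta> X) U} \<and> emeasure \<nu> X = 1"


section \<open>Spectral theory on a normed space of complex functions\<close>

text \<open>Below, \<open>V\<close> is a linear space of complex functions that is complete for the norm \<open>N\<close>, and
  \<open>T\<close> restricts to a bounded linear operator on \<open>V\<close>.\<close>

definition cscale :: "complex \<Rightarrow> ('x \<Rightarrow> complex) \<Rightarrow> ('x \<Rightarrow> complex)" where
  "cscale c f = (\<lambda>x. c * f x)"

global_interpretation cfun: vector_space cscale
  by standard (auto simp: cscale_def fun_eq_iff algebra_simps)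

definition finite_dim :: "('x \<Rightarrow> complex) set \<Rightarrow> bool" where
  "finite_dim E \<longleftrightarrow> (\<exists>B. finite B \<and> E \<subseteq> cfun.span B)"

definition spectrum ::
    "('x \<Rightarrow> complex) set \<Rightarrow> (('x \<Rightarrow> complex) \<Rightarrow> real) \<Rightarrow>
     (('x \<Rightarrow> complex) \<Rightarrow> ('x \<Rightarrow> complex)) \<Rightarrow> complex set" where
  "spectrum V N T =
    {z. \<not> (\<exists>R. (\<forall>f\<in>V. R f \<in> V) \<and> (\<exists>K. \<forall>f\<in>V. N (R f) \<le> K * N f) \<and>
             (\<forall>f\<in>V. R (cscale z f - T f) = f \<and> cscale z (R f) - T (R f) = f))}"

definition spectral_radius ::
    "('x \<Rightarrow> complex) set \<Rightarrow> (('x \<Rightarrow> complex) \<Rightarrow> real) \<Rightarrow>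
     (('x \<Rightarrow> complex) \<Rightarrow> ('x \<Rightarrow> complex)) \<Rightarrow> real" where
  "spectral_radius V N T = (SUP z\<in>spectrum V N T. cmod z)"

definition eigenspace ::
    "('x \<Rightarrow> complex) set \<Rightarrow> (('x \<Rightarrow> complex) \<Rightarrow> ('x \<Rightarrow> complex)) \<Rightarrow> complex \<Rightarrow>
     ('x \<Rightarrow> complex) set" where
  "eigenspace V T p = {f\<in>V. T f = cscale p f}"

definition eigenvalue ::
    "('x \<Rightarrow> complex) set \<Rightarrow> (('x \<Rightarrow> complex) \<Rightarrow> ('x \<Rightarrow> complex)) \<Rightarrow> complex \<Rightarrow> bool" where
  "eigenvalue V T p \<longleftrightarrow> (\<exists>f\<in>eigenspace V T p. f \<noteq> 0)"

definition infinite_mult_eigenvalue ::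
    "('x \<Rightarrow> complex) set \<Rightarrow> (('x \<Rightarrow> complex) \<Rightarrow> ('x \<Rightarrow> complex)) \<Rightarrow> complex \<Rightarrow> bool" where
  "infinite_mult_eigenvalue V T p \<longleftrightarrow> eigenvalue V T p \<and> \<not> finite_dim (eigenspace V T p)"

definition resolvent ::
    "('x \<Rightarrow> complex) set \<Rightarrow> (('x \<Rightarrow> complex) \<Rightarrow> ('x \<Rightarrow> complex)) \<Rightarrow> complex \<Rightarrow>
     ('x \<Rightarrow> complex) \<Rightarrow> ('x \<Rightarrow> complex)" where
  "resolvent V T z f = (THE h. h \<in> V \<and> cscale z h - T h = f)"

text \<open>The Riesz projection \<open>(2\<pi>i)\<^sup>-\<^sup>1 \<oint> (z - T)\<^sup>-\<^sup>1 dz\<close> over the circle of radius \<open>r\<close> about \<open>p\<close>.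
  The integral is taken pointwise; this gives the Banach-space valued integral whenever point
  evaluations are continuous on \<open>V\<close>, as they are for norms dominating the supremum norm.\<close>

definition riesz_projection ::
    "('x \<Rightarrow> complex) set \<Rightarrow> (('x \<Rightarrow> complex) \<Rightarrow> ('x \<Rightarrow> complex)) \<Rightarrow> complex \<Rightarrow> real \<Rightarrow>
     ('x \<Rightarrow> complex) \<Rightarrow> ('x \<Rightarrow> complex)" where
  "riesz_projection V T p r f =
    (\<lambda>x. 1 / (2 * of_real pi * \<i>) * contour_integral (circlepath p r) (\<lambda>z. resolvent V T z f x))"

text \<open>The algebraic multiplicity of an isolated point of the spectrum is the rank of its Riesz
  projection, which does not depend on the choice of the circle.\<close>

definition isolated_finite_mult_eigenvalue ::
    "('x \<Rightarrow> complex) set \<Rightarrow> (('x \<Rightarrow> complex) \<Rightarrow> real) \<Rightarrow>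
     (('x \<Rightarrow> complex) \<Rightarrow> ('x \<Rightarrow> complex)) \<Rightarrow> complex \<Rightarrow> bool" where
  "isolated_finite_mult_eigenvalue V N T p \<longleftrightarrow>
    eigenvalue V T p \<and>
    (\<exists>r>0. spectrum V N T \<inter> cball p r = {p} \<and> finite_dim (riesz_projection V T p r ` V))"

definition ess_spectral_radius ::
    "('x \<Rightarrow> complex) set \<Rightarrow> (('x \<Rightarrow> complex) \<Rightarrow> real) \<Rightarrow>
     (('x \<Rightarrow> complex) \<Rightarrow> ('x \<Rightarrow> complex)) \<Rightarrow> real" where
  "ess_spectral_radius V N T =
    Inf {r. 0 \<le> r \<and> (\<forall>z\<in>spectrum V N T. r < cmod z \<longrightarrow> isolated_finite_mult_eigenvalue V N T z)}"

end

theory Submission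
  imports
    Defs
    "HOL-Probability.Infinite_Product_Measure"
    "HOL-Probability.Probability_Mass_Function"
begin

text \<open>Let \<open>\<rho>\<close> be the exponential growth rate of \<open>b n = sup (L\<^sup>n 1)\<close>. For \<open>x > \<rho>\<close> the resolvent
  \<open>u\<^sub>x = (x - L)\<^sup>-\<^sup>1 1\<close> exists as a Neumann series, lies in a cone of log-Lipschitz functions, and blows up as
  \<open>x \<down> \<rho>\<close>. Normalising \<open>u\<^sub>x\<close>, respectively the functional \<open>f \<mapsto> (x - L)\<^sup>-\<^sup>1 f\<close> evaluated near a maximum
  of \<open>u\<^sub>x\<close>, and passing to a diagonal subsequence gives \<open>g\<close> and \<open>\<nu>\<close>. Summability of the potential
  makes \<open>L\<^sup>n\<close> small on words leaving a large finite alphabet, which keeps both limits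
  from vanishing. Integrating \<open>L\<^sup>n 1\<close> against \<open>\<nu>\<close> compares \<open>\<rho>\<^sup>n\<close> with the partition functions, so
  \<open>\<rho> = exp P\<close>.

  By the same smallness and a Lasota--Yorke inequality, \<open>L\<^sup>n\<close> is a finite-rank operator plus an
  operator of norm at most a constant times \<open>(\<theta> x)\<^sup>n\<close>, for any \<open>x > \<rho>\<close>; analytic Fredholm theory,
  in the elementary form of successive rank-one updates, shows that
  the spectrum outside the disc of radius \<open>\<rho> \<theta>\<close> consists of isolated eigenvalues of finite multiplicity.
  For \<open>\<bar>p\<bar> < \<rho> \<theta>\<close>, eigenfunctions are \<open>g \<cdot> \<Sum>\<^sub>n (p / \<rho>)\<^sup>n (F \<circ> \<sigma>\<^sup>n)\<close>, up to cut-off factors, with \<open>L (g F) = 0\<close>;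
  the space of such \<open>F\<close> is infinite-dimensional unless \<open>X\<close> is a single finite orbit.\<close>

section \<open>Bounded operators on spaces of complex functions\<close>

text \<open>The alphabet may be infinite, so \<open>X\<close> need not be compact: the Riesz
  representation theorem and compactness of measures or functions do not supply \<open>g\<close> and
  \<open>\<nu>\<close>, and a limit of normalised objects may be zero. Both are obtained from
  countably many numbers, one per word, and the measure is rebuilt from its masses of cylinders.
  \<open>M\<close> need not be irreducible, so \<open>g\<close> may vanish on parts of
  \<open>X\<close>; the arguments rest on positivity and on the cone, and the eigenfunctions in the
  disc live where \<open>g\<close> is positive. There the equation \<open>L (g F) = 0\<close> is
  solved either near a transition of \<open>A\<close> that \<open>M\<close> forbids, where
  \<open>L\<close> sees nothing, or on two preimages of one point. The constant \<open>c1\<close> is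
  the solution of \<open>c = (c + \<Phi>) \<theta>\<close>, with \<open>\<Phi>\<close> the seminorm
  of the potential: it is the total distortion of the weights along an inverse branch. The bound
  \<open>1 \<le> k\<close> makes the set of admissible preimages constant on the cylinders involved,
  and the periodic point gives \<open>\<rho> > 0\<close>. Only a high power of \<open>L\<close> is
  close to finite rank, which is why the perturbation argument treats \<open>T^n\<close> and returns
  to \<open>T\<close> by factoring \<open>z^n - T^n\<close>.\<close>

lemma sum_fun_apply: "(\<Sum>i\<in>I. f i) x = (\<Sum>i\<in>I. f i x)" for f :: "'i \<Rightarrow> 'x \<Rightarrow> 'b::comm_monoid_add"
  by (induction I rule: infinite_finite_induct) auto

lemma cscale_apply [simp]: "cscale c f x = c * f x"
  by (simp add: cscale_def)

text \<open>Completeness is encoded by \<open>series\<close>: an absolutely convergent series has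
  its sum in \<open>V\<close>, with the expected norm bound. The sum may be taken pointwise because
  \<open>eval_le\<close> makes point evaluations bounded, so a norm limit is also the pointwise
  limit.\<close>

locale fun_space =
  fixes V :: "('x \<Rightarrow> complex) set" and N :: "('x \<Rightarrow> complex) \<Rightarrow> real"
  assumes zero_mem [simp]: "0 \<in> V"
    and add_mem [simp]: "f \<in> V \<Longrightarrow> g \<in> V \<Longrightarrow> f + g \<in> V"
    and scale_mem [simp]: "f \<in> V \<Longrightarrow> cscale c f \<in> V"
    and N_add: "f \<in> V \<Longrightarrow> g \<in> V \<Longrightarrow> N (f + g) \<le> N f + N g"
    and N_scale [simp]: "f \<in> V \<Longrightarrow> N (cscale c f) = cmod c * N f"
    and eval_le: "f \<in> V \<Longrightarrow> cmod (f x) \<le> N f"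
    and series: "(\<And>i::nat. F i \<in> V) \<Longrightarrow> summable (\<lambda>i. N (F i)) \<Longrightarrow>
       (\<lambda>x. \<Sum>i. F i x) \<in> V \<and> N (\<lambda>x. \<Sum>i. F i x) \<le> (\<Sum>i. N (F i))"
begin

lemma N_nonneg [simp]: "f \<in> V \<Longrightarrow> 0 \<le> N f"
  using eval_le[of f undefined] norm_ge_zero order_trans by blast

lemma N_zero [simp]: "N 0 = 0"
proof -
  have "N (cscale 0 0) = 0" by (subst N_scale) auto
  moreover have "cscale 0 0 = (0 :: 'x \<Rightarrow> complex)" by (auto simp: fun_eq_iff)
  ultimately show ?thesis by simp
qed

lemma N_eq_0: "f \<in> V \<Longrightarrow> N f = 0 \<Longrightarrow> f = 0"
  using eval_le[of f] by (auto simp: fun_eq_iff)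

lemma uminus_cscale: "- f = cscale (-1) f"
  by (auto simp: fun_eq_iff)

lemma uminus_mem [simp]: "f \<in> V \<Longrightarrow> - f \<in> V"
  unfolding uminus_cscale by (rule scale_mem)

lemma N_uminus [simp]: "f \<in> V \<Longrightarrow> N (- f) = N f"
  unfolding uminus_cscale by (subst N_scale) auto

lemma diff_mem [simp]: "f \<in> V \<Longrightarrow> g \<in> V \<Longrightarrow> f - g \<in> V"
  using add_mem[of f "- g"] by simp

lemma N_minus: "f \<in> V \<Longrightarrow> g \<in> V \<Longrightarrow> N (f - g) \<le> N f + N g"
  using N_add[of f "- g"] by simp

lemma N_rev_triangle: "f \<in> V \<Longrightarrow> g \<in> V \<Longrightarrow> N f - N g \<le> N (f - g)"
  using N_add[of "f - g" g] by simp

lemma sum_mem [simp]: "(\<And>i. i \<in> I \<Longrightarrow> F i \<in> V) \<Longrightarrow> (\<Sum>i\<in>I. F i) \<in> V"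
  by (induction I rule: infinite_finite_induct) auto

lemma N_sum: "(\<And>i. i \<in> I \<Longrightarrow> F i \<in> V) \<Longrightarrow> N (\<Sum>i\<in>I. F i) \<le> (\<Sum>i\<in>I. N (F i))"
proof (induction I rule: infinite_finite_induct)
  case (insert i I)
  then have "N (F i + (\<Sum>i\<in>I. F i)) \<le> N (F i) + N (\<Sum>i\<in>I. F i)"
    by (intro N_add) auto
  moreover have "N (\<Sum>i\<in>I. F i) \<le> (\<Sum>i\<in>I. N (F i))" using insert by auto
  ultimately show ?case unfolding sum.insert[OF insert(1,2)] by linarith
qed auto

definition blin :: "(('x \<Rightarrow> complex) \<Rightarrow> ('x \<Rightarrow> complex)) \<Rightarrow> bool" where
  "blin B \<longleftrightarrow> (\<forall>f\<in>V. B f \<in> V) \<and> (\<forall>f\<in>V. \<forall>g\<in>V. B (f + g) = B f + B g) \<and>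
     (\<forall>c. \<forall>f\<in>V. B (cscale c f) = cscale c (B f)) \<and> (\<exists>K\<ge>0. \<forall>f\<in>V. N (B f) \<le> K * N f)"

definition bfun :: "(('x \<Rightarrow> complex) \<Rightarrow> complex) \<Rightarrow> bool" where
  "bfun l \<longleftrightarrow> (\<forall>f\<in>V. \<forall>g\<in>V. l (f + g) = l f + l g) \<and>
     (\<forall>c. \<forall>f\<in>V. l (cscale c f) = c * l f) \<and> (\<exists>K\<ge>0. \<forall>f\<in>V. cmod (l f) \<le> K * N f)"

lemma blinD:
  assumes "blin B" "f \<in> V"
  shows "B f \<in> V" "g \<in> V \<Longrightarrow> B (f + g) = B f + B g" "B (cscale c f) = cscale c (B f)"
    "g \<in> V \<Longrightarrow> B (f - g) = B f - B g"
proof -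
  show *: "B f \<in> V" "g \<in> V \<Longrightarrow> B (f + g) = B f + B g" "B (cscale c f) = cscale c (B f)" for g c
    using assms by (auto simp: blin_def)
  assume "g \<in> V"
  then have "B (- g) = - (B g)" using assms(1) unfolding uminus_cscale blin_def by blast
  then show "B (f - g) = B f - B g"
    using *(2)[of "- g"] \<open>g \<in> V\<close> by simp
qed

lemma blin_bound:
  assumes "blin B" obtains K where "K \<ge> 0" "\<And>f. f \<in> V \<Longrightarrow> N (B f) \<le> K * N f"
  using assms by (auto simp: blin_def)

lemma bfunD:
  assumes "bfun l" "f \<in> V"
  shows "g \<in> V \<Longrightarrow> l (f + g) = l f + l g" "l (cscale c f) = c * l f"
    "g \<in> V \<Longrightarrow> l (f - g) = l f - l g"
proof -
  show *: "g \<in> V \<Longrightarrow> l (f + g) = l f + l g" "l (cscale c f) = c * l f" for g c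
    using assms by (auto simp: bfun_def)
  assume "g \<in> V"
  then have "l (- g) = - 1 * (l g)" using assms(1) unfolding uminus_cscale bfun_def by blast
  then show "l (f - g) = l f - l g"
    using *(1)[of "- g"] \<open>g \<in> V\<close> by simp
qed

lemma bfun_bound:
  assumes "bfun l" obtains K where "K \<ge> 0" "\<And>f. f \<in> V \<Longrightarrow> cmod (l f) \<le> K * N f"
  using assms by (auto simp: bfun_def)

lemma blin_sum:
  assumes "blin B" "\<And>i. i \<in> I \<Longrightarrow> F i \<in> V"
  shows "B (\<Sum>i\<in>I. F i) = (\<Sum>i\<in>I. B (F i))"
proof -
  have "B 0 = 0" using blinD(4)[OF assms(1) zero_mem zero_mem] by simp
  then show ?thesis using assms(2)
    by (induction I rule: infinite_finite_induct) (auto simp: blinD[OF assms(1)])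
qed

lemma bfun_sum:
  assumes "bfun l" "\<And>i. i \<in> I \<Longrightarrow> F i \<in> V"
  shows "l (\<Sum>i\<in>I. F i) = (\<Sum>i\<in>I. l (F i))"
proof -
  have "l 0 = 0" using bfunD(3)[OF assms(1) zero_mem zero_mem] by simp
  then show ?thesis using assms(2)
    by (induction I rule: infinite_finite_induct) (auto simp: bfunD[OF assms(1)])
qed

lemma bfun_eval: "bfun (\<lambda>f. f x)"
  unfolding bfun_def using eval_le by (auto intro!: exI[of _ 1])

lemma bfun_comp: "bfun l \<Longrightarrow> blin B \<Longrightarrow> bfun (\<lambda>f. l (B f))"
proof -
  assume l: "bfun l" and B: "blin B"
  obtain K where K: "K \<ge> 0" "\<And>f. f \<in> V \<Longrightarrow> cmod (l f) \<le> K * N f" using bfun_bound[OF l] by blast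
  obtain K' where K': "K' \<ge> 0" "\<And>f. f \<in> V \<Longrightarrow> N (B f) \<le> K' * N f" using blin_bound[OF B] by blast
  have "cmod (l (B f)) \<le> (K * K') * N f" if "f \<in> V" for f
    using K(2)[of "B f"] mult_left_mono[OF K'(2)[OF that] K(1)] blinD(1)[OF B that]
    by (simp add: mult.assoc)
  then show ?thesis
    unfolding bfun_def using blinD[OF B] bfunD[OF l] K(1) K'(1)
    by (auto intro!: exI[of _ "K * K'"])
qed

lemma blin_id: "blin (\<lambda>f. f)"
  by (auto simp: blin_def intro!: exI[of _ 1])

lemma blin_comp: "blin A \<Longrightarrow> blin B \<Longrightarrow> blin (\<lambda>f. A (B f))"
proof -
  assume l: "blin A" and B: "blin B"
  obtain K where K: "K \<ge> 0" "\<And>f. f \<in> V \<Longrightarrow> N (A f) \<le> K * N f" using blin_bound[OF l] by blast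
  obtain K' where K': "K' \<ge> 0" "\<And>f. f \<in> V \<Longrightarrow> N (B f) \<le> K' * N f" using blin_bound[OF B] by blast
  have "N (A (B f)) \<le> (K * K') * N f" if "f \<in> V" for f
    using K(2)[of "B f"] mult_left_mono[OF K'(2)[OF that] K(1)] blinD(1)[OF B that]
    by (simp add: mult.assoc)
  then show ?thesis
    unfolding blin_def using blinD[OF B] blinD[OF l] K(1) K'(1)
    by (auto intro!: exI[of _ "K * K'"])
qed

lemma blin_funpow: "blin B \<Longrightarrow> blin (B ^^ n)"
proof (induction n)
  case 0 then show ?case using blin_id by (simp add: id_def)
next
  case (Suc n) then show ?case using blin_comp[of B "B ^^ n"] by (simp add: o_def)
qed

lemma blin_scale: "blin B \<Longrightarrow> blin (\<lambda>f. cscale c (B f))"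
proof -
  assume B: "blin B"
  obtain K' where K': "K' \<ge> 0" "\<And>f. f \<in> V \<Longrightarrow> N (B f) \<le> K' * N f" using blin_bound[OF B] by blast
  have "N (cscale c (B f)) \<le> (cmod c * K') * N f" if "f \<in> V" for f
    using mult_left_mono[OF K'(2)[OF that], of "cmod c"] blinD(1)[OF B that]
    by (simp add: mult.assoc)
  then show ?thesis
    unfolding blin_def using blinD[OF B] K'(1)
    by (auto intro!: exI[of _ "cmod c * K'"] simp: fun_eq_iff algebra_simps)
qed

lemma blin_add: "blin A \<Longrightarrow> blin B \<Longrightarrow> blin (\<lambda>f. A f + B f)"
proof -
  assume l: "blin A" and B: "blin B"
  obtain K where K: "K \<ge> 0" "\<And>f. f \<in> V \<Longrightarrow> N (A f) \<le> K * N f" using blin_bound[OF l] by blast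
  obtain K' where K': "K' \<ge> 0" "\<And>f. f \<in> V \<Longrightarrow> N (B f) \<le> K' * N f" using blin_bound[OF B] by blast
  have "N (A f + B f) \<le> (K + K') * N f" if "f \<in> V" for f
    using K(2)[OF that] K'(2)[OF that] N_add[of "A f" "B f"] blinD(1)[OF B that] blinD(1)[OF l that]
    by (simp add: algebra_simps)
  then show ?thesis
    unfolding blin_def using blinD[OF B] blinD[OF l] K(1) K'(1)
    by (auto intro!: exI[of _ "K + K'"] simp: fun_eq_iff algebra_simps)
qed

lemma blin_sum_op: "finite I \<Longrightarrow> (\<And>i. i \<in> I \<Longrightarrow> blin (B i)) \<Longrightarrow> blin (\<lambda>f. \<Sum>i\<in>I. B i f)"
proof (induction I rule: finite_induct)
  case empty
  have "blin (\<lambda>f. 0)" unfolding blin_def by (intro conjI ballI allI exI[of _ 0]) simp_all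
  then show ?case unfolding sum.empty .
next
  case (insert i I)
  then show ?case using blin_add[of "B i" "\<lambda>f. \<Sum>i\<in>I. B i f"] unfolding sum.insert[OF insert(1,2)] by blast
qed

lemma blin_rank1: "bfun l \<Longrightarrow> e \<in> V \<Longrightarrow> blin (\<lambda>f. cscale (l f) e)"
proof -
  assume l: "bfun l" and e: "e \<in> V"
  obtain K where K: "K \<ge> 0" "\<And>f. f \<in> V \<Longrightarrow> cmod (l f) \<le> K * N f" using bfun_bound[OF l] by blast
  have "N (cscale (l f) e) \<le> (K * N e) * N f" if "f \<in> V" for f
    using mult_right_mono[OF K(2)[OF that], of "N e"] e by (simp add: algebra_simps)
  then show ?thesis
    unfolding blin_def using bfunD[OF l] K(1) e
    by (auto intro!: exI[of _ "K * N e"] simp: fun_eq_iff algebra_simps)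
qed

lemma blin_diff: "blin A \<Longrightarrow> blin B \<Longrightarrow> blin (\<lambda>f. A f - B f)"
  using blin_add[of A "\<lambda>f. - B f"] blin_scale[of B "-1"] by simp

text \<open>The norm bound in \<open>series\<close>, applied to the shifted family, upgrades the
  pointwise sum to norm convergence; this lets bounded functionals and operators pass through
  infinite sums.\<close>

lemma series_tail:
  assumes "\<And>i::nat. F i \<in> V" "summable (\<lambda>i. N (F i))"
  shows "N ((\<lambda>x. \<Sum>i. F i x) - (\<Sum>i<m. F i)) \<le> (\<Sum>i. N (F (i + m)))"
proof -
  have sm: "summable (\<lambda>i. F i x)" for x
    by (rule summable_comparison_test'[OF assms(2), of 0]) (simp add: eval_le assms(1))
  have "(\<lambda>x. \<Sum>i. F i x) - (\<Sum>i<m. F i) = (\<lambda>x. \<Sum>i. F (i + m) x)"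
    using suminf_split_initial_segment[OF sm, where k=m] by (auto simp: fun_eq_iff sum_fun_apply)
  then show ?thesis
    using series[of "\<lambda>i. F (i + m)"] assms summable_ignore_initial_segment[OF assms(2), of m] by simp
qed

lemma bfun_series:
  assumes "bfun l" "\<And>i::nat. F i \<in> V" "summable (\<lambda>i. N (F i))"
  shows "(\<lambda>i. l (F i)) sums l (\<lambda>x. \<Sum>i. F i x)"
proof -
  let ?s = "\<lambda>x. \<Sum>i. F i x"
  have sV: "?s \<in> V" using series[OF assms(2,3)] by blast
  obtain K where K: "K \<ge> 0" "\<And>f. f \<in> V \<Longrightarrow> cmod (l f) \<le> K * N f"
    using bfun_bound[OF assms(1)] by blast
  have "cmod ((\<Sum>i<m. l (F i)) - l ?s) \<le> K * (\<Sum>i. N (F (i + m)))" for m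
  proof -
    have "(\<Sum>i<m. l (F i)) - l ?s = - l (?s - (\<Sum>i<m. F i))"
      using bfunD(3)[OF assms(1) sV] bfun_sum[OF assms(1), of "{..<m}" F] assms(2) by simp
    then have "cmod ((\<Sum>i<m. l (F i)) - l ?s) \<le> K * N (?s - (\<Sum>i<m. F i))"
      using K(2)[of "?s - (\<Sum>i<m. F i)"] sV assms(2) by simp
    also have "\<dots> \<le> K * (\<Sum>i. N (F (i + m)))"
      by (intro mult_left_mono series_tail assms K)
    finally show ?thesis .
  qed
  moreover have "(\<lambda>m. K * (\<Sum>i. N (F (i + m)))) \<longlonglongrightarrow> K * 0"
    by (intro tendsto_mult tendsto_const suminf_exist_split2[OF assms(3)])
  ultimately have "(\<lambda>m. (\<Sum>i<m. l (F i)) - l ?s) \<longlonglongrightarrow> 0"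
    using Lim_null_comparison[of "\<lambda>m. (\<Sum>i<m. l (F i)) - l ?s" "\<lambda>m. K * (\<Sum>i. N (F (i + m)))" sequentially]
    by (auto simp: eventually_sequentially)
  then show ?thesis unfolding sums_def using Lim_null[of _ "l ?s"] by blast
qed

lemma blin_series:
  assumes "blin B" "\<And>i::nat. F i \<in> V" "summable (\<lambda>i. N (F i))"
  shows "B (\<lambda>x. \<Sum>i. F i x) = (\<lambda>x. \<Sum>i. B (F i) x)"
  using bfun_series[OF bfun_comp[OF bfun_eval assms(1)] assms(2,3)]
  by (auto simp: fun_eq_iff sums_iff)

section \<open>Neumann series and points outside the spectrum\<close>

definition neumann :: "(('x \<Rightarrow> complex) \<Rightarrow> ('x \<Rightarrow> complex)) \<Rightarrow> ('x \<Rightarrow> complex) \<Rightarrow> ('x \<Rightarrow> complex)" where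
  "neumann B f = (\<lambda>x. \<Sum>i. (B ^^ i) f x)"

text \<open>Separate bounds \<open>c i\<close> on the iterates, with convergent sum, take the place
  of a norm below one: the iterates of interest become small only asymptotically. The two inverse
  identities are the telescoping of the series.\<close>

lemma neumann:
  assumes B: "blin B" and c0: "\<forall>i. \<forall>f\<in>V. N ((B ^^ i) f) \<le> c i * N f" and s: "summable c"
  shows "blin (neumann B)" "f \<in> V \<Longrightarrow> N (neumann B f) \<le> suminf c * N f"
    "f \<in> V \<Longrightarrow> neumann B f - B (neumann B f) = f"
    "f \<in> V \<Longrightarrow> neumann B (f - B f) = f"
proof -
  have c: "N ((B ^^ i) f) \<le> c i * N f" if "f \<in> V" for i f using c0 that by blast
  have pV: "(B ^^ i) f \<in> V" if "f \<in> V" for i f using blinD(1)[OF blin_funpow[OF B] that] .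
  have sN: "summable (\<lambda>i. N ((B ^^ i) f))" if "f \<in> V" for f
    by (rule summable_comparison_test'[OF summable_mult2[OF s, of "N f"], of 0]) (simp add: c pV that)
  have sx: "summable (\<lambda>i. (B ^^ i) f x)" if "f \<in> V" for f x
    by (rule summable_comparison_test'[OF sN[OF that], of 0]) (simp add: eval_le pV that)
  have nV: "neumann B f \<in> V" if "f \<in> V" for f
    unfolding neumann_def using series[of "\<lambda>i. (B ^^ i) f"] pV sN that by blast
  show bd: "N (neumann B f) \<le> suminf c * N f" if "f \<in> V" for f
  proof -
    have "N (neumann B f) \<le> (\<Sum>i. N ((B ^^ i) f))"
      unfolding neumann_def using series[of "\<lambda>i. (B ^^ i) f"] pV sN that by blast
    also have "\<dots> \<le> (\<Sum>i. c i * N f)"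
      by (intro suminf_le sN summable_mult2 s that c)
    finally show ?thesis using suminf_mult2[OF s] by simp
  qed
  have bd': "N (neumann B f) \<le> \<bar>suminf c\<bar> * N f" if "f \<in> V" for f
    using bd[OF that] mult_right_mono[OF abs_ge_self N_nonneg[OF that], of "suminf c"] by linarith
  show "blin (neumann B)"
    unfolding blin_def
  proof (intro conjI ballI allI)
    fix f g assume "f \<in> V" "g \<in> V"
    then show "neumann B (f + g) = neumann B f + neumann B g"
      using sx blinD(2)[OF blin_funpow[OF B]]
      by (auto simp: neumann_def fun_eq_iff suminf_add)
  next
    fix f d assume "f \<in> V"
    then show "neumann B (cscale d f) = cscale d (neumann B f)"
      using sx blinD(3)[OF blin_funpow[OF B]]
      by (auto simp: neumann_def fun_eq_iff suminf_mult)
  qed (use nV bd' in \<open>auto intro!: exI[of _ "\<bar>suminf c\<bar>"]\<close>)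
  have sh: "(\<Sum>i. (B ^^ Suc i) f x) = neumann B f x - f x" if "f \<in> V" for f x
    using suminf_split_head[OF sx[OF that]] by (simp add: neumann_def)
  show "neumann B f - B (neumann B f) = f" if "f \<in> V"
    using blin_series[OF B pV[OF that] sN[OF that]] sh[OF that]
    by (simp add: fun_eq_iff neumann_def)
  show "neumann B (f - B f) = f" if f: "f \<in> V"
  proof
    fix x
    have "(B ^^ i) (f - B f) = (B ^^ i) f - (B ^^ Suc i) f" for i
      using blinD(4)[OF blin_funpow[OF B] f blinD(1)[OF B f]] by (simp add: funpow_swap1)
    then have "neumann B (f - B f) x = (\<Sum>i. (B ^^ i) f x - (B ^^ Suc i) f x)"
      by (simp add: neumann_def)
    also have "\<dots> = (\<Sum>i. (B ^^ i) f x) - (\<Sum>i. (B ^^ Suc i) f x)"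
      using suminf_diff[OF sx[OF f], of "\<lambda>i. (B ^^ Suc i) f x" x] summable_ignore_initial_segment[OF sx[OF f], of 1 x] by simp
    also have "\<dots> = f x" using sh[OF f] by (simp add: neumann_def)
    finally show "neumann B (f - B f) x = f x" .
  qed
qed

lemma not_in_spectrumI:
  assumes "\<And>f. f \<in> V \<Longrightarrow> R f \<in> V" "\<And>f. f \<in> V \<Longrightarrow> N (R f) \<le> K * N f"
    "\<And>f. f \<in> V \<Longrightarrow> R (cscale z f - T f) = f" "\<And>f. f \<in> V \<Longrightarrow> cscale z (R f) - T (R f) = f"
  shows "z \<notin> spectrum V N T"
proof -
  have "(\<forall>f\<in>V. R f \<in> V) \<and> (\<exists>K. \<forall>f\<in>V. N (R f) \<le> K * N f) \<and>
      (\<forall>f\<in>V. R (cscale z f - T f) = f \<and> cscale z (R f) - T (R f) = f)"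
    by (intro conjI ballI exI[of _ K] assms)
  then show ?thesis unfolding spectrum_def mem_Collect_eq not_not by (rule exI[of _ R])
qed

lemma funpow_scale:
  assumes "blin T" "f \<in> V"
  shows "((\<lambda>f. cscale c (T f)) ^^ i) f = cscale (c ^ i) ((T ^^ i) f)"
proof (induction i)
  case 0 show ?case by (simp add: fun_eq_iff)
next
  case (Suc i)
  have "((\<lambda>f. cscale c (T f)) ^^ Suc i) f = cscale c (T (cscale (c ^ i) ((T ^^ i) f)))"
    unfolding funpow.simps o_def Suc.IH ..
  also have "T (cscale (c ^ i) ((T ^^ i) f)) = cscale (c ^ i) (T ((T ^^ i) f))"
    by (rule blinD(3)[OF assms(1) blinD(1)[OF blin_funpow[OF assms(1)] assms(2)]])
  finally show ?case by (simp add: fun_eq_iff)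
qed

text \<open>The resolvent at \<open>z\<close> is \<open>1 / z\<close> times the Neumann series of
  \<open>T / z\<close>, which converges as soon as \<open>cmod z\<close> exceeds the exponential
  growth rate of the iterates.\<close>

lemma not_in_spectrum_power:
  assumes T: "blin T" and c: "\<And>i f. f \<in> V \<Longrightarrow> N ((T ^^ i) f) \<le> c i * N f"
    and s: "summable (\<lambda>i. c i / cmod z ^ i)" and z: "z \<noteq> 0"
  shows "z \<notin> spectrum V N T"
proof -
  let ?B = "\<lambda>f. cscale (1 / z) (T f)"
  have B: "blin ?B" by (rule blin_scale[OF T])
  have bd: "\<forall>i. \<forall>f\<in>V. N ((?B ^^ i) f) \<le> (c i / cmod z ^ i) * N f"
  proof (intro allI ballI)
    fix i f assume f: "f \<in> V"
    show "N ((?B ^^ i) f) \<le> (c i / cmod z ^ i) * N f"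
      using c[OF f, of i] z blinD(1)[OF blin_funpow[OF T] f, of i]
      by (simp add: funpow_scale[OF T f] norm_divide norm_power field_simps)
  qed
  note n = neumann[OF B bd s]
  show ?thesis
  proof (rule not_in_spectrumI[where R = "\<lambda>f. cscale (1/z) (neumann ?B f)"])
    fix f assume f: "f \<in> V"
    then show "cscale (1/z) (neumann ?B f) \<in> V" using blinD(1)[OF n(1)] by simp
    show "N (cscale (1/z) (neumann ?B f)) \<le> (cmod (1/z) * (\<Sum>i. c i / cmod z ^ i)) * N f"
      using mult_left_mono[OF n(2)[OF f], of "cmod (1/z)"] blinD(1)[OF n(1) f] by (simp add: mult.assoc)
    have "cscale z f - T f = cscale z (f - ?B f)" using z by (simp add: fun_eq_iff algebra_simps)
    then have "neumann ?B (cscale z f - T f) = cscale z (neumann ?B (f - ?B f))"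
      using blinD(3)[OF n(1), of "f - ?B f" z] f blinD(1)[OF T f] by simp
    then show "cscale (1/z) (neumann ?B (cscale z f - T f)) = f"
      using z n(4)[OF f] by (simp add: fun_eq_iff)
    show "cscale z (cscale (1/z) (neumann ?B f)) - T (cscale (1/z) (neumann ?B f)) = f"
      using n(3)[OF f] blinD(3)[OF T blinD(1)[OF n(1) f], of "1/z"] z
      by (simp add: fun_eq_iff)
  qed
qed

end

section \<open>Finite-rank perturbations and isolated eigenvalues\<close>

text \<open>A power of \<open>T\<close>, and not \<open>T\<close>, is split into a small and a
  finite-rank part: the estimates for the transfer operator carry a constant factor that only a
  large power absorbs into \<open>r0 ^ n\<close>.\<close>

locale finite_rank_perturbation = fun_space +
  fixes T R :: "('a \<Rightarrow> complex) \<Rightarrow> ('a \<Rightarrow> complex)" and n m :: nat and r0 :: real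
    and e :: "nat \<Rightarrow> 'a \<Rightarrow> complex" and l :: "nat \<Rightarrow> ('a \<Rightarrow> complex) \<Rightarrow> complex"
  assumes T: "blin T" and R: "blin R"
    and R_le: "f \<in> V \<Longrightarrow> N (R f) \<le> r0 ^ n * N f"
    and r0: "0 < r0" and n: "1 \<le> n"
    and e [simp]: "e j \<in> V" and l: "bfun (l j)"
    and T_eq: "f \<in> V \<Longrightarrow> (T ^^ n) f = R f + (\<Sum>j<m. cscale (l j f) (e j))"
begin

definition Omega :: "complex set" where "Omega = {z. r0 < cmod z}"

lemma open_Omega: "open Omega"
  unfolding Omega_def by (intro open_Collect_less continuous_intros)

lemma connected_Omega: "connected Omega"
proof -
  have "Omega = - cball 0 r0" by (auto simp: Omega_def)
  then show ?thesis using connected_complement_bounded_convex[of "cball 0 r0 :: complex set"] by simp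
qed

lemma Omega_nz: "z \<in> Omega \<Longrightarrow> z \<noteq> 0"
  using r0 by (auto simp: Omega_def)

lemma Omega_pow: "z \<in> Omega \<Longrightarrow> r0 ^ n < cmod z ^ n"
  using r0 n by (auto simp: Omega_def intro!: power_strict_mono)

lemma eventually_Omega: "eventually (\<lambda>z. z \<in> Omega) at_infinity"
  unfolding eventually_at_infinity Omega_def by (rule exI[of _ "r0 + 1"]) auto

text \<open>The inverse of \<open>z ^ n - R\<close>, as a Neumann series that converges for
  \<open>r0 < cmod z\<close>.\<close>

definition G :: "complex \<Rightarrow> ('a \<Rightarrow> complex) \<Rightarrow> ('a \<Rightarrow> complex)" where
  "G z f = cscale (1 / z ^ n) (neumann (\<lambda>f. cscale (1 / z ^ n) (R f)) f)"

lemma R_pow: "f \<in> V \<Longrightarrow> N ((R ^^ i) f) \<le> (r0 ^ n) ^ i * N f"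
proof (induction i)
  case (Suc i)
  have "N (R ((R ^^ i) f)) \<le> r0 ^ n * N ((R ^^ i) f)"
    by (intro R_le blinD(1)[OF blin_funpow[OF R]] Suc)
  also have "\<dots> \<le> r0 ^ n * ((r0 ^ n) ^ i * N f)"
    using Suc r0 by (intro mult_left_mono) auto
  finally show ?case by (simp add: mult.assoc)
qed simp

lemma G:
  assumes z: "z \<in> Omega"
  shows "blin (G z)" "f \<in> V \<Longrightarrow> N (G z f) \<le> N f / (cmod z ^ n - r0 ^ n)"
    "f \<in> V \<Longrightarrow> cscale (z ^ n) (G z f) - R (G z f) = f"
    "f \<in> V \<Longrightarrow> G z (cscale (z ^ n) f - R f) = f"
proof -
  let ?B = "\<lambda>f. cscale (1 / z ^ n) (R f)" and ?q = "r0 ^ n / cmod z ^ n"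
  have z0: "z \<noteq> 0" using z by (rule Omega_nz)
  have q: "0 \<le> ?q" "?q < 1" using Omega_pow[OF z] r0 z0 by (auto simp: divide_simps)
  have B: "blin ?B" by (rule blin_scale[OF R])
  have bd: "\<forall>i. \<forall>f\<in>V. N ((?B ^^ i) f) \<le> ?q ^ i * N f"
  proof (intro allI ballI)
    fix i f assume f: "f \<in> V"
    have "N ((?B ^^ i) f) = (1 / cmod z ^ n) ^ i * N ((R ^^ i) f)"
      using blinD(1)[OF blin_funpow[OF R] f, of i]
      by (simp add: funpow_scale[OF R f] norm_divide norm_power)
    also have "\<dots> \<le> (1 / cmod z ^ n) ^ i * ((r0 ^ n) ^ i * N f)"
      by (intro mult_left_mono R_pow f) simp
    finally show "N ((?B ^^ i) f) \<le> ?q ^ i * N f" by (simp add: power_divide)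
  qed
  have s: "summable (\<lambda>i. ?q ^ i)" using q by (intro summable_geometric) auto
  have sg: "(\<Sum>i. ?q ^ i) = 1 / (1 - ?q)" using q by (intro suminf_geometric) auto
  note nm = neumann[OF B bd s]
  show "blin (G z)" unfolding G_def by (rule blin_scale[OF nm(1)])
  show "N (G z f) \<le> N f / (cmod z ^ n - r0 ^ n)" if f: "f \<in> V"
  proof -
    have "N (G z f) = (1 / cmod z ^ n) * N (neumann ?B f)"
      unfolding G_def using blinD(1)[OF nm(1) f] by (simp add: norm_divide norm_power)
    also have "\<dots> \<le> (1 / cmod z ^ n) * (1 / (1 - ?q) * N f)"
      using nm(2)[OF f] unfolding sg by (intro mult_left_mono) auto
    also have "\<dots> = N f / (cmod z ^ n - r0 ^ n)" using z0 q by (simp add: divide_simps)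
    finally show ?thesis .
  qed
  show "cscale (z ^ n) (G z f) - R (G z f) = f" if f: "f \<in> V"
    using nm(3)[OF f] blinD(3)[OF R blinD(1)[OF nm(1) f], of "1 / z ^ n"] z0
    by (simp add: fun_eq_iff G_def)
  show "G z (cscale (z ^ n) f - R f) = f" if f: "f \<in> V"
  proof -
    have "cscale (z ^ n) f - R f = cscale (z ^ n) (f - ?B f)"
      using z0 by (simp add: fun_eq_iff algebra_simps)
    then have "neumann ?B (cscale (z ^ n) f - R f) = cscale (z ^ n) (neumann ?B (f - ?B f))"
      using blinD(3)[OF nm(1), of "f - ?B f" "z ^ n"] f blinD(1)[OF R f] by simp
    then show ?thesis using z0 nm(4)[OF f] by (simp add: fun_eq_iff G_def)
  qed
qed

text \<open>Holomorphy is needed only after a functional has been applied: with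
  \<open>u = 1 / z ^ n\<close> the value is \<open>u\<close> times a scalar power series
  \<open>H u\<close>, convergent for \<open>cmod u < 1 / r0 ^ n\<close>. The extra factor
  \<open>u\<close> gives the limit zero at infinity, and no Banach-valued holomorphic function
  occurs.\<close>

lemma bfun_G:
  assumes L: "bfun L" and f: "f \<in> V"
  shows "(\<lambda>z. L (G z f)) holomorphic_on Omega" "((\<lambda>z. L (G z f)) \<longlongrightarrow> 0) at_infinity"
proof -
  obtain K where K: "K \<ge> 0" "\<And>f. f \<in> V \<Longrightarrow> cmod (L f) \<le> K * N f"
    using bfun_bound[OF L] by blast
  define a where "a i = L ((R ^^ i) f)" for i
  define Q where "Q = r0 ^ n"
  have Q: "Q > 0" using r0 by (simp add: Q_def)
  have a_le: "cmod (a i) \<le> K * N f * Q ^ i" for i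
  proof -
    have "cmod (a i) \<le> K * N ((R ^^ i) f)" unfolding a_def by (intro K blinD(1)[OF blin_funpow[OF R]] f)
    also have "\<dots> \<le> K * (Q ^ i * N f)" unfolding Q_def by (intro mult_left_mono R_pow f K)
    finally show ?thesis by (simp add: algebra_simps)
  qed
  have sm: "summable (\<lambda>i. a i * (u - 0) ^ i)" if "u \<in> ball 0 (1 / Q)" for u :: complex
  proof (rule summable_comparison_test')
    have "Q * cmod u < 1" using that Q by (simp add: field_simps)
    then show "summable (\<lambda>i. K * N f * (Q * cmod u) ^ i)"
      using Q by (intro summable_mult summable_geometric) auto
    show "cmod (a i * (u - 0) ^ i) \<le> K * N f * (Q * cmod u) ^ i" for i
      using mult_right_mono[OF a_le[of i], of "cmod u ^ i"]
      by (simp add: norm_mult norm_power power_mult_distrib algebra_simps)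
  qed
  define H where "H u = (\<Sum>i. a i * (u - 0) ^ i)" for u :: complex
  have H: "H holomorphic_on ball 0 (1 / Q)"
    by (rule power_series_holomorphic[where a = a]) (use sm in \<open>auto simp: H_def intro: summable_sums\<close>)
  have eq: "L (G z f) = (1 / z ^ n) * H (1 / z ^ n)" if z: "z \<in> Omega" for z
  proof -
    let ?B = "\<lambda>f. cscale (1 / z ^ n) (R f)"
    have B: "blin ?B" by (rule blin_scale[OF R])
    have zq: "Q < cmod z ^ n" using Omega_pow[OF z] by (simp add: Q_def)
    have pw: "(?B ^^ i) f = cscale ((1 / z ^ n) ^ i) ((R ^^ i) f)" for i
      by (rule funpow_scale[OF R f])
    have NV: "(?B ^^ i) f \<in> V" for i by (rule blinD(1)[OF blin_funpow[OF B] f])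
    have s: "summable (\<lambda>i. N ((?B ^^ i) f))"
    proof (rule summable_comparison_test')
      show "summable (\<lambda>i. N f * (Q / cmod z ^ n) ^ i)"
        using zq Q by (intro summable_mult summable_geometric) (auto simp: divide_simps)
      show "norm (N ((?B ^^ i) f)) \<le> N f * (Q / cmod z ^ n) ^ i" for i
        unfolding pw using R_pow[OF f, of i] blinD(1)[OF blin_funpow[OF R] f, of i] Omega_nz[OF z]
        by (simp add: norm_divide norm_power Q_def power_divide divide_simps algebra_simps)
    qed
    have "(\<lambda>i. L ((?B ^^ i) f)) sums L (neumann ?B f)"
      using bfun_series[OF L NV s] by (simp add: neumann_def)
    moreover have "L ((?B ^^ i) f) = a i * (1 / z ^ n - 0) ^ i" for i
      using bfunD(2)[OF L blinD(1)[OF blin_funpow[OF R] f, of i]] unfolding pw by (simp add: a_def)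
    ultimately have "L (neumann ?B f) = H (1 / z ^ n)" by (simp add: H_def sums_iff)
    moreover have "neumann ?B f \<in> V"
      unfolding neumann_def using series[of "\<lambda>i. (?B ^^ i) f"] NV s by blast
    ultimately show ?thesis unfolding G_def using bfunD(2)[OF L] by simp
  qed
  have "(\<lambda>z. (1 / z ^ n) * H (1 / z ^ n)) holomorphic_on Omega"
  proof (intro holomorphic_intros)
    have "(H \<circ> (\<lambda>z. 1 / z ^ n)) holomorphic_on Omega"
    proof (rule holomorphic_on_compose_gen[OF _ H])
      show "(\<lambda>z. 1 / z ^ n) holomorphic_on Omega"
        using Omega_nz by (intro holomorphic_intros) auto
      show "(\<lambda>z. 1 / z ^ n) ` Omega \<subseteq> ball 0 (1 / Q)"
        using Omega_pow Omega_nz Q by (auto simp: norm_divide norm_power Q_def divide_simps)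
    qed
    then show "(\<lambda>z. H (1 / z ^ n)) holomorphic_on Omega" by (simp add: o_def)
  qed (use Omega_nz in auto)
  then show "(\<lambda>z. L (G z f)) holomorphic_on Omega"
    by (rule holomorphic_transform) (simp add: eq)
  have "filterlim (\<lambda>z::complex. z ^ n) at_infinity at_infinity"
    using n by (intro filterlim_power_at_infinity filterlim_ident) auto
  then have l0: "((\<lambda>z::complex. 1 / z ^ n) \<longlongrightarrow> 0) at_infinity"
    using filterlim_compose[OF tendsto_inverse_0] by (simp add: field_simps)
  have "isCont H 0"
    using holomorphic_on_imp_continuous_on[OF H] Q by (simp add: continuous_on_eq_continuous_at)
  then have "((\<lambda>z. (1 / z ^ n) * H (1 / z ^ n)) \<longlongrightarrow> 0 * H 0) at_infinity"
    by (intro tendsto_mult isCont_tendsto_compose[where g = H] l0)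
  then have "((\<lambda>z. (1 / z ^ n) * H (1 / z ^ n)) \<longlongrightarrow> 0) at_infinity" by simp
  then show "((\<lambda>z. L (G z f)) \<longlongrightarrow> 0) at_infinity"
    by (rule Lim_transform_eventually) (rule eventually_mono[OF eventually_Omega], simp add: eq)
qed

text \<open>Interpolates between \<open>z ^ n - R\<close> at \<open>i = 0\<close> and, by
  \<open>T_eq\<close>, \<open>z ^ n - T ^^ n\<close> at \<open>i = m\<close>.\<close>

definition Aop :: "nat \<Rightarrow> complex \<Rightarrow> ('a \<Rightarrow> complex) \<Rightarrow> ('a \<Rightarrow> complex)" where
  "Aop i z f = cscale (z ^ n) f - R f - (\<Sum>j<i. cscale (l j f) (e j))"

lemma blin_Aop: "blin (Aop i z)"
  unfolding Aop_def
  by (intro blin_diff blin_scale[of "\<lambda>f. f"] blin_id R blin_sum_op blin_rank1 l e) simp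

text \<open>The resolvent of \<open>R\<close> plus finitely many rank-one operators, written with a scalar denominator
  \<open>d\<close>.  Each rank-one summand \<open>l \<otimes> e\<close> is added by the Sherman--Morrison formula
  \<open>(A - l \<otimes> e)\<^sup>-\<^sup>1 f = A\<^sup>-\<^sup>1 f + l (A\<^sup>-\<^sup>1 f) / (1 - l (A\<^sup>-\<^sup>1 e)) \<cdot> A\<^sup>-\<^sup>1 e\<close>; the limits at
  infinity guarantee that the denominator does not vanish identically.\<close>

definition good_family :: "nat \<Rightarrow> (complex \<Rightarrow> complex) \<Rightarrow> (complex \<Rightarrow> ('a \<Rightarrow> complex) \<Rightarrow> ('a \<Rightarrow> complex)) \<Rightarrow> bool" where
  "good_family i d P \<longleftrightarrow> d holomorphic_on Omega \<and> (d \<longlongrightarrow> 1) at_infinity \<and>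
     (\<forall>z\<in>Omega. blin (P z)) \<and>
     (\<forall>z\<in>Omega. \<forall>f\<in>V. Aop i z (P z f) = cscale (d z) f \<and> P z (Aop i z f) = cscale (d z) f) \<and>
     (\<forall>f\<in>V. \<exists>a. (\<forall>j<i. a j holomorphic_on Omega \<and> (a j \<longlongrightarrow> 0) at_infinity) \<and>
        (\<forall>z\<in>Omega. P z f = cscale (d z) (G z f) + (\<Sum>j<i. cscale (a j z) (G z (e j)))))"

lemma good_familyE:
  assumes g: "good_family i d P" and f: "f \<in> V"
  obtains a where "\<forall>j<i. a j holomorphic_on Omega" "\<forall>j<i. (a j \<longlongrightarrow> 0) at_infinity"
    "\<forall>z\<in>Omega. P z f = cscale (d z) (G z f) + (\<Sum>j<i. cscale (a j z) (G z (e j)))"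
proof -
  have "\<exists>a. (\<forall>j<i. a j holomorphic_on Omega \<and> (a j \<longlongrightarrow> 0) at_infinity) \<and>
        (\<forall>z\<in>Omega. P z f = cscale (d z) (G z f) + (\<Sum>j<i. cscale (a j z) (G z (e j))))"
    using g unfolding good_family_def by (elim conjE) (erule bspec[OF _ f])
  then obtain a where "\<forall>j<i. a j holomorphic_on Omega \<and> (a j \<longlongrightarrow> 0) at_infinity"
    "\<forall>z\<in>Omega. P z f = cscale (d z) (G z f) + (\<Sum>j<i. cscale (a j z) (G z (e j)))"
    by (elim exE conjE)
  then show ?thesis by (intro that[of a]) blast+
qed

text \<open>The expansion of \<open>P z f\<close> in \<open>G z f\<close> and the
  \<open>G z (e j)\<close> has scalar holomorphic coefficients, so holomorphy and the limit reduce
  to \<open>bfun_G\<close>. The limit zero keeps the next denominator asymptotic to one.\<close>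

lemma good_family_bfun:
  assumes g: "good_family i d P" and L: "bfun L" and f: "f \<in> V"
  shows "(\<lambda>z. L (P z f)) holomorphic_on Omega" "((\<lambda>z. L (P z f)) \<longlongrightarrow> 0) at_infinity"
proof -
  obtain a where a': "\<forall>j<i. a j holomorphic_on Omega" "\<forall>j<i. (a j \<longlongrightarrow> 0) at_infinity"
    and P': "\<forall>z\<in>Omega. P z f = cscale (d z) (G z f) + (\<Sum>j<i. cscale (a j z) (G z (e j)))"
    by (rule good_familyE[OF g f])
  note a = a'[rule_format] and P = P'[rule_format]
  have d: "d holomorphic_on Omega" "(d \<longlongrightarrow> 1) at_infinity" using g by (auto simp: good_family_def)
  have eq: "L (P z f) = d z * L (G z f) + (\<Sum>j<i. a j z * L (G z (e j)))" if z: "z \<in> Omega" for z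
  proof -
    have V: "G z h \<in> V" if "h \<in> V" for h using blinD(1)[OF G(1)[OF z] that] .
    show ?thesis unfolding P[OF z]
      using V f by (simp add: bfunD[OF L] bfun_sum[OF L])
  qed
  note GL = bfun_G[OF L f] bfun_G[OF L e]
  have "(\<lambda>z. d z * L (G z f) + (\<Sum>j<i. a j z * L (G z (e j)))) holomorphic_on Omega"
    by (intro holomorphic_on_add holomorphic_on_mult holomorphic_on_sum d a GL) auto
  then show "(\<lambda>z. L (P z f)) holomorphic_on Omega"
    by (rule holomorphic_transform) (simp add: eq)
  have "((\<lambda>z. d z * L (G z f) + (\<Sum>j<i. a j z * L (G z (e j)))) \<longlongrightarrow> 1 * 0 + (\<Sum>j<i. 0 * 0)) at_infinity"
    by (intro tendsto_add tendsto_mult tendsto_sum d a GL) auto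
  then have "((\<lambda>z. d z * L (G z f) + (\<Sum>j<i. a j z * L (G z (e j)))) \<longlongrightarrow> 0) at_infinity" by simp
  then show "((\<lambda>z. L (P z f)) \<longlongrightarrow> 0) at_infinity"
    by (rule Lim_transform_eventually) (rule eventually_mono[OF eventually_Omega], simp add: eq)
qed

lemma good_family_0: "good_family 0 (\<lambda>z. 1) G"
  unfolding good_family_def using G by (auto simp: Aop_def)

lemma good_family_Suc:
  assumes g: "good_family i d P"
  shows "\<exists>d' P'. good_family (Suc i) d' P'"
proof -
  \<comment> \<open>With \<open>P / d\<close> as the inverse of the previous operator, the
    Sherman--Morrison correction has denominator \<open>c / d\<close>. Multiplying through by
    \<open>d * c\<close> clears all denominators and gives \<open>d'\<close> and \<open>P'\<close>,
    so zeros of \<open>d\<close> and \<open>c\<close> call for no separate treatment.\<close>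
  define c where "c z = d z - l i (P z (e i))" for z
  define d' where "d' z = d z * c z" for z
  define P' where "P' z f = cscale (c z) (P z f) + cscale (l i (P z f)) (P z (e i))" for z f
  have d: "d holomorphic_on Omega" "(d \<longlongrightarrow> 1) at_infinity" using g by (auto simp: good_family_def)
  have P: "blin (P z)" if "z \<in> Omega" for z using g that by (auto simp: good_family_def)
  have A1: "Aop i z (P z f) = cscale (d z) f" and A2: "P z (Aop i z f) = cscale (d z) f"
    if "z \<in> Omega" "f \<in> V" for z f
    using g that by (auto simp: good_family_def)
  have AS: "Aop (Suc i) z f = Aop i z f - cscale (l i f) (e i)" for z f
    by (simp add: Aop_def fun_eq_iff)
  have c: "c holomorphic_on Omega" "(c \<longlongrightarrow> 1 - 0) at_infinity"
    unfolding c_def[abs_def] by (intro holomorphic_intros tendsto_intros d good_family_bfun[OF g] l e)+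
  have "good_family (Suc i) d' P'"
    unfolding good_family_def
  proof (intro conjI ballI)
    show "d' holomorphic_on Omega" unfolding d'_def[abs_def] by (intro holomorphic_intros d c)
    show "(d' \<longlongrightarrow> 1) at_infinity" using tendsto_mult[OF d(2) c(2)] by (simp add: d'_def[abs_def])
  next
    fix z assume z: "z \<in> Omega"
    have eV: "P z (e i) \<in> V" by (rule blinD(1)[OF P[OF z] e])
    show "blin (P' z)" unfolding P'_def
      by (intro blin_add blin_scale P z blin_rank1 bfun_comp[OF l] eV)
    fix f assume f: "f \<in> V"
    have fV: "P z f \<in> V" by (rule blinD(1)[OF P[OF z] f])
    have "Aop i z (P' z f) = cscale (c z) (cscale (d z) f) + cscale (l i (P z f)) (cscale (d z) (e i))"
      unfolding P'_def using fV eV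
      by (simp add: blinD[OF blin_Aop] A1 z f)
    moreover have "l i (P' z f) = c z * l i (P z f) + l i (P z f) * l i (P z (e i))"
      unfolding P'_def using fV eV by (simp add: bfunD[OF l])
    ultimately show "Aop (Suc i) z (P' z f) = cscale (d' z) f"
      unfolding AS by (simp add: fun_eq_iff d'_def c_def algebra_simps)
    have AV: "Aop i z f \<in> V" by (rule blinD(1)[OF blin_Aop f])
    have u: "P z (Aop (Suc i) z f) = cscale (d z) f - cscale (l i f) (P z (e i))"
      unfolding AS using AV blinD(4)[OF P[OF z] AV, of "cscale (l i f) (e i)"] blinD(3)[OF P[OF z] e]
      by (simp add: A2 z f)
    have v: "l i (P z (Aop (Suc i) z f)) = d z * l i f - l i f * l i (P z (e i))"
      unfolding u using bfunD(3)[OF l, of "cscale (d z) f" "cscale (l i f) (P z (e i))"] f eV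
      by (simp add: bfunD(2)[OF l])
    show "P' z (Aop (Suc i) z f) = cscale (d' z) f"
      unfolding P'_def v unfolding u by (simp add: fun_eq_iff d'_def c_def algebra_simps)
  next
    fix f assume f: "f \<in> V"
    obtain a where a0: "\<forall>j<i. a j holomorphic_on Omega" "\<forall>j<i. (a j \<longlongrightarrow> 0) at_infinity"
      "\<forall>z\<in>Omega. P z f = cscale (d z) (G z f) + (\<Sum>j<i. cscale (a j z) (G z (e j)))"
      by (rule good_familyE[OF g f])
    obtain b where b0: "\<forall>j<i. b j holomorphic_on Omega" "\<forall>j<i. (b j \<longlongrightarrow> 0) at_infinity"
      "\<forall>z\<in>Omega. P z (e i) = cscale (d z) (G z (e i)) + (\<Sum>j<i. cscale (b j z) (G z (e j)))"
      by (rule good_familyE[OF g e])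
    note a = a0(1,2)[rule_format] and Pa = a0(3)[rule_format]
    note b = b0(1,2)[rule_format] and Pb = b0(3)[rule_format]
    let ?L = "\<lambda>z. l i (P z f)"
    note L = good_family_bfun[OF g l f, of i]
    define a' where "a' j = (if j < i then (\<lambda>z. c z * a j z + ?L z * b j z) else (\<lambda>z. ?L z * d z))" for j
    show "\<exists>a. (\<forall>j<Suc i. a j holomorphic_on Omega \<and> (a j \<longlongrightarrow> 0) at_infinity) \<and>
        (\<forall>z\<in>Omega. P' z f = cscale (d' z) (G z f) + (\<Sum>j<Suc i. cscale (a j z) (G z (e j))))"
    proof (intro exI[of _ a'] conjI allI impI ballI)
      fix j assume "j < Suc i"
      show "a' j holomorphic_on Omega"
        unfolding a'_def using \<open>j < Suc i\<close>
        by (cases "j < i") (auto intro!: holomorphic_on_add holomorphic_on_mult c(1) a(1) L(1) b(1) d(1))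
      have "((\<lambda>z. c z * a j z + ?L z * b j z) \<longlongrightarrow> (1 - 0) * 0 + 0 * 0) at_infinity" if "j < i"
        by (intro tendsto_add tendsto_mult c a L b d that)
      moreover have "((\<lambda>z. ?L z * d z) \<longlongrightarrow> 0 * 1) at_infinity"
        by (intro tendsto_mult L d)
      ultimately show "(a' j \<longlongrightarrow> 0) at_infinity" by (simp add: a'_def)
    next
      fix z assume z: "z \<in> Omega"
      have *: "(\<Sum>j<i. a' j z * G z (e j) x) =
          c z * (\<Sum>j<i. a j z * G z (e j) x) + ?L z * (\<Sum>j<i. b j z * G z (e j) x)" for x
        by (simp add: a'_def sum_distrib_left sum.distrib[symmetric] algebra_simps)
      show "P' z f = cscale (d' z) (G z f) + (\<Sum>j<Suc i. cscale (a' j z) (G z (e j)))"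
      proof
        fix x
        have "P' z f x = c z * (d z * G z f x + (\<Sum>j<i. a j z * G z (e j) x)) +
            ?L z * (d z * G z (e i) x + (\<Sum>j<i. b j z * G z (e j) x))"
          using fun_cong[OF Pa[OF z], of x] fun_cong[OF Pb[OF z], of x]
          by (simp add: P'_def sum_fun_apply)
        also have "\<dots> = d' z * G z f x + ((\<Sum>j<i. a' j z * G z (e j) x) + a' i z * G z (e i) x)"
          unfolding * by (simp add: a'_def d'_def algebra_simps)
        finally show "P' z f x = (cscale (d' z) (G z f) + (\<Sum>j<Suc i. cscale (a' j z) (G z (e j)))) x"
          by (simp add: sum_fun_apply)
      qed
    qed
  qed
  then show ?thesis by blast
qed

lemma good_family_ex: "\<exists>d P. good_family i d P"
  using good_family_0 good_family_Suc by (induction i) blast+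

text \<open>The cofactor in \<open>z ^ n - T ^^ n = (z - T) Q z\<close>. It commutes with
  \<open>T\<close>, so an inverse of \<open>z ^ n - T ^^ n\<close> followed by \<open>Q z\<close>
  inverts \<open>z - T\<close>; this is \<open>res\<close>.\<close>

definition Q :: "complex \<Rightarrow> ('a \<Rightarrow> complex) \<Rightarrow> ('a \<Rightarrow> complex)" where
  "Q z f = (\<Sum>i<n. cscale (z ^ (n - 1 - i)) ((T ^^ i) f))"

lemma blin_Q: "blin (Q z)"
  unfolding Q_def by (intro blin_sum_op blin_scale blin_funpow T) simp

lemma T_pow_mem [simp]: "f \<in> V \<Longrightarrow> (T ^^ i) f \<in> V"
  by (rule blinD(1)[OF blin_funpow[OF T]])

lemma T_Q: "f \<in> V \<Longrightarrow> T (Q z f) = Q z (T f)"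
  unfolding Q_def by (simp add: blin_sum[OF T] blinD[OF T] funpow_swap1)

lemma Q_eq:
  assumes f: "f \<in> V" shows "cscale z (Q z f) - T (Q z f) = Aop m z f"
proof
  fix x
  define h where "h i = z ^ (n - i) * (T ^^ i) f x" for i
  have "(cscale z (Q z f) - T (Q z f)) x = (\<Sum>i<n. h i - h (Suc i))"
  proof -
    have "T (Q z f) = (\<Sum>i<n. cscale (z ^ (n - 1 - i)) ((T ^^ Suc i) f))"
      unfolding Q_def using f by (simp add: blin_sum[OF T] blinD[OF T])
    then have "(cscale z (Q z f) - T (Q z f)) x =
        (\<Sum>i<n. z * (z ^ (n - 1 - i) * (T ^^ i) f x) - z ^ (n - 1 - i) * (T ^^ Suc i) f x)"
      by (simp add: Q_def sum_fun_apply sum_distrib_left sum_subtractf)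
    also have "\<dots> = (\<Sum>i<n. h i - h (Suc i))"
    proof (intro sum.cong refl)
      fix i assume "i \<in> {..<n}"
      then have "n - i = Suc (n - 1 - i)" "n - 1 - i = n - Suc i" by auto
      then show "z * (z ^ (n - 1 - i) * (T ^^ i) f x) - z ^ (n - 1 - i) * (T ^^ Suc i) f x = h i - h (Suc i)"
        by (simp add: h_def)
    qed
    finally show ?thesis .
  qed
  also have "\<dots> = h 0 - h n" by (rule sum_lessThan_telescope')
  also have "\<dots> = Aop m z f x" using T_eq[OF f] by (simp add: h_def Aop_def)
  finally show "(cscale z (Q z f) - T (Q z f)) x = Aop m z f x" .
qed

lemma blin_zT: "blin (\<lambda>f. cscale z f - T f)"
  by (intro blin_diff blin_scale[of "\<lambda>f. f"] blin_id T)

lemma Q_zT: "f \<in> V \<Longrightarrow> Q z (cscale z f - T f) = Aop m z f"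
  using Q_eq[of f z] blinD(4)[OF blin_Q, of "cscale z f" "T f"] blinD(1)[OF T, of f]
  by (simp add: T_Q blinD(3)[OF blin_Q])

definition d :: "complex \<Rightarrow> complex" where "d = (SOME d. \<exists>P. good_family m d P)"
definition P :: "complex \<Rightarrow> ('a \<Rightarrow> complex) \<Rightarrow> ('a \<Rightarrow> complex)" where "P = (SOME P. good_family m d P)"

lemma good: "good_family m d P"
proof -
  have "\<exists>P. good_family m d P" unfolding d_def by (rule someI_ex[of "\<lambda>d. \<exists>P. good_family m d P"]) (rule good_family_ex)
  then show ?thesis unfolding P_def by (rule someI_ex)
qed

lemma P:
  assumes "z \<in> Omega"
  shows "blin (P z)" "f \<in> V \<Longrightarrow> Aop m z (P z f) = cscale (d z) f"
    "f \<in> V \<Longrightarrow> P z (Aop m z f) = cscale (d z) f"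
  using good assms by (auto simp: good_family_def)

definition res :: "complex \<Rightarrow> ('a \<Rightarrow> complex) \<Rightarrow> ('a \<Rightarrow> complex)" where
  "res z f = cscale (1 / d z) (Q z (P z f))"

lemma res:
  assumes z: "z \<in> Omega" "d z \<noteq> 0"
  shows "blin (res z)" "f \<in> V \<Longrightarrow> cscale z (res z f) - T (res z f) = f"
    "f \<in> V \<Longrightarrow> res z (cscale z f - T f) = f"
    "f \<in> V \<Longrightarrow> g \<in> V \<Longrightarrow> cscale z f - T f = cscale z g - T g \<Longrightarrow> f = g"
proof -
  show b: "blin (res z)" unfolding res_def by (intro blin_scale blin_comp[OF blin_Q] P z)
  have PV: "P z f \<in> V" "Q z f \<in> V" "Q z (P z f) \<in> V" if "f \<in> V" for f
    using blinD(1)[OF P(1)[OF z(1)] that] blinD(1)[OF blin_Q] that by auto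
  show *: "cscale z (res z f) - T (res z f) = f" if f: "f \<in> V" for f
  proof -
    have "cscale z (res z f) - T (res z f) = cscale (1 / d z) (Aop m z (P z f))"
      unfolding Q_eq[OF PV(1)[OF f], symmetric] res_def
      using blinD(3)[OF T PV(3)[OF f]] by (simp add: fun_eq_iff algebra_simps)
    then show ?thesis using P(2)[OF z(1) f] z by (simp add: fun_eq_iff)
  qed
  show inj: "f = g" if f: "f \<in> V" "g \<in> V" and eq: "cscale z f - T f = cscale z g - T g" for f g
  proof -
    have "cscale (d z) f = cscale (d z) g"
      using P(3)[OF z(1) f(1)] P(3)[OF z(1) f(2)] Q_zT[OF f(1), of z] Q_zT[OF f(2), of z] eq by simp
    then show ?thesis using z by (simp add: fun_eq_iff)
  qed
  show "res z (cscale z f - T f) = f" if f: "f \<in> V"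
    by (rule inj) (use * blinD(1)[OF b] blinD(1)[OF T] f in simp_all)
qed

lemma not_in_spectrum: 
  assumes z: "z \<in> Omega" "d z \<noteq> 0" shows "z \<notin> spectrum V N T"
proof -
  obtain K where "\<And>f. f \<in> V \<Longrightarrow> N (res z f) \<le> K * N f" using blin_bound[OF res(1)[OF z]] by blast
  then show ?thesis
    by (intro not_in_spectrumI[where R = "res z" and K = K]) (simp_all add: res[OF z] blinD(1)[OF res(1)[OF z]])
qed

lemma resolvent_eq:
  assumes z: "z \<in> Omega" "d z \<noteq> 0" and f: "f \<in> V" shows "resolvent V T z f = res z f"
  unfolding resolvent_def
proof (rule the_equality)
  show "res z f \<in> V \<and> cscale z (res z f) - T (res z f) = f"
    using res(2)[OF z f] blinD(1)[OF res(1)[OF z] f] by blast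
next
  fix h assume "h \<in> V \<and> cscale z h - T h = f"
  then show "h = res z f" using res(2)[OF z f] blinD(1)[OF res(1)[OF z] f] res(4)[OF z, of h "res z f"] by simp
qed

text \<open>A spectral point is a zero of \<open>d\<close>. Since \<open>d\<close> tends to one at
  infinity and \<open>Omega\<close> is connected, \<open>d\<close> is not constant, so the zero is
  isolated and of finite order. Isolation in the spectrum comes from here.\<close>

lemma zero_factor:
  assumes p: "p \<in> Omega" "p \<in> spectrum V N T"
  obtains g r t where "0 < t" "0 < r" "ball p r \<subseteq> Omega" "g holomorphic_on ball p r"
    "\<And>w. w \<in> ball p r \<Longrightarrow> d w = (w - p) ^ t * g w" "\<And>w. w \<in> ball p r \<Longrightarrow> g w \<noteq> 0"
proof -
  have d: "d holomorphic_on Omega" "(d \<longlongrightarrow> 1) at_infinity" using good by (auto simp: good_family_def)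
  have dp: "d p = 0" using not_in_spectrum p by blast
  have "\<not> d constant_on Omega"
  proof
    assume "d constant_on Omega"
    then have "d z = 0" if "z \<in> Omega" for z using dp p(1) that by (auto simp: constant_on_def)
    then have "(d \<longlongrightarrow> 0) at_infinity"
      by (intro tendsto_eventually eventually_mono[OF eventually_Omega]) auto
    then show False using tendsto_unique[OF trivial_limit_at_infinity _ d(2)] by fastforce
  qed
  then show ?thesis
    by (rule holomorphic_factor_zero_nonconstant[OF d(1) open_Omega connected_Omega p(1) dp]) (rule that)
qed

text \<open>If \<open>p - T\<close> were bounded below by \<open>\<kappa>\<close>, the resolvents at
  points close to \<open>p\<close> with \<open>d \<noteq> 0\<close> would be bounded by
  \<open>2 / \<kappa>\<close>, and a Neumann series around one of them would invert
  \<open>p - T\<close>.\<close>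

lemma approximate_eigenvector:
  assumes p: "p \<in> Omega" "p \<in> spectrum V N T" and \<kappa>: "\<kappa> > 0"
  shows "\<exists>f\<in>V. N f = 1 \<and> N (cscale p f - T f) < \<kappa>"
proof (rule ccontr)
  assume neg: "\<not> ?thesis"
  have low: "\<kappa> * N f \<le> N (cscale p f - T f)" if f: "f \<in> V" for f
  proof (cases "N f = 0")
    case True
    then show ?thesis using blinD(1)[OF blin_zT f, of p] by simp
  next
    case False
    then have pos: "N f > 0" using N_nonneg[OF f] by linarith
    let ?c = "complex_of_real (1 / N f)"
    have "N (cscale ?c f) = 1" using f pos by (simp add: norm_divide)
    then have "\<kappa> \<le> N (cscale p (cscale ?c f) - T (cscale ?c f))"
      using neg scale_mem[OF f, of ?c] by (meson not_less)
    also have "cscale p (cscale ?c f) - T (cscale ?c f) = cscale ?c (cscale p f - T f)"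
      using blinD(3)[OF blin_zT f, of p ?c] by simp
    also have "N \<dots> = N (cscale p f - T f) / N f"
      using blinD(1)[OF blin_zT f, of p] pos by (simp add: norm_divide)
    finally show ?thesis using pos by (simp add: field_simps)
  qed
  obtain g r t where g: "0 < t" "0 < r" "ball p r \<subseteq> Omega" and "g holomorphic_on ball p r"
    and g': "\<And>w. w \<in> ball p r \<Longrightarrow> d w = (w - p) ^ t * g w" "\<And>w. w \<in> ball p r \<Longrightarrow> g w \<noteq> 0"
    by (rule zero_factor[OF p]) blast
  \<comment> \<open>Half the radius keeps \<open>z\<close> in the punctured ball where
    \<open>d\<close> has no zero; \<open>\<kappa> / 4\<close> lets the perturbation be absorbed into
    the lower bound and makes \<open>(z - p) * res z\<close> of norm at most one half.\<close>
  define z where "z = p + of_real (min (r / 2) (\<kappa> / 4))"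
  have zp: "cmod (z - p) = min (r / 2) (\<kappa> / 4)" "cmod (z - p) > 0"
    using g(2) \<kappa> by (auto simp: z_def)
  have "z \<in> ball p r" using zp g(2) by (auto simp: dist_norm norm_minus_commute)
  then have z: "z \<in> Omega" "d z \<noteq> 0" using g g' zp by auto
  have rV: "res z f \<in> V" if "f \<in> V" for f using blinD(1)[OF res(1)[OF z] that] .
  have rb: "N (res z f) \<le> 2 / \<kappa> * N f" if f: "f \<in> V" for f
  proof -
    let ?h = "res z f"
    have "cscale p ?h - T ?h = f - cscale (z - p) ?h"
      using res(2)[OF z f] by (auto simp: fun_eq_iff algebra_simps)
    then have "\<kappa> * N ?h \<le> N (f - cscale (z - p) ?h)" using low[OF rV[OF f]] by simp
    also have "\<dots> \<le> N f + cmod (z - p) * N ?h" using N_minus[of f "cscale (z - p) ?h"] f rV by simp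
    also have "cmod (z - p) * N ?h \<le> \<kappa> / 4 * N ?h"
      using zp(1) N_nonneg[OF rV[OF f]] by (intro mult_right_mono) auto
    finally have "3 / 4 * \<kappa> * N ?h \<le> N f" by simp
    moreover have "\<kappa> / 2 * N ?h \<le> 3 / 4 * \<kappa> * N ?h"
      using \<kappa> N_nonneg[OF rV[OF f]] by (intro mult_right_mono) auto
    ultimately have "\<kappa> / 2 * N ?h \<le> N f" by linarith
    then show ?thesis using \<kappa> by (simp add: field_simps)
  qed
  let ?B = "\<lambda>f. cscale (z - p) (res z f)"
  have B: "blin ?B" by (intro blin_scale res(1)[OF z])
  have Bh: "N (?B f) \<le> 1 / 2 * N f" if f: "f \<in> V" for f
  proof -
    have "N (?B f) = cmod (z - p) * N (res z f)" using rV[OF f] by simp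
    also have "\<dots> \<le> \<kappa> / 4 * (2 / \<kappa> * N f)"
      using zp(1) \<kappa> N_nonneg[OF rV[OF f]] by (intro mult_mono rb f) auto
    finally show ?thesis using \<kappa> by simp
  qed
  have Bi: "N ((?B ^^ i) f) \<le> (1/2) ^ i * N f" if f: "f \<in> V" for f i
  proof (induction i)
    case (Suc i)
    have "N (?B ((?B ^^ i) f)) \<le> 1 / 2 * N ((?B ^^ i) f)"
      by (rule Bh[OF blinD(1)[OF blin_funpow[OF B] f]])
    also have "\<dots> \<le> 1 / 2 * ((1/2) ^ i * N f)" by (rule mult_left_mono[OF Suc]) simp
    finally show ?case unfolding funpow.simps o_def power_Suc mult.assoc .
  qed simp
  have Bi': "\<forall>i. \<forall>f\<in>V. N ((?B ^^ i) f) \<le> (1/2) ^ i * N f" using Bi by blast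
  have "summable (\<lambda>i. (1/2::real) ^ i)" by (intro summable_geometric) auto
  note nm = neumann[OF B Bi' this]
  have bl: "blin (\<lambda>f. res z (neumann ?B f))" by (rule blin_comp[OF res(1)[OF z] nm(1)])
  obtain K where K: "\<And>f. f \<in> V \<Longrightarrow> N (res z (neumann ?B f)) \<le> K * N f" using blin_bound[OF bl] by blast
  have shift: "cscale p (res z h) - T (res z h) = h - ?B h" if h: "h \<in> V" for h
    using res(2)[OF z h] by (auto simp: fun_eq_iff algebra_simps)
  have "p \<notin> spectrum V N T"
  proof (rule not_in_spectrumI[where R = "\<lambda>f. res z (neumann ?B f)" and K = K])
    fix f assume f: "f \<in> V"
    show "res z (neumann ?B f) \<in> V" by (rule blinD(1)[OF bl f])
    show "N (res z (neumann ?B f)) \<le> K * N f" by (rule K[OF f])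
    show "cscale p (res z (neumann ?B f)) - T (res z (neumann ?B f)) = f"
      unfolding shift[OF blinD(1)[OF nm(1) f]] by (rule nm(3)[OF f])
    have zf: "cscale z f - T f \<in> V" by (rule blinD(1)[OF blin_zT f])
    have eq: "cscale p f - T f = (cscale z f - T f) - ?B (cscale z f - T f)"
      using shift[OF zf] res(3)[OF z f] by simp
    show "res z (neumann ?B (cscale p f - T f)) = f"
      unfolding eq nm(4)[OF zf] by (rule res(3)[OF z f])
  qed
  then show False using p by blast
qed

text \<open>Approximate eigenvectors converge along a subsequence: applying \<open>G p\<close> and
  \<open>Q p\<close> to \<open>p f - T f\<close> returns \<open>f\<close> minus the sum of the
  \<open>l j f * G p (e j)\<close>, so \<open>f\<close> is close to a vector determined by
  \<open>m\<close> bounded numbers. The limit \<open>h\<close> has norm at least one, hence is a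
  genuine eigenvector.\<close>

lemma eigenvalue_of_spectrum:
  assumes p: "p \<in> Omega" "p \<in> spectrum V N T" shows "eigenvalue V T p"
proof -
  have "\<exists>f\<in>V. N f = 1 \<and> N (cscale p f - T f) < 1 / real (Suc i)" for i
    by (intro approximate_eigenvector p) simp
  then obtain F where F: "\<And>i. F i \<in> V" "\<And>i. N (F i) = 1"
    "\<And>i. N (cscale p (F i) - T (F i)) < 1 / real (Suc i)" by metis
  have "\<forall>j. \<exists>K. \<forall>f\<in>V. cmod (l j f) \<le> K * N f" using l unfolding bfun_def by blast
  then obtain Kl where "\<forall>j. \<forall>f\<in>V. cmod (l j f) \<le> Kl j * N f" by (rule choice[THEN exE])
  then have Kl: "\<And>j f. f \<in> V \<Longrightarrow> cmod (l j f) \<le> Kl j * N f" by blast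
  have "countable {..<m}" by simp
  moreover have "norm (l j (F i)) \<le> (\<Sum>j<m. \<bar>Kl j\<bar>)" if "j \<in> {..<m}" for i j
  proof -
    have "norm (l j (F i)) \<le> \<bar>Kl j\<bar>" using Kl[OF F(1), of j i] F(2) by simp
    also have "\<dots> \<le> (\<Sum>j<m. \<bar>Kl j\<bar>)" using that by (intro member_le_sum) auto
    finally show ?thesis .
  qed
  ultimately obtain s where s: "strict_mono (s :: nat \<Rightarrow> nat)"
    "\<And>j. j \<in> {..<m} \<Longrightarrow> \<exists>c. (\<lambda>i. l j (F (s i))) \<longlonglongrightarrow> c"
    using function_convergent_subsequence[of "{..<m}" "\<lambda>i j. l j (F i)"] by metis
  obtain c where c: "\<And>j. j < m \<Longrightarrow> (\<lambda>i. l j (F (s i))) \<longlonglongrightarrow> c j" using s(2) by (metis lessThan_iff)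
  define h where "h = (\<Sum>j<m. cscale (c j) (G p (e j)))"
  have GV: "G p f \<in> V" if "f \<in> V" for f using blinD(1)[OF G(1)[OF p(1)] that] .
  have hV: "h \<in> V" unfolding h_def using GV by simp
  obtain K where K: "K \<ge> 0" "\<And>f. f \<in> V \<Longrightarrow> N (G p (Q p f)) \<le> K * N f"
    using blin_bound[OF blin_comp[OF G(1)[OF p(1)] blin_Q]] by blast
  obtain K' where K': "K' \<ge> 0" "\<And>f. f \<in> V \<Longrightarrow> N (cscale p f - T f) \<le> K' * N f"
    using blin_bound[OF blin_zT] by blast
  have GA: "G p (Q p (cscale p f - T f)) = f - (\<Sum>j<m. cscale (l j f) (G p (e j)))" if f: "f \<in> V" for f
  proof -
    have V': "cscale (p ^ n) f - R f \<in> V" using f blinD(1)[OF R f] by simp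
    show ?thesis
      unfolding Q_zT[OF f] Aop_def
      using blinD(4)[OF G(1)[OF p(1)] V', of "\<Sum>j<m. cscale (l j f) (e j)"]
      by (simp add: G(4)[OF p(1) f] blin_sum[OF G(1)[OF p(1)]] blinD(3)[OF G(1)[OF p(1)]])
  qed
  have dist: "N (F i - h) \<le> K / real (Suc i) + (\<Sum>j<m. cmod (l j (F i) - c j) * N (G p (e j)))" for i
  proof -
    let ?f = "F i"
    have zf: "cscale p ?f - T ?f \<in> V" by (rule blinD(1)[OF blin_zT F(1)])
    have "N (G p (Q p (cscale p ?f - T ?f))) \<le> K * (1 / real (Suc i))"
      using K(2)[OF zf] mult_left_mono[OF less_imp_le[OF F(3)[of i]] K(1)] by linarith
    moreover have "?f - h = G p (Q p (cscale p ?f - T ?f)) + (\<Sum>j<m. cscale (l j ?f - c j) (G p (e j)))"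
      unfolding GA[OF F(1)] by (auto simp: h_def fun_eq_iff sum_fun_apply algebra_simps sum_subtractf)
    moreover have "N (G p (Q p (cscale p ?f - T ?f)) + (\<Sum>j<m. cscale (l j ?f - c j) (G p (e j)))) \<le>
        N (G p (Q p (cscale p ?f - T ?f))) + N (\<Sum>j<m. cscale (l j ?f - c j) (G p (e j)))"
      using GV e blinD(1)[OF blin_Q zf] by (intro N_add sum_mem scale_mem) auto
    moreover have "N (\<Sum>j<m. cscale (l j ?f - c j) (G p (e j))) \<le> (\<Sum>j<m. cmod (l j ?f - c j) * N (G p (e j)))"
      using N_sum[of "{..<m}" "\<lambda>j. cscale (l j ?f - c j) (G p (e j))"] GV e by simp
    ultimately show ?thesis by simp
  qed
  have inv0: "(\<lambda>i. a / real (Suc (s i))) \<longlonglongrightarrow> 0" for a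
  proof -
    have "(\<lambda>i. a / real (Suc i)) \<longlonglongrightarrow> 0"
      using tendsto_mult[OF tendsto_const[of a] LIMSEQ_inverse_real_of_nat] by (simp add: divide_inverse)
    from LIMSEQ_subseq_LIMSEQ[OF this s(1)] show ?thesis by (simp add: o_def)
  qed
  have "(\<lambda>i. \<Sum>j<m. cmod (l j (F (s i)) - c j) * N (G p (e j))) \<longlonglongrightarrow> (\<Sum>j<m. 0 * N (G p (e j)))"
  proof (intro tendsto_sum tendsto_mult tendsto_const)
    fix j assume "j \<in> {..<m}"
    then have "(\<lambda>i. l j (F (s i)) - c j) \<longlonglongrightarrow> 0" using c LIM_zero by auto
    then show "(\<lambda>i. cmod (l j (F (s i)) - c j)) \<longlonglongrightarrow> 0" by (rule tendsto_norm_zero)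
  qed
  from tendsto_add[OF inv0[of K] this]
  have "(\<lambda>i. K / real (Suc (s i)) + (\<Sum>j<m. cmod (l j (F (s i)) - c j) * N (G p (e j)))) \<longlonglongrightarrow> 0" by simp
  then have lim: "(\<lambda>i. N (F (s i) - h)) \<longlonglongrightarrow> 0"
  proof (rule Lim_null_comparison[rotated], intro always_eventually allI)
    fix i show "norm (N (F (s i) - h)) \<le> K / real (Suc (s i)) + (\<Sum>j<m. cmod (l j (F (s i)) - c j) * N (G p (e j)))"
      using dist[of "s i"] N_nonneg[OF diff_mem[OF F(1) hV], of "s i"] by simp
  qed
  have "1 \<le> N h"
  proof (rule tendsto_le[OF _ tendsto_add[OF tendsto_const[of "N h"] lim, simplified] tendsto_const[of 1]])
    show "\<forall>\<^sub>F i in sequentially. 1 \<le> N h + N (F (s i) - h)"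
      using N_rev_triangle[OF F(1) hV] F(2) by (intro always_eventually) (auto simp: algebra_simps)
  qed simp
  then have h0: "h \<noteq> 0" by auto
  have "N (cscale p h - T h) \<le> 0"
  proof (rule tendsto_le[OF _ _ tendsto_const])
    show "(\<lambda>i. 1 / real (Suc (s i)) + K' * N (F (s i) - h)) \<longlonglongrightarrow> 0"
      using tendsto_add[OF inv0[of 1] tendsto_mult[OF tendsto_const[of K'] lim]] by simp
    show "\<forall>\<^sub>F i in sequentially. N (cscale p h - T h) \<le> 1 / real (Suc (s i)) + K' * N (F (s i) - h)"
    proof (intro always_eventually allI)
      fix i
      let ?f = "F (s i)"
      have V1: "cscale p ?f - T ?f \<in> V" "cscale p (?f - h) - T (?f - h) \<in> V"
        using blinD(1)[OF blin_zT] F(1) hV diff_mem by blast+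
      have "cscale p h - T h = (cscale p ?f - T ?f) - (cscale p (?f - h) - T (?f - h))"
        using blinD(4)[OF T F(1) hV] by (auto simp: fun_eq_iff algebra_simps)
      then have "N (cscale p h - T h) \<le> N (cscale p ?f - T ?f) + N (cscale p (?f - h) - T (?f - h))"
        using N_minus[OF V1] by simp
      also have "N (cscale p (?f - h) - T (?f - h)) \<le> K' * N (?f - h)"
        by (intro K' diff_mem F(1) hV)
      finally show "N (cscale p h - T h) \<le> 1 / real (Suc (s i)) + K' * N (F (s i) - h)"
        using F(3)[of "s i"] by linarith
    qed
  qed simp
  then have "N (cscale p h - T h) = 0" using N_nonneg[OF blinD(1)[OF blin_zT hV], of p] by linarith
  then have "cscale p h - T h = 0" by (intro N_eq_0 blinD(1)[OF blin_zT hV])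
  then have "T h = cscale p h" by (simp add: fun_eq_iff)
  then show ?thesis unfolding eigenvalue_def eigenspace_def using hV h0 by blast
qed

lemma Q_G_holomorphic:
  assumes f: "f \<in> V" shows "(\<lambda>z. Q z (G z f) x) holomorphic_on Omega"
proof -
  have "(\<lambda>z. \<Sum>i<n. z ^ (n - 1 - i) * (T ^^ i) (G z f) x) holomorphic_on Omega"
    by (intro holomorphic_on_sum holomorphic_on_mult holomorphic_on_power holomorphic_on_ident
        bfun_G(1)[OF bfun_comp[OF bfun_eval blin_funpow[OF T]] f])
  then show ?thesis by (simp add: Q_def sum_fun_apply)
qed

text \<open>A residue computation. The resolvent is \<open>Q z (G z f)\<close>, holomorphic near
  \<open>p\<close>, plus the terms \<open>a j z / d z\<close> times \<open>Q z (G z (e j))\<close>.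
  The first contributes nothing to the contour integral; as \<open>d\<close> vanishes to order
  \<open>k + 1\<close>, the others give derivatives at \<open>p\<close> of order at most
  \<open>k\<close> of functions that do not depend on \<open>f\<close>. These finitely many
  derivatives span the range.\<close>

theorem isolated_finite_mult:
  assumes p: "p \<in> spectrum V N T" "r0 < cmod p"
  shows "isolated_finite_mult_eigenvalue V N T p"
proof -
  have pO: "p \<in> Omega" using p by (simp add: Omega_def)
  obtain g r t where t: "0 < t" and r: "0 < r" "ball p r \<subseteq> Omega" and g: "g holomorphic_on ball p r"
    and df: "\<And>w. w \<in> ball p r \<Longrightarrow> d w = (w - p) ^ t * g w" and gn: "\<And>w. w \<in> ball p r \<Longrightarrow> g w \<noteq> 0"
    by (rule zero_factor[OF pO p(1)]) blast
  obtain k where k: "t = Suc k" using t by (cases t) auto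
  define r' where "r' = r / 2"
  have r': "0 < r'" "cball p r' \<subseteq> ball p r" using r by (auto simp: r'_def)
  have dn: "d w \<noteq> 0" if "w \<in> ball p r" "w \<noteq> p" for w using df[OF that(1)] gn[OF that(1)] that by simp
  have sp: "spectrum V N T \<inter> cball p r' = {p}"
  proof (intro subset_antisym subsetI)
    fix z assume "z \<in> spectrum V N T \<inter> cball p r'"
    then have "z \<in> ball p r" "z \<in> Omega" "z \<in> spectrum V N T" using r'(2) r(2) by blast+
    then show "z \<in> {p}" using not_in_spectrum[of z] dn[of z] by blast
  qed (use p r' in auto)
  define D where "D j s x = (deriv ^^ s) (\<lambda>z. Q z (G z (e j)) x) p" for j s x
  let ?B = "(\<lambda>(j, s). D j s) ` ({..<m} \<times> {..k})"
  have "riesz_projection V T p r' f \<in> cfun.span ?B" if f: "f \<in> V" for f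
  proof -
    obtain a where a: "\<forall>j<m. a j holomorphic_on Omega" "\<forall>j<m. (a j \<longlongrightarrow> 0) at_infinity"
      and Pa: "\<forall>z\<in>Omega. P z f = cscale (d z) (G z f) + (\<Sum>j<m. cscale (a j z) (G z (e j)))"
      by (rule good_familyE[OF good f])
    \<comment> \<open>The Leibniz coefficients of the \<open>k\<close>-th derivative in Cauchy's
      formula; all dependence on \<open>f\<close> sits in the scalars \<open>a j\<close>.\<close>
    define C where "C j s = (1 / fact k) * (of_nat (k choose s) * (deriv ^^ s) (\<lambda>z. a j z / g z) p)" for j s
    have "riesz_projection V T p r' f x = (\<Sum>j<m. \<Sum>s=0..k. C j s * D j (k - s) x)" for x
    proof -
      let ?W = "\<lambda>h z. Q z (G z h) x"
      have W: "?W h holomorphic_on ball p r" if "h \<in> V" for h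
        using Q_G_holomorphic[OF that] r(2) by (rule holomorphic_on_subset)
      have u: "(\<lambda>z. a j z / g z) holomorphic_on ball p r" if "j < m" for j
        using a(1) that r(2) g gn by (intro holomorphic_on_divide) (auto intro: holomorphic_on_subset)
      define I where "I j = 2 * of_real pi * \<i> / fact k * (deriv ^^ k) (\<lambda>z. a j z / g z * ?W (e j) z) p" for j
      have I: "((\<lambda>z. a j z / g z * ?W (e j) z / (z - p) ^ Suc k) has_contour_integral I j) (circlepath p r')"
        if j: "j < m" for j
      proof -
        have hol: "(\<lambda>z. a j z / g z * ?W (e j) z) holomorphic_on ball p r"
          using u[OF j] W[OF e] by (rule holomorphic_on_mult)
        have "((\<lambda>z. a j z / g z * ?W (e j) z / (z - p) ^ Suc k) has_contour_integral
            2 * pi * \<i> / fact k * (deriv ^^ k) (\<lambda>z. a j z / g z * ?W (e j) z) p) (circlepath p r')"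
        proof (rule Cauchy_has_contour_integral_higher_derivative_circlepath)
          show "continuous_on (cball p r') (\<lambda>z. a j z / g z * ?W (e j) z)"
            using holomorphic_on_imp_continuous_on[OF hol] r'(2) by (rule continuous_on_subset)
          show "(\<lambda>z. a j z / g z * ?W (e j) z) holomorphic_on ball p r'"
            using hol r'(2) ball_subset_cball by (blast intro: holomorphic_on_subset)
        qed (use r' in simp)
        then show ?thesis unfolding I_def by simp
      qed
      have I': "I j = 2 * of_real pi * \<i> * (\<Sum>s=0..k. C j s * D j (k - s) x)" if j: "j < m" for j
        unfolding I_def C_def D_def
        using higher_deriv_mult[OF u[OF j] W[OF e, of j] open_ball, of p k] r(1)
        by (simp add: sum_distrib_left mult.assoc)
      have "(?W f has_contour_integral 0) (circlepath p r')"
        by (rule Cauchy_theorem_disc_simple[OF W[OF f]]) (use r' r in \<open>auto simp: r'_def dist_norm\<close>)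
      then have "((\<lambda>z. ?W f z + (\<Sum>j<m. a j z / g z * ?W (e j) z / (z - p) ^ Suc k))
          has_contour_integral (0 + (\<Sum>j<m. I j))) (circlepath p r')"
        by (intro has_contour_integral_add has_contour_integral_sum I) auto
      moreover have "resolvent V T z f x = ?W f z + (\<Sum>j<m. a j z / g z * ?W (e j) z / (z - p) ^ Suc k)"
        if "z \<in> path_image (circlepath p r')" for z
      proof -
        have "z \<in> sphere p r'" using that r' by simp
        then have zb: "z \<in> ball p r" "z \<noteq> p" using r' by auto
        then have z: "z \<in> Omega" "d z \<noteq> 0" using r(2) dn by auto
        have GV: "G z h \<in> V" if "h \<in> V" for h using blinD(1)[OF G(1)[OF z(1)] that] .
        have "Q z (P z f) = cscale (d z) (Q z (G z f)) + (\<Sum>j<m. cscale (a j z) (Q z (G z (e j))))"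
          using Pa z(1) GV f by (simp add: blinD[OF blin_Q] blin_sum[OF blin_Q])
        then have "res z f x = ?W f z + (\<Sum>j<m. a j z * ?W (e j) z) / d z"
          using z(2) by (simp add: res_def sum_fun_apply field_simps)
        also have "(\<Sum>j<m. a j z * ?W (e j) z) / d z = (\<Sum>j<m. a j z / g z * ?W (e j) z / (z - p) ^ Suc k)"
          unfolding sum_divide_distrib df[OF zb(1)] k by (intro sum.cong) (simp_all add: field_simps)
        finally show ?thesis using resolvent_eq[OF z f] by simp
      qed
      ultimately have "((\<lambda>z. resolvent V T z f x) has_contour_integral (\<Sum>j<m. I j)) (circlepath p r')"
        by (subst has_contour_integral_cong) auto
      then have "contour_integral (circlepath p r') (\<lambda>z. resolvent V T z f x) = (\<Sum>j<m. I j)"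
        by (rule contour_integral_unique)
      also have "\<dots> = 2 * of_real pi * \<i> * (\<Sum>j<m. \<Sum>s=0..k. C j s * D j (k - s) x)"
        using I' by (simp add: sum_distrib_left)
      finally show ?thesis unfolding riesz_projection_def by simp
    qed
    then have "riesz_projection V T p r' f = (\<Sum>j<m. \<Sum>s=0..k. cscale (C j s) (D j (k - s)))"
      by (simp add: fun_eq_iff sum_fun_apply)
    moreover have "(\<Sum>j<m. \<Sum>s=0..k. cscale (C j s) (D j (k - s))) \<in> cfun.span ?B"
    proof (intro cfun.span_sum cfun.span_scale cfun.span_base)
      fix j s assume "j \<in> {..<m}" "s \<in> {0..k}"
      then have "(j, k - s) \<in> {..<m} \<times> {..k}" by auto
      then show "D j (k - s) \<in> ?B" by (rule rev_image_eqI) simp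
    qed
    ultimately show ?thesis by simp
  qed
  then have "finite_dim (riesz_projection V T p r' ` V)"
    unfolding finite_dim_def by (intro exI[of _ ?B]) auto
  then show ?thesis
    unfolding isolated_finite_mult_eigenvalue_def using eigenvalue_of_spectrum[OF pO p(1)] sp r'(1) by blast
qed

end

section \<open>Lipschitz functions on symbolic spaces\<close>

text \<open>Agreement to depth \<open>n\<close> is membership in the closed ball of radius
  \<open>\<theta> ^ n\<close> (\<open>d_theta_le\<close>). The estimates are phrased with it, so
  that depths can be counted as letters are prepended or shifted off.\<close>

definition agree :: "nat \<Rightarrow> (nat \<Rightarrow> 's) \<Rightarrow> (nat \<Rightarrow> 's) \<Rightarrow> bool" where
  "agree n \<omega> \<upsilon> \<longleftrightarrow> (\<forall>i<n. \<omega> i = \<upsilon> i)"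

lemma agree_refl [simp]: "agree n \<omega> \<omega>"
  and agree_sym: "agree n \<omega> \<upsilon> \<Longrightarrow> agree n \<upsilon> \<omega>"
  and agree_trans: "agree n \<omega> \<upsilon> \<Longrightarrow> agree n \<upsilon> \<tau> \<Longrightarrow> agree n \<omega> \<tau>"
  and agree_mono: "agree n \<omega> \<upsilon> \<Longrightarrow> m \<le> n \<Longrightarrow> agree m \<omega> \<upsilon>"
  by (auto simp: agree_def)

lemma agree_shift: "agree (Suc n) \<omega> \<upsilon> \<Longrightarrow> agree n (shift \<omega>) (shift \<upsilon>)"
  by (auto simp: agree_def shift_def)

lemma agree_prepend: "agree n \<omega> \<upsilon> \<Longrightarrow> agree (Suc n) (prepend a \<omega>) (prepend a \<upsilon>)"
  by (auto simp: agree_def prepend_def split: nat.split)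

lemma shift_prepend [simp]: "shift (prepend a \<omega>) = \<omega>"
  by (auto simp: shift_def prepend_def)

lemma prepend_0 [simp]: "prepend a \<omega> 0 = a"
  and prepend_Suc [simp]: "prepend a \<omega> (Suc i) = \<omega> i"
  by (simp_all add: prepend_def)

lemma prepend_shift [simp]: "prepend (\<omega> 0) (shift \<omega>) = \<omega>"
  by (auto simp: shift_def prepend_def split: nat.split)

lemma funpow_shift: "(shift ^^ i) \<omega> n = \<omega> (n + i)"
  by (induction i arbitrary: n) (auto simp: shift_def)

lemma agree_neq: "\<omega> \<noteq> \<upsilon> \<Longrightarrow> agree n \<omega> \<upsilon> \<longleftrightarrow> n \<le> (LEAST i. \<omega> i \<noteq> \<upsilon> i)"
proof -
  assume "\<omega> \<noteq> \<upsilon>"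
  then obtain i where "\<omega> i \<noteq> \<upsilon> i" by (auto simp: fun_eq_iff)
  then have "\<omega> (LEAST i. \<omega> i \<noteq> \<upsilon> i) \<noteq> \<upsilon> (LEAST i. \<omega> i \<noteq> \<upsilon> i)" by (rule LeastI)
  then show ?thesis unfolding agree_def using not_less_Least[of _ "\<lambda>i. \<omega> i \<noteq> \<upsilon> i"]
    by (meson le_less_trans not_le)
qed

lemma agree_all: "(\<And>n. agree n \<omega> \<upsilon>) \<Longrightarrow> \<omega> = \<upsilon>"
  unfolding agree_def by (rule ext) (meson lessI)

locale theta_space =
  fixes \<theta> :: real and X :: "(nat \<Rightarrow> 's) set"
  assumes \<theta>0: "0 < \<theta>" and \<theta>1: "\<theta> < 1" and X_ne: "X \<noteq> {}"
begin

lemma \<theta>_pow_pos [simp]: "0 < \<theta> ^ n" "0 \<le> \<theta> ^ n" "\<theta> ^ n \<noteq> 0"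
  using \<theta>0 by auto

lemma \<theta>_pow_le_1: "\<theta> ^ n \<le> 1"
  using \<theta>0 \<theta>1 by (simp add: power_le_one)

lemma \<theta>_decr: "m \<le> n \<Longrightarrow> \<theta> ^ n \<le> \<theta> ^ m"
  using \<theta>0 \<theta>1 by (intro power_decreasing) auto

lemma \<theta>_tendsto: "(\<lambda>n. \<theta> ^ n) \<longlonglongrightarrow> 0"
  using \<theta>0 \<theta>1 by (intro LIMSEQ_realpow_zero) auto

lemma \<theta>_small: "e > 0 \<Longrightarrow> \<exists>n. \<theta> ^ n < e"
  using \<theta>1 by (rule real_arch_pow_inv[rotated])

lemma d_theta_le: "d_theta \<theta> \<omega> \<upsilon> \<le> \<theta> ^ n \<longleftrightarrow> agree n \<omega> \<upsilon>"
proof (cases "\<omega> = \<upsilon>")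
  case False
  then show ?thesis using \<theta>0 \<theta>1
    by (simp add: agree_neq d_theta_def power_decreasing_iff)
qed (auto simp: d_theta_def)

lemma d_theta_agree:
  assumes "agree n \<omega> \<upsilon>" "\<omega> \<noteq> \<upsilon>"
  obtains m where "n \<le> m" "agree m \<omega> \<upsilon>" "d_theta \<theta> \<omega> \<upsilon> = \<theta> ^ m"
proof (rule that[of "LEAST i. \<omega> i \<noteq> \<upsilon> i"])
  show "n \<le> (LEAST i. \<omega> i \<noteq> \<upsilon> i)" "agree (LEAST i. \<omega> i \<noteq> \<upsilon> i) \<omega> \<upsilon>"
    using assms by (simp_all add: agree_neq)
qed (use assms in \<open>simp add: d_theta_def\<close>)

lemma openin_theta:
  "openin (theta_topology \<theta> X) U \<longleftrightarrow> U \<subseteq> X \<and> (\<forall>\<omega>\<in>U. \<exists>n. \<forall>\<upsilon>\<in>X. agree n \<omega> \<upsilon> \<longrightarrow> \<upsilon> \<in> U)"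
proof -
  interpret Metric_space X "d_theta \<theta>" using \<theta>0 \<theta>1 by (rule Metric_space_d_theta)
  have "(\<exists>r>0. mball \<omega> r \<subseteq> U) \<longleftrightarrow> (\<exists>n. \<forall>\<upsilon>\<in>X. agree n \<omega> \<upsilon> \<longrightarrow> \<upsilon> \<in> U)" if "\<omega> \<in> X" for \<omega>
  proof
    assume "\<exists>r>0. mball \<omega> r \<subseteq> U"
    then obtain r where r: "r > 0" "mball \<omega> r \<subseteq> U" by blast
    obtain n where n: "\<theta> ^ n < r" using \<theta>_small r by blast
    have "\<upsilon> \<in> U" if "\<upsilon> \<in> X" "agree n \<omega> \<upsilon>" for \<upsilon>
      using r(2) that \<open>\<omega> \<in> X\<close> n d_theta_le[of \<omega> \<upsilon> n] by (auto simp: in_mball subset_iff)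
    then show "\<exists>n. \<forall>\<upsilon>\<in>X. agree n \<omega> \<upsilon> \<longrightarrow> \<upsilon> \<in> U" by blast
  next
    assume "\<exists>n. \<forall>\<upsilon>\<in>X. agree n \<omega> \<upsilon> \<longrightarrow> \<upsilon> \<in> U"
    then obtain n where "\<forall>\<upsilon>\<in>X. agree n \<omega> \<upsilon> \<longrightarrow> \<upsilon> \<in> U" by blast
    then show "\<exists>r>0. mball \<omega> r \<subseteq> U"
      by (intro exI[of _ "\<theta> ^ n"]) (auto simp: in_mball d_theta_le[symmetric] less_imp_le)
  qed
  then show ?thesis unfolding theta_topology_def openin_mtopology by blast
qed

lemma topspace_theta [simp]: "topspace (theta_topology \<theta> X) = X"
proof -
  interpret Metric_space X "d_theta \<theta>" using \<theta>0 \<theta>1 by (rule Metric_space_d_theta)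
  show ?thesis by (simp add: theta_topology_def)
qed

text \<open>Despite the name, continuity at each point: the depth \<open>n\<close> may depend on
  \<open>\<omega>\<close>. It is continuity in the topology of \<open>d_theta\<close>
  (\<open>continuous_map_theta\<close>).\<close>

definition ucont :: "((nat \<Rightarrow> 's) \<Rightarrow> 'b::real_normed_vector) \<Rightarrow> bool" where
  "ucont f \<longleftrightarrow> (\<forall>\<omega>\<in>X. \<forall>e>0. \<exists>n. \<forall>\<upsilon>\<in>X. agree n \<omega> \<upsilon> \<longrightarrow> norm (f \<omega> - f \<upsilon>) < e)"

lemma continuous_map_theta:
  "continuous_map (theta_topology \<theta> X) euclidean f \<longleftrightarrow> ucont (f :: (nat \<Rightarrow> 's) \<Rightarrow> 'b::real_normed_vector)"
proof
  assume f: "continuous_map (theta_topology \<theta> X) euclidean f"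
  show "ucont f" unfolding ucont_def
  proof (intro ballI allI impI)
    fix \<omega> and e :: real assume "\<omega> \<in> X" "e > 0"
    have "openin (theta_topology \<theta> X) {x \<in> topspace (theta_topology \<theta> X). f x \<in> ball (f \<omega>) e}"
      using f unfolding continuous_map_def by (auto simp flip: open_openin)
    then obtain n where "\<forall>\<upsilon>\<in>X. agree n \<omega> \<upsilon> \<longrightarrow> f \<upsilon> \<in> ball (f \<omega>) e"
      unfolding openin_theta using \<open>\<omega> \<in> X\<close> \<open>e > 0\<close> by fastforce
    then show "\<exists>n. \<forall>\<upsilon>\<in>X. agree n \<omega> \<upsilon> \<longrightarrow> norm (f \<omega> - f \<upsilon>) < e" by (auto simp: dist_norm)
  qed
next
  assume f: "ucont f"
  show "continuous_map (theta_topology \<theta> X) euclidean f"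
    unfolding continuous_map_def
  proof (intro conjI allI impI)
    fix U :: "'b set" assume "openin euclidean U"
    then have U: "open U" using open_openin by blast
    show "openin (theta_topology \<theta> X) {x \<in> topspace (theta_topology \<theta> X). f x \<in> U}"
      unfolding openin_theta
    proof (intro conjI ballI)
      fix \<omega> assume "\<omega> \<in> {x \<in> topspace (theta_topology \<theta> X). f x \<in> U}"
      then have \<omega>: "\<omega> \<in> X" "f \<omega> \<in> U" by auto
      obtain e where e: "e > 0" "ball (f \<omega>) e \<subseteq> U" using U \<omega>(2) openE by blast
      obtain n where "\<forall>\<upsilon>\<in>X. agree n \<omega> \<upsilon> \<longrightarrow> norm (f \<omega> - f \<upsilon>) < e"
        using f \<omega>(1) e(1) unfolding ucont_def by blast
      then have "\<forall>\<upsilon>\<in>X. agree n \<omega> \<upsilon> \<longrightarrow> f \<upsilon> \<in> ball (f \<omega>) e" by (simp add: dist_norm)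
      then have "\<forall>\<upsilon>\<in>X. agree n \<omega> \<upsilon> \<longrightarrow> \<upsilon> \<in> {x \<in> topspace (theta_topology \<theta> X). f x \<in> U}"
        using e(2) by (simp add: subset_eq)
      then show "\<exists>n. \<forall>\<upsilon>\<in>X. agree n \<omega> \<upsilon> \<longrightarrow> \<upsilon> \<in> {x \<in> topspace (theta_topology \<theta> X). f x \<in> U}" ..
    qed simp
  qed simp
qed

lemma C_space_iff: "f \<in> C_space \<theta> X \<longleftrightarrow> ucont f \<and> (\<forall>\<omega>. \<omega> \<notin> X \<longrightarrow> f \<omega> = 0)"
  by (simp add: C_space_def continuous_map_theta)

lemma Cb_iff: "f \<in> Cb_space \<theta> X \<longleftrightarrow> ucont f \<and> (\<forall>\<omega>. \<omega> \<notin> X \<longrightarrow> f \<omega> = 0) \<and> (\<exists>B. \<forall>\<omega>\<in>X. cmod (f \<omega>) \<le> B)"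
  by (auto simp: Cb_space_def C_space_iff bounded_iff)

text \<open>The inequality \<open>theta_seminorm \<theta> X j f \<le> C\<close> without extended
  reals (\<open>theta_seminorm_le_iff\<close>). The level \<open>j\<close> is explicit because it
  changes: applying the operator lowers it, while the potential is controlled from level
  \<open>k + 1\<close> on.\<close>

definition lip :: "nat \<Rightarrow> real \<Rightarrow> ((nat \<Rightarrow> 's) \<Rightarrow> 'b::real_normed_vector) \<Rightarrow> bool" where
  "lip j C f \<longleftrightarrow> (\<forall>n\<ge>j. \<forall>\<omega>\<in>X. \<forall>\<upsilon>\<in>X. agree n \<omega> \<upsilon> \<longrightarrow> norm (f \<omega> - f \<upsilon>) \<le> C * \<theta> ^ n)"

lemma lipD: "lip j C f \<Longrightarrow> j \<le> n \<Longrightarrow> \<omega> \<in> X \<Longrightarrow> \<upsilon> \<in> X \<Longrightarrow> agree n \<omega> \<upsilon> \<Longrightarrow> norm (f \<omega> - f \<upsilon>) \<le> C * \<theta> ^ n"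
  by (auto simp: lip_def)

lemma lip_nonneg: "lip j C f \<Longrightarrow> 0 \<le> C"
proof -
  assume l: "lip j C f"
  obtain \<omega> where "\<omega> \<in> X" using X_ne by blast
  then have "0 \<le> C * \<theta> ^ j" using lipD[OF l, of j \<omega> \<omega>] by simp
  then show ?thesis using \<theta>_pow_pos(1)[of j] by (simp add: zero_le_mult_iff del: \<theta>_pow_pos)
qed

lemma lip_ucont: 
  assumes l: "lip j C f" shows "ucont f"
  unfolding ucont_def
proof (intro ballI allI impI)
  fix \<omega> and e :: real assume \<omega>: "\<omega> \<in> X" and e: "e > 0"
  have C: "0 \<le> C" by (rule lip_nonneg[OF l])
  obtain n where n: "\<theta> ^ n < e / (C + 1)" using \<theta>_small[of "e / (C + 1)"] e C by auto
  have "C * \<theta> ^ max j n \<le> C * \<theta> ^ n" using C by (intro mult_left_mono \<theta>_decr) auto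
  also have "\<dots> \<le> (C + 1) * \<theta> ^ n" by (intro mult_right_mono) auto
  also have "\<dots> < e" using n C by (simp add: field_simps)
  finally have "C * \<theta> ^ max j n < e" .
  then show "\<exists>n. \<forall>\<upsilon>\<in>X. agree n \<omega> \<upsilon> \<longrightarrow> norm (f \<omega> - f \<upsilon>) < e"
    using lipD[OF l, of "max j n" \<omega>] \<omega> by (intro exI[of _ "max j n"]) force
qed

lemma theta_seminorm_le_iff:
  assumes "0 \<le> C"
  shows "theta_seminorm \<theta> X j f \<le> ennreal C \<longleftrightarrow> lip j C f"
proof -
  have "var X n f / ennreal (\<theta> ^ n) \<le> ennreal C \<longleftrightarrow>
      (\<forall>\<omega>\<in>X. \<forall>\<upsilon>\<in>X. agree n \<omega> \<upsilon> \<longrightarrow> norm (f \<omega> - f \<upsilon>) \<le> C * \<theta> ^ n)" for n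
  proof -
    have "var X n f / ennreal (\<theta> ^ n) \<le> ennreal C \<longleftrightarrow> var X n f \<le> ennreal C * ennreal (\<theta> ^ n)"
    proof
      assume "var X n f / ennreal (\<theta> ^ n) \<le> ennreal C"
      then have "ennreal (\<theta> ^ n) * (var X n f / ennreal (\<theta> ^ n)) \<le> ennreal (\<theta> ^ n) * ennreal C"
        by (intro mult_left_mono) auto
      moreover have "ennreal (\<theta> ^ n) * (var X n f / ennreal (\<theta> ^ n)) = var X n f"
        unfolding ennreal_times_divide by (subst mult.commute) (rule mult_divide_eq_ennreal, use \<theta>0 in auto)
      ultimately show "var X n f \<le> ennreal C * ennreal (\<theta> ^ n)" by (simp add: mult.commute)
    qed (rule divide_le_posI_ennreal, use \<theta>0 in \<open>auto simp: mult.commute\<close>)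
    also have "\<dots> \<longleftrightarrow> var X n f \<le> ennreal (C * \<theta> ^ n)" using assms by (simp add: ennreal_mult)
    also have "\<dots> \<longleftrightarrow> (\<forall>\<omega>\<in>X. \<forall>\<upsilon>\<in>X. agree n \<omega> \<upsilon> \<longrightarrow> norm (f \<omega> - f \<upsilon>) \<le> C * \<theta> ^ n)"
      unfolding var_def SUP_le_iff using assms by (auto simp: agree_def ennreal_le_iff)
    finally show ?thesis .
  qed
  then show ?thesis unfolding theta_seminorm_def SUP_le_iff lip_def by auto
qed

lemma theta_seminorm_finite:
  "theta_seminorm \<theta> X j f < \<infinity> \<longleftrightarrow> (\<exists>C. lip j C f)"
proof
  assume "theta_seminorm \<theta> X j f < \<infinity>"
  then have "theta_seminorm \<theta> X j f \<le> ennreal (enn2real (theta_seminorm \<theta> X j f))" by simp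
  then show "\<exists>C. lip j C f" by (subst (asm) theta_seminorm_le_iff) auto
next
  assume "\<exists>C. lip j C f"
  then obtain C where C: "lip j C f" by blast
  then have "theta_seminorm \<theta> X j f \<le> ennreal C" using lip_nonneg by (subst theta_seminorm_le_iff) auto
  then show "theta_seminorm \<theta> X j f < \<infinity>" by (rule le_less_trans) simp
qed

lemma lip_seminorm:
  assumes "lip j C f" shows "lip j (enn2real (theta_seminorm \<theta> X j f)) f"
proof -
  have "theta_seminorm \<theta> X j f < \<infinity>" unfolding theta_seminorm_finite using assms by blast
  then have "theta_seminorm \<theta> X j f \<le> ennreal (enn2real (theta_seminorm \<theta> X j f))" by simp
  then show ?thesis by (subst (asm) theta_seminorm_le_iff) simp_all
qed

lemma seminorm_le: "lip j C f \<Longrightarrow> enn2real (theta_seminorm \<theta> X j f) \<le> C"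
proof -
  assume l: "lip j C f"
  then have "theta_seminorm \<theta> X j f \<le> ennreal C" using lip_nonneg by (subst theta_seminorm_le_iff) auto
  then show ?thesis using enn2real_mono[of _ "ennreal C"] lip_nonneg[OF l] by simp
qed

lemma Fb_iff: "f \<in> Fb_space \<theta> X j \<longleftrightarrow> (\<forall>\<omega>. \<omega> \<notin> X \<longrightarrow> f \<omega> = 0) \<and> (\<exists>B. \<forall>\<omega>\<in>X. cmod (f \<omega>) \<le> B) \<and> (\<exists>C. lip j C f)"
  unfolding Fb_space_def mem_Collect_eq Cb_iff theta_seminorm_finite using lip_ucont by blast

section \<open>The Banach spaces of bounded continuous and of Lipschitz functions\<close>

lemma sup_norm_ge: "\<forall>\<omega>\<in>X. cmod (f \<omega>) \<le> B \<Longrightarrow> \<omega> \<in> X \<Longrightarrow> cmod (f \<omega>) \<le> sup_norm X f"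
  unfolding sup_norm_def by (rule cSUP_upper) (auto intro!: bdd_aboveI[of _ B])

lemma sup_norm_le: "(\<And>\<omega>. \<omega> \<in> X \<Longrightarrow> cmod (f \<omega>) \<le> B) \<Longrightarrow> sup_norm X f \<le> B"
  unfolding sup_norm_def using X_ne by (intro cSUP_least) auto

lemma Cb_sup_norm: "f \<in> Cb_space \<theta> X \<Longrightarrow> cmod (f \<omega>) \<le> sup_norm X f"
proof -
  assume f: "f \<in> Cb_space \<theta> X"
  then obtain B where B: "\<forall>\<omega>\<in>X. cmod (f \<omega>) \<le> B" unfolding Cb_iff by blast
  obtain \<omega>0 where "\<omega>0 \<in> X" using X_ne by blast
  from sup_norm_ge[OF B this] have 0: "0 \<le> sup_norm X f" using norm_ge_zero order_trans by blast
  show ?thesis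
  proof (cases "\<omega> \<in> X")
    case True then show ?thesis by (rule sup_norm_ge[OF B])
  next
    case False then show ?thesis using f 0 unfolding Cb_iff by simp
  qed
qed

lemma Fb_Cb: "f \<in> Fb_space \<theta> X j \<Longrightarrow> f \<in> Cb_space \<theta> X"
  by (simp add: Fb_space_def)

lemma sup_norm_nonneg: "f \<in> Cb_space \<theta> X \<Longrightarrow> 0 \<le> sup_norm X f"
  using Cb_sup_norm[of f undefined] norm_ge_zero order_trans by blast

lemma Fb_lip: "f \<in> Fb_space \<theta> X j \<Longrightarrow> lip j (enn2real (theta_seminorm \<theta> X j f)) f"
  using lip_seminorm unfolding Fb_iff by blast

lemma ucont_suminf:
  assumes F: "\<And>i::nat. ucont (F i)" and c: "\<And>i \<omega>. \<omega> \<in> X \<Longrightarrow> norm (F i \<omega>) \<le> c i" and s: "summable c"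
  shows "ucont (\<lambda>\<omega>. \<Sum>i. F i \<omega> :: 'b::banach)"
  unfolding ucont_def
proof (intro ballI allI impI)
  fix \<omega> and e :: real assume \<omega>: "\<omega> \<in> X" and e: "e > 0"
  have "(\<lambda>m. \<Sum>i. c (i + m)) \<longlonglongrightarrow> 0" by (rule suminf_exist_split2[OF s])
  then obtain m where m: "\<bar>\<Sum>i. c (i + m)\<bar> < e / 3"
    using e by (auto simp: LIMSEQ_iff dest!: spec[of _ "e / 3"])
  have sm: "summable (\<lambda>i. F i \<upsilon>)" if "\<upsilon> \<in> X" for \<upsilon>
    by (rule summable_comparison_test'[OF s, of 0]) (use c that in auto)
  have tail: "norm ((\<Sum>i. F i \<upsilon>) - (\<Sum>i<m. F i \<upsilon>)) < e / 3" if "\<upsilon> \<in> X" for \<upsilon>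
  proof -
    have sc: "summable (\<lambda>i. c (i + m))" using s by (simp add: summable_iff_shift)
    have sn: "summable (\<lambda>i. norm (F (i + m) \<upsilon>))"
      by (rule summable_comparison_test'[OF sc, of 0]) (use c that in auto)
    have "(\<Sum>i. F i \<upsilon>) - (\<Sum>i<m. F i \<upsilon>) = (\<Sum>i. F (i + m) \<upsilon>)"
      using suminf_split_initial_segment[OF sm[OF that], of m] by simp
    also have "norm \<dots> \<le> (\<Sum>i. norm (F (i + m) \<upsilon>))" by (rule summable_norm[OF sn])
    also have "\<dots> \<le> (\<Sum>i. c (i + m))" by (intro suminf_le sn sc c that)
    finally show ?thesis using m by linarith
  qed
  have "\<exists>n. \<forall>\<upsilon>\<in>X. agree n \<omega> \<upsilon> \<longrightarrow> norm (F i \<omega> - F i \<upsilon>) < e / (3 * (real m + 1))" for i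
    using F[of i] \<omega> e unfolding ucont_def by (auto dest!: bspec spec[of _ "e / (3 * (real m + 1))"])
  then obtain n where n: "\<And>i \<upsilon>. \<upsilon> \<in> X \<Longrightarrow> agree (n i) \<omega> \<upsilon> \<Longrightarrow> norm (F i \<omega> - F i \<upsilon>) < e / (3 * (real m + 1))" by metis
  \<comment> \<open>The element \<open>0\<close> keeps the set nonempty when
    \<open>m = 0\<close>.\<close>
  define K where "K = Max (n ` {..<m} \<union> {0})"
  have "norm ((\<Sum>i. F i \<omega>) - (\<Sum>i. F i \<upsilon>)) < e" if \<upsilon>: "\<upsilon> \<in> X" "agree K \<omega> \<upsilon>" for \<upsilon>
  proof -
    have "norm ((\<Sum>i<m. F i \<omega>) - (\<Sum>i<m. F i \<upsilon>)) \<le> (\<Sum>i<m. e / (3 * (real m + 1)))"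
      unfolding sum_subtractf[symmetric]
    proof (rule sum_norm_le)
      fix i assume "i \<in> {..<m}"
      then have "n i \<le> K" by (auto simp: K_def)
      then show "norm (F i \<omega> - F i \<upsilon>) \<le> e / (3 * (real m + 1))"
        using n[of \<upsilon> i] \<upsilon> agree_mono by (meson less_imp_le)
    qed
    also have "\<dots> < e / 3" using e by (simp add: field_simps)
    finally have "norm ((\<Sum>i<m. F i \<omega>) - (\<Sum>i<m. F i \<upsilon>)) < e / 3" .
    moreover have "norm (a - b) \<le> norm (a - a') + norm (a' - b') + norm (b - b')" for a a' b b' :: 'b
      using norm_triangle_ineq[of "a - a'" "a' - b'"] norm_triangle_ineq4[of "a - a' + (a' - b')" "b - b'"] by simp
    note this[of "\<Sum>i. F i \<omega>" "\<Sum>i. F i \<upsilon>" "\<Sum>i<m. F i \<omega>" "\<Sum>i<m. F i \<upsilon>"]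
    ultimately show ?thesis using tail[OF \<omega>] tail[OF \<upsilon>(1)] by linarith
  qed
  then show "\<exists>n. \<forall>\<upsilon>\<in>X. agree n \<omega> \<upsilon> \<longrightarrow> norm ((\<Sum>i. F i \<omega>) - (\<Sum>i. F i \<upsilon>)) < e" by blast
qed

lemma lip_suminf:
  assumes F: "\<And>i::nat. lip j (C i) (F i)" and C: "summable C"
    and c: "\<And>i \<omega>. \<omega> \<in> X \<Longrightarrow> norm (F i \<omega>) \<le> c i" and s: "summable c"
  shows "lip j (\<Sum>i. C i) (\<lambda>\<omega>. \<Sum>i. F i \<omega> :: 'b::banach)"
  unfolding lip_def
proof (intro allI impI ballI)
  fix n \<omega> \<upsilon> assume *: "j \<le> n" "\<omega> \<in> X" "\<upsilon> \<in> X" "agree n \<omega> \<upsilon>"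
  have sm: "summable (\<lambda>i. F i \<upsilon>)" if "\<upsilon> \<in> X" for \<upsilon>
    by (rule summable_comparison_test'[OF s, of 0]) (use c that in auto)
  have le: "norm (F i \<omega> - F i \<upsilon>) \<le> C i * \<theta> ^ n" for i using lipD[OF F *] .
  have sC: "summable (\<lambda>i. C i * \<theta> ^ n)" by (intro summable_mult2 C)
  have sn: "summable (\<lambda>i. norm (F i \<omega> - F i \<upsilon>))"
    by (rule summable_comparison_test'[OF sC, of 0]) (use le in auto)
  have "norm ((\<Sum>i. F i \<omega>) - (\<Sum>i. F i \<upsilon>)) = norm (\<Sum>i. F i \<omega> - F i \<upsilon>)"
    using suminf_diff[OF sm sm] * by simp
  also have "\<dots> \<le> (\<Sum>i. norm (F i \<omega> - F i \<upsilon>))" by (rule summable_norm[OF sn])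
  also have "\<dots> \<le> (\<Sum>i. C i * \<theta> ^ n)" by (intro suminf_le le sn sC)
  also have "\<dots> = (\<Sum>i. C i) * \<theta> ^ n" using suminf_mult2[OF C] by simp
  finally show "norm ((\<Sum>i. F i \<omega>) - (\<Sum>i. F i \<upsilon>)) \<le> (\<Sum>i. C i) * \<theta> ^ n" .
qed

lemma lip_add: "lip j C f \<Longrightarrow> lip j D g \<Longrightarrow> lip j (C + D) (\<lambda>\<omega>. f \<omega> + g \<omega>)"
  unfolding lip_def distrib_right
proof (intro allI impI ballI)
  fix n \<omega> \<upsilon>
  assume "\<forall>n\<ge>j. \<forall>\<omega>\<in>X. \<forall>\<upsilon>\<in>X. agree n \<omega> \<upsilon> \<longrightarrow> norm (f \<omega> - f \<upsilon>) \<le> C * \<theta> ^ n"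
    "\<forall>n\<ge>j. \<forall>\<omega>\<in>X. \<forall>\<upsilon>\<in>X. agree n \<omega> \<upsilon> \<longrightarrow> norm (g \<omega> - g \<upsilon>) \<le> D * \<theta> ^ n"
    "j \<le> n" "\<omega> \<in> X" "\<upsilon> \<in> X" "agree n \<omega> \<upsilon>"
  then have "norm (f \<omega> - f \<upsilon>) \<le> C * \<theta> ^ n" "norm (g \<omega> - g \<upsilon>) \<le> D * \<theta> ^ n" by blast+
  then show "norm (f \<omega> + g \<omega> - (f \<upsilon> + g \<upsilon>)) \<le> C * \<theta> ^ n + D * \<theta> ^ n"
    using norm_diff_triangle_ineq[of "f \<omega>" "g \<omega>" "f \<upsilon>" "g \<upsilon>"] by linarith
qed

lemma lip_cmult: "lip j C f \<Longrightarrow> lip j (norm c * C) (\<lambda>\<omega>. c * f \<omega> :: 'b::real_normed_div_algebra)"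
  unfolding lip_def
proof (intro allI impI ballI)
  fix n \<omega> \<upsilon>
  assume "\<forall>n\<ge>j. \<forall>\<omega>\<in>X. \<forall>\<upsilon>\<in>X. agree n \<omega> \<upsilon> \<longrightarrow> norm (f \<omega> - f \<upsilon>) \<le> C * \<theta> ^ n"
    "j \<le> n" "\<omega> \<in> X" "\<upsilon> \<in> X" "agree n \<omega> \<upsilon>"
  then have "norm (f \<omega> - f \<upsilon>) \<le> C * \<theta> ^ n" by blast
  then show "norm (c * f \<omega> - c * f \<upsilon>) \<le> norm c * C * \<theta> ^ n"
    unfolding right_diff_distrib[symmetric] norm_mult mult.assoc by (rule mult_left_mono) simp
qed

lemma ucont_add: "ucont f \<Longrightarrow> ucont g \<Longrightarrow> ucont (\<lambda>\<omega>. f \<omega> + g \<omega>)"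
  unfolding continuous_map_theta[symmetric] by (rule continuous_map_add)

lemma ucont_cmult: "ucont f \<Longrightarrow> ucont (\<lambda>\<omega>. c * f \<omega> :: 'b::real_normed_algebra)"
  unfolding ucont_def
proof (intro ballI allI impI)
  fix \<omega> and e :: real assume *: "\<forall>\<omega>\<in>X. \<forall>e>0. \<exists>n. \<forall>\<upsilon>\<in>X. agree n \<omega> \<upsilon> \<longrightarrow> norm (f \<omega> - f \<upsilon>) < e"
    and \<omega>: "\<omega> \<in> X" and e: "e > 0"
  have "e / (norm c + 1) > 0" using e by (simp add: add_nonneg_pos)
  then obtain n where n: "\<And>\<upsilon>. \<upsilon> \<in> X \<Longrightarrow> agree n \<omega> \<upsilon> \<Longrightarrow> norm (f \<omega> - f \<upsilon>) < e / (norm c + 1)"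
    using * \<omega> by blast
  have "norm (c * f \<omega> - c * f \<upsilon>) < e" if "\<upsilon> \<in> X" "agree n \<omega> \<upsilon>" for \<upsilon>
  proof -
    have "norm (c * f \<omega> - c * f \<upsilon>) \<le> norm c * norm (f \<omega> - f \<upsilon>)"
      unfolding right_diff_distrib[symmetric] by (rule norm_mult_ineq)
    also have "\<dots> \<le> (norm c + 1) * norm (f \<omega> - f \<upsilon>)" by (intro mult_right_mono) auto
    also have "\<dots> = norm (f \<omega> - f \<upsilon>) * (norm c + 1)" by (rule mult.commute)
    also have "\<dots> < e" using n[OF that] by (subst (asm) pos_less_divide_eq) (simp_all add: add_nonneg_pos)
    finally show ?thesis .
  qed
  then show "\<exists>n. \<forall>\<upsilon>\<in>X. agree n \<omega> \<upsilon> \<longrightarrow> norm (c * f \<omega> - c * f \<upsilon>) < e" by blast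
qed

lemma Cb_fun_space: "fun_space (Cb_space \<theta> X) (sup_norm X)"
proof
  show "0 \<in> Cb_space \<theta> X" unfolding Cb_iff ucont_def by (auto intro!: exI[of _ 0])
next
  fix f g assume f: "f \<in> Cb_space \<theta> X" and g: "g \<in> Cb_space \<theta> X"
  show "f + g \<in> Cb_space \<theta> X"
    unfolding Cb_iff
  proof (intro conjI)
    show "ucont (f + g)" using ucont_add f g unfolding Cb_iff by (auto simp: plus_fun_def)
    show "\<exists>B. \<forall>\<omega>\<in>X. cmod ((f + g) \<omega>) \<le> B"
      using Cb_sup_norm[OF f] Cb_sup_norm[OF g]
      by (auto intro!: exI[of _ "sup_norm X f + sup_norm X g"] norm_triangle_le add_mono)
  qed (use f g in \<open>auto simp: Cb_iff\<close>)
  show "sup_norm X (f + g) \<le> sup_norm X f + sup_norm X g"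
    by (rule sup_norm_le) (auto intro!: norm_triangle_le add_mono Cb_sup_norm f g)
next
  fix f c assume f: "f \<in> Cb_space \<theta> X"
  show 1: "cscale c f \<in> Cb_space \<theta> X"
    unfolding Cb_iff
  proof (intro conjI)
    show "ucont (cscale c f)" using ucont_cmult[of f c] f unfolding Cb_iff by (auto simp: cscale_def)
    show "\<exists>B. \<forall>\<omega>\<in>X. cmod (cscale c f \<omega>) \<le> B"
      using Cb_sup_norm[OF f] by (auto intro!: exI[of _ "cmod c * sup_norm X f"] mult_left_mono simp: norm_mult)
  qed (use f in \<open>auto simp: Cb_iff\<close>)
  have le: "sup_norm X (cscale c f) \<le> cmod c * sup_norm X f"
    by (rule sup_norm_le) (auto simp: norm_mult intro!: mult_left_mono Cb_sup_norm f)
  show "sup_norm X (cscale c f) = cmod c * sup_norm X f"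
  proof (cases "c = 0")
    case True
    then have "sup_norm X (cscale c f) = 0"
      unfolding sup_norm_def using X_ne by simp
    with True show ?thesis by simp
  next
    case False
    have "sup_norm X f \<le> sup_norm X (cscale c f) / cmod c"
      by (rule sup_norm_le) (use Cb_sup_norm[OF 1] False in \<open>auto simp: norm_mult field_simps\<close>)
    then show ?thesis using le False by (simp add: field_simps)
  qed
next
  fix f x assume "f \<in> Cb_space \<theta> X"
  then show "cmod (f x) \<le> sup_norm X f" by (rule Cb_sup_norm)
next
  fix F :: "nat \<Rightarrow> _" assume F: "\<And>i. F i \<in> Cb_space \<theta> X" and s: "summable (\<lambda>i. sup_norm X (F i))"
  have le: "cmod (\<Sum>i. F i x) \<le> (\<Sum>i. sup_norm X (F i))" for x
  proof -
    have sn: "summable (\<lambda>i. cmod (F i x))"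
      by (rule summable_comparison_test'[OF s, of 0]) (use Cb_sup_norm[OF F] in auto)
    have "cmod (\<Sum>i. F i x) \<le> (\<Sum>i. cmod (F i x))" by (rule summable_norm[OF sn])
    also have "\<dots> \<le> (\<Sum>i. sup_norm X (F i))" by (intro suminf_le sn s Cb_sup_norm F)
    finally show ?thesis .
  qed
  have "ucont (\<lambda>x. \<Sum>i. F i x)"
    by (rule ucont_suminf[OF _ _ s]) (use F Cb_sup_norm in \<open>auto simp: Cb_iff\<close>)
  then show "(\<lambda>x. \<Sum>i. F i x) \<in> Cb_space \<theta> X \<and> sup_norm X (\<lambda>x. \<Sum>i. F i x) \<le> (\<Sum>i. sup_norm X (F i))"
    using le F by (auto simp: Cb_iff intro!: sup_norm_le)
qed

lemma Fb_norm_le: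
  assumes "lip j C f" "\<And>\<omega>. \<omega> \<in> X \<Longrightarrow> cmod (f \<omega>) \<le> B"
  shows "Fb_norm \<theta> X j f \<le> B + C"
  unfolding Fb_norm_def by (intro add_mono sup_norm_le seminorm_le assms)

lemma Fb_fun_space: "fun_space (Fb_space \<theta> X j) (Fb_norm \<theta> X j)"
proof -
  interpret Cb: fun_space "Cb_space \<theta> X" "sup_norm X" by (rule Cb_fun_space)
  let ?s = "\<lambda>f. enn2real (theta_seminorm \<theta> X j f) :: real"
  show ?thesis
  proof
    have "lip j 0 (0 :: (nat \<Rightarrow> 's) \<Rightarrow> complex)" by (auto simp: lip_def)
    then show "0 \<in> Fb_space \<theta> X j" unfolding Fb_iff by (auto intro!: exI[of _ 0])
  next
    fix f g assume f: "f \<in> Fb_space \<theta> X j" and g: "g \<in> Fb_space \<theta> X j"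
    have l: "lip j (?s f + ?s g) (f + g)"
      using lip_add[OF Fb_lip[OF f] Fb_lip[OF g]] by (simp add: plus_fun_def)
    then show "f + g \<in> Fb_space \<theta> X j"
      using Cb.add_mem[OF Fb_Cb[OF f] Fb_Cb[OF g]] unfolding Fb_iff Cb_iff by blast
    show "Fb_norm \<theta> X j (f + g) \<le> Fb_norm \<theta> X j f + Fb_norm \<theta> X j g"
      using seminorm_le[OF l] Cb.N_add[OF Fb_Cb[OF f] Fb_Cb[OF g]] by (simp add: Fb_norm_def)
  next
    fix f c assume f: "f \<in> Fb_space \<theta> X j"
    have l: "lip j (cmod c * ?s f) (cscale c f)"
      using lip_cmult[OF Fb_lip[OF f]] by (simp add: cscale_def)
    then show F: "cscale c f \<in> Fb_space \<theta> X j"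
      using Cb.scale_mem[OF Fb_Cb[OF f]] unfolding Fb_iff Cb_iff by blast
    have "?s (cscale c f) = cmod c * ?s f"
    proof (cases "c = 0")
      case True
      then show ?thesis using seminorm_le[OF l] by (simp add: order.antisym)
    next
      case False
      have "lip j (cmod (1 / c) * ?s (cscale c f)) f"
        using lip_cmult[OF Fb_lip[OF F], of "1 / c"] False by simp
      from seminorm_le[OF this] show ?thesis using seminorm_le[OF l] False
        by (simp add: norm_divide field_simps)
    qed
    then show "Fb_norm \<theta> X j (cscale c f) = cmod c * Fb_norm \<theta> X j f"
      using Cb.N_scale[OF Fb_Cb[OF f]] by (simp add: Fb_norm_def distrib_left)
  next
    fix f x assume "f \<in> Fb_space \<theta> X j"
    then show "cmod (f x) \<le> Fb_norm \<theta> X j f"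
      using Cb_sup_norm[OF Fb_Cb, of f j x] enn2real_nonneg[of "theta_seminorm \<theta> X j f"]
      unfolding Fb_norm_def by linarith
  next
    fix F :: "nat \<Rightarrow> _" assume F: "\<And>i. F i \<in> Fb_space \<theta> X j" and s: "summable (\<lambda>i. Fb_norm \<theta> X j (F i))"
    have s1: "summable (\<lambda>i. sup_norm X (F i))"
      by (rule summable_comparison_test'[OF s, of 0])
        (auto simp: Fb_norm_def sup_norm_nonneg[OF Fb_Cb[OF F]])
    have s2: "summable (\<lambda>i. ?s (F i))"
      by (rule summable_comparison_test'[OF s, of 0])
        (auto simp: Fb_norm_def sup_norm_nonneg[OF Fb_Cb[OF F]])
    have l: "lip j (\<Sum>i. ?s (F i)) (\<lambda>x. \<Sum>i. F i x)"
      by (rule lip_suminf[OF Fb_lip[OF F] s2 _ s1]) (rule Cb_sup_norm[OF Fb_Cb[OF F]])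
    have C: "(\<lambda>x. \<Sum>i. F i x) \<in> Cb_space \<theta> X" "sup_norm X (\<lambda>x. \<Sum>i. F i x) \<le> (\<Sum>i. sup_norm X (F i))"
      using Cb.series[of F, OF Fb_Cb[OF F] s1] by auto
    show "(\<lambda>x. \<Sum>i. F i x) \<in> Fb_space \<theta> X j \<and> Fb_norm \<theta> X j (\<lambda>x. \<Sum>i. F i x) \<le> (\<Sum>i. Fb_norm \<theta> X j (F i))"
    proof
      show "(\<lambda>x. \<Sum>i. F i x) \<in> Fb_space \<theta> X j" using C(1) l unfolding Fb_iff Cb_iff by blast
      show "Fb_norm \<theta> X j (\<lambda>x. \<Sum>i. F i x) \<le> (\<Sum>i. Fb_norm \<theta> X j (F i))"
        unfolding Fb_norm_def suminf_add[OF s1 s2, symmetric] by (intro add_mono C seminorm_le l)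
    qed
  qed
qed

lemma lip_mult:
  fixes f g :: "(nat \<Rightarrow> 's) \<Rightarrow> 'b::real_normed_algebra"
  assumes f: "lip j C f" and g: "lip j D g" and fb: "\<And>\<omega>. \<omega> \<in> X \<Longrightarrow> norm (f \<omega>) \<le> B" and gb: "\<And>\<omega>. \<omega> \<in> X \<Longrightarrow> norm (g \<omega>) \<le> B'"
  shows "lip j (C * B' + B * D) (\<lambda>\<omega>. f \<omega> * g \<omega>)"
  unfolding lip_def
proof (intro allI impI ballI)
  fix n \<omega> \<upsilon> assume n: "j \<le> n" and \<omega>: "\<omega> \<in> X" and \<upsilon>: "\<upsilon> \<in> X" and a: "agree n \<omega> \<upsilon>"
  have "f \<omega> * g \<omega> - f \<upsilon> * g \<upsilon> = (f \<omega> - f \<upsilon>) * g \<omega> + f \<upsilon> * (g \<omega> - g \<upsilon>)" by (simp add: algebra_simps)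
  then have "norm (f \<omega> * g \<omega> - f \<upsilon> * g \<upsilon>) \<le> norm ((f \<omega> - f \<upsilon>) * g \<omega>) + norm (f \<upsilon> * (g \<omega> - g \<upsilon>))"
    by (simp add: norm_triangle_ineq)
  also have "\<dots> \<le> norm (f \<omega> - f \<upsilon>) * norm (g \<omega>) + norm (f \<upsilon>) * norm (g \<omega> - g \<upsilon>)"
    by (intro add_mono norm_mult_ineq)
  also have "\<dots> \<le> (C * \<theta> ^ n) * B' + B * (D * \<theta> ^ n)"
    using lipD[OF f n \<omega> \<upsilon> a] lipD[OF g n \<omega> \<upsilon> a] fb[OF \<upsilon>] gb[OF \<omega>]
      order.trans[OF norm_ge_zero lipD[OF f n \<omega> \<upsilon> a]] order.trans[OF norm_ge_zero fb[OF \<upsilon>]]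
    by (intro add_mono mult_mono norm_ge_zero)
  finally show "norm (f \<omega> * g \<omega> - f \<upsilon> * g \<upsilon>) \<le> (C * B' + B * D) * \<theta> ^ n" by (simp add: algebra_simps)
qed

text \<open>Below depth \<open>j\<close> only boundedness is available, and there
  \<open>2 * B\<close> is at most \<open>2 * B / \<theta> ^ j\<close> times
  \<open>\<theta> ^ n\<close>.\<close>

lemma lip_level0:
  assumes f: "lip j C f" and fb: "\<And>\<omega>. \<omega> \<in> X \<Longrightarrow> norm (f \<omega>) \<le> B"
  shows "lip 0 (C + 2 * B / \<theta> ^ j) f"
  unfolding lip_def
proof (intro allI impI ballI)
  fix n \<omega> \<upsilon> assume \<omega>: "\<omega> \<in> X" and \<upsilon>: "\<upsilon> \<in> X" and a: "agree n \<omega> \<upsilon>"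
  have B0: "0 \<le> B" using fb[OF \<omega>] norm_ge_zero[of "f \<omega>"] by linarith
  have C0: "0 \<le> C" by (rule lip_nonneg[OF f])
  show "norm (f \<omega> - f \<upsilon>) \<le> (C + 2 * B / \<theta> ^ j) * \<theta> ^ n"
  proof (cases "j \<le> n")
    case True
    have "norm (f \<omega> - f \<upsilon>) \<le> C * \<theta> ^ n" by (rule lipD[OF f True \<omega> \<upsilon> a])
    also have "\<dots> \<le> (C + 2 * B / \<theta> ^ j) * \<theta> ^ n" using B0 by (intro mult_right_mono) auto
    finally show ?thesis .
  next
    case False
    have "norm (f \<omega> - f \<upsilon>) \<le> 2 * B" using norm_triangle_ineq4[of "f \<omega>" "f \<upsilon>"] fb[OF \<omega>] fb[OF \<upsilon>] by linarith
    also have "\<dots> = 2 * B / \<theta> ^ j * \<theta> ^ j" using \<theta>0 by simp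
    also have "\<dots> \<le> 2 * B / \<theta> ^ j * \<theta> ^ n" using \<theta>_decr[of n j] False B0 by (intro mult_left_mono) auto
    also have "\<dots> \<le> (C + 2 * B / \<theta> ^ j) * \<theta> ^ n" using C0 by (intro mult_right_mono) auto
    finally show ?thesis .
  qed
qed

end

section \<open>The transfer operator\<close>

locale transfer_setup =
  fixes S S0 :: "'s set" and A M :: "'s \<Rightarrow> 's \<Rightarrow> nat" and \<theta> :: real
    and \<phi> :: "(nat \<Rightarrow> 's) \<Rightarrow> real" and k :: nat
  assumes S_countable: "countable S"
    and th0: "0 < \<theta>" and th1: "\<theta> < 1"
    and A01: "zero_one_matrix S A"
    and S0_sub: "S0 \<subseteq> S" and S0_ne: "S0 \<noteq> {}"
    and M_le: "\<forall>i\<in>S0. \<forall>j\<in>S0. M i j \<le> A i j"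
    and M_out: "\<forall>i j. i \<notin> S0 \<or> j \<notin> S0 \<longrightarrow> M i j = 0"
    and A_irr: "irreducible_matrix S A"
    and per: "has_periodic_point (markov_shift S0 M)"
    and k1: "1 \<le> k"
    and phi_sum: "summable_potential S (markov_shift S A) \<phi>"
    and phi_lip: "theta_seminorm \<theta> (markov_shift S A) (k + 1) \<phi> < \<infinity>"
begin

definition X where "X = markov_shift S A"
definition XM where "XM = markov_shift S0 M"

lemma X_iff: "\<omega> \<in> X \<longleftrightarrow> (\<forall>n. \<omega> n \<in> S) \<and> (\<forall>n. A (\<omega> n) (\<omega> (Suc n)) = 1)"
  by (simp add: X_def markov_shift_def)

lemma XM_iff: "\<omega> \<in> XM \<longleftrightarrow> (\<forall>n. \<omega> n \<in> S0) \<and> (\<forall>n. M (\<omega> n) (\<omega> (Suc n)) = 1)"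
  by (simp add: XM_def markov_shift_def)

lemma M_one: "M a b = 1 \<Longrightarrow> a \<in> S0" "M a b = 1 \<Longrightarrow> b \<in> S0" "M a b = 1 \<Longrightarrow> A a b = 1"
proof -
  assume m: "M a b = 1"
  show ab: "a \<in> S0" "b \<in> S0"
    by (rule ccontr, use m spec[OF spec[OF M_out, of a], of b] in simp)+
  then have "a \<in> S" "b \<in> S" using S0_sub by blast+
  then have "A a b \<in> {0, 1}" using A01 unfolding zero_one_matrix_def by blast
  moreover have "A a b \<ge> 1" using bspec[OF bspec[OF M_le ab(1)] ab(2)] m by simp
  ultimately show "A a b = 1" by simp
qed

lemma XM_sub: "XM \<subseteq> X"
proof
  fix \<omega> assume "\<omega> \<in> XM"
  then show "\<omega> \<in> X" using M_one(3) S0_sub unfolding XM_iff X_iff by blast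
qed

lemma irreducible_path:
  assumes "a \<in> S" "b \<in> S"
  obtains n :: nat and w :: "nat \<Rightarrow> 's" where "n \<ge> 1" "\<forall>i\<in>{1..n+1}. w i \<in> S" "w 1 = a" "w (n+1) = b"
    "\<forall>i\<in>{1..n}. A (w i) (w (i+1)) = 1"
  using bspec[OF bspec[OF A_irr[unfolded irreducible_matrix_def] assms(1)] assms(2)]
  by (elim exE conjE) (rule that)

text \<open>Irreducibility in the form in which it is used: induction along a path from
  \<open>a\<close> to \<open>b\<close>, starting at its end.\<close>

lemma path_induct_back:
  assumes "a \<in> S" "b \<in> S" "Q b" and step: "\<And>a b. a \<in> S \<Longrightarrow> b \<in> S \<Longrightarrow> A a b = 1 \<Longrightarrow> Q b \<Longrightarrow> Q a"
  shows "Q a"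
proof -
  obtain n :: nat and w :: "nat \<Rightarrow> 's" where n: "n \<ge> 1" and w: "\<forall>i\<in>{1..n+1}. w i \<in> S" "w 1 = a" "w (n+1) = b"
    "\<forall>i\<in>{1..n}. A (w i) (w (i+1)) = 1"
    by (rule irreducible_path[OF assms(1,2)]) blast
  have "Q (w (n + 1 - j))" if "j \<le> n" for j
    using that
  proof (induction j)
    case 0 then show ?case using w(3) assms(3) by simp
  next
    case (Suc j)
    then have e: "n + 1 - j = (n + 1 - Suc j) + 1" "n + 1 - Suc j \<in> {1..n}" by auto
    then have "A (w (n + 1 - Suc j)) (w (n + 1 - j)) = 1" using bspec[OF w(4) e(2)] by (simp only: e(1))
    moreover have "n + 1 - Suc j \<in> {1..n+1}" "n + 1 - j \<in> {1..n+1}" using Suc(2) by auto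
    then have "w (n + 1 - Suc j) \<in> S" "w (n + 1 - j) \<in> S" using w(1) by blast+
    moreover have "Q (w (n + 1 - j))" using Suc by simp
    ultimately show ?case using step[of "w (n + 1 - Suc j)" "w (n + 1 - j)"] by blast
  qed
  from this[of n] show ?thesis using w(2) by simp
qed

lemma path_induct_forward:
  assumes "a \<in> S" "b \<in> S" "Q a" and step: "\<And>a b. a \<in> S \<Longrightarrow> b \<in> S \<Longrightarrow> A a b = 1 \<Longrightarrow> Q a \<Longrightarrow> Q b"
  shows "Q b"
proof -
  have "Q a \<longrightarrow> Q b"
  proof (rule path_induct_back[where Q = "\<lambda>c. Q c \<longrightarrow> Q b", OF assms(1,2)])
    fix c d assume "c \<in> S" "d \<in> S" "A c d = 1" "Q d \<longrightarrow> Q b"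
    then show "Q c \<longrightarrow> Q b" using step[of c d] by simp
  qed simp
  then show ?thesis using assms(3) by simp
qed

lemma S_succ: "a \<in> S \<Longrightarrow> \<exists>b\<in>S. A a b = 1"
proof -
  assume a: "a \<in> S"
  obtain n :: nat and w :: "nat \<Rightarrow> 's" where n: "n \<ge> 1" and w: "\<forall>i\<in>{1..n+1}. w i \<in> S" "w 1 = a" "w (n+1) = a"
    "\<forall>i\<in>{1..n}. A (w i) (w (i+1)) = 1"
    by (rule irreducible_path[OF a a]) blast
  have "A a (w (1 + 1)) = 1" "w (1 + 1) \<in> S" using n w by auto
  then show ?thesis by blast
qed

text \<open>By irreducibility every letter has a successor, and iterating a choice of successors
  gives a point. Hence the sum in the summability condition runs over all of
  \<open>S\<close>.\<close>

lemma cylinder_ne: "s \<in> S \<Longrightarrow> \<exists>\<omega>\<in>X. \<omega> 0 = s"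
proof -
  assume s: "s \<in> S"
  obtain f where f: "\<And>a. a \<in> S \<Longrightarrow> f a \<in> S \<and> A a (f a) = 1" using S_succ by metis
  define \<omega> where "\<omega> n = (f ^^ n) s" for n
  have "\<omega> n \<in> S" for n by (induction n) (use s f in \<open>auto simp: \<omega>_def\<close>)
  then have "\<omega> \<in> X" using f by (auto simp: X_iff \<omega>_def)
  then show ?thesis by (intro bexI[of _ \<omega>]) (auto simp: \<omega>_def)
qed

lemma X_ne': "X \<noteq> {}"
  using cylinder_ne S0_sub S0_ne by blast

sublocale theta_space \<theta> X
  using th0 th1 X_ne' by unfold_locales

lemma X_shift: "\<omega> \<in> X \<Longrightarrow> shift \<omega> \<in> X"
  by (auto simp: X_iff shift_def)

lemma X_shift_pow: "\<omega> \<in> X \<Longrightarrow> (shift ^^ i) \<omega> \<in> X"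
  by (induction i) (auto intro: X_shift)

lemma X_prepend: "\<omega> \<in> X \<Longrightarrow> a \<in> S \<Longrightarrow> A a (\<omega> 0) = 1 \<Longrightarrow> prepend a \<omega> \<in> X"
  by (auto simp: X_iff prepend_def split: nat.split)

text \<open>The letters that the operator may prepend. They depend on \<open>\<omega>\<close> only
  through \<open>\<omega> 0\<close>, so the set is constant on cylinders of positive depth; this is
  the use of \<open>1 \<le> k\<close>.\<close>

definition pre where "pre \<omega> = {a \<in> S. M a (\<omega> 0) = 1}"

lemma pre_X: "\<omega> \<in> X \<Longrightarrow> a \<in> pre \<omega> \<Longrightarrow> prepend a \<omega> \<in> X"
  unfolding pre_def using M_one(3) by (blast intro: X_prepend)

lemma pre_sub: "pre \<omega> \<subseteq> S" by (auto simp: pre_def)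

lemma pre_agree: "agree n \<omega> \<upsilon> \<Longrightarrow> 1 \<le> n \<Longrightarrow> pre \<omega> = pre \<upsilon>"
  by (auto simp: pre_def agree_def)

lemma pre_XM: "\<omega> \<in> XM \<Longrightarrow> a \<in> pre \<omega> \<Longrightarrow> prepend a \<omega> \<in> XM"
proof -
  assume \<omega>: "\<omega> \<in> XM" and "a \<in> pre \<omega>"
  then have a: "M a (\<omega> 0) = 1" "a \<in> S0" unfolding pre_def using M_one(1) by blast+
  show ?thesis unfolding XM_iff
  proof (intro conjI allI)
    fix n show "prepend a \<omega> n \<in> S0" "M (prepend a \<omega> n) (prepend a \<omega> (Suc n)) = 1"
      using a \<omega> by (cases n; simp add: XM_iff)+
  qed
qed

definition E where "E s = exp (SUP \<omega>\<in>cylinder X [s]. \<phi> \<omega>)"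

lemma E_pos [simp]: "0 < E s" "0 \<le> E s" by (simp_all add: E_def)

lemma cylinder1: "cylinder X [s] = {\<omega>\<in>X. \<omega> 0 = s}"
  by (auto simp: cylinder_def)

lemma exp_phi_le: "\<omega> \<in> X \<Longrightarrow> exp (\<phi> \<omega>) \<le> E (\<omega> 0)"
proof -
  assume \<omega>: "\<omega> \<in> X"
  then have "bdd_above (\<phi> ` cylinder X [\<omega> 0])"
    using phi_sum unfolding summable_potential_def X_def[symmetric] by (auto simp: X_iff)
  then have "\<phi> \<omega> \<le> (SUP \<omega>\<in>cylinder X [\<omega> 0]. \<phi> \<omega>)" using \<omega> by (intro cSUP_upper) (auto simp: cylinder1)
  then show ?thesis by (simp add: E_def)
qed

lemma E_summable: "E summable_on S"
proof -
  have "{s\<in>S. cylinder X [s] \<noteq> {}} = S" using cylinder_ne by (auto simp: cylinder1)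
  then show ?thesis using phi_sum unfolding summable_potential_def X_def[symmetric] E_def[abs_def] by simp
qed

text \<open>Bounds the operator on bounded functions (\<open>bd_Lop\<close>) and serves wherever a
  crude estimate of one step suffices.\<close>

definition K where "K = infsum E S"

lemma K_pos: "0 < K"
proof -
  obtain s where s: "s \<in> S" using S0_ne S0_sub by blast
  have "sum E {s} \<le> K" unfolding K_def using s E_summable by (intro finite_sum_le_infsum) auto
  then have "E s \<le> K" by simp
  with E_pos(1)[of s] show ?thesis by (rule less_le_trans)
qed

lemma E_tail:
  assumes "\<epsilon> > 0" shows "\<exists>F. finite F \<and> F \<subseteq> S \<and> infsum E (S - F) \<le> \<epsilon>"
proof -
  obtain F where F: "finite F" "F \<subseteq> S" "dist (sum E F) (infsum E S) \<le> \<epsilon>"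
    using infsum_finite_approximation[OF E_summable assms] by blast
  have "infsum E (F \<union> (S - F)) = infsum E F + infsum E (S - F)"
    by (intro infsum_Un_disjoint) (use F summable_on_subset_banach[OF E_summable] in auto)
  moreover have "F \<union> (S - F) = S" using F by auto
  ultimately show ?thesis using F by (auto simp: dist_real_def)
qed

text \<open>One operator for real and complex functions: positivity arguments run over the reals,
  spectral theory over the complex numbers, and \<open>Lop_of_real\<close> relates the two. The
  value zero off \<open>X\<close> matches the convention that functions on \<open>X\<close> are
  extended by zero.\<close>

definition Lop :: "((nat \<Rightarrow> 's) \<Rightarrow> 'b) \<Rightarrow> (nat \<Rightarrow> 's) \<Rightarrow> 'b::{real_normed_field,banach,second_countable_topology}" where
  "Lop f \<omega> = (if \<omega> \<in> X then \<Sum>\<^sub>\<infinity>a\<in>pre \<omega>. of_real (exp (\<phi> (prepend a \<omega>))) * f (prepend a \<omega>) else 0)"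

lemma transfer_op_eq: "transfer_op S X M \<phi> = Lop"
  by (auto simp: fun_eq_iff transfer_op_def Lop_def pre_def)

definition bd :: "real \<Rightarrow> ((nat \<Rightarrow> 's) \<Rightarrow> 'b::real_normed_vector) \<Rightarrow> bool" where
  "bd B f \<longleftrightarrow> (\<forall>\<omega>\<in>X. norm (f \<omega>) \<le> B)"

lemma bdD: "bd B f \<Longrightarrow> \<omega> \<in> X \<Longrightarrow> norm (f \<omega>) \<le> B" by (simp add: bd_def)

lemma bd_nonneg: "bd B f \<Longrightarrow> 0 \<le> B"
proof -
  assume b: "bd B f"
  obtain \<omega> where "\<omega> \<in> X" using X_ne by blast
  from bdD[OF b this] show ?thesis using norm_ge_zero order_trans by blast
qed

lemma E_summable_pre: "E summable_on pre \<omega>"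
  using E_summable pre_sub by (rule summable_on_subset_banach)

lemma term_le:
  assumes "bd B f" "\<omega> \<in> X" "a \<in> pre \<omega>"
  shows "norm (of_real (exp (\<phi> (prepend a \<omega>))) * f (prepend a \<omega>) :: 'b::{real_normed_field}) \<le> E a * B"
proof -
  have x: "prepend a \<omega> \<in> X" using assms by (intro pre_X)
  have "norm (of_real (exp (\<phi> (prepend a \<omega>))) * f (prepend a \<omega>)) = exp (\<phi> (prepend a \<omega>)) * norm (f (prepend a \<omega>))"
    by (simp add: norm_mult)
  also have "\<dots> \<le> E a * B"
    using exp_phi_le[OF x] bdD[OF assms(1) x] bd_nonneg[OF assms(1)] by (intro mult_mono) auto
  finally show ?thesis .
qed

lemma term_summable:
  fixes f :: "(nat \<Rightarrow> 's) \<Rightarrow> 'b::{real_normed_field,banach,second_countable_topology}"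
  assumes "bd B f" "\<omega> \<in> X"
  shows "Infinite_Sum.abs_summable_on (\<lambda>a. of_real (exp (\<phi> (prepend a \<omega>))) * f (prepend a \<omega>)) (pre \<omega>)"
    "(\<lambda>a. of_real (exp (\<phi> (prepend a \<omega>))) * f (prepend a \<omega>)) summable_on (pre \<omega>)"
proof -
  show *: "Infinite_Sum.abs_summable_on (\<lambda>a. of_real (exp (\<phi> (prepend a \<omega>))) * f (prepend a \<omega>)) (pre \<omega>)"
    by (rule summable_on_comparison_test[OF summable_on_cmult_left[OF E_summable_pre, of B]])
      (use term_le[OF assms] in auto)
  then show "(\<lambda>a. of_real (exp (\<phi> (prepend a \<omega>))) * f (prepend a \<omega>)) summable_on (pre \<omega>)"
    by (rule abs_summable_summable)
qed

lemma Lop_out [simp]: "\<omega> \<notin> X \<Longrightarrow> Lop f \<omega> = 0" by (simp add: Lop_def)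

lemma Lop_cong: "(\<And>\<omega>. \<omega> \<in> X \<Longrightarrow> f \<omega> = g \<omega>) \<Longrightarrow> Lop f = Lop g"
  by (auto simp: Lop_def fun_eq_iff pre_X intro!: infsum_cong)

lemma Lop_add: "bd B f \<Longrightarrow> bd C g \<Longrightarrow> Lop (\<lambda>\<omega>. f \<omega> + g \<omega>) \<omega> = Lop f \<omega> + Lop g \<omega>"
  unfolding Lop_def distrib_left by (simp add: infsum_add term_summable)

lemma Lop_cmult: "Lop (\<lambda>\<omega>. c * f \<omega>) \<omega> = c * Lop f \<omega>"
  by (simp add: Lop_def infsum_cmult_right'[symmetric] mult.left_commute)

lemma bd_add: "bd B f \<Longrightarrow> bd C g \<Longrightarrow> bd (B + C) (\<lambda>\<omega>. f \<omega> + g \<omega>)"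
  unfolding bd_def by (auto intro!: norm_triangle_mono)

lemma bd_cmult: "bd B f \<Longrightarrow> bd (norm c * B) (\<lambda>\<omega>. c * f \<omega> :: 'b::real_normed_div_algebra)"
  unfolding bd_def by (simp add: norm_mult mult_left_mono)

lemma Lop_diff:
  assumes "bd B f" "bd C g" shows "Lop (\<lambda>\<omega>. f \<omega> - g \<omega>) \<omega> = Lop f \<omega> - Lop g \<omega>"
proof -
  have "bd C (\<lambda>\<omega>. (-1) * g \<omega>)" using bd_cmult[OF assms(2), of "-1"] by simp
  from Lop_add[OF assms(1) this, of \<omega>] show ?thesis unfolding Lop_cmult by simp
qed

lemma norm_Lop_le:
  fixes f :: "(nat \<Rightarrow> 's) \<Rightarrow> 'b::{real_normed_field,banach,second_countable_topology}"
  assumes "\<And>\<omega>. \<omega> \<in> X \<Longrightarrow> norm (f \<omega>) \<le> g \<omega>" "bd B g"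
  shows "norm (Lop f \<omega>) \<le> Lop g \<omega>"
proof (cases "\<omega> \<in> X")
  case True
  have f: "bd B f" unfolding bd_def
  proof
    fix \<omega> assume \<omega>: "\<omega> \<in> X"
    show "norm (f \<omega>) \<le> B" using assms(1)[OF \<omega>] bdD[OF assms(2) \<omega>] by simp
  qed
  show ?thesis unfolding Lop_def using True
  proof (simp, intro norm_infsum_le[OF has_sum_infsum has_sum_infsum])
    show "(\<lambda>a. of_real (exp (\<phi> (prepend a \<omega>))) * f (prepend a \<omega>)) summable_on pre \<omega>"
      using term_summable(2)[OF f True] .
    show "(\<lambda>a. exp (\<phi> (prepend a \<omega>)) * g (prepend a \<omega>)) summable_on pre \<omega>"
      using term_summable(2)[OF assms(2) True] by simp
    fix a assume "a \<in> pre \<omega>"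
    then show "norm (of_real (exp (\<phi> (prepend a \<omega>))) * f (prepend a \<omega>)) \<le> exp (\<phi> (prepend a \<omega>)) * g (prepend a \<omega>)"
      using assms(1)[OF pre_X[OF True]] by (simp add: norm_mult)
  qed
qed simp

lemma Lop_mono:
  fixes f g :: "(nat \<Rightarrow> 's) \<Rightarrow> real"
  assumes "\<And>\<omega>. \<omega> \<in> X \<Longrightarrow> f \<omega> \<le> g \<omega>" "bd B f" "bd C g"
  shows "Lop f \<omega> \<le> Lop g \<omega>"
proof (cases "\<omega> \<in> X")
  case True
  show ?thesis unfolding Lop_def using True
  proof (simp, intro infsum_mono)
    show "(\<lambda>a. exp (\<phi> (prepend a \<omega>)) * f (prepend a \<omega>)) summable_on pre \<omega>"
      "(\<lambda>a. exp (\<phi> (prepend a \<omega>)) * g (prepend a \<omega>)) summable_on pre \<omega>"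
      using term_summable(2)[OF assms(2) True] term_summable(2)[OF assms(3) True] by simp_all
    fix a assume "a \<in> pre \<omega>"
    then show "exp (\<phi> (prepend a \<omega>)) * f (prepend a \<omega>) \<le> exp (\<phi> (prepend a \<omega>)) * g (prepend a \<omega>)"
      using assms(1)[OF pre_X[OF True]] by simp
  qed
qed simp

lemma Lop_nonneg: "(\<And>\<omega>. \<omega> \<in> X \<Longrightarrow> 0 \<le> f \<omega>) \<Longrightarrow> 0 \<le> (Lop f \<omega> :: real)"
  by (auto simp: Lop_def intro!: infsum_nonneg mult_nonneg_nonneg dest: pre_X)

lemma bd_Lop: 
  assumes "bd B f" shows "bd (K * B) (Lop f)"
  unfolding bd_def
proof
  fix \<omega> assume \<omega>: "\<omega> \<in> X"
  have "norm (Lop f \<omega>) \<le> (\<Sum>\<^sub>\<infinity>a\<in>pre \<omega>. E a * B)"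
    unfolding Lop_def using \<omega>
    by (simp, intro norm_infsum_le[OF has_sum_infsum has_sum_infsum] term_summable(2)[OF assms \<omega>]
        summable_on_cmult_left E_summable_pre term_le[OF assms \<omega>])
  also have "\<dots> = infsum E (pre \<omega>) * B" by (rule infsum_cmult_left')
  also have "infsum E (pre \<omega>) \<le> K" unfolding K_def
    by (intro infsum_mono2 E_summable_pre E_summable pre_sub) simp
  finally show "norm (Lop f \<omega>) \<le> K * B" using bd_nonneg[OF assms] by (simp add: mult_right_mono)
qed

lemma Lop_of_real: 
  assumes "bd B u"
  shows "Lop (\<lambda>\<omega>. of_real (u \<omega>) :: 'b::{real_normed_field,banach,second_countable_topology}) \<omega> = of_real (Lop u \<omega>)"
proof (cases "\<omega> \<in> X")
  case True
  have "(\<Sum>\<^sub>\<infinity>a\<in>pre \<omega>. of_real (exp (\<phi> (prepend a \<omega>)) * u (prepend a \<omega>)) :: 'b) =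
      of_real (\<Sum>\<^sub>\<infinity>a\<in>pre \<omega>. exp (\<phi> (prepend a \<omega>)) * u (prepend a \<omega>))"
    unfolding of_real_def by (rule infsum_scaleR_left) (use term_summable(2)[OF assms True] in simp)
  then show ?thesis using True by (simp add: Lop_def)
qed simp

lemma Lop_shift: "Lop (\<lambda>\<omega>. h \<omega> * f (shift \<omega>)) \<omega> = Lop h \<omega> * f \<omega>"
  by (simp add: Lop_def infsum_cmult_left'[symmetric] mult.assoc)

lemma Lop_ge_term:
  assumes "\<And>\<omega>. \<omega> \<in> X \<Longrightarrow> 0 \<le> h \<omega>" "bd B h" "\<omega> \<in> X" "M (\<omega> 0) (\<omega> 1) = 1"
  shows "exp (\<phi> \<omega>) * h \<omega> \<le> (Lop h (shift \<omega>) :: real)"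
proof -
  have sX: "shift \<omega> \<in> X" by (rule X_shift[OF assms(3)])
  have p: "\<omega> 0 \<in> pre (shift \<omega>)" using assms(3,4) by (auto simp: pre_def shift_def X_iff)
  have "(\<Sum>a\<in>{\<omega> 0}. exp (\<phi> (prepend a (shift \<omega>))) * h (prepend a (shift \<omega>))) \<le> Lop h (shift \<omega>)"
    unfolding Lop_def if_P[OF sX] of_real_eq_id id_apply
  proof (intro finite_sum_le_infsum)
    show "(\<lambda>a. exp (\<phi> (prepend a (shift \<omega>))) * h (prepend a (shift \<omega>))) summable_on pre (shift \<omega>)"
      using term_summable(2)[OF assms(2) sX] by simp
    show "0 \<le> exp (\<phi> (prepend a (shift \<omega>))) * h (prepend a (shift \<omega>))" if "a \<in> pre (shift \<omega>) - {\<omega> 0}" for a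
      using assms(1)[OF pre_X[OF sX]] that by simp
  qed (use p in auto)
  then show ?thesis by simp
qed

text \<open>The sum over preimages is read as an integral for counting measure, with the summable
  majorant \<open>E a * B\<close>. Infinitely many preimages make this the substitute for taking
  limits term by term in a finite sum.\<close>

lemma Lop_dominated:
  fixes f :: "nat \<Rightarrow> (nat \<Rightarrow> 's) \<Rightarrow> 'b::{real_normed_field,banach,second_countable_topology}"
  assumes "\<And>i. bd B (f i)" "\<And>\<omega>. \<omega> \<in> X \<Longrightarrow> (\<lambda>i. f i \<omega>) \<longlonglongrightarrow> g \<omega>"
  shows "(\<lambda>i. Lop (f i) \<omega>) \<longlonglongrightarrow> Lop g \<omega>"
proof (cases "\<omega> \<in> X")
  case True
  have g: "bd B g" unfolding bd_def
  proof
    fix \<omega> assume \<omega>: "\<omega> \<in> X"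
    show "norm (g \<omega>) \<le> B"
      by (rule tendsto_upperbound[OF tendsto_norm[OF assms(2)[OF \<omega>]]]) (use bdD[OF assms(1) \<omega>] in auto)
  qed
  let ?t = "\<lambda>f a. of_real (exp (\<phi> (prepend a \<omega>))) * f (prepend a \<omega>) :: 'b"
  have eq: "infsum (?t f) (pre \<omega>) = (LINT a|count_space (pre \<omega>). ?t f a)" if "bd B f" for f
    using term_summable(1)[OF that True] unfolding abs_summable_equivalent
    by (subst infsetsum_infsum[symmetric]) (auto simp: infsetsum_def)
  have "(\<lambda>i. LINT a|count_space (pre \<omega>). ?t (f i) a) \<longlonglongrightarrow> (LINT a|count_space (pre \<omega>). ?t g a)"
  proof (rule integral_dominated_convergence[where w = "\<lambda>a. E a * B"])
    have "Infinite_Set_Sum.abs_summable_on E (pre \<omega>)" using E_summable_pre by (simp flip: abs_summable_equivalent)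
    then show "integrable (count_space (pre \<omega>)) (\<lambda>a. E a * B)"
      unfolding abs_summable_on_def by simp
    show "AE a in count_space (pre \<omega>). (\<lambda>i. ?t (f i) a) \<longlonglongrightarrow> ?t g a"
      by (auto simp: AE_count_space intro!: tendsto_mult assms(2) pre_X True)
    show "AE a in count_space (pre \<omega>). norm (?t (f i) a) \<le> E a * B" for i
      using term_le[OF assms(1) True] by (auto simp: AE_count_space)
  qed auto
  then show ?thesis using True eq[OF g] eq[OF assms(1)] by (simp add: Lop_def)
qed simp

lemma Lop_in: "\<omega> \<in> X \<Longrightarrow> Lop f \<omega> = (\<Sum>\<^sub>\<infinity>a\<in>pre \<omega>. of_real (exp (\<phi> (prepend a \<omega>))) * f (prepend a \<omega>))"
  by (simp add: Lop_def)

lemma bd_const [simp]: "bd (norm c) (\<lambda>_. c)" by (simp add: bd_def)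

lemma bd_one [simp]: "bd 1 (\<lambda>_. 1 :: 'b::{real_normed_field})" by (simp add: bd_def)

lemma bd_pow: "bd B f \<Longrightarrow> bd (K ^ n * B) ((Lop ^^ n) f)"
proof (induction n)
  case (Suc n)
  from bd_Lop[OF Suc.IH[OF Suc.prems]] show ?case by (simp add: mult.assoc)
qed simp

lemma pow_cong: "(\<And>\<omega>. \<omega> \<in> X \<Longrightarrow> f \<omega> = g \<omega>) \<Longrightarrow> \<omega> \<in> X \<Longrightarrow> (Lop ^^ n) f \<omega> = (Lop ^^ n) g \<omega>"
proof (induction n arbitrary: \<omega>)
  case (Suc n)
  have "Lop ((Lop ^^ n) f) = Lop ((Lop ^^ n) g)" by (rule Lop_cong) (use Suc in blast)
  then show ?case by simp
qed simp

lemma pow_cmult: "(Lop ^^ n) (\<lambda>\<omega>. c * f \<omega>) = (\<lambda>\<omega>. c * (Lop ^^ n) f \<omega>)"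
  by (induction n) (auto simp: Lop_cmult)

lemma pow_add:
  assumes "bd B f" "bd C g"
  shows "(Lop ^^ n) (\<lambda>\<omega>. f \<omega> + g \<omega>) = (\<lambda>\<omega>. (Lop ^^ n) f \<omega> + (Lop ^^ n) g \<omega>)"
proof (induction n)
  case (Suc n)
  show ?case
    unfolding funpow.simps o_def Suc.IH by (rule ext) (rule Lop_add[OF bd_pow[OF assms(1)] bd_pow[OF assms(2)]])
qed simp

lemma pow_diff:
  assumes "bd B f" "bd C g"
  shows "(Lop ^^ n) (\<lambda>\<omega>. f \<omega> - g \<omega>) = (\<lambda>\<omega>. (Lop ^^ n) f \<omega> - (Lop ^^ n) g \<omega>)"
proof (induction n)
  case (Suc n)
  show ?case
    unfolding funpow.simps o_def Suc.IH by (rule ext) (rule Lop_diff[OF bd_pow[OF assms(1)] bd_pow[OF assms(2)]])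
qed simp

lemma pow_norm_le:
  assumes "\<And>\<omega>. \<omega> \<in> X \<Longrightarrow> norm (f \<omega>) \<le> g \<omega>" "bd B g" "\<omega> \<in> X"
  shows "norm ((Lop ^^ n) f \<omega>) \<le> (Lop ^^ n) g \<omega>"
  using assms(3)
proof (induction n arbitrary: \<omega>)
  case (Suc n)
  have "norm (Lop ((Lop ^^ n) f) \<omega>) \<le> Lop ((Lop ^^ n) g) \<omega>"
    by (rule norm_Lop_le[OF Suc.IH bd_pow[OF assms(2)]])
  then show ?case by simp
qed (use assms in simp)

lemma pow_nonneg: "(\<And>\<omega>. \<omega> \<in> X \<Longrightarrow> 0 \<le> f \<omega>) \<Longrightarrow> \<omega> \<in> X \<Longrightarrow> 0 \<le> ((Lop ^^ n) f \<omega> :: real)"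
proof (induction n arbitrary: \<omega>)
  case (Suc n)
  have "0 \<le> Lop ((Lop ^^ n) f) \<omega>" by (rule Lop_nonneg) (rule Suc.IH[OF Suc.prems(1)])
  then show ?case by simp
qed simp

lemma pow_mono:
  assumes "\<And>\<omega>. \<omega> \<in> X \<Longrightarrow> f \<omega> \<le> g \<omega>" "bd B f" "bd C g" "\<omega> \<in> X"
  shows "(Lop ^^ n) f \<omega> \<le> ((Lop ^^ n) g \<omega> :: real)"
proof -
  have "0 \<le> (Lop ^^ n) (\<lambda>\<omega>. g \<omega> - f \<omega>) \<omega>" by (rule pow_nonneg) (use assms in auto)
  then show ?thesis unfolding pow_diff[OF assms(3,2)] by simp
qed

definition Ln :: "nat \<Rightarrow> (nat \<Rightarrow> 's) \<Rightarrow> real" where "Ln n = (Lop ^^ n) (\<lambda>_. 1)"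

text \<open>The norm of the \<open>n\<close>-th iterate on bounded functions: by positivity the
  constant function one is extremal (\<open>bd_pow_b\<close>).\<close>

definition b :: "nat \<Rightarrow> real" where "b n = (SUP \<omega>\<in>X. Ln n \<omega>)"

lemma Ln_nonneg: "\<omega> \<in> X \<Longrightarrow> 0 \<le> Ln n \<omega>"
  unfolding Ln_def by (rule pow_nonneg) auto

lemma bd_Ln: "bd (K ^ n) (Ln n)"
  unfolding Ln_def using bd_pow[OF bd_one, of n] by simp

lemma Ln_bdd: "bdd_above (Ln n ` X)"
  using bdD[OF bd_Ln, of _ n] by (intro bdd_aboveI[of _ "K ^ n"]) force

lemma Ln_le_b: "\<omega> \<in> X \<Longrightarrow> Ln n \<omega> \<le> b n"
  unfolding b_def by (rule cSUP_upper[OF _ Ln_bdd])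

lemma b_le: "(\<And>\<omega>. \<omega> \<in> X \<Longrightarrow> Ln n \<omega> \<le> c) \<Longrightarrow> b n \<le> c"
  unfolding b_def using X_ne by (intro cSUP_least) auto

lemma b_nonneg: "0 \<le> b n"
proof -
  obtain \<omega> where "\<omega> \<in> X" using X_ne by blast
  then show ?thesis using Ln_nonneg[of \<omega> n] Ln_le_b[of \<omega> n] by linarith
qed

lemma b_le_K: "b n \<le> K ^ n"
  by (rule b_le) (use bdD[OF bd_Ln, of _ n] in force)

lemma bd_pow_b: "bd B f \<Longrightarrow> bd (b n * B) ((Lop ^^ n) f)"
  unfolding bd_def
proof
  fix \<omega> assume f: "\<forall>\<omega>\<in>X. norm (f \<omega>) \<le> B" and \<omega>: "\<omega> \<in> X"
  have B: "B \<ge> 0" using f bd_nonneg[of B f] by (simp add: bd_def)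
  have "norm ((Lop ^^ n) f \<omega>) \<le> (Lop ^^ n) (\<lambda>\<omega>. B * 1) \<omega>"
    by (rule pow_norm_le[where B = B]) (use f \<omega> B in \<open>auto simp: bd_def\<close>)
  also have "\<dots> = B * Ln n \<omega>" unfolding pow_cmult Ln_def ..
  also have "\<dots> \<le> b n * B" using Ln_le_b[OF \<omega>, of n] B by (simp add: mult.commute mult_left_mono)
  finally show "norm ((Lop ^^ n) f \<omega>) \<le> b n * B" .
qed

lemma pow_shift: "(Lop ^^ n) (\<lambda>\<omega>. h \<omega> * f ((shift ^^ n) \<omega>)) = (\<lambda>\<omega>. (Lop ^^ n) h \<omega> * f \<omega>)"
proof (induction n arbitrary: h)
  case (Suc n)
  have "Lop (\<lambda>\<omega>. h \<omega> * f ((shift ^^ Suc n) \<omega>)) = (\<lambda>\<omega>. Lop h \<omega> * f ((shift ^^ n) \<omega>))"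
    using Lop_shift[of h "\<lambda>\<omega>. f ((shift ^^ n) \<omega>)"] by (auto simp: funpow_swap1 fun_eq_iff)
  then show ?case unfolding funpow_Suc_right o_def using Suc.IH[of "Lop h"] by (simp add: funpow_swap1)
qed simp

text \<open>All terms of the \<open>n\<close>-fold sum are nonnegative, and the inverse branch along
  \<open>\<omega>\<close> is one of them when its first \<open>n\<close> transitions are admissible.
  The bound serves both \<open>\<rho>_pos\<close> and the upper estimate of the partition
  functions.\<close>

lemma pow_ge_term:
  assumes "\<And>\<omega>. \<omega> \<in> X \<Longrightarrow> 0 \<le> h \<omega>" "bd B h" "\<omega> \<in> X" "\<And>i. i < n \<Longrightarrow> M (\<omega> i) (\<omega> (Suc i)) = 1"
  shows "exp (birkhoff_sum \<phi> n \<omega>) * h \<omega> \<le> ((Lop ^^ n) h ((shift ^^ n) \<omega>) :: real)"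
  using assms(4)
proof (induction n)
  case 0
  then show ?case by (simp add: birkhoff_sum_def)
next
  case (Suc n)
  let ?\<upsilon> = "(shift ^^ n) \<omega>"
  have \<upsilon>: "?\<upsilon> \<in> X" by (rule X_shift_pow[OF assms(3)])
  have "exp (birkhoff_sum \<phi> (Suc n) \<omega>) * h \<omega> = exp (\<phi> ?\<upsilon>) * (exp (birkhoff_sum \<phi> n \<omega>) * h \<omega>)"
    by (simp add: birkhoff_sum_def exp_add)
  also have "\<dots> \<le> exp (\<phi> ?\<upsilon>) * (Lop ^^ n) h ?\<upsilon>" using Suc by (intro mult_left_mono) auto
  also have "\<dots> \<le> Lop ((Lop ^^ n) h) (shift ?\<upsilon>)"
    by (rule Lop_ge_term[OF pow_nonneg bd_pow[OF assms(2)] \<upsilon>]) (use assms(1) Suc(2)[of n] in \<open>auto simp: funpow_shift\<close>)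
  finally show ?case by simp
qed

section \<open>Bounded distortion and the Lasota--Yorke inequality\<close>

definition \<Phi> where "\<Phi> = enn2real (theta_seminorm \<theta> X (k + 1) \<phi>)"
definition c1 where "c1 = \<Phi> * \<theta> / (1 - \<theta>)"

lemma lip_phi: "lip (k + 1) \<Phi> \<phi>"
proof -
  obtain C where "lip (k + 1) C \<phi>"
    using phi_lip unfolding X_def[symmetric] theta_seminorm_finite by blast
  then show ?thesis unfolding \<Phi>_def by (rule lip_seminorm)
qed

lemma \<Phi>_nonneg: "0 \<le> \<Phi>" by (rule lip_nonneg[OF lip_phi])

lemma c1_nonneg: "0 \<le> c1" unfolding c1_def using \<Phi>_nonneg th0 th1 by simp

text \<open>\<open>c1\<close> solves \<open>(c1 + \<Phi>) * \<theta> = c1\<close>: one prepended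
  letter adds a distortion \<open>\<Phi>\<close> of the potential and moves the comparison one level
  deeper, and the two effects balance. Hence the cone is preserved with the same constant.\<close>

lemma c1_eq: "(c1 + \<Phi>) * \<theta> ^ Suc m = c1 * \<theta> ^ m"
proof -
  have "c1 + \<Phi> = \<Phi> / (1 - \<theta>)" using th1 by (simp add: c1_def field_simps)
  then show ?thesis by (simp add: c1_def)
qed

lemma phi_diff:
  assumes "\<omega> \<in> X" "\<upsilon> \<in> X" "agree m \<omega> \<upsilon>" "k \<le> m" "a \<in> pre \<omega>"
  shows "\<bar>\<phi> (prepend a \<omega>) - \<phi> (prepend a \<upsilon>)\<bar> \<le> \<Phi> * \<theta> ^ Suc m"
proof -
  have "a \<in> pre \<upsilon>" using pre_agree[OF assms(3)] k1 assms(4,5) by auto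
  then have "norm (\<phi> (prepend a \<omega>) - \<phi> (prepend a \<upsilon>)) \<le> \<Phi> * \<theta> ^ Suc m"
    using assms by (intro lipD[OF lip_phi] pre_X agree_prepend) auto
  then show ?thesis by simp
qed

lemma Lop_compare:
  fixes f g :: "(nat \<Rightarrow> 's) \<Rightarrow> real"
  assumes "\<omega> \<in> X" "\<upsilon> \<in> X" "pre \<omega> = pre \<upsilon>" "bd B f" "bd C g"
    "\<And>a. a \<in> pre \<upsilon> \<Longrightarrow> exp (\<phi> (prepend a \<omega>)) * f (prepend a \<omega>) \<le> c * (exp (\<phi> (prepend a \<upsilon>)) * g (prepend a \<upsilon>))"
  shows "Lop f \<omega> \<le> c * Lop g \<upsilon>"
proof -
  have s: "(\<lambda>a. exp (\<phi> (prepend a \<omega>)) * f (prepend a \<omega>)) summable_on pre \<upsilon>"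
    "(\<lambda>a. exp (\<phi> (prepend a \<upsilon>)) * g (prepend a \<upsilon>)) summable_on pre \<upsilon>"
    using term_summable(2)[OF assms(4,1)] term_summable(2)[OF assms(5,2)] assms(3) by simp_all
  have "(\<Sum>\<^sub>\<infinity>a\<in>pre \<upsilon>. exp (\<phi> (prepend a \<omega>)) * f (prepend a \<omega>)) \<le>
      (\<Sum>\<^sub>\<infinity>a\<in>pre \<upsilon>. c * (exp (\<phi> (prepend a \<upsilon>)) * g (prepend a \<upsilon>)))"
    by (intro infsum_mono s summable_on_cmult_right assms(6))
  then show ?thesis using assms(1-3) by (simp add: Lop_def infsum_cmult_right')
qed

text \<open>Each prepended letter deepens the agreement by one, so it suffices that \<open>h\<close>
  is log-Lipschitz from level \<open>t \<le> n + m\<close> on; this admits indicators of words of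
  length up to \<open>n\<close>. The condition \<open>k \<le> m\<close> stays, since the potential
  is controlled from level \<open>k + 1\<close> on.\<close>

lemma cone_pow:
  fixes h :: "(nat \<Rightarrow> 's) \<Rightarrow> real"
  assumes h0: "\<And>\<omega>. \<omega> \<in> X \<Longrightarrow> 0 \<le> h \<omega>" and bh: "bd B h"
    and h: "\<And>j \<omega> \<upsilon>. t \<le> j \<Longrightarrow> \<omega> \<in> X \<Longrightarrow> \<upsilon> \<in> X \<Longrightarrow> agree j \<omega> \<upsilon> \<Longrightarrow> h \<omega> \<le> exp (c1 * \<theta> ^ j) * h \<upsilon>"
    and "k \<le> m" "t \<le> n + m" "\<omega> \<in> X" "\<upsilon> \<in> X" "agree m \<omega> \<upsilon>"
  shows "(Lop ^^ n) h \<omega> \<le> exp (c1 * \<theta> ^ m) * (Lop ^^ n) h \<upsilon>"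
  using assms(4-)
proof (induction n arbitrary: m \<omega> \<upsilon>)
  case 0
  then show ?case using h by simp
next
  case (Suc n)
  let ?f = "(Lop ^^ n) h"
  have pp: "pre \<omega> = pre \<upsilon>" using pre_agree[OF Suc.prems(5)] k1 Suc.prems(1) by simp
  have "Lop ?f \<omega> \<le> exp (c1 * \<theta> ^ m) * Lop ?f \<upsilon>"
  proof (rule Lop_compare[OF Suc.prems(3,4) pp bd_pow[OF bh] bd_pow[OF bh]])
    fix a assume a: "a \<in> pre \<upsilon>"
    then have a': "a \<in> pre \<omega>" by (simp add: pp)
    let ?\<omega> = "prepend a \<omega>" and ?\<upsilon> = "prepend a \<upsilon>"
    have ag: "agree (Suc m) ?\<omega> ?\<upsilon>" by (intro agree_prepend Suc.prems)
    have ex: "exp (\<phi> ?\<omega>) \<le> exp (\<phi> ?\<upsilon> + \<Phi> * \<theta> ^ Suc m)"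
      using phi_diff[OF Suc.prems(3,4,5,1) a'] by simp
    have fl: "?f ?\<omega> \<le> exp (c1 * \<theta> ^ Suc m) * ?f ?\<upsilon>"
      using Suc.prems by (intro Suc.IH ag pre_X a a') auto
    have "exp (\<phi> ?\<omega>) * ?f ?\<omega> \<le> exp (\<phi> ?\<upsilon> + \<Phi> * \<theta> ^ Suc m) * (exp (c1 * \<theta> ^ Suc m) * ?f ?\<upsilon>)"
      using ex fl pow_nonneg[OF h0 pre_X[OF Suc.prems(3) a']] by (intro mult_mono) auto
    also have "\<dots> = exp (c1 * \<theta> ^ m) * (exp (\<phi> ?\<upsilon>) * ?f ?\<upsilon>)"
      unfolding c1_eq[of m, symmetric] by (simp add: exp_add distrib_right)
    finally show "exp (\<phi> ?\<omega>) * ?f ?\<omega> \<le> exp (c1 * \<theta> ^ m) * (exp (\<phi> ?\<upsilon>) * ?f ?\<upsilon>)" .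
  qed
  then show ?case by simp
qed

lemma exp_diff_le: "\<bar>x - y\<bar> \<le> \<delta> \<Longrightarrow> \<bar>exp x - exp y\<bar> \<le> exp y * (exp \<delta> - 1)" for x y \<delta> :: real
proof -
  assume d: "\<bar>x - y\<bar> \<le> \<delta>"
  have e: "\<bar>exp x - exp y\<bar> = exp y * \<bar>exp (x - y) - 1\<bar>"
  proof -
    have "exp x - exp y = exp y * (exp (x - y) - 1)" by (simp add: exp_diff algebra_simps)
    then show ?thesis by (simp add: abs_mult)
  qed
  have "exp (x - y) \<le> exp \<delta>" "exp (- \<delta>) \<le> exp (x - y)" using d by auto
  moreover have "1 - exp (- \<delta>) \<le> exp \<delta> - 1"
    using exp_ge_add_one_self[of "-\<delta>"] exp_ge_add_one_self[of \<delta>] by linarith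
  ultimately have "\<bar>exp (x - y) - 1\<bar> \<le> exp \<delta> - 1" by linarith
  then show ?thesis unfolding e by (intro mult_left_mono) auto
qed

text \<open>Along \<open>n\<close> prepended letters the variation of \<open>h\<close> shrinks by
  \<open>\<theta> ^ n\<close>, while the distortion of the weights acts on the size of
  \<open>h\<close>. The terms \<open>Ln n \<omega>\<close> and the iterate of the norm of
  \<open>h\<close> are not replaced by suprema: the induction then closes exactly by
  \<open>c1_eq\<close>, and smallness of that iterate can be exploited later.\<close>

lemma lasota_yorke:
  fixes h :: "(nat \<Rightarrow> 's) \<Rightarrow> 'b::{real_normed_field,banach,second_countable_topology}"
  assumes bh: "bd B h" and D: "0 \<le> D"
    and h: "\<And>j \<omega> \<upsilon>. t \<le> j \<Longrightarrow> \<omega> \<in> X \<Longrightarrow> \<upsilon> \<in> X \<Longrightarrow> agree j \<omega> \<upsilon> \<Longrightarrow> norm (h \<omega> - h \<upsilon>) \<le> D * \<theta> ^ j"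
    and "k \<le> m" "t \<le> n + m" "\<omega> \<in> X" "\<upsilon> \<in> X" "agree m \<omega> \<upsilon>"
  shows "norm ((Lop ^^ n) h \<omega> - (Lop ^^ n) h \<upsilon>) \<le>
    D * \<theta> ^ (n + m) * Ln n \<omega> + (exp (c1 * \<theta> ^ m) - 1) * (Lop ^^ n) (\<lambda>\<omega>. norm (h \<omega>)) \<upsilon>"
  using assms(4-)
proof (induction n arbitrary: m \<omega> \<upsilon>)
  case 0
  have "norm (h \<omega> - h \<upsilon>) \<le> D * \<theta> ^ m" using 0 h by simp
  moreover have "0 \<le> (exp (c1 * \<theta> ^ m) - 1) * norm (h \<upsilon>)" using c1_nonneg by simp
  ultimately show ?case by (simp add: Ln_def)
next
  case (Suc n)
  let ?f = "(Lop ^^ n) h" and ?G = "(Lop ^^ n) (\<lambda>\<omega>. norm (h \<omega>))"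
  have bn: "bd B (\<lambda>\<omega>. norm (h \<omega>))" using bh by (simp add: bd_def)
  have pp: "pre \<omega> = pre \<upsilon>" using pre_agree[OF Suc.prems(5)] k1 Suc.prems(1) by simp
  have w: "\<omega> \<in> X" and u: "\<upsilon> \<in> X" using Suc.prems by auto
  define T where "T \<omega> a = of_real (exp (\<phi> (prepend a \<omega>))) * ?f (prepend a \<omega>)" for \<omega> a
  define q where "q = D * \<theta> ^ (Suc n + m)"
  define r where "r = exp (c1 * \<theta> ^ m) - 1"
  have s: "T \<omega> summable_on pre \<upsilon>" "T \<upsilon> summable_on pre \<upsilon>"
    using term_summable(2)[OF bd_pow[OF bh] w, of n] term_summable(2)[OF bd_pow[OF bh] u, of n]
    unfolding T_def pp by auto
  have sL: "(\<lambda>a. exp (\<phi> (prepend a \<omega>)) * Ln n (prepend a \<omega>)) summable_on pre \<upsilon>"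
    using term_summable(2)[OF bd_Ln w, of n] by (simp add: pp)
  have sG: "(\<lambda>a. exp (\<phi> (prepend a \<upsilon>)) * ?G (prepend a \<upsilon>)) summable_on pre \<upsilon>"
    using term_summable(2)[OF bd_pow[OF bn] u, of n] by simp
  have pw: "norm (T \<omega> a - T \<upsilon> a) \<le> q * (exp (\<phi> (prepend a \<omega>)) * Ln n (prepend a \<omega>)) +
      r * (exp (\<phi> (prepend a \<upsilon>)) * ?G (prepend a \<upsilon>))" if a: "a \<in> pre \<upsilon>" for a
  proof -
    have a': "a \<in> pre \<omega>" using a by (simp add: pp)
    let ?\<omega> = "prepend a \<omega>" and ?\<upsilon> = "prepend a \<upsilon>"
    let ?e = "exp (\<phi> ?\<omega>)" and ?e' = "exp (\<phi> ?\<upsilon>)" and ?g = "?G ?\<upsilon>" and ?d = "\<Phi> * \<theta> ^ Suc m"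
    let ?r = "exp (c1 * \<theta> ^ Suc m) - 1"
    have X': "?\<omega> \<in> X" "?\<upsilon> \<in> X" using pre_X a a' w u by auto
    have g0: "0 \<le> ?g" by (rule pow_nonneg[OF _ X'(2)]) simp
    have r0: "0 \<le> ?r" using c1_nonneg th0 by simp
    have pd: "\<bar>\<phi> ?\<omega> - \<phi> ?\<upsilon>\<bar> \<le> ?d" by (rule phi_diff[OF w u Suc.prems(5,1) a'])
    have ih: "norm (?f ?\<omega> - ?f ?\<upsilon>) \<le> D * \<theta> ^ (n + Suc m) * Ln n ?\<omega> + ?r * ?g"
      using Suc.prems X' by (intro Suc.IH agree_prepend) auto
    have fg: "norm (?f ?\<upsilon>) \<le> ?g" by (rule pow_norm_le[OF _ bn X'(2)]) simp
    \<comment> \<open>The weight at \<open>\<omega>\<close> multiplies the difference of values, and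
      the value at \<open>\<upsilon>\<close> multiplies the difference of weights; this mixed
      splitting matches the two base points in the claim.\<close>
    have "T \<omega> a - T \<upsilon> a = of_real ?e * (?f ?\<omega> - ?f ?\<upsilon>) + of_real (?e - ?e') * ?f ?\<upsilon>"
      by (simp add: T_def algebra_simps)
    then have "norm (T \<omega> a - T \<upsilon> a) \<le> ?e * norm (?f ?\<omega> - ?f ?\<upsilon>) + \<bar>?e - ?e'\<bar> * norm (?f ?\<upsilon>)"
      using norm_triangle_ineq[of "of_real ?e * (?f ?\<omega> - ?f ?\<upsilon>)" "of_real (?e - ?e') * ?f ?\<upsilon>"]
      by (simp add: norm_mult del: of_real_diff)
    also have "\<dots> \<le> ?e * (D * \<theta> ^ (n + Suc m) * Ln n ?\<omega> + ?r * ?g) + ?e' * (exp ?d - 1) * ?g"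
      using exp_diff_le[OF pd] fg ih g0 by (intro add_mono mult_left_mono mult_mono) auto
    also have "\<dots> = q * (?e * Ln n ?\<omega>) + (?e * ?r + ?e' * (exp ?d - 1)) * ?g"
      by (simp add: q_def algebra_simps)
    also have "?e \<le> ?e' * exp ?d" using pd by (simp flip: exp_add)
    then have "?e * ?r + ?e' * (exp ?d - 1) \<le> ?e' * exp ?d * ?r + ?e' * (exp ?d - 1)"
      using r0 by (intro add_right_mono mult_right_mono)
    also have "\<dots> = ?e' * r"
      unfolding r_def c1_eq[of m, symmetric] by (simp add: distrib_right exp_add algebra_simps)
    finally have "norm (T \<omega> a - T \<upsilon> a) \<le> q * (?e * Ln n ?\<omega>) + ?e' * r * ?g"
      using g0 by (simp add: mult_right_mono)
    then show ?thesis by (simp add: algebra_simps)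
  qed
  have "norm (infsum (T \<omega>) (pre \<upsilon>) - infsum (T \<upsilon>) (pre \<upsilon>)) \<le>
      q * (\<Sum>\<^sub>\<infinity>a\<in>pre \<upsilon>. exp (\<phi> (prepend a \<omega>)) * Ln n (prepend a \<omega>)) +
      r * (\<Sum>\<^sub>\<infinity>a\<in>pre \<upsilon>. exp (\<phi> (prepend a \<upsilon>)) * ?G (prepend a \<upsilon>))"
  proof (rule norm_infsum_le)
    show "((\<lambda>a. T \<omega> a - T \<upsilon> a) has_sum infsum (T \<omega>) (pre \<upsilon>) - infsum (T \<upsilon>) (pre \<upsilon>)) (pre \<upsilon>)"
      using has_sum_add[OF has_sum_infsum[OF s(1)], of "\<lambda>a. - T \<upsilon> a" "- infsum (T \<upsilon>) (pre \<upsilon>)"]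
        has_sum_infsum[OF s(2)] by (simp add: has_sum_uminus)
    show "((\<lambda>a. q * (exp (\<phi> (prepend a \<omega>)) * Ln n (prepend a \<omega>)) + r * (exp (\<phi> (prepend a \<upsilon>)) * ?G (prepend a \<upsilon>))) has_sum
        q * (\<Sum>\<^sub>\<infinity>a\<in>pre \<upsilon>. exp (\<phi> (prepend a \<omega>)) * Ln n (prepend a \<omega>)) +
        r * (\<Sum>\<^sub>\<infinity>a\<in>pre \<upsilon>. exp (\<phi> (prepend a \<upsilon>)) * ?G (prepend a \<upsilon>))) (pre \<upsilon>)"
      by (intro has_sum_add has_sum_cmult_right has_sum_infsum sL sG)
  qed (rule pw)
  then show ?case
    unfolding T_def q_def[symmetric] r_def[symmetric] funpow.simps o_def Lop_in[OF w] Lop_in[OF u] pp Ln_def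
    by (simp add: Lop_in w u pp)
qed

section \<open>Smallness of the iterates on words leaving a finite alphabet\<close>

definition tail :: "'s set \<Rightarrow> nat \<Rightarrow> (nat \<Rightarrow> 's) \<Rightarrow> real" where
  "tail F n \<omega> = (if \<forall>i<n. \<omega> i \<in> F then 0 else 1)"

lemma bd_tail: "bd 1 (tail F n)" by (auto simp: bd_def tail_def)

text \<open>A union bound over the position of a letter outside \<open>F\<close>: that position
  costs \<open>\<epsilon>\<close>, each of the other \<open>n - 1\<close> positions a factor
  \<open>K\<close>. The form \<open>K ^ n * (\<epsilon> / K)\<close> avoids the exponent
  \<open>n - 1\<close>.\<close>

lemma tail_pow:
  assumes F: "infsum E (S - F) \<le> \<epsilon>" and \<omega>: "\<omega> \<in> X"
  shows "(Lop ^^ n) (tail F n) \<omega> \<le> real n * K ^ n * (\<epsilon> / K)"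
  using \<omega>
proof (induction n arbitrary: \<omega>)
  case 0
  then show ?case by (simp add: tail_def)
next
  case (Suc n)
  have e0: "0 \<le> \<epsilon>" using F infsum_nonneg[of "S - F" E] by simp
  have t1: "Lop (tail F 1) \<upsilon> \<le> \<epsilon>" if \<upsilon>: "\<upsilon> \<in> X" for \<upsilon>
  proof -
    have "(\<Sum>\<^sub>\<infinity>a\<in>pre \<upsilon>. exp (\<phi> (prepend a \<upsilon>)) * tail F 1 (prepend a \<upsilon>)) \<le> infsum E (S - F)"
    proof (rule infsum_mono_neutral)
      show "(\<lambda>a. exp (\<phi> (prepend a \<upsilon>)) * tail F 1 (prepend a \<upsilon>)) summable_on pre \<upsilon>"
        using term_summable(2)[OF bd_tail \<upsilon>, of F 1] by simp
      show "E summable_on S - F" by (rule summable_on_subset_banach[OF E_summable]) auto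
      show "exp (\<phi> (prepend a \<upsilon>)) * tail F 1 (prepend a \<upsilon>) \<le> E a" if "a \<in> pre \<upsilon> \<inter> (S - F)" for a
        using exp_phi_le[OF pre_X[OF \<upsilon>], of a] that by (auto simp: tail_def)
      show "exp (\<phi> (prepend a \<upsilon>)) * tail F 1 (prepend a \<upsilon>) \<le> 0" if "a \<in> pre \<upsilon> - (S - F)" for a
        using that pre_sub by (auto simp: tail_def)
    qed auto
    then show ?thesis using F \<upsilon> by (simp add: Lop_def)
  qed
  have le: "Lop (tail F (Suc n)) \<upsilon> \<le> \<epsilon> + K * tail F n \<upsilon>" if \<upsilon>: "\<upsilon> \<in> X" for \<upsilon>
  proof -
    have b2: "bd 1 (\<lambda>\<omega>. 1 * tail F n (shift \<omega>))" by (auto simp: bd_def tail_def)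
    have "Lop (tail F (Suc n)) \<upsilon> \<le> Lop (\<lambda>\<omega>. tail F 1 \<omega> + 1 * tail F n (shift \<omega>)) \<upsilon>"
    proof (rule Lop_mono[OF _ bd_tail bd_add[OF bd_tail b2]])
      fix \<omega> :: "nat \<Rightarrow> 's"
      show "tail F (Suc n) \<omega> \<le> tail F 1 \<omega> + 1 * tail F n (shift \<omega>)"
        by (auto simp: tail_def shift_def less_Suc_eq_0_disj)
    qed
    also have "\<dots> = Lop (tail F 1) \<upsilon> + Lop (\<lambda>_. 1) \<upsilon> * tail F n \<upsilon>"
      unfolding Lop_add[OF bd_tail b2] Lop_shift[of "\<lambda>_. 1" "tail F n"] ..
    also have "\<dots> \<le> \<epsilon> + K * tail F n \<upsilon>"
    proof (intro add_mono mult_right_mono t1 \<upsilon>)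
      have "norm (Lop (\<lambda>_. 1 :: real) \<upsilon>) \<le> K * 1" by (rule bdD[OF bd_Lop[OF bd_one] \<upsilon>])
      then show "Lop (\<lambda>_. 1) \<upsilon> \<le> K" by simp
    qed (simp add: tail_def)
    finally show ?thesis .
  qed
  have c: "bd \<epsilon> (\<lambda>_. \<epsilon> * 1)" using e0 by (simp add: bd_def)
  have bK: "bd (K * 1) (\<lambda>\<omega>. K * tail F n \<omega>)" using bd_cmult[OF bd_tail, of K F n] K_pos by simp
  have "(Lop ^^ n) (Lop (tail F (Suc n))) \<omega> \<le> (Lop ^^ n) (\<lambda>\<omega>. \<epsilon> * 1 + K * tail F n \<omega>) \<omega>"
    by (rule pow_mono[OF _ bd_Lop[OF bd_tail] bd_add[OF c bK] Suc.prems]) (use le in simp)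
  also have "\<dots> = \<epsilon> * Ln n \<omega> + K * (Lop ^^ n) (tail F n) \<omega>"
    unfolding pow_add[OF c bK] unfolding pow_cmult Ln_def ..
  also have "\<dots> \<le> \<epsilon> * K ^ n + K * (real n * K ^ n * (\<epsilon> / K))"
    using Suc K_pos e0 bdD[OF bd_Ln Suc.prems, of n] by (intro add_mono mult_left_mono) auto
  also have "\<dots> = real (Suc n) * K ^ Suc n * (\<epsilon> / K)" using K_pos by (simp add: field_simps)
  finally show ?case unfolding funpow_Suc_right o_def .
qed

lemma tail_small:
  assumes "\<epsilon> > 0" shows "\<exists>F. finite F \<and> F \<subseteq> S \<and> (\<forall>\<omega>\<in>X. (Lop ^^ n) (tail F n) \<omega> \<le> \<epsilon>)"
proof -
  \<comment> \<open>\<open>real n + 1\<close> in place of \<open>real n\<close> covers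
    \<open>n = 0\<close>.\<close>
  define \<delta> where "\<delta> = \<epsilon> * K / ((real n + 1) * K ^ n)"
  have "\<delta> > 0" using assms K_pos by (simp add: \<delta>_def)
  then obtain F where F: "finite F" "F \<subseteq> S" "infsum E (S - F) \<le> \<delta>" using E_tail by blast
  define x where "x = real n + 1"
  have "x > 0" by (simp add: x_def)
  then have "real n * K ^ n * (\<delta> / K) = real n / x * \<epsilon>"
    using K_pos unfolding \<delta>_def x_def[symmetric] by (simp add: field_simps)
  also have "\<dots> \<le> 1 * \<epsilon>" using assms by (intro mult_right_mono) (auto simp: x_def)
  finally have "real n * K ^ n * (\<delta> / K) \<le> \<epsilon>" by simp
  then have "\<forall>\<omega>\<in>X. (Lop ^^ n) (tail F n) \<omega> \<le> \<epsilon>" using tail_pow[OF F(3)] order_trans by blast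
  with F show ?thesis by blast
qed

text \<open>The infimum yields both directions used later without a limit of roots: every
  \<open>x > \<rho>\<close> bounds the growth of \<open>b\<close> up to a constant, and every
  positive \<open>x\<close> with such a bound satisfies \<open>\<rho> \<le> x\<close>.\<close>

definition \<rho> where "\<rho> = Inf {x. 0 < x \<and> (\<exists>C. \<forall>n. b n \<le> C * x ^ n)}"

lemma b_growth: "\<rho> < x \<Longrightarrow> \<exists>C>0. \<forall>n. b n \<le> C * x ^ n"
proof -
  assume x: "\<rho> < x"
  let ?A = "{x. 0 < x \<and> (\<exists>C. \<forall>n. b n \<le> C * x ^ n)}"
  have "K \<in> ?A" using K_pos b_le_K by (auto intro!: exI[of _ 1])
  then have "?A \<noteq> {}" by blast
  then obtain y where y: "y \<in> ?A" "y < x" using x unfolding \<rho>_def by (meson cInf_lessD)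
  then obtain C where C: "\<forall>n. b n \<le> C * y ^ n" by blast
  have "b n \<le> (\<bar>C\<bar> + 1) * x ^ n" for n
  proof -
    have "b n \<le> (\<bar>C\<bar> + 1) * y ^ n" using C y by (smt (verit) mem_Collect_eq mult_right_mono zero_le_power)
    also have "\<dots> \<le> (\<bar>C\<bar> + 1) * x ^ n" using y by (intro mult_left_mono power_mono) auto
    finally show ?thesis .
  qed
  then show ?thesis by (intro exI[of _ "\<bar>C\<bar> + 1"]) auto
qed

lemma \<rho>_le: "0 < x \<Longrightarrow> (\<And>n. b n \<le> C * x ^ n) \<Longrightarrow> \<rho> \<le> x"
  unfolding \<rho>_def by (rule cInf_lower) (auto intro!: bdd_belowI[of _ 0])

text \<open>At a point of period \<open>q\<close> in \<open>XM\<close> the branch that follows the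
  orbit returns to the point, so \<open>b (q * j)\<close> is at least \<open>exp (j * s)\<close>
  with \<open>s\<close> the Birkhoff sum over \<open>q\<close> steps; hence
  \<open>exp (s / q) \<le> \<rho>\<close>.\<close>

lemma \<rho>_pos: "0 < \<rho>"
proof -
  obtain \<omega> q where \<omega>: "\<omega> \<in> XM" "q \<ge> 1" "(shift ^^ q) \<omega> = \<omega>"
    using per unfolding has_periodic_point_def XM_def[symmetric] by blast
  have \<omega>X: "\<omega> \<in> X" using \<omega> XM_sub by blast
  define s where "s = birkhoff_sum \<phi> q \<omega>"
  have it: "(shift ^^ (q * j)) \<omega> = \<omega>" for j
    by (induction j) (simp_all add: funpow_add \<omega>)
  have sum_split: "(\<Sum>i<m + n. f i) = (\<Sum>i<m. f i) + (\<Sum>i<n. f (m + i))" for f :: "nat \<Rightarrow> real" and m n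
    by (induction n) auto
  have bs: "birkhoff_sum \<phi> (q * j) \<omega> = real j * s" for j
  proof (induction j)
    case (Suc j)
    have "birkhoff_sum \<phi> (q * j + q) \<omega> = birkhoff_sum \<phi> (q * j) \<omega> + (\<Sum>i<q. \<phi> ((shift ^^ (q * j + i)) \<omega>))"
      unfolding birkhoff_sum_def by (rule sum_split)
    also have "(\<Sum>i<q. \<phi> ((shift ^^ (q * j + i)) \<omega>)) = s"
      unfolding s_def birkhoff_sum_def using it by (intro sum.cong) (simp_all add: funpow_add add.commute)
    finally show ?case using Suc by (simp add: algebra_simps)
  qed (simp add: birkhoff_sum_def)
  have bj: "exp (real j * s) \<le> b (q * j)" for j
  proof -
    have "exp (birkhoff_sum \<phi> (q * j) \<omega>) * 1 \<le> (Lop ^^ (q * j)) (\<lambda>_. 1) ((shift ^^ (q * j)) \<omega>)"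
      by (rule pow_ge_term[OF _ bd_one \<omega>X]) (use \<omega>(1) in \<open>auto simp: XM_iff\<close>)
    also have "\<dots> \<le> b (q * j)" using Ln_le_b[OF \<omega>X] unfolding it Ln_def .
    finally show ?thesis by (simp add: bs)
  qed
  define c where "c = exp (s / real q)"
  have cq: "c ^ q = exp s" unfolding c_def using \<omega>(2) by (simp flip: exp_of_nat_mult)
  have "c \<le> x" if x: "0 < x" "\<forall>n. b n \<le> C * x ^ n" for x C
  proof (rule ccontr)
    assume "\<not> c \<le> x"
    then have "x ^ q < c ^ q" using x \<omega>(2) by (intro power_strict_mono) auto
    then have "1 < exp s / x ^ q" using x by (simp add: cq)
    then obtain j where j: "C < (exp s / x ^ q) ^ j" using real_arch_pow by blast
    have "exp s ^ j \<le> C * (x ^ q) ^ j"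
      using bj[of j] x(2)[rule_format, of "q * j"] by (simp add: exp_of_nat_mult power_mult)
    then show False using j x by (simp add: power_divide field_simps)
  qed
  moreover have "K \<in> {x. 0 < x \<and> (\<exists>C. \<forall>n. b n \<le> C * x ^ n)}"
    using K_pos b_le_K by (auto intro!: exI[of _ 1])
  ultimately have "c \<le> \<rho>" unfolding \<rho>_def by (intro cInf_greatest) blast+
  moreover have "0 < c" by (simp add: c_def)
  ultimately show ?thesis by linarith
qed

end

section \<open>Resolvents near the growth rate\<close>

context transfer_setup
begin

definition Rx :: "real \<Rightarrow> ((nat \<Rightarrow> 's) \<Rightarrow> 'b) \<Rightarrow> (nat \<Rightarrow> 's) \<Rightarrow> 'b::{real_normed_field,banach,second_countable_topology}" where
  "Rx x f \<omega> = (\<Sum>n. of_real (1 / x ^ Suc n) * (Lop ^^ n) f \<omega>)"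

lemma Rx_bound_summable:
  assumes "\<rho> < x" shows "summable (\<lambda>n. 1 / x ^ Suc n * (b n * B))"
proof -
  obtain y where y: "\<rho> < y" "y < x" using assms dense by blast
  obtain C where C: "\<And>n. b n \<le> C * y ^ n" using b_growth[OF y(1)] by blast
  have y0: "0 < y" "0 < x" using y \<rho>_pos by auto
  have "summable (\<lambda>n. (1 / x * C) * (y / x) ^ n)"
    using y y0 by (intro summable_mult summable_geometric) auto
  then have "summable (\<lambda>n. 1 / x ^ Suc n * b n)"
  proof (rule summable_comparison_test')
    fix n
    have "1 / x ^ Suc n * b n \<le> 1 / x ^ Suc n * (C * y ^ n)" using y0 C by (intro mult_left_mono) auto
    also have "\<dots> = 1 / x * C * (y / x) ^ n" using y0 by (simp add: power_divide)
    finally show "norm (1 / x ^ Suc n * b n) \<le> 1 / x * C * (y / x) ^ n"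
      using b_nonneg y0 by (simp add: abs_mult)
  qed
  from summable_mult2[OF this, of B] show ?thesis by (simp add: mult.assoc)
qed

lemma Rx_term_le:
  assumes "\<rho> < x" "bd B f" "\<omega> \<in> X"
  shows "norm (of_real (1 / x ^ Suc n) * (Lop ^^ n) f \<omega>) \<le> 1 / x ^ Suc n * (b n * B)"
proof -
  have "0 < x" using assms(1) \<rho>_pos by linarith
  then have "norm (of_real (1 / x ^ Suc n) * (Lop ^^ n) f \<omega>) = 1 / x ^ Suc n * norm ((Lop ^^ n) f \<omega>)"
    by (simp add: norm_mult norm_divide norm_power)
  also have "\<dots> \<le> 1 / x ^ Suc n * (b n * B)"
    using bdD[OF bd_pow_b[OF assms(2)] assms(3)] \<open>0 < x\<close> by (intro mult_left_mono) auto
  finally show ?thesis .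
qed

lemma Rx_summable:
  assumes "\<rho> < x" "bd B f" "\<omega> \<in> X"
  shows "summable (\<lambda>n. of_real (1 / x ^ Suc n) * (Lop ^^ n) f \<omega>)"
  by (rule summable_comparison_test'[OF Rx_bound_summable[OF assms(1), of B], of 0])
    (use Rx_term_le[OF assms] in auto)

lemma Rx_sums:
  assumes "\<rho> < x" "bd B f" "\<omega> \<in> X"
  shows "(\<lambda>n. of_real (1 / x ^ Suc n) * (Lop ^^ n) f \<omega>) sums Rx x f \<omega>"
  unfolding Rx_def by (rule summable_sums[OF Rx_summable[OF assms]])

lemma bd_Rx: "\<rho> < x \<Longrightarrow> bd B f \<Longrightarrow> bd (\<Sum>n. 1 / x ^ Suc n * (b n * B)) (Rx x f)"
  unfolding bd_def
proof
  fix \<omega> assume x: "\<rho> < x" and f: "\<forall>\<omega>\<in>X. norm (f \<omega>) \<le> B" and \<omega>: "\<omega> \<in> X"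
  then have f: "bd B f" by (simp add: bd_def)
  have s: "summable (\<lambda>n. norm (of_real (1 / x ^ Suc n) * (Lop ^^ n) f \<omega>))"
    by (rule summable_comparison_test'[OF Rx_bound_summable[OF x, of B], of 0])
      (use Rx_term_le[OF x f \<omega>] in auto)
  have "norm (Rx x f \<omega>) \<le> (\<Sum>n. norm (of_real (1 / x ^ Suc n) * (Lop ^^ n) f \<omega>))"
    unfolding Rx_def by (rule summable_norm[OF s])
  also have "\<dots> \<le> (\<Sum>n. 1 / x ^ Suc n * (b n * B))"
    by (intro suminf_le Rx_term_le x f \<omega> s Rx_bound_summable)
  finally show "norm (Rx x f \<omega>) \<le> (\<Sum>n. 1 / x ^ Suc n * (b n * B))" .
qed

lemma Rx_add:
  assumes "\<rho> < x" "bd B f" "bd C g" "\<omega> \<in> X"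
  shows "Rx x (\<lambda>\<omega>. f \<omega> + g \<omega>) \<omega> = Rx x f \<omega> + Rx x g \<omega>"
proof -
  have "(\<lambda>n. of_real (1 / x ^ Suc n) * (Lop ^^ n) (\<lambda>\<omega>. f \<omega> + g \<omega>) \<omega>) sums (Rx x f \<omega> + Rx x g \<omega>)"
    unfolding pow_add[OF assms(2,3)] distrib_left
    by (intro sums_add Rx_sums[OF assms(1,2,4)] Rx_sums[OF assms(1,3,4)])
  then show ?thesis unfolding Rx_def by (rule sums_unique[symmetric])
qed

lemma Rx_cmult:
  assumes "\<rho> < x" "bd B f" "\<omega> \<in> X"
  shows "Rx x (\<lambda>\<omega>. c * f \<omega>) \<omega> = c * Rx x f \<omega>"
proof -
  have "(\<lambda>n. c * (of_real (1 / x ^ Suc n) * (Lop ^^ n) f \<omega>)) sums (c * Rx x f \<omega>)"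
    by (intro sums_mult Rx_sums[OF assms])
  then have "(\<lambda>n. of_real (1 / x ^ Suc n) * (Lop ^^ n) (\<lambda>\<omega>. c * f \<omega>) \<omega>) sums (c * Rx x f \<omega>)"
    by (simp add: pow_cmult mult.left_commute)
  then show ?thesis unfolding Rx_def by (rule sums_unique[symmetric])
qed

lemma Rx_norm_le:
  assumes "\<rho> < x" "bd B g" "\<omega> \<in> X" "\<And>\<omega>. \<omega> \<in> X \<Longrightarrow> norm (f \<omega>) \<le> g \<omega>"
  shows "norm (Rx x f \<omega>) \<le> Rx x g \<omega>"
proof -
  have x: "0 < x" using assms(1) \<rho>_pos by linarith
  have t: "norm (of_real (1 / x ^ Suc n) * (Lop ^^ n) f \<omega>) \<le> 1 / x ^ Suc n * (Lop ^^ n) g \<omega>" for n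
    using pow_norm_le[OF assms(4,2,3)] x
    by (simp add: norm_mult norm_divide norm_power divide_right_mono)
  have sg: "summable (\<lambda>n. 1 / x ^ Suc n * (Lop ^^ n) g \<omega>)" using Rx_summable[OF assms(1-3)] by simp
  have s: "summable (\<lambda>n. norm (of_real (1 / x ^ Suc n) * (Lop ^^ n) f \<omega>))"
    by (rule summable_comparison_test'[OF sg, of 0]) (use t in auto)
  have "norm (Rx x f \<omega>) \<le> (\<Sum>n. norm (of_real (1 / x ^ Suc n) * (Lop ^^ n) f \<omega>))"
    unfolding Rx_def by (rule summable_norm[OF s])
  also have "\<dots> \<le> (\<Sum>n. 1 / x ^ Suc n * (Lop ^^ n) g \<omega>)" by (intro suminf_le t s sg)
  finally show ?thesis by (simp add: Rx_def)
qed

lemma Rx_Lop: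
  assumes "\<rho> < x" "bd B f" "\<omega> \<in> X"
  shows "Rx x (Lop f) \<omega> = of_real x * Rx x f \<omega> - f \<omega>"
proof -
  have x: "0 < x" using assms(1) \<rho>_pos by linarith
  let ?t = "\<lambda>n. of_real (1 / x ^ Suc n) * (Lop ^^ n) f \<omega>"
  have "(\<lambda>n. ?t (Suc n)) sums (Rx x f \<omega> - ?t 0)"
    using Rx_sums[OF assms] by (subst sums_Suc_iff) simp
  then have "(\<lambda>n. of_real x * ?t (Suc n)) sums (of_real x * (Rx x f \<omega> - ?t 0))"
    by (rule sums_mult)
  moreover have "of_real x * ?t (Suc n) = of_real (1 / x ^ Suc n) * (Lop ^^ n) (Lop f) \<omega>" for n
    using x by (simp add: funpow_swap1 field_simps)
  ultimately have "Rx x (Lop f) \<omega> = of_real x * (Rx x f \<omega> - ?t 0)"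
    unfolding Rx_def by (simp only: sums_iff)
  also have "\<dots> = of_real x * Rx x f \<omega> - f \<omega>" using x by (simp add: field_simps)
  finally show ?thesis .
qed

abbreviation one :: "(nat \<Rightarrow> 's) \<Rightarrow> real" where "one \<equiv> (\<lambda>_. 1)"

text \<open>Moving the operator inside the series exchanges two infinite sums, which dominated
  convergence justifies through the partial sums; in \<open>Rx_Lop\<close>, by contrast, the
  operator already sits inside and only the index shifts.\<close>

lemma Lop_Rx:
  fixes f :: "(nat \<Rightarrow> 's) \<Rightarrow> 'b::{real_normed_field,banach,second_countable_topology}"
  assumes "\<rho> < x" "bd B f" "\<omega> \<in> X"
  shows "Lop (Rx x f) \<omega> = of_real x * Rx x f \<omega> - f \<omega>"
proof -
  have x: "0 < x" using assms(1) \<rho>_pos by linarith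
  let ?t = "\<lambda>n \<omega>. of_real (1 / x ^ Suc n) * (Lop ^^ n) f \<omega>"
  let ?S = "\<lambda>m \<omega>. \<Sum>n<m. ?t n \<omega>"
  define Q where "Q = (\<Sum>n. 1 / x ^ Suc n * (b n * B))"
  have "bd Q (?S m)" for m
    unfolding bd_def
  proof
    fix \<omega> assume \<omega>: "\<omega> \<in> X"
    have "norm (?S m \<omega>) \<le> (\<Sum>n<m. 1 / x ^ Suc n * (b n * B))"
      by (rule sum_norm_le) (rule Rx_term_le[OF assms(1,2) \<omega>])
    also have "\<dots> \<le> Q" unfolding Q_def
      using bd_nonneg[OF assms(2)] x b_nonneg
      by (intro sum_le_suminf Rx_bound_summable assms) auto
    finally show "norm (?S m \<omega>) \<le> Q" .
  qed
  then have "(\<lambda>m. Lop (?S m) \<omega>) \<longlonglongrightarrow> Lop (Rx x f) \<omega>"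
    by (rule Lop_dominated) (use Rx_sums[OF assms(1,2)] in \<open>simp add: sums_def\<close>)
  moreover have "Lop (?S m) \<omega> = of_real x * (?S (Suc m) \<omega> - ?t 0 \<omega>)" for m
  proof -
    have "Lop (?S m) \<omega> = (\<Sum>n<m. Lop (?t n) \<omega>)"
    proof (induction m)
      case 0
      have "Lop (\<lambda>\<omega>. 0 * f \<omega>) \<omega> = 0 * Lop f \<omega>" by (rule Lop_cmult)
      then show ?case by simp
    next
      case (Suc m)
      have "bd (norm (of_real (1 / x ^ Suc m) :: 'b) * (K ^ m * B)) (?t m)"
        by (rule bd_cmult[OF bd_pow[OF assms(2)]])
      from Lop_add[OF \<open>\<And>m. bd Q (?S m)\<close> this] show ?case using Suc by simp
    qed
    also have "\<dots> = (\<Sum>n<m. of_real x * ?t (Suc n) \<omega>)"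
      unfolding Lop_cmult using x by (intro sum.cong refl) (simp add: field_simps)
    also have "\<dots> = of_real x * (?S (Suc m) \<omega> - ?t 0 \<omega>)"
      unfolding sum.lessThan_Suc_shift sum_distrib_left[symmetric] by simp
    finally show ?thesis .
  qed
  moreover have "(\<lambda>m. of_real x * (?S (Suc m) \<omega> - ?t 0 \<omega>)) \<longlonglongrightarrow> of_real x * (Rx x f \<omega> - ?t 0 \<omega>)"
    using Rx_sums[OF assms] unfolding sums_def
    by (intro tendsto_mult tendsto_const tendsto_diff) (rule LIMSEQ_Suc)
  ultimately have "Lop (Rx x f) \<omega> = of_real x * (Rx x f \<omega> - ?t 0 \<omega>)"
    using LIMSEQ_unique by simp
  also have "\<dots> = of_real x * Rx x f \<omega> - f \<omega>" using x by (simp add: field_simps)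
  finally show ?thesis .
qed

lemma Rx_one_ge:
  assumes "\<rho> < x" "\<omega> \<in> X" shows "1 / x \<le> Rx x one \<omega>"
proof -
  have x: "0 < x" using assms(1) \<rho>_pos by linarith
  have "summable (\<lambda>n. of_real (1 / x ^ Suc n) * (Lop ^^ n) one \<omega>)"
    by (rule Rx_summable[OF assms(1) bd_one assms(2)])
  then have s: "summable (\<lambda>n. 1 / x ^ Suc n * Ln n \<omega>)" by (simp add: Ln_def)
  have "(\<Sum>n<1. 1 / x ^ Suc n * Ln n \<omega>) \<le> (\<Sum>n. 1 / x ^ Suc n * Ln n \<omega>)"
    by (intro sum_le_suminf s) (use x Ln_nonneg[OF assms(2)] in auto)
  then show ?thesis by (simp add: Rx_def Ln_def)
qed

text \<open>If \<open>u = (x - L)\<^sup>-\<^sup>1 1\<close> were bounded by \<open>C\<close> for all \<open>x\<close> near \<open>\<rho>\<close>, then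
  \<open>L u = x u - 1 \<le> (x - 1/C) u\<close> would make the iterates of \<open>1\<close> grow at a rate below \<open>\<rho>\<close>.\<close>

lemma blow_up:
  assumes C: "C > 0"
  shows "\<exists>x. \<rho> < x \<and> x < \<rho> + 1 / C \<and> (\<exists>\<omega>\<in>X. C < Rx x one \<omega>)"
proof (rule ccontr)
  assume neg: "\<not> ?thesis"
  \<comment> \<open>The midpoint makes \<open>x - 1 / C = \<rho> - 1 / (2 * C)\<close>, a rate below
    \<open>\<rho>\<close>.\<close>
  define x where "x = \<rho> + 1 / (2 * C)"
  have x12: "\<rho> < x" "x < \<rho> + 1 / C" using C by (auto simp: x_def field_simps)
  then have x: "\<rho> < x" "x < \<rho> + 1 / C" "0 < x" using \<rho>_pos by auto
  have u: "Rx x one \<omega> \<le> C" if "\<omega> \<in> X" for \<omega> using neg x that by force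
  \<comment> \<open>The maximum with \<open>\<rho> / 2\<close> keeps the rate positive, as
    \<open>\<rho>_le\<close> demands, and still below \<open>\<rho>\<close>.\<close>
  define y where "y = max (x - 1 / C) (\<rho> / 2)"
  have y: "0 < y" "y < \<rho>" using C \<rho>_pos by (auto simp: y_def x_def field_simps)
  have bu: "bd (\<Sum>n. 1 / x ^ Suc n * (b n * 1)) (Rx x one)" by (rule bd_Rx[OF x(1) bd_one])
  have Pu: "Lop (Rx x one) \<omega> \<le> y * Rx x one \<omega>" if \<omega>: "\<omega> \<in> X" for \<omega>
  proof -
    have u0: "0 \<le> Rx x one \<omega>" using Rx_one_ge[OF x(1) \<omega>] x by (smt (verit) divide_pos_pos)
    have "Lop (Rx x one) \<omega> = x * Rx x one \<omega> - 1"
      using Lop_Rx[OF x(1) bd_one[where ?'b = real] \<omega>] by simp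
    also have "\<dots> \<le> x * Rx x one \<omega> - Rx x one \<omega> / C" using u[OF \<omega>] C by simp
    also have "\<dots> = (x - 1 / C) * Rx x one \<omega>" by (simp add: algebra_simps)
    also have "\<dots> \<le> y * Rx x one \<omega>" using u0 by (intro mult_right_mono) (auto simp: y_def)
    finally show ?thesis .
  qed
  have Pn: "(Lop ^^ n) (Rx x one) \<omega> \<le> y ^ n * Rx x one \<omega>" if \<omega>: "\<omega> \<in> X" for n \<omega>
    using \<omega>
  proof (induction n arbitrary: \<omega>)
    case (Suc n)
    have "(Lop ^^ Suc n) (Rx x one) \<omega> \<le> Lop (\<lambda>\<omega>. y ^ n * Rx x one \<omega>) \<omega>"
      unfolding funpow.simps o_def by (rule Lop_mono[OF Suc.IH bd_pow[OF bu] bd_cmult[OF bu]])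
    also have "\<dots> \<le> y ^ n * (y * Rx x one \<omega>)" unfolding Lop_cmult
      using Pu[OF Suc.prems] y by (intro mult_left_mono) auto
    finally show ?case by (simp add: mult.assoc mult.left_commute)
  qed simp
  have "b n \<le> x * C * y ^ n" for n
  proof (rule b_le)
    fix \<omega> assume \<omega>: "\<omega> \<in> X"
    have "Ln n \<omega> \<le> (Lop ^^ n) (\<lambda>\<omega>. x * Rx x one \<omega>) \<omega>"
      unfolding Ln_def
      by (rule pow_mono[OF _ bd_one bd_cmult[OF bu] \<omega>]) (use Rx_one_ge[OF x(1)] x in \<open>simp add: field_simps\<close>)
    also have "\<dots> \<le> x * (y ^ n * C)"
    proof -
      have "y ^ n * Rx x one \<omega> \<le> y ^ n * C" using u[OF \<omega>] y by (intro mult_left_mono) auto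
      then have "(Lop ^^ n) (Rx x one) \<omega> \<le> y ^ n * C" using Pn[OF \<omega>, of n] by linarith
      then show ?thesis unfolding pow_cmult using x by (intro mult_left_mono) auto
    qed
    finally show "Ln n \<omega> \<le> x * C * y ^ n" by (simp add: algebra_simps)
  qed
  then have "\<rho> \<le> y" by (rule \<rho>_le[OF y(1)])
  then show False using y by simp
qed

text \<open>A positive functional with value one at the constant one. Its failure to be an
  eigenfunctional is \<open>f \<upsilon> / Rx x one \<upsilon>\<close> (\<open>ell_Lop\<close>),
  which tends to zero when the denominator blows up.\<close>

definition ell :: "real \<Rightarrow> (nat \<Rightarrow> 's) \<Rightarrow> ((nat \<Rightarrow> 's) \<Rightarrow> 'b) \<Rightarrow> 'b::{real_normed_field,banach,second_countable_topology}" where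
  "ell x \<upsilon> f = Rx x f \<upsilon> / of_real (Rx x one \<upsilon>)"

lemma Rx_one_pos: "\<rho> < x \<Longrightarrow> \<omega> \<in> X \<Longrightarrow> 0 < Rx x one \<omega>"
  using Rx_one_ge[of x \<omega>] \<rho>_pos by (smt (verit) divide_pos_pos)

lemma ell_add:
  assumes "\<rho> < x" "bd B f" "bd C g" "\<upsilon> \<in> X"
  shows "ell x \<upsilon> (\<lambda>\<omega>. f \<omega> + g \<omega>) = ell x \<upsilon> f + ell x \<upsilon> g"
  unfolding ell_def Rx_add[OF assms] by (rule add_divide_distrib)

lemma ell_cmult:
  assumes "\<rho> < x" "bd B f" "\<upsilon> \<in> X"
  shows "ell x \<upsilon> (\<lambda>\<omega>. c * f \<omega>) = c * ell x \<upsilon> f"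
  unfolding ell_def Rx_cmult[OF assms] by simp

lemma ell_diff:
  assumes "\<rho> < x" "bd B f" "bd C g" "\<upsilon> \<in> X"
  shows "ell x \<upsilon> (\<lambda>\<omega>. f \<omega> - g \<omega>) = ell x \<upsilon> f - ell x \<upsilon> g"
  using ell_add[OF assms(1,2) bd_cmult[OF assms(3), of "-1"] assms(4)] ell_cmult[OF assms(1,3,4), of "-1"] by simp

lemma ell_norm_le:
  assumes "\<rho> < x" "bd B g" "\<upsilon> \<in> X" "\<And>\<omega>. \<omega> \<in> X \<Longrightarrow> norm (f \<omega>) \<le> g \<omega>"
  shows "norm (ell x \<upsilon> f) \<le> ell x \<upsilon> g"
  using Rx_norm_le[OF assms] Rx_one_pos[OF assms(1,3)]
  by (simp add: ell_def norm_divide divide_right_mono)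

lemma ell_one: "\<rho> < x \<Longrightarrow> \<upsilon> \<in> X \<Longrightarrow> ell x \<upsilon> one = 1"
  using Rx_one_pos[of x \<upsilon>] by (simp add: ell_def)

lemma ell_nonneg:
  assumes "\<rho> < x" "bd B g" "\<upsilon> \<in> X" "\<And>\<omega>. \<omega> \<in> X \<Longrightarrow> 0 \<le> (g \<omega> :: real)"
  shows "0 \<le> ell x \<upsilon> g"
  using ell_norm_le[OF assms(1-3), of g] assms(4) norm_ge_zero order_trans by (metis abs_of_nonneg order_refl real_norm_def)

lemma ell_mono:
  assumes "\<rho> < x" "bd B f" "bd C g" "\<upsilon> \<in> X" "\<And>\<omega>. \<omega> \<in> X \<Longrightarrow> f \<omega> \<le> (g \<omega> :: real)"
  shows "ell x \<upsilon> f \<le> ell x \<upsilon> g"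
proof -
  have "bd (C + B) (\<lambda>\<omega>. g \<omega> - f \<omega>)" using bd_add[OF assms(3) bd_cmult[OF assms(2), of "-1"]] by simp
  then have "0 \<le> ell x \<upsilon> (\<lambda>\<omega>. g \<omega> - f \<omega>)" using assms(5) by (intro ell_nonneg assms) auto
  then show ?thesis unfolding ell_diff[OF assms(1,3,2,4)] by simp
qed

lemma ell_bound:
  assumes "\<rho> < x" "bd B f" "\<upsilon> \<in> X" shows "norm (ell x \<upsilon> f) \<le> B"
proof -
  have "bd B (\<lambda>_. B * 1)" using bd_nonneg[OF assms(2)] by (simp add: bd_def)
  then have "norm (ell x \<upsilon> f) \<le> ell x \<upsilon> (\<lambda>_. B * 1)"
    by (rule ell_norm_le[OF assms(1) _ assms(3)]) (use bdD[OF assms(2)] in simp)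
  also have "\<dots> = B" unfolding ell_cmult[OF assms(1) bd_one assms(3)] using ell_one[OF assms(1,3)] by simp
  finally show ?thesis .
qed

lemma ell_Lop:
  assumes "\<rho> < x" "bd B f" "\<upsilon> \<in> X"
  shows "ell x \<upsilon> (Lop f) = of_real x * ell x \<upsilon> f - f \<upsilon> / of_real (Rx x one \<upsilon>)"
  unfolding ell_def Rx_Lop[OF assms] by (simp add: diff_divide_distrib)

text \<open>Iterates \<open>ell_Lop\<close>, with the error of each step bounded through
  \<open>K\<close>. The accumulated error is divided by \<open>Rx x one \<upsilon>\<close> and so
  disappears in the limit.\<close>

lemma ell_pow_le:
  assumes x: "\<rho> < x" and h: "bd 1 h" "\<And>\<omega>. \<omega> \<in> X \<Longrightarrow> 0 \<le> (h \<omega> :: real)" and \<upsilon>: "\<upsilon> \<in> X"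
  shows "x ^ n * ell x \<upsilon> h \<le> ell x \<upsilon> ((Lop ^^ n) h) + (\<Sum>j<n. x ^ (n - 1 - j) * K ^ j) / Rx x one \<upsilon>"
proof (induction n)
  case (Suc n)
  have x0: "0 < x" using x \<rho>_pos by linarith
  let ?D = "Rx x one \<upsilon>"
  have D: "0 < ?D" by (rule Rx_one_pos[OF x \<upsilon>])
  have "x ^ Suc n * ell x \<upsilon> h \<le> x * (ell x \<upsilon> ((Lop ^^ n) h) + (\<Sum>j<n. x ^ (n - 1 - j) * K ^ j) / ?D)"
    using Suc x0 by (simp add: mult.assoc)
  also have "\<dots> = (x * ell x \<upsilon> ((Lop ^^ n) h) - (Lop ^^ n) h \<upsilon> / ?D) + ((Lop ^^ n) h \<upsilon> + x * (\<Sum>j<n. x ^ (n - 1 - j) * K ^ j)) / ?D"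
    by (simp add: algebra_simps add_divide_distrib)
  also have "x * ell x \<upsilon> ((Lop ^^ n) h) - (Lop ^^ n) h \<upsilon> / ?D = ell x \<upsilon> ((Lop ^^ Suc n) h)"
    using ell_Lop[OF x bd_pow[OF h(1)] \<upsilon>, of n] by simp
  also have "(Lop ^^ n) h \<upsilon> + x * (\<Sum>j<n. x ^ (n - 1 - j) * K ^ j) \<le> (\<Sum>j<Suc n. x ^ (Suc n - 1 - j) * K ^ j)"
  proof -
    have "x * (\<Sum>j<n. x ^ (n - 1 - j) * K ^ j) = (\<Sum>j<n. x ^ (Suc n - 1 - j) * K ^ j)"
      unfolding sum_distrib_left
    proof (intro sum.cong refl)
      fix j assume "j \<in> {..<n}"
      then have "Suc n - 1 - j = Suc (n - 1 - j)" by auto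
      then show "x * (x ^ (n - 1 - j) * K ^ j) = x ^ (Suc n - 1 - j) * K ^ j" by simp
    qed
    moreover have "(Lop ^^ n) h \<upsilon> \<le> K ^ n" using bdD[OF bd_pow[OF h(1)] \<upsilon>, of n] by simp
    ultimately show ?thesis by simp
  qed
  then have "((Lop ^^ n) h \<upsilon> + x * (\<Sum>j<n. x ^ (n - 1 - j) * K ^ j)) / ?D \<le> (\<Sum>j<Suc n. x ^ (Suc n - 1 - j) * K ^ j) / ?D"
    using D by (intro divide_right_mono) auto
  finally show ?case by simp
qed simp

end

section \<open>The eigenfunction and the limit functional\<close>

lemma map_upt_nth: "map \<omega> [0..<n] \<in> lists S \<longleftrightarrow> (\<forall>i<n. \<omega> i \<in> S)"
  by (auto simp: in_lists_conv_set)

lemma cylinder_map: "\<upsilon> \<in> cylinder X (map \<omega> [0..<n]) \<longleftrightarrow> \<upsilon> \<in> X \<and> agree n \<upsilon> \<omega>"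
  by (auto simp: cylinder_def agree_def)

lemma cylinder_agree: "\<omega> \<in> cylinder X w \<Longrightarrow> \<upsilon> \<in> cylinder X w \<Longrightarrow> agree (length w) \<omega> \<upsilon>"
  by (auto simp: cylinder_def agree_def)

lemma cylinder_prefix: "\<omega> \<in> cylinder X w \<Longrightarrow> w = map \<omega> [0..<length w]"
  by (auto simp: cylinder_def intro!: nth_equalityI)

context transfer_setup
begin

definition rep :: "'s list \<Rightarrow> nat \<Rightarrow> 's" where "rep w = (SOME \<omega>. \<omega> \<in> cylinder X w)"

lemma rep: "\<omega> \<in> cylinder X w \<Longrightarrow> rep w \<in> cylinder X w"
  unfolding rep_def by (rule someI[where P = "\<lambda>\<omega>. \<omega> \<in> cylinder X w"])

lemma rep_map: "\<omega> \<in> X \<Longrightarrow> rep (map \<omega> [0..<n]) \<in> X \<and> agree n \<omega> (rep (map \<omega> [0..<n]))"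
  using rep[of \<omega> "map \<omega> [0..<n]"] by (auto simp: cylinder_map intro: agree_sym)

lemma X_lists: "\<omega> \<in> X \<Longrightarrow> map \<omega> [0..<n] \<in> lists S"
  by (simp add: map_upt_nth X_iff)

definition sx :: "real \<Rightarrow> real" where "sx x = (SUP \<omega>\<in>X. Rx x one \<omega>)"
definition Gam :: "real \<Rightarrow> (nat \<Rightarrow> 's) \<Rightarrow> real" where "Gam x \<omega> = Rx x one \<omega> / sx x"

lemma Rx_le_sx: "\<rho> < x \<Longrightarrow> \<omega> \<in> X \<Longrightarrow> Rx x one \<omega> \<le> sx x"
proof -
  assume x: "\<rho> < x" and \<omega>: "\<omega> \<in> X"
  have bx: "bd (\<Sum>n. 1 / x ^ Suc n * (b n * 1)) (Rx x one)" by (rule bd_Rx[OF x bd_one])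
  have "Rx x one \<upsilon> \<le> (\<Sum>n. 1 / x ^ Suc n * (b n * 1))" if "\<upsilon> \<in> X" for \<upsilon>
    using bdD[OF bx that] by simp
  then have "bdd_above (Rx x one ` X)" by (rule bdd_aboveI2)
  then show ?thesis unfolding sx_def using \<omega> by (intro cSUP_upper)
qed

lemma sx_pos: "\<rho> < x \<Longrightarrow> 0 < sx x"
proof -
  assume x: "\<rho> < x"
  obtain \<omega> where "\<omega> \<in> X" using X_ne by blast
  then show ?thesis using Rx_le_sx[OF x] Rx_one_pos[OF x] by (meson less_le_trans)
qed

lemma Gam_range: "\<rho> < x \<Longrightarrow> \<omega> \<in> X \<Longrightarrow> 0 \<le> Gam x \<omega> \<and> Gam x \<omega> \<le> 1"
  using Rx_le_sx[of x \<omega>] Rx_one_pos[of x \<omega>] sx_pos[of x] by (simp add: Gam_def)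

lemma bd_Gam: "\<rho> < x \<Longrightarrow> bd 1 (Gam x)"
  using Gam_range by (auto simp: bd_def)

text \<open>\<open>cone_pow\<close> with \<open>t = 0\<close> applies to every term of the series,
  since the constant one lies in the cone. The factor does not depend on \<open>x\<close>, which is
  what makes the normalised resolvents equicontinuous.\<close>

lemma Rx_cone:
  assumes x: "\<rho> < x" and "k \<le> m" "\<omega> \<in> X" "\<upsilon> \<in> X" "agree m \<omega> \<upsilon>"
  shows "Rx x one \<omega> \<le> exp (c1 * \<theta> ^ m) * Rx x one \<upsilon>"
proof -
  have x0: "0 < x" using x \<rho>_pos by linarith
  have s: "summable (\<lambda>n. of_real (1 / x ^ Suc n) * (Lop ^^ n) one \<omega>)" if "\<omega> \<in> X" for \<omega>
    by (rule Rx_summable[OF x bd_one that])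
  have "Rx x one \<omega> \<le> (\<Sum>n. exp (c1 * \<theta> ^ m) * (of_real (1 / x ^ Suc n) * (Lop ^^ n) one \<upsilon>))"
    unfolding Rx_def
  proof (intro suminf_le s summable_mult assms)
    fix n
    have "(Lop ^^ n) one \<omega> \<le> exp (c1 * \<theta> ^ m) * (Lop ^^ n) one \<upsilon>"
      by (rule cone_pow[where t = 0 and B = 1]) (use assms c1_nonneg in auto)
    from mult_left_mono[OF this, of "of_real (1 / x ^ Suc n)"]
    show "of_real (1 / x ^ Suc n) * (Lop ^^ n) one \<omega> \<le> exp (c1 * \<theta> ^ m) * (of_real (1 / x ^ Suc n) * (Lop ^^ n) one \<upsilon>)"
      using x0 by (simp add: mult.left_commute)
  qed
  also have "\<dots> = exp (c1 * \<theta> ^ m) * Rx x one \<upsilon>"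
    unfolding Rx_def by (rule suminf_mult[OF s[OF assms(4)]])
  finally show ?thesis .
qed

lemma Gam_cone:
  assumes x: "\<rho> < x" and "k \<le> m" "\<omega> \<in> X" "\<upsilon> \<in> X" "agree m \<omega> \<upsilon>"
  shows "Gam x \<omega> \<le> exp (c1 * \<theta> ^ m) * Gam x \<upsilon>"
  using Rx_cone[OF assms] sx_pos[OF x] by (simp add: Gam_def divide_right_mono)

lemma Gam_diff:
  assumes x: "\<rho> < x" and "k \<le> m" "\<omega> \<in> X" "\<upsilon> \<in> X" "agree m \<omega> \<upsilon>"
  shows "\<bar>Gam x \<omega> - Gam x \<upsilon>\<bar> \<le> exp (c1 * \<theta> ^ m) - 1"
proof -
  have *: "Gam x \<omega> - Gam x \<upsilon> \<le> exp (c1 * \<theta> ^ m) - 1" if "\<omega> \<in> X" "\<upsilon> \<in> X" "agree m \<omega> \<upsilon>" for \<omega> \<upsilon>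
  proof -
    have "Gam x \<omega> - Gam x \<upsilon> \<le> (exp (c1 * \<theta> ^ m) - 1) * Gam x \<upsilon>"
      using Gam_cone[OF x assms(2) that] by (simp add: algebra_simps)
    also have "\<dots> \<le> (exp (c1 * \<theta> ^ m) - 1) * 1"
      using Gam_range[OF x that(2)] c1_nonneg by (intro mult_left_mono) auto
    finally show ?thesis by simp
  qed
  show ?thesis using *[OF assms(3-5)] *[OF assms(4,3) agree_sym[OF assms(5)]] by linarith
qed

lemma Lop_Gam: "\<rho> < x \<Longrightarrow> \<omega> \<in> X \<Longrightarrow> Lop (Gam x) \<omega> = x * Gam x \<omega> - 1 / sx x"
proof -
  assume x: "\<rho> < x" and \<omega>: "\<omega> \<in> X"
  have "Lop (\<lambda>\<omega>. 1 / sx x * Rx x one \<omega>) \<omega> = 1 / sx x * (of_real x * Rx x one \<omega> - 1)"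
    unfolding Lop_cmult Lop_Rx[OF x bd_one \<omega>] ..
  then show ?thesis using sx_pos[OF x] by (simp add: Gam_def[abs_def] field_simps)
qed

text \<open>Each use of \<open>Lop_Gam\<close> costs \<open>1 / sx x\<close>; the errors of
  \<open>n\<close> steps add up to a term that vanishes as \<open>sx x\<close> blows up.\<close>

lemma Gam_pow_le:
  assumes x: "\<rho> < x" and \<omega>: "\<omega> \<in> X"
  shows "x ^ n * Gam x \<omega> \<le> (Lop ^^ n) (Gam x) \<omega> + (\<Sum>j<n. x ^ (n - 1 - j) * K ^ j) / sx x"
proof (induction n)
  case (Suc n)
  have x0: "0 < x" using x \<rho>_pos by linarith
  note s = sx_pos[OF x]
  have eq: "(Lop ^^ n) (\<lambda>\<omega>. x * Gam x \<omega>) \<omega> = (Lop ^^ n) (\<lambda>\<omega>. Lop (Gam x) \<omega> + 1 / sx x * 1) \<omega>"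
    by (rule pow_cong[OF _ \<omega>]) (simp add: Lop_Gam[OF x])
  have b2: "bd (1 / sx x) (\<lambda>\<omega>. 1 / sx x * 1)" using s by (simp add: bd_def)
  have eq': "x * (Lop ^^ n) (Gam x) \<omega> = (Lop ^^ Suc n) (Gam x) \<omega> + 1 / sx x * Ln n \<omega>"
    using eq unfolding pow_add[OF bd_Lop[OF bd_Gam[OF x]] b2] unfolding pow_cmult
    by (simp add: Ln_def funpow_swap1)
  have "x ^ Suc n * Gam x \<omega> \<le> x * ((Lop ^^ n) (Gam x) \<omega> + (\<Sum>j<n. x ^ (n - 1 - j) * K ^ j) / sx x)"
    using Suc x0 by (simp add: mult.assoc)
  also have "\<dots> = (Lop ^^ Suc n) (Gam x) \<omega> + (Ln n \<omega> + x * (\<Sum>j<n. x ^ (n - 1 - j) * K ^ j)) / sx x"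
    unfolding distrib_left eq' by (simp add: add_divide_distrib)
  also have "Ln n \<omega> + x * (\<Sum>j<n. x ^ (n - 1 - j) * K ^ j) \<le> (\<Sum>j<Suc n. x ^ (Suc n - 1 - j) * K ^ j)"
  proof -
    have "x * (\<Sum>j<n. x ^ (n - 1 - j) * K ^ j) = (\<Sum>j<n. x ^ (Suc n - 1 - j) * K ^ j)"
      unfolding sum_distrib_left
    proof (intro sum.cong refl)
      fix j assume "j \<in> {..<n}"
      then have "Suc n - 1 - j = Suc (n - 1 - j)" by auto
      then show "x * (x ^ (n - 1 - j) * K ^ j) = x ^ (Suc n - 1 - j) * K ^ j" by simp
    qed
    moreover have "Ln n \<omega> \<le> K ^ n" using bdD[OF bd_Ln \<omega>, of n] by simp
    ultimately show ?thesis by simp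
  qed
  then have "(Ln n \<omega> + x * (\<Sum>j<n. x ^ (n - 1 - j) * K ^ j)) / sx x \<le> (\<Sum>j<Suc n. x ^ (Suc n - 1 - j) * K ^ j) / sx x"
    using s by (intro divide_right_mono) auto
  finally show ?case by simp
qed simp

abbreviation ind :: "'s list \<Rightarrow> (nat \<Rightarrow> 's) \<Rightarrow> real" where "ind w \<equiv> indicator (cylinder X w)"

lemma bd_ind: "bd 1 (ind w)" by (simp add: bd_def indicator_def)

text \<open>Since \<open>S\<close> is countable there are countably many words, and one diagonal
  subsequence makes the functionals converge on all cylinders and the normalised resolvents at one
  point \<open>rep w\<close> per nonempty cylinder. Equicontinuity and Lipschitz approximation
  extend both limits later. One choice of base points serves both purposes, because the supremum
  \<open>sx\<close> dominates the values that blow up.\<close>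

lemma limit_data:
  "\<exists>xs us. (\<forall>i. \<rho> < xs i) \<and> xs \<longlonglongrightarrow> \<rho> \<and> (\<forall>i. us i \<in> X) \<and>
     (\<lambda>i. 1 / Rx (xs i) one (us i)) \<longlonglongrightarrow> 0 \<and>
     (\<forall>w\<in>lists S. convergent (\<lambda>i. ell (xs i) (us i) (ind w))) \<and>
     (\<forall>w\<in>lists S. cylinder X w \<noteq> {} \<longrightarrow> convergent (\<lambda>i. Gam (xs i) (rep w)))"
proof -
  have "\<exists>x \<omega>. \<rho> < x \<and> x < \<rho> + 1 / real (Suc i) \<and> \<omega> \<in> X \<and> real (Suc i) < Rx x one \<omega>" for i
    using blow_up[of "real (Suc i)"] by auto
  then obtain x u where xu: "\<And>i. \<rho> < x i" "\<And>i. x i < \<rho> + 1 / real (Suc i)" "\<And>i. u i \<in> X"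
    "\<And>i. real (Suc i) < Rx (x i) one (u i)" by metis
  have lim0: "(\<lambda>i. 1 / real (Suc i)) \<longlonglongrightarrow> 0"
    using LIMSEQ_inverse_real_of_nat by (simp add: inverse_eq_divide)
  have xl: "x \<longlonglongrightarrow> \<rho>"
  proof (rule tendsto_sandwich[of "\<lambda>_. \<rho>" x _ "\<lambda>i. \<rho> + 1 / real (Suc i)"])
    show "(\<lambda>i. \<rho> + 1 / real (Suc i)) \<longlonglongrightarrow> \<rho>" using tendsto_add[OF tendsto_const[of \<rho>] lim0] by simp
    show "\<forall>\<^sub>F i in sequentially. \<rho> \<le> x i"
      by (intro always_eventually allI less_imp_le xu)
    show "\<forall>\<^sub>F i in sequentially. x i \<le> \<rho> + 1 / real (Suc i)"
      by (intro always_eventually allI less_imp_le xu)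
  qed simp
  have Dl: "(\<lambda>i. 1 / Rx (x i) one (u i)) \<longlonglongrightarrow> 0"
  proof (rule tendsto_sandwich[OF _ _ tendsto_const lim0])
    show "\<forall>\<^sub>F i in sequentially. 0 \<le> 1 / Rx (x i) one (u i)"
      using Rx_one_pos[OF xu(1,3)] by (simp add: less_imp_le)
    show "\<forall>\<^sub>F i in sequentially. 1 / Rx (x i) one (u i) \<le> 1 / real (Suc i)"
      by (intro always_eventually allI frac_le less_imp_le[OF xu(4)]) simp_all
  qed
  \<comment> \<open>The flag \<open>True\<close> marks values of the functional on a cylinder,
    \<open>False\<close> values of the normalised resolvent at a representative.\<close>
  define I where "I = (lists S \<times> {True}) \<union> ({w\<in>lists S. cylinder X w \<noteq> {}} \<times> {False})"
  define f where "f i z = (if snd z then ell (x i) (u i) (ind (fst z)) else Gam (x i) (rep (fst z)))" for i and z :: "'s list \<times> bool"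
  have "countable (lists S)" using S_countable by (rule countable_lists)
  then have "countable I" unfolding I_def by (intro countable_Un countable_SIGMA) (auto intro: countable_subset)
  moreover have "norm (f i z) \<le> 1" if "z \<in> I" for i z
  proof (cases "snd z")
    case True
    then show ?thesis using ell_bound[OF xu(1) bd_ind xu(3)] by (simp add: f_def)
  next
    case False
    then have "rep (fst z) \<in> X" using that rep unfolding I_def by (auto simp: cylinder_def)
    then show ?thesis using Gam_range[OF xu(1)] False by (simp add: f_def)
  qed
  ultimately obtain r where r: "strict_mono (r :: nat \<Rightarrow> nat)" "\<And>z. z \<in> I \<Longrightarrow> \<exists>l. (\<lambda>n. f (r n) z) \<longlonglongrightarrow> l"
    using function_convergent_subsequence[of I f 1] by metis
  show ?thesis
  proof (intro exI[of _ "x \<circ> r"] exI[of _ "u \<circ> r"] conjI allI ballI impI)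
    show "\<rho> < (x \<circ> r) i" "(u \<circ> r) i \<in> X" for i using xu by auto
    show "(x \<circ> r) \<longlonglongrightarrow> \<rho>" by (rule LIMSEQ_subseq_LIMSEQ[OF xl r(1)])
    show "(\<lambda>i. 1 / Rx ((x \<circ> r) i) one ((u \<circ> r) i)) \<longlonglongrightarrow> 0"
      using LIMSEQ_subseq_LIMSEQ[OF Dl r(1)] by (simp add: o_def)
    show "convergent (\<lambda>i. ell ((x \<circ> r) i) ((u \<circ> r) i) (ind w))" if "w \<in> lists S" for w
      using r(2)[of "(w, True)"] that by (auto simp: I_def f_def convergent_def)
    show "convergent (\<lambda>i. Gam ((x \<circ> r) i) (rep w))" if "w \<in> lists S" "cylinder X w \<noteq> {}" for w
      using r(2)[of "(w, False)"] that by (auto simp: I_def f_def convergent_def)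
  qed
qed

end

text \<open>The sequences obtained from \<open>limit_data\<close> are fixed as locale parameters, so
  that \<open>g\<close> and \<open>nu\<close> become definitions instead of existentially bound
  objects.\<close>

locale transfer_limit = transfer_setup +
  fixes xs :: "nat \<Rightarrow> real" and us :: "nat \<Rightarrow> nat \<Rightarrow> 'a"
  assumes xs: "\<rho> < xs i" and xs_lim: "xs \<longlonglongrightarrow> \<rho>" and us: "us i \<in> X"
    and D_lim: "(\<lambda>i. 1 / Rx (xs i) one (us i)) \<longlonglongrightarrow> 0"
    and ell_conv: "w \<in> lists S \<Longrightarrow> convergent (\<lambda>i. ell (xs i) (us i) (ind w))"
    and Gam_conv: "w \<in> lists S \<Longrightarrow> cylinder X w \<noteq> {} \<Longrightarrow> convergent (\<lambda>i. Gam (xs i) (rep w))"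
begin

lemma xs_pos: "0 < xs i" using xs[of i] \<rho>_pos by linarith

lemma sx_lim: "(\<lambda>i. 1 / sx (xs i)) \<longlonglongrightarrow> 0"
proof (rule tendsto_sandwich[OF _ _ tendsto_const D_lim])
  show "\<forall>\<^sub>F i in sequentially. 0 \<le> 1 / sx (xs i)" using sx_pos[OF xs] by (simp add: less_imp_le)
  show "\<forall>\<^sub>F i in sequentially. 1 / sx (xs i) \<le> 1 / Rx (xs i) one (us i)"
    by (intro always_eventually allI frac_le Rx_le_sx Rx_one_pos xs us) simp_all
qed

text \<open>The oscillation of \<open>Gam x\<close> on a cylinder of depth \<open>n \<ge> k\<close>
  is at most \<open>exp (c1 * \<theta> ^ n) - 1\<close>, uniformly in \<open>x\<close>; convergence
  at the representatives therefore spreads to every point.\<close>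

lemma Gam_converges:
  assumes \<omega>: "\<omega> \<in> X" shows "convergent (\<lambda>i. Gam (xs i) \<omega>)"
proof -
  have "Cauchy (\<lambda>i. Gam (xs i) \<omega>)"
    unfolding Cauchy_altdef2
  proof (intro allI impI)
    fix e :: real assume e: "e > 0"
    have lim: "(\<lambda>n. exp (c1 * \<theta> ^ n) - 1) \<longlonglongrightarrow> exp (c1 * 0) - 1"
      by (intro tendsto_intros \<theta>_tendsto)
    have "\<forall>\<^sub>F n in sequentially. exp (c1 * \<theta> ^ n) - 1 < e / 3"
      by (rule order_tendstoD(2)[OF lim]) (use e in simp)
    then obtain n0 where n0: "\<And>n. n \<ge> n0 \<Longrightarrow> exp (c1 * \<theta> ^ n) - 1 < e / 3"
      by (auto simp: eventually_sequentially)
    define n where "n = max k n0"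
    let ?w = "map \<omega> [0..<n]"
    have rw: "rep ?w \<in> X" "agree n \<omega> (rep ?w)" using rep_map[OF \<omega>] by auto
    have close: "\<bar>Gam (xs i) \<omega> - Gam (xs i) (rep ?w)\<bar> < e / 3" for i
      using Gam_diff[OF xs _ \<omega> rw, of i] n0[of n] by (simp add: n_def)
    have "\<omega> \<in> cylinder X ?w" using \<omega> by (simp add: cylinder_map)
    then have "Cauchy (\<lambda>i. Gam (xs i) (rep ?w))"
      using Gam_conv[OF X_lists[OF \<omega>], of n] by (intro convergent_Cauchy) blast
    then obtain N where N: "\<And>i. i \<ge> N \<Longrightarrow> dist (Gam (xs i) (rep ?w)) (Gam (xs N) (rep ?w)) < e / 3"
      unfolding Cauchy_altdef2 using e by (meson zero_less_divide_iff zero_less_numeral)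
    have "dist (Gam (xs i) \<omega>) (Gam (xs N) \<omega>) < e" if "i \<ge> N" for i
      using N[OF that] close[of i] close[of N] unfolding dist_real_def by linarith
    then show "\<exists>N. \<forall>i\<ge>N. dist (Gam (xs i) \<omega>) (Gam (xs N) \<omega>) < e" by blast
  qed
  then show ?thesis by (rule Cauchy_convergent)
qed

definition g0 :: "(nat \<Rightarrow> 'a) \<Rightarrow> real" where "g0 \<omega> = (if \<omega> \<in> X then lim (\<lambda>i. Gam (xs i) \<omega>) else 0)"

lemma g0_lim: "\<omega> \<in> X \<Longrightarrow> (\<lambda>i. Gam (xs i) \<omega>) \<longlonglongrightarrow> g0 \<omega>"
  using Gam_converges by (simp add: g0_def convergent_LIMSEQ_iff)

lemma g0_range: "\<omega> \<in> X \<Longrightarrow> 0 \<le> g0 \<omega> \<and> g0 \<omega> \<le> 1"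
  using Gam_range[OF xs] by (auto intro!: tendsto_lowerbound[OF g0_lim] tendsto_upperbound[OF g0_lim])

lemma g0_cone:
  assumes "k \<le> m" "\<omega> \<in> X" "\<upsilon> \<in> X" "agree m \<omega> \<upsilon>"
  shows "g0 \<omega> \<le> exp (c1 * \<theta> ^ m) * g0 \<upsilon>"
proof (rule tendsto_le[OF _ tendsto_mult[OF tendsto_const g0_lim] g0_lim])
  show "\<forall>\<^sub>F i in sequentially. Gam (xs i) \<omega> \<le> exp (c1 * \<theta> ^ m) * Gam (xs i) \<upsilon>"
    using Gam_cone[OF xs assms] by simp
qed (use assms in auto)

lemma Lop_g0: "Lop g0 \<omega> = \<rho> * g0 \<omega>"
proof (cases "\<omega> \<in> X")
  case True
  have "(\<lambda>i. Lop (Gam (xs i)) \<omega>) \<longlonglongrightarrow> Lop g0 \<omega>"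
    by (rule Lop_dominated[OF bd_Gam[OF xs] g0_lim])
  moreover have "(\<lambda>i. xs i * Gam (xs i) \<omega> - 1 / sx (xs i)) \<longlonglongrightarrow> \<rho> * g0 \<omega> - 0"
    by (intro tendsto_diff tendsto_mult xs_lim g0_lim sx_lim True)
  ultimately show ?thesis unfolding Lop_Gam[OF xs True] using LIMSEQ_unique by simp
qed (simp add: g0_def)

definition words :: "'a set \<Rightarrow> nat \<Rightarrow> 'a list set" where
  "words F n = {w \<in> lists F. length w = n \<and> cylinder X w \<noteq> {}}"

lemma finite_words: "finite F \<Longrightarrow> finite (words F n)"
  unfolding words_def by (rule finite_subset[OF _ finite_lists_length_eq[of F n]]) (auto simp: in_lists_conv_set)

lemma words_rep: "w \<in> words F n \<Longrightarrow> rep w \<in> X \<and> rep w \<in> cylinder X w"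
  unfolding words_def using rep by (auto simp: cylinder_def)

lemma words_cover: "\<omega> \<in> X \<Longrightarrow> \<forall>i<n. \<omega> i \<in> F \<Longrightarrow> map \<omega> [0..<n] \<in> words F n"
  unfolding words_def using cylinder_map[of \<omega> X \<omega> n] by (auto simp: map_upt_nth)

text \<open>Each \<open>Gam x\<close> has supremum one, but the points where it is large might
  escape through the alphabet. If the limit vanished, \<open>Gam (xs i)\<close> would tend to zero
  uniformly on the words of length \<open>k\<close> over a finite \<open>F\<close>; after
  \<open>k\<close> iterations the remaining words contribute at most half of
  \<open>\<rho> ^ k\<close>. This contradicts \<open>Gam_pow_le\<close>, where the left side has
  supremum \<open>x ^ k\<close>. Depth \<open>k\<close> is what the cone comparison with
  representatives requires.\<close>

lemma g0_nonzero: "\<exists>\<omega>\<in>X. 0 < g0 \<omega>"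
proof (rule ccontr)
  assume "\<not> ?thesis"
  then have z: "g0 \<omega> = 0" if "\<omega> \<in> X" for \<omega> using g0_range[OF that] that by force
  define \<epsilon> where "\<epsilon> = \<rho> ^ k / 2"
  have "\<epsilon> > 0" using \<rho>_pos by (simp add: \<epsilon>_def)
  then obtain F where F: "finite F" "F \<subseteq> S" "\<forall>\<omega>\<in>X. (Lop ^^ k) (tail F k) \<omega> \<le> \<epsilon>"
    using tail_small[of \<epsilon> k] by blast
  note fw = finite_words[OF F(1), of k]
  define Q where "Q i = exp c1 * (\<Sum>w\<in>words F k. Gam (xs i) (rep w))" for i
  define c where "c i = (\<Sum>j<k. xs i ^ (k - 1 - j) * K ^ j) / sx (xs i)" for i
  have Q0: "0 \<le> Q i" for i
    unfolding Q_def using Gam_range[OF xs] words_rep by (intro mult_nonneg_nonneg sum_nonneg) auto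
  have G: "Gam (xs i) \<omega> \<le> Q i * 1 + tail F k \<omega>" if \<omega>: "\<omega> \<in> X" for i \<omega>
  proof (cases "\<forall>i<k. \<omega> i \<in> F")
    case True
    let ?w = "map \<omega> [0..<k]"
    have "Gam (xs i) \<omega> \<le> exp (c1 * \<theta> ^ k) * Gam (xs i) (rep ?w)"
      using rep_map[OF \<omega>] by (intro Gam_cone xs \<omega>) auto
    also have "\<dots> \<le> exp c1 * Gam (xs i) (rep ?w)"
      using Gam_range[OF xs] rep_map[OF \<omega>] c1_nonneg \<theta>_pow_le_1[of k]
      by (intro mult_right_mono) (auto intro: mult_left_le)
    also have "Gam (xs i) (rep ?w) \<le> (\<Sum>w\<in>words F k. Gam (xs i) (rep w))"
      using words_cover[OF \<omega> True] fw Gam_range[OF xs] words_rep by (intro member_le_sum) auto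
    finally show ?thesis using True by (simp add: Q_def tail_def)
  next
    case False
    then show ?thesis using Gam_range[OF xs \<omega>, of i] Q0[of i] by (auto simp: tail_def)
  qed
  have main: "xs i ^ k \<le> Q i * K ^ k + \<epsilon> + c i" for i
  proof -
    let ?B = "Q i * K ^ k + \<epsilon> + c i"
    have bq: "bd (Q i) (\<lambda>_. Q i * 1)" using Q0[of i] by (simp add: bd_def)
    have "xs i ^ k * Gam (xs i) \<omega> \<le> ?B" if \<omega>: "\<omega> \<in> X" for \<omega>
    proof -
      have "(Lop ^^ k) (Gam (xs i)) \<omega> \<le> (Lop ^^ k) (\<lambda>\<omega>. Q i * 1 + tail F k \<omega>) \<omega>"
        by (rule pow_mono[OF G bd_Gam[OF xs] bd_add[OF bq bd_tail] \<omega>])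
      also have "\<dots> = Q i * Ln k \<omega> + (Lop ^^ k) (tail F k) \<omega>"
        unfolding pow_add[OF bq bd_tail] unfolding pow_cmult Ln_def ..
      also have "\<dots> \<le> Q i * K ^ k + \<epsilon>"
        using F(3) \<omega> Q0[of i] bdD[OF bd_Ln \<omega>, of k] by (intro add_mono mult_left_mono) auto
      finally show ?thesis using Gam_pow_le[OF xs \<omega>, of i k] by (simp add: c_def)
    qed
    then have "Rx (xs i) one \<omega> \<le> sx (xs i) * ?B / xs i ^ k" if "\<omega> \<in> X" for \<omega>
      using that sx_pos[OF xs, of i] xs_pos[of i] by (simp add: Gam_def field_simps)
    then have "sx (xs i) \<le> sx (xs i) * ?B / xs i ^ k"
      using X_ne by (subst (1) sx_def) (intro cSUP_least, auto)
    then have "xs i ^ k * sx (xs i) \<le> ?B * sx (xs i)" using xs_pos[of i] by (simp add: field_simps)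
    then show ?thesis using sx_pos[OF xs, of i] by (rule mult_right_le_imp_le)
  qed
  have "c \<longlonglongrightarrow> (\<Sum>j<k. \<rho> ^ (k - 1 - j) * K ^ j) * 0"
    unfolding c_def[abs_def] divide_inverse
    using sx_lim by (intro tendsto_mult tendsto_sum tendsto_power xs_lim tendsto_const) (simp add: inverse_eq_divide)
  moreover have "Q \<longlonglongrightarrow> exp c1 * (\<Sum>w\<in>words F k. 0)"
    unfolding Q_def[abs_def]
  proof (intro tendsto_mult tendsto_const tendsto_sum)
    fix w assume "w \<in> words F k"
    then have "rep w \<in> X" using words_rep by blast
    from g0_lim[OF this] z[OF this] show "(\<lambda>i. Gam (xs i) (rep w)) \<longlonglongrightarrow> 0" by simp
  qed
  ultimately have lim: "(\<lambda>i. Q i * K ^ k + \<epsilon> + c i) \<longlonglongrightarrow> 0 * K ^ k + \<epsilon> + 0"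
    by (intro tendsto_add tendsto_mult tendsto_const) auto
  have "\<rho> ^ k \<le> 0 * K ^ k + \<epsilon> + 0"
    by (rule tendsto_le[OF sequentially_bot lim tendsto_power[OF xs_lim]]) (use main in auto)
  then show False using \<rho>_pos by (simp add: \<epsilon>_def)
qed

section \<open>The limit masses of cylinders\<close>

definition mu :: "'a list \<Rightarrow> real" where "mu w = lim (\<lambda>i. ell (xs i) (us i) (ind w))"

lemma mu_lim: "w \<in> lists S \<Longrightarrow> (\<lambda>i. ell (xs i) (us i) (ind w)) \<longlonglongrightarrow> mu w"
  using ell_conv by (simp add: mu_def convergent_LIMSEQ_iff)

lemma mu_nonneg: "w \<in> lists S \<Longrightarrow> 0 \<le> mu w"
  by (rule tendsto_lowerbound[OF mu_lim]) (auto intro!: always_eventually ell_nonneg[OF xs bd_ind us])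

lemma mu_Nil: "mu [] = 1"
proof -
  have "ell (xs i) (us i) (ind []) = 1" for i
  proof -
    have "(Lop ^^ n) (ind []) (us i) = (Lop ^^ n) one (us i)" for n
      by (rule pow_cong[OF _ us]) (simp add: cylinder_def)
    then have "ell (xs i) (us i) (ind []) = ell (xs i) (us i) one" by (simp add: ell_def Rx_def)
    then show ?thesis using ell_one[OF xs us] by simp
  qed
  then have "(\<lambda>i. 1) \<longlonglongrightarrow> mu []" using mu_lim[of "[]"] by simp
  then show ?thesis using LIMSEQ_unique tendsto_const by blast
qed

text \<open>A function whose \<open>n\<close>-th iterate is small is asymptotically negligible; this is what keeps
  the mass from escaping to infinity in the alphabet.\<close>

lemma ell_limit_le:
  assumes h: "bd 1 h" "\<And>\<omega>. \<omega> \<in> X \<Longrightarrow> 0 \<le> (h \<omega> :: real)" and e: "\<And>\<omega>. \<omega> \<in> X \<Longrightarrow> (Lop ^^ n) h \<omega> \<le> \<epsilon>"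
    and l: "(\<lambda>i. e i) \<longlonglongrightarrow> l" and le: "\<And>i. e i \<le> ell (xs i) (us i) h"
  shows "\<rho> ^ n * l \<le> \<epsilon>"
proof -
  define c where "c i = (\<Sum>j<n. xs i ^ (n - 1 - j) * K ^ j) / Rx (xs i) one (us i)" for i
  have "c \<longlonglongrightarrow> (\<Sum>j<n. \<rho> ^ (n - 1 - j) * K ^ j) * 0"
    unfolding c_def[abs_def] divide_inverse
    using D_lim by (intro tendsto_mult tendsto_sum tendsto_power xs_lim tendsto_const) (simp add: inverse_eq_divide)
  then have cl: "(\<lambda>i. \<epsilon> + c i) \<longlonglongrightarrow> \<epsilon> + 0" by (intro tendsto_add tendsto_const) simp
  have "\<rho> ^ n * l \<le> \<epsilon> + 0"
  proof (rule tendsto_le[OF sequentially_bot cl tendsto_mult[OF tendsto_power[OF xs_lim] l]])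
    have "xs i ^ n * e i \<le> \<epsilon> + c i" for i
    proof -
      obtain \<omega> where \<omega>: "\<omega> \<in> X" using X_ne by blast
      have "0 \<le> (Lop ^^ n) h \<omega>" by (rule pow_nonneg[OF h(2) \<omega>])
      with e[OF \<omega>] have e0: "0 \<le> \<epsilon>" by linarith
      have "xs i ^ n * e i \<le> xs i ^ n * ell (xs i) (us i) h" using le xs_pos[of i] by (intro mult_left_mono) auto
      also have "\<dots> \<le> ell (xs i) (us i) ((Lop ^^ n) h) + c i"
        unfolding c_def by (rule ell_pow_le[OF xs h us])
      also have "ell (xs i) (us i) ((Lop ^^ n) h) \<le> ell (xs i) (us i) (\<lambda>_. \<epsilon> * 1)"
        by (rule ell_mono[OF xs bd_pow[OF h(1)] _ us, where C = \<epsilon>]) (use e e0 in \<open>auto simp: bd_def\<close>)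
      also have "\<dots> = \<epsilon>" unfolding ell_cmult[OF xs bd_one us] ell_one[OF xs us] by simp
      finally show ?thesis by simp
    qed
    then show "\<forall>\<^sub>F i in sequentially. xs i ^ n * e i \<le> \<epsilon> + c i" by simp
  qed
  then show ?thesis by simp
qed

lemma ell_sum:
  assumes "finite I" "\<And>j. j \<in> I \<Longrightarrow> bd (B j) (f j)"
  shows "ell (xs i) (us i) (\<lambda>\<omega>. \<Sum>j\<in>I. f j \<omega>) = (\<Sum>j\<in>I. ell (xs i) (us i) (f j)) \<and> bd (\<Sum>j\<in>I. B j) (\<lambda>\<omega>. \<Sum>j\<in>I. f j \<omega>)"
  using assms
proof (induction I rule: finite_induct)
  case empty
  have "ell (xs i) (us i) (\<lambda>\<omega>. 0 * 1) = 0 * ell (xs i) (us i) (\<lambda>_. 1)" by (rule ell_cmult[OF xs bd_one us])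
  then show ?case by (simp add: bd_def)
next
  case (insert j I)
  then have IH: "ell (xs i) (us i) (\<lambda>\<omega>. \<Sum>j\<in>I. f j \<omega>) = (\<Sum>j\<in>I. ell (xs i) (us i) (f j))"
    "bd (\<Sum>j\<in>I. B j) (\<lambda>\<omega>. \<Sum>j\<in>I. f j \<omega>)" by auto
  have fj: "bd (B j) (f j)" using insert by simp
  show ?case
    using ell_add[OF xs fj IH(2) us] bd_add[OF fj IH(2)] IH(1) insert(1,2) by simp
qed

lemma cylinder_snoc: "\<omega> \<in> cylinder X (w @ [s]) \<longleftrightarrow> \<omega> \<in> cylinder X w \<and> \<omega> (length w) = s"
  by (auto simp: cylinder_def nth_append less_Suc_eq)

text \<open>Finite additivity passes to the limit and gives one inequality; mass could still be lost
  to infinitely many letters. The defect sits where the letter after \<open>w\<close> lies outside a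
  finite \<open>F\<close>, and \<open>ell_limit_le\<close> makes it small. The identity turns the
  conditional laws in \<open>trans\<close> into probability distributions.\<close>

lemma mu_has_sum:
  assumes w: "w \<in> lists S" shows "((\<lambda>s. mu (w @ [s])) has_sum mu w) S"
proof -
  have ws: "w @ [s] \<in> lists S" if "s \<in> S" for s using w that by simp
  have sumind: "(\<Sum>s\<in>F. ind (w @ [s]) \<omega>) = (if \<omega> \<in> cylinder X w \<and> \<omega> (length w) \<in> F then 1 else 0)" if "finite F" for F \<omega>
  proof -
    have "(\<Sum>s\<in>F. ind (w @ [s]) \<omega>) = (\<Sum>s\<in>F. if s = \<omega> (length w) then ind w \<omega> else 0)"
      by (intro sum.cong refl) (auto simp: indicator_def cylinder_snoc)
    then show ?thesis using that by (simp add: indicator_def)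
  qed
  have le: "(\<Sum>s\<in>F. mu (w @ [s])) \<le> mu w" if F: "finite F" "F \<subseteq> S" for F
  proof (rule tendsto_le[OF _ mu_lim[OF w]])
    show "(\<lambda>i. \<Sum>s\<in>F. ell (xs i) (us i) (ind (w @ [s]))) \<longlonglongrightarrow> (\<Sum>s\<in>F. mu (w @ [s]))"
      using F ws by (intro tendsto_sum mu_lim) auto
    have "(\<Sum>s\<in>F. ell (xs i) (us i) (ind (w @ [s]))) \<le> ell (xs i) (us i) (ind w)" for i
    proof -
      note es = ell_sum[OF F(1), of "\<lambda>_. 1" "\<lambda>s. ind (w @ [s])" i, OF bd_ind]
      have "ell (xs i) (us i) (\<lambda>\<omega>. \<Sum>s\<in>F. ind (w @ [s]) \<omega>) \<le> ell (xs i) (us i) (ind w)"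
        by (rule ell_mono[OF xs conjunct2[OF es] bd_ind us]) (unfold sumind[OF F(1)], simp add: indicator_def)
      then show ?thesis using es by simp
    qed
    then show "\<forall>\<^sub>F i in sequentially. (\<Sum>s\<in>F. ell (xs i) (us i) (ind (w @ [s]))) \<le> ell (xs i) (us i) (ind w)" by simp
  qed simp
  have nn: "0 \<le> mu (w @ [s])" if "s \<in> S" for s by (rule mu_nonneg[OF ws[OF that]])
  have sm: "(\<lambda>s. mu (w @ [s])) summable_on S"
  proof (rule nonneg_bdd_above_summable_on)
    show "bdd_above (sum (\<lambda>s. mu (w @ [s])) ` {F. F \<subseteq> S \<and> finite F})"
      using le by (intro bdd_aboveI2[of _ _ "mu w"]) auto
  qed (rule nn)
  have "mu w \<le> (\<Sum>\<^sub>\<infinity>s\<in>S. mu (w @ [s])) + \<epsilon>" if \<epsilon>: "\<epsilon> > 0" for \<epsilon>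
  proof -
    \<comment> \<open>Large enough for \<open>tail F n\<close> to see the letter that follows
      \<open>w\<close>.\<close>
    define n where "n = Suc (length w)"
    have "\<epsilon> * \<rho> ^ n > 0" using \<epsilon> \<rho>_pos by simp
    then obtain F where F: "finite F" "F \<subseteq> S" "\<forall>\<omega>\<in>X. (Lop ^^ n) (tail F n) \<omega> \<le> \<epsilon> * \<rho> ^ n"
      using tail_small[of "\<epsilon> * \<rho> ^ n" n] by blast
    have "(\<lambda>i. ell (xs i) (us i) (ind w) - (\<Sum>s\<in>F. ell (xs i) (us i) (ind (w @ [s])))) \<longlonglongrightarrow> mu w - (\<Sum>s\<in>F. mu (w @ [s]))"
      using F ws w by (intro tendsto_diff tendsto_sum mu_lim) auto
    moreover have "ell (xs i) (us i) (ind w) - (\<Sum>s\<in>F. ell (xs i) (us i) (ind (w @ [s]))) \<le> ell (xs i) (us i) (tail F n)" for i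
    proof -
      note es = ell_sum[OF F(1), of "\<lambda>_. 1" "\<lambda>s. ind (w @ [s])" i, OF bd_ind]
      have "ell (xs i) (us i) (ind w) \<le> ell (xs i) (us i) (\<lambda>\<omega>. (\<Sum>s\<in>F. ind (w @ [s]) \<omega>) + tail F n \<omega>)"
      proof (rule ell_mono[OF xs bd_ind bd_add[OF conjunct2[OF es] bd_tail] us])
        fix \<omega>
        show "ind w \<omega> \<le> (\<Sum>s\<in>F. ind (w @ [s]) \<omega>) + tail F n \<omega>"
          unfolding sumind[OF F(1)] by (auto simp: indicator_def tail_def n_def)
      qed
      then show ?thesis using es ell_add[OF xs conjunct2[OF es] bd_tail us] by simp
    qed
    ultimately have "\<rho> ^ n * (mu w - (\<Sum>s\<in>F. mu (w @ [s]))) \<le> \<epsilon> * \<rho> ^ n"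
      using F(3) by (intro ell_limit_le[OF bd_tail]) (auto simp: tail_def)
    then have "mu w - (\<Sum>s\<in>F. mu (w @ [s])) \<le> \<epsilon>" using \<rho>_pos by (simp add: mult.commute)
    moreover have "(\<Sum>s\<in>F. mu (w @ [s])) \<le> (\<Sum>\<^sub>\<infinity>s\<in>S. mu (w @ [s]))"
      by (intro finite_sum_le_infsum sm F) (use nn in auto)
    ultimately show ?thesis by linarith
  qed
  then have "mu w \<le> (\<Sum>\<^sub>\<infinity>s\<in>S. mu (w @ [s]))" by (rule field_le_epsilon)
  moreover have "(\<Sum>\<^sub>\<infinity>s\<in>S. mu (w @ [s])) \<le> mu w" by (intro infsum_le_finite_sums sm le)
  ultimately show ?thesis using has_sum_infsum[OF sm] by simp
qed

text \<open>After \<open>i\<close> iterations the forbidden transition stands at positions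
  \<open>0\<close> and \<open>1\<close>, and the next application sums only over letters admissible
  for \<open>M\<close>; so \<open>Suc i\<close> iterations annihilate the indicator.\<close>

lemma mu_inadmissible:
  assumes w: "w \<in> lists S" and i: "Suc i < length w" "M (w ! i) (w ! Suc i) \<noteq> 1"
  shows "mu w = 0"
proof -
  define bad where "bad \<omega> = (if M (\<omega> 0) (\<omega> 1) = 1 then 0 else 1 :: real)" for \<omega> :: "nat \<Rightarrow> 'a"
  have bb: "bd 1 (\<lambda>\<omega>. one \<omega> * bad ((shift ^^ i) \<omega>))" by (auto simp: bd_def bad_def)
  have "(Lop ^^ Suc i) (ind w) \<omega> \<le> 0" if \<omega>: "\<omega> \<in> X" for \<omega>
  proof -
    have "(Lop ^^ Suc i) (ind w) \<omega> \<le> (Lop ^^ Suc i) (\<lambda>\<omega>. one \<omega> * bad ((shift ^^ i) \<omega>)) \<omega>"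
    proof (rule pow_mono[OF _ bd_ind bb \<omega>])
      fix \<omega> 
      show "ind w \<omega> \<le> one \<omega> * bad ((shift ^^ i) \<omega>)"
        using i by (auto simp: bad_def indicator_def cylinder_def funpow_shift)
    qed
    also have "\<dots> = Lop (\<lambda>\<omega>. (Lop ^^ i) one \<omega> * bad \<omega>) \<omega>"
      unfolding funpow.simps o_def pow_shift[of i one bad] ..
    also have "\<dots> = 0" using \<omega> by (auto simp: Lop_in bad_def pre_def intro!: infsum_0)
    finally show ?thesis .
  qed
  then have "\<rho> ^ Suc i * mu w \<le> 0"
    by (intro ell_limit_le[OF bd_ind _ _ mu_lim[OF w]]) auto
  then have "\<rho> ^ Suc i * mu w \<le> \<rho> ^ Suc i * 0" by simp
  then have "mu w \<le> 0" by (rule mult_left_le_imp_le) (use \<rho>_pos in simp)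
  then show ?thesis using mu_nonneg[OF w] by simp
qed

end

section \<open>The eigenmeasure\<close>

text \<open>The eigenmeasure is realised as the law of a random sequence: a function \<open>y\<close> from words to
  letters is drawn from a product measure, and the letter following the word \<open>w\<close> is \<open>y w\<close>.\<close>

primrec prefix_word :: "('s list \<Rightarrow> 's) \<Rightarrow> nat \<Rightarrow> 's list" where
  "prefix_word y 0 = []"
| "prefix_word y (Suc n) = prefix_word y n @ [y (prefix_word y n)]"

lemma length_prefix_word [simp]: "length (prefix_word y n) = n"
  by (induction n) auto

definition follow :: "('s list \<Rightarrow> 's) \<Rightarrow> nat \<Rightarrow> 's" where "follow y n = y (prefix_word y n)"

lemma map_follow: "map (follow y) [0..<n] = prefix_word y n"
  by (induction n) (auto simp: follow_def)

lemma prefix_word_eq_iff: "prefix_word y (length w) = w \<longleftrightarrow> (\<forall>i<length w. y (take i w) = w ! i)"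
proof (induction w rule: rev_induct)
  case (snoc s w)
  have "prefix_word y (length (w @ [s])) = w @ [s] \<longleftrightarrow> prefix_word y (length w) = w \<and> y w = s"
    by auto
  also have "\<dots> \<longleftrightarrow> (\<forall>i<length (w @ [s]). y (take i (w @ [s])) = (w @ [s]) ! i)"
    unfolding snoc by (auto simp: less_Suc_eq nth_append)
  finally show ?case .
qed simp

lemma has_sum_nn_integral:
  fixes f :: "'s \<Rightarrow> real"
  assumes "(f has_sum c) UNIV" "\<And>s. 0 \<le> f s"
  shows "(\<integral>\<^sup>+s. ennreal (f s) \<partial>count_space UNIV) = ennreal c"
proof -
  have "Infinite_Sum.abs_summable_on f UNIV" using assms summable_on_def by auto
  then have a: "Infinite_Set_Sum.abs_summable_on f UNIV" unfolding abs_summable_equivalent .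
  then have "(\<integral>\<^sup>+s. ennreal (f s) \<partial>count_space UNIV) = ennreal (infsetsum f UNIV)"
    unfolding infsetsum_def using assms(2)
    by (intro nn_integral_eq_integral) (auto simp: abs_summable_on_def)
  also have "infsetsum f UNIV = c" using infsetsum_infsum[OF a] infsumI[OF assms(1)] by simp
  finally show ?thesis .
qed

context transfer_limit
begin

text \<open>The conditional law of the letter after \<open>w\<close>. The Dirac mass on words of
  mass zero is a default that matters only on a null event (\<open>AE_prefix\<close>).\<close>

definition trans :: "'a list \<Rightarrow> 'a pmf" where
  "trans w = (if w \<in> lists S \<and> mu w > 0
     then embed_pmf (\<lambda>s. if s \<in> S then mu (w @ [s]) / mu w else 0)
     else return_pmf undefined)"

lemma pmf_trans:
  assumes w: "w \<in> lists S" "mu w > 0"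
  shows "pmf (trans w) s = (if s \<in> S then mu (w @ [s]) / mu w else 0)"
proof -
  let ?f = "\<lambda>s. if s \<in> S then mu (w @ [s]) / mu w else 0"
  have n: "0 \<le> ?f s" for s using mu_nonneg[of "w @ [s]"] w by auto
  have "((\<lambda>s. mu (w @ [s]) * (1 / mu w)) has_sum (mu w * (1 / mu w))) S"
    by (intro has_sum_cmult_left mu_has_sum w)
  then have "(?f has_sum 1) UNIV"
    using w by (subst has_sum_cong_neutral[where T = S and g = "\<lambda>s. mu (w @ [s]) / mu w"]) auto
  from has_sum_nn_integral[OF this n] have "(\<integral>\<^sup>+s. ennreal (?f s) \<partial>count_space UNIV) = 1" by simp
  then show ?thesis using w n by (simp add: trans_def pmf_embed_pmf)
qed

definition PP :: "('a list \<Rightarrow> 'a) measure" where "PP = PiM UNIV (\<lambda>w. measure_pmf (trans w))"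

sublocale PP: product_prob_space "\<lambda>w. measure_pmf (trans w)" UNIV
  by unfold_locales

lemma prob_PP: "prob_space PP" unfolding PP_def by (rule PP.prob_space_axioms)

lemma space_PP [simp]: "space PP = UNIV" by (simp add: PP_def space_PiM)

lemma word_event: "{y. prefix_word y (length w) = w} \<in> sets PP"
proof -
  have m: "(\<lambda>y. y v) \<in> measurable PP (count_space UNIV)" for v
    unfolding PP_def using measurable_component_singleton[of v UNIV "\<lambda>w. measure_pmf (trans w)"]
    by (simp add: measurable_cong_sets[OF refl sets_measure_pmf_count_space[symmetric]])
  have "{y. prefix_word y (length w) = w} = space PP \<inter> (\<Inter>i\<in>{..<length w}. (\<lambda>y. y (take i w)) -` {w ! i} \<inter> space PP)"
    by (auto simp: prefix_word_eq_iff)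
  also have "\<dots> \<in> sets PP"
  proof (cases "w = []")
    case False
    have "(\<Inter>i\<in>{..<length w}. (\<lambda>y. y (take i w)) -` {w ! i} \<inter> space PP) \<in> sets PP"
      using False measurable_sets[OF m] by (intro sets.finite_INT) (auto simp del: space_PP)
    then show ?thesis by (intro sets.Int sets.top)
  next
    case True
    show ?thesis unfolding True using sets.top[of PP] by simp
  qed
  finally show ?thesis .
qed

lemma take_inj: "inj_on (\<lambda>i. take i w) {..<length w}"
proof (rule inj_onI)
  fix i j assume "i \<in> {..<length w}" "j \<in> {..<length w}" "take i w = take j w"
  then have "length (take i w) = length (take j w)" "i < length w" "j < length w" by simp_all
  then show "i = j" by simp
qed

text \<open>The proper prefixes of \<open>w\<close> are distinct coordinates
  (\<open>take_inj\<close>), so the event is a product event; its probability is the product of the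
  conditional probabilities, which telescopes. If a prefix has mass zero, so has each of its
  extensions, by \<open>mu_has_sum\<close>.\<close>

lemma word_prob:
  assumes "w \<in> lists S"
  shows "measure PP {y. prefix_word y (length w) = w} = mu w"
proof -
  have eq: "measure PP {y. prefix_word y (length w) = w} = (\<Prod>i<length w. pmf (trans (take i w)) (w ! i))" for w
  proof -
    let ?J = "(\<lambda>i. take i w) ` {..<length w}"
    let ?A = "\<lambda>v. {w ! length v}"
    have "{y. prefix_word y (length w) = w} = prod_emb UNIV (\<lambda>w. measure_pmf (trans w)) ?J (PiE ?J ?A)"
      by (auto simp: prefix_word_eq_iff prod_emb_def PiE_iff restrict_def extensional_def min_def)
    then have "measure PP {y. prefix_word y (length w) = w} = (\<Prod>v\<in>?J. measure (measure_pmf (trans v)) (?A v))"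
      unfolding PP_def by (simp only:) (rule PP.measure_PiM_emb, auto)
    also have "\<dots> = (\<Prod>i<length w. measure (measure_pmf (trans (take i w))) {w ! length (take i w)})"
      by (rule prod.reindex_cong[OF take_inj]) auto
    also have "\<dots> = (\<Prod>i<length w. pmf (trans (take i w)) (w ! i))"
      by (intro prod.cong refl) (simp add: measure_pmf_single min_def)
    finally show ?thesis .
  qed
  show ?thesis unfolding eq using assms
  proof (induction w rule: rev_induct)
    case Nil
    then show ?case by (simp add: mu_Nil)
  next
    case (snoc s w)
    then have w: "w \<in> lists S" "s \<in> S" by auto
    have "(\<Prod>i<length (w @ [s]). pmf (trans (take i (w @ [s]))) ((w @ [s]) ! i)) =
        (\<Prod>i<length w. pmf (trans (take i w)) (w ! i)) * pmf (trans w) s"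
      by (simp add: nth_append)
    also have "\<dots> = mu w * pmf (trans w) s" using snoc w by simp
    also have "\<dots> = mu (w @ [s])"
    proof (cases "mu w > 0")
      case True
      then show ?thesis using pmf_trans[OF w(1) True, of s] w by simp
    next
      case False
      then have 0: "mu w = 0" using mu_nonneg[OF w(1)] by linarith
      have "(\<Sum>t\<in>{s}. mu (w @ [t])) \<le> mu w"
        by (rule finite_sum_le_has_sum[OF mu_has_sum[OF w(1)]]) (use w mu_nonneg in auto)
      then have "mu (w @ [s]) = 0" using 0 mu_nonneg[of "w @ [s]"] w by simp
      with 0 show ?thesis by simp
    qed
    finally show ?case .
  qed
qed

lemma AE_prefix: "AE y in PP. \<forall>n. prefix_word y n \<in> lists S \<and> mu (prefix_word y n) > 0"
proof -
  interpret P: prob_space PP by (rule prob_PP)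
  have "AE y in PP. \<forall>w\<in>lists S. prefix_word y (length w) = w \<longrightarrow> mu w > 0 \<and> y w \<in> S"
  proof (rule AE_ball_countable')
    fix w assume w: "w \<in> lists S"
    show "AE y in PP. prefix_word y (length w) = w \<longrightarrow> mu w > 0 \<and> y w \<in> S"
    proof (cases "mu w > 0")
      case True
      have "AE s in measure_pmf (trans w). s \<in> S"
        using pmf_trans[OF w True] by (auto simp: AE_measure_pmf_iff set_pmf_iff split: if_splits)
      then have "AE y in PP. y w \<in> S"
        unfolding PP_def by (rule PP.AE_component[rotated]) simp
      then show ?thesis using True by auto
    next
      case False
      then have "mu w = 0" using mu_nonneg[OF w] by linarith
      then have "emeasure PP {y. prefix_word y (length w) = w} = 0"
        using word_prob[OF w] by (simp add: P.emeasure_eq_measure)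
      then have "AE y in PP. y \<notin> {y. prefix_word y (length w) = w}"
        using word_event[of w] by (intro AE_not_in) (auto simp: null_sets_def)
      then show ?thesis by auto
    qed
  qed (use S_countable countable_lists in blast)
  then show ?thesis
  proof eventually_elim
    case (elim y)
    have "prefix_word y n \<in> lists S" for n
    proof (induction n)
      case (Suc n)
      then have "y (prefix_word y n) \<in> S" using elim by auto
      then show ?case using Suc by simp
    qed simp
    then show ?case using elim by auto
  qed
qed

lemma AE_follow: "AE y in PP. follow y \<in> X"
  using AE_prefix
proof eventually_elim
  case (elim y)
  show ?case unfolding X_iff
  proof (intro conjI allI)
    fix n
    let ?w = "prefix_word y (Suc (Suc n))"
    have w: "?w \<in> lists S" "mu ?w > 0" using elim by blast+
    have nth: "?w ! i = follow y i" if "i < Suc (Suc n)" for i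
      unfolding map_follow[symmetric] using that by (subst nth_map_upt) auto
    show "follow y n \<in> S" using w(1) nth[of n] by (metis in_listsD length_prefix_word lessI less_SucI nth_mem)
    have "M (?w ! n) (?w ! Suc n) = 1" using mu_inadmissible[OF w(1), of n] w(2) by fastforce
    then show "A (follow y n) (follow y (Suc n)) = 1" using nth[of n] nth[of "Suc n"] M_one(3) by simp
  qed
qed

definition x0 where "x0 = (SOME \<omega>. \<omega> \<in> X)"

lemma x0: "x0 \<in> X" unfolding x0_def using X_ne by (simp add: some_in_eq)

text \<open>The default \<open>x0\<close> makes the map take values in \<open>X\<close> everywhere;
  almost surely \<open>follow y\<close> lies in \<open>X\<close> already.\<close>

definition path :: "('a list \<Rightarrow> 'a) \<Rightarrow> nat \<Rightarrow> 'a" where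
  "path y = (if follow y \<in> X then follow y else x0)"

definition cyls where "cyls = cylinder X ` lists S"

definition nu :: "(nat \<Rightarrow> 'a) measure" where "nu = distr PP (sigma X cyls) path"

lemma cyls_sub: "cyls \<subseteq> Pow X" by (auto simp: cyls_def cylinder_def)

lemma countable_lists_S: "countable (lists S)" using S_countable by (rule countable_lists)

lemma follow_cylinder: "follow y \<in> cylinder X w \<longleftrightarrow> follow y \<in> X \<and> prefix_word y (length w) = w"
proof -
  have "prefix_word y (length w) = w \<longleftrightarrow> (\<forall>i<length w. follow y i = w ! i)"
    unfolding map_follow[symmetric] list_eq_iff_nth_eq[of _ w] by simp
  then show ?thesis by (auto simp: cylinder_def)
qed

text \<open>Membership in \<open>X\<close> concerns letters and transitions, hence finite prefixes:
  it is equivalent to every prefix being a word over \<open>S\<close> with nonempty cylinder, a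
  countable condition.\<close>

lemma follow_X_event: "{y. follow y \<in> X} \<in> sets PP"
proof -
  have "{y. follow y \<in> X} = space PP \<inter> (\<Inter>n. \<Union>w\<in>{w\<in>lists S. length w = n \<and> cylinder X w \<noteq> {}}. {y. prefix_word y (length w) = w})"
    (is "?l = ?r")
  proof (intro set_eqI iffI)
    fix y assume "y \<in> ?l"
    then have y: "follow y \<in> X" by simp
    then have "prefix_word y n \<in> lists S \<and> follow y \<in> cylinder X (prefix_word y n)" for n
      using X_lists[OF y, of n] follow_cylinder[of y "prefix_word y n"] by (simp add: map_follow)
    then show "y \<in> ?r" by fastforce
  next
    fix y assume y: "y \<in> ?r"
    have *: "prefix_word y n \<in> lists S \<and> cylinder X (prefix_word y n) \<noteq> {}" for n using y by fastforce
    have "follow y n \<in> S \<and> A (follow y n) (follow y (Suc n)) = 1" for n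
    proof -
      obtain \<omega> where "\<omega> \<in> cylinder X (prefix_word y (Suc (Suc n)))" using * by blast
      then have \<omega>: "\<omega> \<in> X" "agree (Suc (Suc n)) \<omega> (follow y)"
        unfolding map_follow[symmetric] cylinder_map by auto
      then show ?thesis by (auto simp: X_iff agree_def) (metis less_SucI lessI)+
    qed
    then show "y \<in> ?l" by (simp add: X_iff)
  qed
  also have "?r \<in> sets PP"
  proof -
    have "(\<Union>w\<in>{w\<in>lists S. length w = n \<and> cylinder X w \<noteq> {}}. {y. prefix_word y (length w) = w}) \<in> sets PP" for n
      by (rule sets.countable_UN'[OF countable_subset[OF _ countable_lists_S]]) (use word_event in auto)
    then show ?thesis by (intro sets.Int sets.top sets.countable_INT') auto
  qed
  finally show ?thesis .
qed

lemma path_measurable: "path \<in> measurable PP (sigma X cyls)"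
proof (rule measurable_measure_of[OF cyls_sub])
  show "path \<in> space PP \<rightarrow> X" using x0 by (auto simp: path_def)
  fix C assume "C \<in> cyls"
  then obtain w where C: "C = cylinder X w" by (auto simp: cyls_def)
  have "path -` C \<inter> space PP = ({y. follow y \<in> X} \<inter> {y. prefix_word y (length w) = w}) \<union>
      (if x0 \<in> C then space PP - {y. follow y \<in> X} else {})"
    using x0 by (auto simp: C path_def follow_cylinder split: if_splits)
  also have "\<dots> \<in> sets PP"
    using sets.Int[OF follow_X_event word_event[of w]] sets.compl_sets[OF follow_X_event]
    by (cases "x0 \<in> C") (auto intro: sets.Un)
  finally show "path -` C \<inter> space PP \<in> sets PP" .
qed

lemma space_nu [simp]: "space nu = X"
  using cyls_sub by (simp add: nu_def)

lemma sets_nu_cyls: "sets nu = sigma_sets X cyls"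
  using cyls_sub by (simp add: nu_def)

sublocale nu: prob_space nu
  unfolding nu_def by (rule prob_space.prob_space_distr[OF prob_PP path_measurable])

lemma cyl_sets: "w \<in> lists S \<Longrightarrow> cylinder X w \<in> sets nu"
  unfolding sets_nu_cyls cyls_def by (intro sigma_sets.Basic) auto

lemma nu_cyl:
  assumes w: "w \<in> lists S" shows "measure nu (cylinder X w) = mu w"
proof -
  interpret P: prob_space PP by (rule prob_PP)
  have "measure nu (cylinder X w) = measure PP (path -` cylinder X w \<inter> space PP)"
    unfolding nu_def by (rule measure_distr[OF path_measurable]) (use cyl_sets[OF w] in \<open>simp add: nu_def\<close>)
  also have "\<dots> = measure PP {y. prefix_word y (length w) = w}"
  proof (rule P.finite_measure_eq_AE)
    show "AE y in PP. (y \<in> path -` cylinder X w \<inter> space PP) = (y \<in> {y. prefix_word y (length w) = w})"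
      using AE_follow by eventually_elim (simp add: path_def follow_cylinder)
    show "path -` cylinder X w \<inter> space PP \<in> sets PP"
      using path_measurable by (rule measurable_sets) (use cyl_sets[OF w] in \<open>simp add: nu_def\<close>)
  qed (rule word_event)
  also have "\<dots> = mu w" by (rule word_prob[OF w])
  finally show ?thesis .
qed

lemma open_cylinder: "openin (theta_topology \<theta> X) (cylinder X w)"
  unfolding openin_theta
proof (intro conjI ballI)
  show "cylinder X w \<subseteq> X" by (auto simp: cylinder_def)
  fix \<omega> assume "\<omega> \<in> cylinder X w"
  then show "\<exists>n. \<forall>\<upsilon>\<in>X. agree n \<omega> \<upsilon> \<longrightarrow> \<upsilon> \<in> cylinder X w"
    by (intro exI[of _ "length w"]) (auto simp: cylinder_def agree_def)
qed

text \<open>Every open set is the union of the cylinders it contains, and there are only countably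
  many cylinders; so the cylinder and the Borel sigma-algebra coincide.\<close>

lemma sets_nu: "sets nu = sigma_sets X {U. openin (theta_topology \<theta> X) U}"
proof (rule antisym)
  show "sets nu \<subseteq> sigma_sets X {U. openin (theta_topology \<theta> X) U}"
    unfolding sets_nu_cyls
    by (rule sigma_sets_mono) (auto simp: cyls_def intro!: sigma_sets.Basic open_cylinder)
  have "U \<in> sigma_sets X cyls" if U: "openin (theta_topology \<theta> X) U" for U
  proof -
    have "U = (\<Union>w\<in>{w\<in>lists S. cylinder X w \<subseteq> U}. cylinder X w)"
    proof (intro set_eqI iffI)
      fix \<omega> assume \<omega>: "\<omega> \<in> U"
      then obtain n where n: "\<forall>\<upsilon>\<in>X. agree n \<omega> \<upsilon> \<longrightarrow> \<upsilon> \<in> U" and \<omega>X: "\<omega> \<in> X"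
        using U unfolding openin_theta by blast
      have "cylinder X (map \<omega> [0..<n]) \<subseteq> U"
      proof
        fix x assume "x \<in> cylinder X (map \<omega> [0..<n])"
        then have "x \<in> X" "agree n \<omega> x" by (simp_all add: cylinder_map agree_sym)
        then show "x \<in> U" using n by blast
      qed
      moreover have "\<omega> \<in> cylinder X (map \<omega> [0..<n])" using \<omega>X by (simp add: cylinder_map)
      ultimately show "\<omega> \<in> (\<Union>w\<in>{w\<in>lists S. cylinder X w \<subseteq> U}. cylinder X w)"
        using X_lists[OF \<omega>X, of n] by blast
    qed auto
    moreover have "(\<Union>w\<in>{w\<in>lists S. cylinder X w \<subseteq> U}. cylinder X w) \<in> sets nu"
      by (intro sets.countable_UN' countable_subset[OF _ countable_lists_S]) (auto intro: cyl_sets)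
    ultimately show ?thesis unfolding sets_nu_cyls by simp
  qed
  then show "sigma_sets X {U. openin (theta_topology \<theta> X) U} \<subseteq> sets nu"
    unfolding sets_nu_cyls by (intro sigma_sets_mono) auto
qed

lemma nu_borel_probability: "borel_probability \<theta> X nu"
  unfolding borel_probability_def using sets_nu nu.emeasure_space_1 by simp

text \<open>The complement of \<open>XM\<close> in \<open>X\<close> is the countable union of the
  cylinders of words with a transition forbidden by \<open>M\<close>, each of mass zero by
  \<open>mu_inadmissible\<close>.\<close>

lemma XM_sets: "XM \<in> sets nu" and nu_XM: "measure nu XM = 1"
proof -
  define W where "W = {w\<in>lists S. \<exists>i. Suc i < length w \<and> M (w ! i) (w ! Suc i) \<noteq> 1}"
  have cW: "countable W" unfolding W_def by (rule countable_subset[OF _ countable_lists_S]) auto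
  have eq: "X - XM = (\<Union>w\<in>W. cylinder X w)"
  proof (intro set_eqI iffI)
    fix \<omega> assume \<omega>: "\<omega> \<in> X - XM"
    then have "\<not> (\<forall>n. M (\<omega> n) (\<omega> (Suc n)) = 1)" using M_one(1)[of "\<omega> n" "\<omega> (Suc n)" for n] by (auto simp: XM_iff)
    then obtain n where n: "M (\<omega> n) (\<omega> (Suc n)) \<noteq> 1" by auto
    let ?w = "map \<omega> [0..<Suc (Suc n)]"
    have "?w ! n = \<omega> n" "?w ! Suc n = \<omega> (Suc n)" by (simp_all add: nth_append)
    then have "?w \<in> W" using \<omega> n X_lists[of \<omega> "Suc (Suc n)"] unfolding W_def mem_Collect_eq
      by (intro conjI exI[of _ n]) (simp_all del: upt_Suc)
    moreover have "\<omega> \<in> cylinder X ?w" using \<omega> unfolding cylinder_map by simp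
    ultimately show "\<omega> \<in> (\<Union>w\<in>W. cylinder X w)" by blast
  next
    fix \<omega> assume "\<omega> \<in> (\<Union>w\<in>W. cylinder X w)"
    then obtain w i where "\<omega> \<in> cylinder X w" "Suc i < length w" "M (w ! i) (w ! Suc i) \<noteq> 1"
      by (auto simp: W_def)
    then have "\<omega> \<in> X" "M (\<omega> i) (\<omega> (Suc i)) \<noteq> 1" by (simp_all add: cylinder_def)
    then show "\<omega> \<in> X - XM" by (auto simp: XM_iff)
  qed
  have "cylinder X w \<in> null_sets nu" if "w \<in> W" for w
    using that nu_cyl[of w] mu_inadmissible[of w] cyl_sets[of w]
    by (auto simp: W_def null_sets_def nu.emeasure_eq_measure)
  then have n: "X - XM \<in> null_sets nu" unfolding eq by (intro null_sets_UN' cW)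
  have XMe: "XM = space nu - (X - XM)" using XM_sub by auto
  then show "XM \<in> sets nu" using n sets.compl_sets[of "X - XM" nu] by auto
  show "measure nu XM = 1"
    using n nu.prob_compl[of "X - XM"] XMe by (auto simp: null_sets_def nu.emeasure_eq_measure)
qed

end

context transfer_setup
begin

section \<open>The operator on continuous and on Lipschitz functions\<close>

lemma pow_sum:
  assumes "finite I" "\<And>j. j \<in> I \<Longrightarrow> bd (B j) (f j)"
  shows "(Lop ^^ n) (\<lambda>\<omega>. \<Sum>j\<in>I. f j \<omega>) = (\<lambda>\<omega>. \<Sum>j\<in>I. (Lop ^^ n) (f j) \<omega>) \<and>
    bd (\<Sum>j\<in>I. B j) (\<lambda>\<omega>. \<Sum>j\<in>I. f j \<omega>)"
  using assms
proof (induction I rule: finite_induct)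
  case empty
  have "(Lop ^^ n) (\<lambda>_. 0 * (0::'b)) = (\<lambda>\<omega>. 0 * (Lop ^^ n) (\<lambda>_. 0) \<omega>)" by (rule pow_cmult)
  then show ?case by (simp add: bd_def)
next
  case (insert i I)
  have b: "bd (B i) (f i)" using insert.prems by simp
  have IH: "(Lop ^^ n) (\<lambda>\<omega>. \<Sum>j\<in>I. f j \<omega>) = (\<lambda>\<omega>. \<Sum>j\<in>I. (Lop ^^ n) (f j) \<omega>)"
    "bd (\<Sum>j\<in>I. B j) (\<lambda>\<omega>. \<Sum>j\<in>I. f j \<omega>)"
    using insert.IH insert.prems by auto
  show ?case using pow_add[OF b IH(2), of n] bd_add[OF b IH(2)] insert.hyps by (simp add: IH(1))
qed

lemma exp_cone_le: "exp (c1 * \<theta> ^ m) - 1 \<le> c1 * exp c1 * \<theta> ^ m"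
proof -
  have "exp (c1 * \<theta> ^ m) - 1 \<le> c1 * \<theta> ^ m * exp (c1 * \<theta> ^ m)"
    using exp_ge_add_one_self[of "- (c1 * \<theta> ^ m)"] by (simp add: exp_minus field_simps)
  also have "\<dots> \<le> c1 * \<theta> ^ m * exp c1"
    using c1_nonneg \<theta>_pow_le_1[of m] by (intro mult_left_mono) (auto simp: mult_left_le)
  finally show ?thesis by (simp add: mult_ac)
qed

text \<open>The Lasota--Yorke bound with the distortion linearised by \<open>exp_cone_le\<close>.
  The level falls from \<open>j\<close> by one per iteration, but not below \<open>k\<close>, the
  depth from which the weights are controlled.\<close>

lemma pow_lip:
  fixes f :: "(nat \<Rightarrow> 's) \<Rightarrow> 'b::{real_normed_field,banach,second_countable_topology}"
  assumes B: "bd B f" and l: "lip j D f"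
  shows "lip (max k (j - n)) (D * \<theta> ^ n * b n + c1 * exp c1 * (b n * B)) ((Lop ^^ n) f)"
  unfolding lip_def
proof (intro allI impI ballI)
  fix m \<omega> \<upsilon> assume m: "max k (j - n) \<le> m" and \<omega>: "\<omega> \<in> X" and \<upsilon>: "\<upsilon> \<in> X" and a: "agree m \<omega> \<upsilon>"
  have D: "0 \<le> D" by (rule lip_nonneg[OF l])
  have bn: "bd B (\<lambda>\<omega>. norm (f \<omega>))" using B by (simp add: bd_def)
  have "norm ((Lop ^^ n) f \<omega> - (Lop ^^ n) f \<upsilon>) \<le>
    D * \<theta> ^ (n + m) * Ln n \<omega> + (exp (c1 * \<theta> ^ m) - 1) * (Lop ^^ n) (\<lambda>\<omega>. norm (f \<omega>)) \<upsilon>"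
    by (rule lasota_yorke[OF B D lipD[OF l] _ _ \<omega> \<upsilon> a]) (use m in auto)
  also have "\<dots> \<le> D * \<theta> ^ (n + m) * b n + (c1 * exp c1 * \<theta> ^ m) * (b n * B)"
  proof (intro add_mono mult_mono)
    show "(Lop ^^ n) (\<lambda>\<omega>. norm (f \<omega>)) \<upsilon> \<le> b n * B" using bdD[OF bd_pow_b[OF bn] \<upsilon>, of n] by simp
  qed (use D \<omega> \<upsilon> th0 c1_nonneg Ln_nonneg Ln_le_b exp_cone_le pow_nonneg[of "\<lambda>\<omega>. norm (f \<omega>)" \<upsilon> n] in auto)
  also have "\<dots> = (D * \<theta> ^ n * b n + c1 * exp c1 * (b n * B)) * \<theta> ^ m" by (simp add: algebra_simps power_add)
  finally show "norm ((Lop ^^ n) f \<omega> - (Lop ^^ n) f \<upsilon>) \<le> (D * \<theta> ^ n * b n + c1 * exp c1 * (b n * B)) * \<theta> ^ m" .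
qed

lemma Lop_lip:
  assumes "bd B f" "lip j D f"
  shows "lip (max k (j - 1)) (D * \<theta> ^ 1 * b 1 + c1 * exp c1 * (b 1 * B)) (Lop f)"
  using pow_lip[OF assms, of 1] by simp

lemma ucont_seq:
  assumes "ucont f" "\<omega> \<in> X" "\<And>i. \<upsilon> i \<in> X" "\<And>i. agree i \<omega> (\<upsilon> i)"
  shows "(\<lambda>i. f (\<upsilon> i)) \<longlonglongrightarrow> f \<omega>"
proof (rule LIMSEQ_I)
  fix e :: real assume "e > 0"
  then obtain n where n: "\<And>x. x \<in> X \<Longrightarrow> agree n \<omega> x \<Longrightarrow> norm (f \<omega> - f x) < e"
    using assms(1,2) unfolding ucont_def by blast
  have "norm (f (\<upsilon> i) - f \<omega>) < e" if "i \<ge> n" for i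
    using n[OF assms(3) agree_mono[OF assms(4) that]] by (simp add: norm_minus_commute)
  then show "\<exists>no. \<forall>i\<ge>no. norm (f (\<upsilon> i) - f \<omega>) < e" by blast
qed

lemma ucontI_seq:
  assumes "\<And>\<omega> \<upsilon>. \<omega> \<in> X \<Longrightarrow> (\<And>i. \<upsilon> i \<in> X) \<Longrightarrow> (\<And>i. agree i \<omega> (\<upsilon> i)) \<Longrightarrow> (\<lambda>i. f (\<upsilon> i)) \<longlonglongrightarrow> f \<omega>"
  shows "ucont f"
  unfolding ucont_def
proof (intro ballI allI impI, rule ccontr)
  fix \<omega> e assume \<omega>: "\<omega> \<in> X" and e: "0 < (e::real)"
    and "\<not> (\<exists>n. \<forall>\<upsilon>\<in>X. agree n \<omega> \<upsilon> \<longrightarrow> norm (f \<omega> - f \<upsilon>) < e)"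
  then have "\<forall>n. \<exists>\<upsilon>. \<upsilon> \<in> X \<and> agree n \<omega> \<upsilon> \<and> e \<le> norm (f \<omega> - f \<upsilon>)" by (simp add: not_less) blast
  then obtain \<upsilon> where \<upsilon>: "\<And>n. \<upsilon> n \<in> X" "\<And>n. agree n \<omega> (\<upsilon> n)" "\<And>n. e \<le> norm (f \<omega> - f (\<upsilon> n))"
    by metis
  from LIMSEQ_D[OF assms[OF \<omega> \<upsilon>(1,2)] e] obtain n where "norm (f (\<upsilon> n) - f \<omega>) < e" by blast
  then show False using \<upsilon>(3)[of n] by (simp add: norm_minus_commute)
qed

text \<open>\<open>Lop_dominated\<close> varies functions, not base points. The values of
  \<open>f\<close> at preimages of \<open>\<upsilon> (i + k)\<close> are therefore transported to
  the preimages of \<open>\<omega>\<close>, with the ratio of the weights as a factor; for the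
  resulting \<open>F i\<close> one has
  \<open>Lop (F i) \<omega> = Lop f (\<upsilon> (i + k))\<close>. The shift by \<open>k\<close>
  makes the preimage letters coincide and bounds the ratio by \<open>exp \<Phi>\<close>.\<close>

lemma Lop_ucont:
  fixes f :: "(nat \<Rightarrow> 's) \<Rightarrow> 'b::{real_normed_field,banach,second_countable_topology}"
  assumes B: "bd B f" and f: "ucont f" shows "ucont (Lop f)"
proof (rule ucontI_seq)
  fix \<omega> \<upsilon> assume \<omega>: "\<omega> \<in> X" and \<upsilon>: "\<And>i. \<upsilon> i \<in> X" and a: "\<And>i. agree i \<omega> (\<upsilon> i)"
  define c where "c \<omega>' \<longleftrightarrow> shift \<omega>' = \<omega> \<and> \<omega>' 0 \<in> pre \<omega>" for \<omega>'
  define F where "F i \<omega>' = (if c \<omega>' then of_real (exp (\<phi> (prepend (\<omega>' 0) (\<upsilon> (i + k))) - \<phi> \<omega>')) * f (prepend (\<omega>' 0) (\<upsilon> (i + k))) else 0)"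
    for i and \<omega>' :: "nat \<Rightarrow> 's"
  have c: "prepend (\<omega>' 0) \<omega> = \<omega>'" "\<omega>' 0 \<in> pre \<omega>" if "c \<omega>'" for \<omega>'
    using that prepend_shift[of \<omega>'] unfolding c_def by auto
  have ak: "agree (i + k) \<omega> (\<upsilon> (i + k))" for i by (rule a)
  have pre: "pre (\<upsilon> (i + k)) = pre \<omega>" for i
    using pre_agree[OF a[of "i + k"]] k1 by simp
  have pX: "prepend s (\<upsilon> (i + k)) \<in> X" if "s \<in> pre \<omega>" for s i
    using pre_X[OF \<upsilon>] that pre by simp
  have F: "bd (exp \<Phi> * B) (F i)" for i
    unfolding bd_def
  proof
    fix \<omega>' assume "\<omega>' \<in> X"
    show "norm (F i \<omega>') \<le> exp \<Phi> * B"
    proof (cases "c \<omega>'")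
      case True
      have "\<bar>\<phi> (prepend (\<omega>' 0) \<omega>) - \<phi> (prepend (\<omega>' 0) (\<upsilon> (i + k)))\<bar> \<le> \<Phi> * \<theta> ^ Suc (i + k)"
        by (rule phi_diff[OF \<omega> \<upsilon> ak _ c(2)[OF True]]) simp
      also have "\<dots> \<le> \<Phi>" using \<Phi>_nonneg \<theta>_pow_le_1[of "Suc (i + k)"] by (rule mult_left_le[rotated])
      finally have e: "exp (\<phi> (prepend (\<omega>' 0) (\<upsilon> (i + k))) - \<phi> \<omega>') \<le> exp \<Phi>" unfolding c(1)[OF True] by simp
      have "norm (F i \<omega>') = exp (\<phi> (prepend (\<omega>' 0) (\<upsilon> (i + k))) - \<phi> \<omega>') * norm (f (prepend (\<omega>' 0) (\<upsilon> (i + k))))"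
        unfolding F_def if_P[OF True] norm_mult norm_of_real by simp
      also have "\<dots> \<le> exp \<Phi> * B" using e bdD[OF B pX[OF c(2)[OF True]]] by (intro mult_mono) auto
      finally show ?thesis .
    next
      case False
      then show ?thesis using bd_nonneg[OF B] by (simp add: F_def)
    qed
  qed
  have lim: "(\<lambda>i. F i \<omega>') \<longlonglongrightarrow> (if c \<omega>' then f \<omega>' else 0)" if "\<omega>' \<in> X" for \<omega>'
  proof (cases "c \<omega>'")
    case True
    have ag: "agree i \<omega>' (prepend (\<omega>' 0) (\<upsilon> (i + k)))" for i
    proof -
      have "agree (Suc (i + k)) (prepend (\<omega>' 0) \<omega>) (prepend (\<omega>' 0) (\<upsilon> (i + k)))" by (rule agree_prepend[OF ak])
      then have "agree (Suc (i + k)) \<omega>' (prepend (\<omega>' 0) (\<upsilon> (i + k)))" unfolding c(1)[OF True] .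
      then show ?thesis by (rule agree_mono) simp
    qed
    have "(\<lambda>i. \<phi> (prepend (\<omega>' 0) (\<upsilon> (i + k)))) \<longlonglongrightarrow> \<phi> \<omega>'"
      by (rule ucont_seq[OF lip_ucont[OF lip_phi] that pX[OF c(2)[OF True]] ag])
    moreover have "(\<lambda>i. f (prepend (\<omega>' 0) (\<upsilon> (i + k)))) \<longlonglongrightarrow> f \<omega>'"
      by (rule ucont_seq[OF f that pX[OF c(2)[OF True]] ag])
    ultimately have "(\<lambda>i. of_real (exp (\<phi> (prepend (\<omega>' 0) (\<upsilon> (i + k))) - \<phi> \<omega>')) * f (prepend (\<omega>' 0) (\<upsilon> (i + k))))
        \<longlonglongrightarrow> of_real (exp (\<phi> \<omega>' - \<phi> \<omega>')) * f \<omega>'"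
      by (intro tendsto_mult tendsto_of_real tendsto_exp tendsto_diff tendsto_const)
    then show ?thesis using True by (simp add: F_def)
  qed (simp add: F_def)
  from Lop_dominated[OF F lim, of \<omega>] have l: "(\<lambda>i. Lop (F i) \<omega>) \<longlonglongrightarrow> Lop (\<lambda>\<omega>'. if c \<omega>' then f \<omega>' else 0) \<omega>" .
  have cp: "c (prepend s \<omega>)" if "s \<in> pre \<omega>" for s using that by (simp add: c_def)
  have "Lop (F i) \<omega> = Lop f (\<upsilon> (i + k))" for i
    unfolding Lop_in[OF \<omega>] Lop_in[OF \<upsilon>] pre
  proof (rule infsum_cong)
    fix s assume s: "s \<in> pre \<omega>"
    have "exp (\<phi> (prepend s \<omega>)) * exp (\<phi> (prepend s (\<upsilon> (i + k))) - \<phi> (prepend s \<omega>)) = exp (\<phi> (prepend s (\<upsilon> (i + k))))"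
      by (simp add: exp_add[symmetric])
    then show "of_real (exp (\<phi> (prepend s \<omega>))) * F i (prepend s \<omega>) =
        of_real (exp (\<phi> (prepend s (\<upsilon> (i + k))))) * f (prepend s (\<upsilon> (i + k)))"
      unfolding F_def if_P[OF cp[OF s]] mult.assoc[symmetric] of_real_mult[symmetric] prepend_0 by simp
  qed
  moreover have "Lop (\<lambda>\<omega>'. if c \<omega>' then f \<omega>' else 0) \<omega> = Lop f \<omega>"
    unfolding Lop_in[OF \<omega>] by (rule infsum_cong) (simp add: cp)
  ultimately have "(\<lambda>i. Lop f (\<upsilon> (i + k))) \<longlonglongrightarrow> Lop f \<omega>" using l by simp
  then show "(\<lambda>i. Lop f (\<upsilon> i)) \<longlonglongrightarrow> Lop f \<omega>" by (rule LIMSEQ_offset)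
qed

lemma Cb_Lop: "f \<in> Cb_space \<theta> X \<Longrightarrow> Lop f \<in> Cb_space \<theta> X"
proof -
  assume f: "f \<in> Cb_space \<theta> X"
  then obtain B where "ucont f" "bd B f" by (auto simp: Cb_iff bd_def)
  then show ?thesis using Lop_ucont[of B f] bd_Lop[of B f] by (auto simp: Cb_iff bd_def)
qed

lemma Fb_Lop: "f \<in> Fb_space \<theta> X k \<Longrightarrow> Lop f \<in> Fb_space \<theta> X k"
proof -
  assume f: "f \<in> Fb_space \<theta> X k"
  then obtain B C where "lip k C f" "bd B f" by (auto simp: Fb_iff bd_def)
  then have "lip k (C * \<theta> ^ 1 * b 1 + c1 * exp c1 * (b 1 * B)) (Lop f)" "bd (K * B) (Lop f)"
    using Lop_lip[of B f k C] bd_Lop[of B f] by simp_all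
  then show ?thesis by (auto simp: Fb_iff bd_def)
qed

end

context transfer_limit
begin

section \<open>The limit functional is integration against the measure\<close>

lemma ucont_measurable:
  fixes f :: "(nat \<Rightarrow> 'a) \<Rightarrow> 'b::real_normed_vector"
  assumes "ucont f" shows "f \<in> borel_measurable nu"
proof (rule borel_measurableI)
  fix U :: "'b set" assume U: "open U"
  have "openin (theta_topology \<theta> X) (f -` U \<inter> X)"
    unfolding openin_theta
  proof (intro conjI ballI)
    fix \<omega> assume \<omega>: "\<omega> \<in> f -` U \<inter> X"
    then obtain e where e: "e > 0" "\<And>y. dist y (f \<omega>) < e \<Longrightarrow> y \<in> U" using U unfolding open_dist by blast
    then obtain n where n: "\<And>\<upsilon>. \<upsilon> \<in> X \<Longrightarrow> agree n \<omega> \<upsilon> \<Longrightarrow> norm (f \<omega> - f \<upsilon>) < e"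
      using assms \<omega> unfolding ucont_def by blast
    have "\<upsilon> \<in> f -` U \<inter> X" if "\<upsilon> \<in> X" "agree n \<omega> \<upsilon>" for \<upsilon>
      using n[OF that] e(2)[of "f \<upsilon>"] that(1) by (simp add: dist_norm norm_minus_commute)
    then show "\<exists>n. \<forall>\<upsilon>\<in>X. agree n \<omega> \<upsilon> \<longrightarrow> \<upsilon> \<in> f -` U \<inter> X" by blast
  qed simp
  then show "f -` U \<inter> space nu \<in> sets nu" unfolding sets_nu space_nu by (intro sigma_sets.Basic) simp
qed

lemma bd_integrable: "bd B f \<Longrightarrow> f \<in> borel_measurable nu \<Longrightarrow> integrable nu (f :: _ \<Rightarrow> 'b::{banach,second_countable_topology})"
  by (rule nu.integrable_const_bound[of _ B]) (auto simp: bd_def)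

lemma lint_ind: "w \<in> lists S \<Longrightarrow> integrable nu (ind w)" "w \<in> lists S \<Longrightarrow> (\<integral>\<omega>. ind w \<omega> \<partial>nu) = mu w"
proof -
  assume w: "w \<in> lists S"
  show i: "integrable nu (ind w)" using cyl_sets[OF w] by (intro bd_integrable[OF bd_ind]) simp
  have "cylinder X w \<inter> space nu = cylinder X w" by (auto simp: cylinder_def)
  then show "(\<integral>\<omega>. ind w \<omega> \<partial>nu) = mu w" using nu_cyl[OF w] by simp
qed

lemma words_lists: "F \<subseteq> S \<Longrightarrow> w \<in> words F n \<Longrightarrow> w \<in> lists S" by (auto simp: words_def)

lemma tail_words:
  assumes "finite F" "\<omega> \<in> X"
  shows "tail F n \<omega> = 1 - (\<Sum>w\<in>words F n. ind w \<omega>)"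
    and "(\<Sum>w\<in>words F n. c w * ind w \<omega>) = (if tail F n \<omega> = 0 then c (map \<omega> [0..<n]) else 0)"
proof -
  let ?w = "map \<omega> [0..<n]"
  have ind: "ind w \<omega> = (if w = ?w then 1 else 0)" if "w \<in> words F n" for w
  proof -
    have "length w = n" using that by (simp add: words_def)
    then have "\<omega> \<in> cylinder X w \<Longrightarrow> w = ?w" using cylinder_prefix[of \<omega> X w] by blast
    moreover have "\<omega> \<in> cylinder X ?w" using assms(2) by (simp add: cylinder_map)
    ultimately have "\<omega> \<in> cylinder X w \<longleftrightarrow> w = ?w" by metis
    then show ?thesis unfolding indicator_def by (simp only: of_bool_def)
  qed
  have "?w \<in> words F n \<longleftrightarrow> (\<forall>i<n. \<omega> i \<in> F)"
    using words_cover[OF assms(2), of n F] by (auto simp: words_def)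
  then have w: "?w \<in> words F n \<longleftrightarrow> tail F n \<omega> = 0" by (simp add: tail_def)
  show *: "(\<Sum>w\<in>words F n. c w * ind w \<omega>) = (if tail F n \<omega> = 0 then c ?w else 0)" for c
  proof -
    have "(\<Sum>w\<in>words F n. c w * ind w \<omega>) = (\<Sum>w\<in>words F n. if ?w = w then c w else 0)"
      by (rule sum.cong) (use ind in auto)
    also have "\<dots> = (if tail F n \<omega> = 0 then c ?w else 0)"
      unfolding sum.delta'[OF finite_words[OF assms(1)]] using w by (simp split: if_splits)
    finally show ?thesis .
  qed
  show "tail F n \<omega> = 1 - (\<Sum>w\<in>words F n. ind w \<omega>)" using *[of "\<lambda>_. 1"] by (auto simp: tail_def split: if_splits)
qed

lemma ell_words:
  assumes F: "finite F" "F \<subseteq> S"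
  shows "(\<lambda>i. ell (xs i) (us i) (\<lambda>\<omega>. \<Sum>w\<in>words F n. c w * ind w \<omega>)) \<longlonglongrightarrow> (\<Sum>w\<in>words F n. c w * mu w)"
    and "(\<integral>\<omega>. (\<Sum>w\<in>words F n. c w * ind w \<omega>) \<partial>nu) = (\<Sum>w\<in>words F n. c w * mu w)"
    and "integrable nu (\<lambda>\<omega>. \<Sum>w\<in>words F n. c w * ind w \<omega>)"
    and "bd (\<Sum>w\<in>words F n. \<bar>c w\<bar>) (\<lambda>\<omega>. \<Sum>w\<in>words F n. c w * ind w \<omega>)"
proof -
  have b: "bd \<bar>c w\<bar> (\<lambda>\<omega>. c w * ind w \<omega>)" for w using bd_cmult[OF bd_ind, of "c w" w] by simp
  have e: "ell (xs i) (us i) (\<lambda>\<omega>. \<Sum>w\<in>words F n. c w * ind w \<omega>) =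
      (\<Sum>w\<in>words F n. ell (xs i) (us i) (\<lambda>\<omega>. c w * ind w \<omega>)) \<and>
      bd (\<Sum>w\<in>words F n. \<bar>c w\<bar>) (\<lambda>\<omega>. \<Sum>w\<in>words F n. c w * ind w \<omega>)" for i
    by (rule ell_sum[OF finite_words[OF F(1)] b])
  show "bd (\<Sum>w\<in>words F n. \<bar>c w\<bar>) (\<lambda>\<omega>. \<Sum>w\<in>words F n. c w * ind w \<omega>)" using e by blast
  have "ell (xs i) (us i) (\<lambda>\<omega>. \<Sum>w\<in>words F n. c w * ind w \<omega>) = (\<Sum>w\<in>words F n. c w * ell (xs i) (us i) (ind w))" for i
    using e[of i] ell_cmult[OF xs bd_ind us] by simp
  then show "(\<lambda>i. ell (xs i) (us i) (\<lambda>\<omega>. \<Sum>w\<in>words F n. c w * ind w \<omega>)) \<longlonglongrightarrow> (\<Sum>w\<in>words F n. c w * mu w)"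
    by simp (intro tendsto_sum tendsto_mult tendsto_const mu_lim words_lists[OF F(2)])
  show "integrable nu (\<lambda>\<omega>. \<Sum>w\<in>words F n. c w * ind w \<omega>)"
    by (intro Bochner_Integration.integrable_sum integrable_mult_right lint_ind words_lists[OF F(2)])
  have "(\<integral>\<omega>. (\<Sum>w\<in>words F n. c w * ind w \<omega>) \<partial>nu) = (\<Sum>w\<in>words F n. \<integral>\<omega>. c w * ind w \<omega> \<partial>nu)"
    by (intro Bochner_Integration.integral_sum integrable_mult_right lint_ind words_lists[OF F(2)])
  also have "\<dots> = (\<Sum>w\<in>words F n. c w * mu w)"
    by (rule sum.cong) (use lint_ind(2) words_lists[OF F(2)] in auto)
  finally show "(\<integral>\<omega>. (\<Sum>w\<in>words F n. c w * ind w \<omega>) \<partial>nu) = (\<Sum>w\<in>words F n. c w * mu w)" .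
qed

text \<open>\<open>tail F n\<close> is one minus a finite sum of indicators of words, so convergence
  on cylinders suffices although infinitely many cylinders meet its support.\<close>

lemma tail_limit:
  assumes F: "finite F" "F \<subseteq> S"
  shows "(\<lambda>i. ell (xs i) (us i) (tail F n)) \<longlonglongrightarrow> (\<integral>\<omega>. tail F n \<omega> \<partial>nu)" and "integrable nu (tail F n)"
proof -
  note e = ell_words[OF F, where c = "\<lambda>_. 1" and n = n, simplified]
  have i: "integrable nu (\<lambda>\<omega>. 1 - (\<Sum>w\<in>words F n. ind w \<omega>))" using e(3) by simp
  have eq: "ell (xs i) (us i) (tail F n) = 1 - ell (xs i) (us i) (\<lambda>\<omega>. \<Sum>w\<in>words F n. ind w \<omega>)" for i
  proof -
    have "Rx (xs i) (tail F n) (us i) = Rx (xs i) (\<lambda>\<omega>. 1 - (\<Sum>w\<in>words F n. ind w \<omega>)) (us i)"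
      unfolding Rx_def by (rule suminf_cong) (use pow_cong[OF tail_words(1)[OF F(1)] us] in simp)
    then have "ell (xs i) (us i) (tail F n) = ell (xs i) (us i) (\<lambda>\<omega>. 1 - (\<Sum>w\<in>words F n. ind w \<omega>))"
      by (simp add: ell_def)
    also have "\<dots> = 1 - ell (xs i) (us i) (\<lambda>\<omega>. \<Sum>w\<in>words F n. ind w \<omega>)"
      using ell_diff[OF xs bd_one e(4) us] ell_one[OF xs us] by simp
    finally show ?thesis .
  qed
  have "(\<integral>\<omega>. tail F n \<omega> \<partial>nu) = (\<integral>\<omega>. 1 - (\<Sum>w\<in>words F n. ind w \<omega>) \<partial>nu)"
    by (rule Bochner_Integration.integral_cong) (auto simp: tail_words(1)[OF F(1)])
  also have "\<dots> = 1 - (\<Sum>w\<in>words F n. mu w)" using e(2,3) nu.prob_space by simp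
  finally show "(\<lambda>i. ell (xs i) (us i) (tail F n)) \<longlonglongrightarrow> (\<integral>\<omega>. tail F n \<omega> \<partial>nu)"
    unfolding eq using e(1) by (auto intro: tendsto_intros)
  show "integrable nu (tail F n)"
    using i by (rule Bochner_Integration.integrable_cong[THEN iffD1, rotated -1]) (auto simp: tail_words(1)[OF F(1)])
qed

lemma tail_integral_small:
  assumes "\<epsilon> > 0" shows "\<exists>F. finite F \<and> F \<subseteq> S \<and> (\<integral>\<omega>. tail F n \<omega> \<partial>nu) \<le> \<epsilon>"
proof -
  have "0 < \<epsilon> * \<rho> ^ n" using assms \<rho>_pos by simp
  then obtain F where F: "finite F" "F \<subseteq> S" "\<And>\<omega>. \<omega> \<in> X \<Longrightarrow> (Lop ^^ n) (tail F n) \<omega> \<le> \<epsilon> * \<rho> ^ n"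
    using tail_small[of "\<epsilon> * \<rho> ^ n" n] by blast
  have "\<rho> ^ n * (\<integral>\<omega>. tail F n \<omega> \<partial>nu) \<le> \<epsilon> * \<rho> ^ n"
    by (rule ell_limit_le[OF bd_tail _ F(3) tail_limit(1)[OF F(1,2)]]) (auto simp: tail_def)
  then have "(\<integral>\<omega>. tail F n \<omega> \<partial>nu) \<le> \<epsilon>" using \<rho>_pos by (simp add: mult.commute)
  then show ?thesis using F by blast
qed

text \<open>Convergence on cylinders is extended to Lipschitz \<open>f\<close> by step functions
  over the words of a finite alphabet. The error is at most \<open>D * \<epsilon>\<close> on these
  words and \<open>B\<close> elsewhere, where \<open>tail_integral_small\<close> and
  \<open>tail_limit\<close> control the measure and the functionals alike.\<close>

lemma ell_integral:
  fixes f :: "(nat \<Rightarrow> 'a) \<Rightarrow> real"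
  assumes B: "bd B f" and l: "lip j D f"
  shows "(\<lambda>i. ell (xs i) (us i) f) \<longlonglongrightarrow> (\<integral>\<omega>. f \<omega> \<partial>nu)"
proof (rule LIMSEQ_I)
  fix e :: real assume e: "e > 0"
  have D: "0 \<le> D" and B0: "0 \<le> B" using lip_nonneg[OF l] bd_nonneg[OF B] by auto
  \<comment> \<open>The three errors add up to less than
    \<open>2 * D * \<epsilon> + 3 * B * \<epsilon> + \<epsilon>\<close>, which is at most
    \<open>3 * e / 5\<close>; the summand \<open>1\<close> avoids a zero denominator.\<close>
  define \<epsilon> where "\<epsilon> = e / (5 * (D + B + 1))"
  have \<epsilon>: "\<epsilon> > 0" using e D B0 by (simp add: \<epsilon>_def)
  have \<epsilon>e: "\<epsilon> * (D + B + 1) = e / 5" using D B0 unfolding \<epsilon>_def times_divide_eq_left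
    by (subst nonzero_divide_eq_eq) (simp, simp add: algebra_simps)
  obtain n0 where n0: "\<theta> ^ n0 < \<epsilon>" using \<theta>_small[OF \<epsilon>] by blast
  define n where "n = max j n0"
  have n: "j \<le> n" "\<theta> ^ n \<le> \<epsilon>" using \<theta>_decr[of n0 n] n0 by (auto simp: n_def)
  obtain F where F: "finite F" "F \<subseteq> S" "(\<integral>\<omega>. tail F n \<omega> \<partial>nu) \<le> \<epsilon>"
    using tail_integral_small[OF \<epsilon>, of n] by blast
  define h where "h \<omega> = (\<Sum>w\<in>words F n. f (rep w) * ind w \<omega>)" for \<omega>
  note hw = ell_words[OF F(1,2), where c = "\<lambda>w. f (rep w)" and n = n, folded h_def]
  have diff: "\<bar>f \<omega> - h \<omega>\<bar> \<le> D * \<epsilon> + B * tail F n \<omega>" if \<omega>: "\<omega> \<in> X" for \<omega>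
  proof (cases "tail F n \<omega> = 0")
    case True
    have "\<bar>f \<omega> - h \<omega>\<bar> = \<bar>f \<omega> - f (rep (map \<omega> [0..<n]))\<bar>"
      unfolding h_def tail_words(2)[OF F(1) \<omega>] using True by simp
    also have "\<dots> \<le> D * \<theta> ^ n" using lipD[OF l n(1) \<omega>] rep_map[OF \<omega>, of n] by simp
    also have "\<dots> \<le> D * \<epsilon>" using n(2) D by (rule mult_left_mono)
    finally show ?thesis using True by simp
  next
    case False
    then have "h \<omega> = 0" "tail F n \<omega> = 1"
      unfolding h_def tail_words(2)[OF F(1) \<omega>] by (simp, simp add: tail_def split: if_splits)
    moreover have "0 \<le> D * \<epsilon>" using D \<epsilon> by simp
    ultimately show ?thesis using bdD[OF B \<omega>] by simp
  qed
  have bt: "bd (D * \<epsilon> + B) (\<lambda>\<omega>. D * \<epsilon> + B * tail F n \<omega>)"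
    using D \<epsilon> B0 by (auto simp: bd_def tail_def)
  have e1: "\<bar>ell (xs i) (us i) f - ell (xs i) (us i) h\<bar> \<le> D * \<epsilon> + B * ell (xs i) (us i) (tail F n)" for i
  proof -
    have "\<bar>ell (xs i) (us i) (\<lambda>\<omega>. f \<omega> - h \<omega>)\<bar> \<le> ell (xs i) (us i) (\<lambda>\<omega>. D * \<epsilon> + B * tail F n \<omega>)"
      using ell_norm_le[OF xs bt us, of "\<lambda>\<omega>. f \<omega> - h \<omega>" i] diff by simp
    moreover have "ell (xs i) (us i) (\<lambda>\<omega>. D * \<epsilon> * 1 + B * tail F n \<omega>) = D * \<epsilon> * 1 + B * ell (xs i) (us i) (tail F n)"
      using ell_add[OF xs[of i] bd_cmult[where c = "D * \<epsilon>", OF bd_one] bd_cmult[where c = B, OF bd_tail[of F n]] us[of i]]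
        ell_cmult[OF xs[of i] bd_one us[of i], where c = "D * \<epsilon>"] ell_cmult[OF xs[of i] bd_tail us[of i], where c = B]
        ell_one[OF xs[of i] us[of i]] by simp
    ultimately show ?thesis using ell_diff[OF xs B hw(4) us] by simp
  qed
  have fm: "integrable nu f" by (rule bd_integrable[OF B ucont_measurable[OF lip_ucont[OF l]]])
  have e2: "\<bar>(\<integral>\<omega>. f \<omega> \<partial>nu) - (\<integral>\<omega>. h \<omega> \<partial>nu)\<bar> \<le> D * \<epsilon> + B * \<epsilon>"
  proof -
    have fh: "integrable nu (\<lambda>\<omega>. f \<omega> - h \<omega>)" using fm hw(3) by (rule Bochner_Integration.integrable_diff)
    have "\<bar>\<integral>\<omega>. f \<omega> - h \<omega> \<partial>nu\<bar> \<le> (\<integral>\<omega>. \<bar>f \<omega> - h \<omega>\<bar> \<partial>nu)" by (rule integral_abs_bound)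
    also have "\<dots> \<le> (\<integral>\<omega>. D * \<epsilon> + B * tail F n \<omega> \<partial>nu)"
      by (rule Bochner_Integration.integral_mono)
        (use fh tail_limit(2)[OF F(1,2)] diff in \<open>simp_all add: space_nu\<close>)
    also have "\<dots> = D * \<epsilon> + B * (\<integral>\<omega>. tail F n \<omega> \<partial>nu)"
      using tail_limit(2)[OF F(1,2)] nu.prob_space by simp
    also have "\<dots> \<le> D * \<epsilon> + B * \<epsilon>" using F(3) B0 by (intro add_left_mono mult_left_mono)
    finally show ?thesis using fm hw(3) by simp
  qed
  have "eventually (\<lambda>i. ell (xs i) (us i) (tail F n) < 2 * \<epsilon>) sequentially"
    by (rule order_tendstoD(2)[OF tail_limit(1)[OF F(1,2)]]) (use F(3) \<epsilon> in linarith)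
  moreover have "eventually (\<lambda>i. dist (ell (xs i) (us i) h) (\<integral>\<omega>. h \<omega> \<partial>nu) < \<epsilon>) sequentially"
    using tendstoD[OF hw(1) \<epsilon>] unfolding hw(2) .
  ultimately have "eventually (\<lambda>i. norm (ell (xs i) (us i) f - (\<integral>\<omega>. f \<omega> \<partial>nu)) < e) sequentially"
  proof eventually_elim
    case (elim i)
    have "B * ell (xs i) (us i) (tail F n) \<le> B * (2 * \<epsilon>)" using elim(1) B0 by (intro mult_left_mono) auto
    moreover have "\<epsilon> * D + \<epsilon> * B + \<epsilon> = e / 5" using \<epsilon>e by (simp add: algebra_simps)
    moreover have "0 \<le> \<epsilon> * D" "0 \<le> \<epsilon> * B" using \<epsilon> D B0 by auto
    ultimately show ?case using elim(2) e1[of i] e2 \<epsilon> e unfolding dist_real_def real_norm_def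
      by (simp add: mult.commute[of D] mult.commute[of B])
  qed
  then show "\<exists>no. \<forall>i\<ge>no. norm (ell (xs i) (us i) f - (\<integral>\<omega>. f \<omega> \<partial>nu)) < e"
    unfolding eventually_sequentially .
qed

lemma eigenmeasure_lip:
  fixes f :: "(nat \<Rightarrow> 'a) \<Rightarrow> real"
  assumes B: "bd B f" and l: "lip j D f"
  shows "(\<integral>\<omega>. Lop f \<omega> \<partial>nu) = \<rho> * (\<integral>\<omega>. f \<omega> \<partial>nu)"
proof -
  have L: "(\<lambda>i. ell (xs i) (us i) (Lop f)) \<longlonglongrightarrow> (\<integral>\<omega>. Lop f \<omega> \<partial>nu)"
    by (rule ell_integral[OF bd_Lop[OF B] Lop_lip[OF B l]])
  have "(\<lambda>i. f (us i) / Rx (xs i) one (us i)) \<longlonglongrightarrow> 0"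
  proof (rule Lim_null_comparison)
    show "eventually (\<lambda>i. norm (f (us i) / Rx (xs i) one (us i)) \<le> B * (1 / Rx (xs i) one (us i))) sequentially"
      using bdD[OF B us] Rx_one_pos[OF xs us]
      by (intro always_eventually allI) (simp add: divide_right_mono less_imp_le)
    show "(\<lambda>i. B * (1 / Rx (xs i) one (us i))) \<longlonglongrightarrow> 0" using tendsto_mult_right_zero[OF D_lim] .
  qed
  then have "(\<lambda>i. xs i * ell (xs i) (us i) f - f (us i) / Rx (xs i) one (us i)) \<longlonglongrightarrow> \<rho> * (\<integral>\<omega>. f \<omega> \<partial>nu) - 0"
    by (intro tendsto_intros xs_lim ell_integral[OF B l])
  then have "(\<lambda>i. ell (xs i) (us i) (Lop f)) \<longlonglongrightarrow> \<rho> * (\<integral>\<omega>. f \<omega> \<partial>nu)"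
    using ell_Lop[OF xs B us] by simp
  from LIMSEQ_unique[OF L this] show ?thesis .
qed

text \<open>\<open>F n\<close> depends on the first \<open>n\<close> letters only, so it is
  Lipschitz with constant \<open>0\<close> from level \<open>n\<close> on, and it converges
  pointwise to \<open>f\<close>. Dominated convergence, under the integral and inside the operator,
  carries the identity over without any uniformity in the continuity of \<open>f\<close>.\<close>

lemma eigenmeasure_ucont:
  fixes f :: "(nat \<Rightarrow> 'a) \<Rightarrow> real"
  assumes B: "bd B f" and f: "ucont f"
  shows "(\<integral>\<omega>. Lop f \<omega> \<partial>nu) = \<rho> * (\<integral>\<omega>. f \<omega> \<partial>nu)"
proof -
  define F where "F n \<omega> = f (rep (map \<omega> [0..<n]))" for n and \<omega> :: "nat \<Rightarrow> 'a"
  have Fb: "bd B (F n)" for n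
    unfolding bd_def F_def using bdD[OF B] rep_map by blast
  have Fl: "lip n 0 (F n)" for n
    unfolding lip_def
  proof (intro allI impI ballI)
    fix m and \<omega> \<upsilon> :: "nat \<Rightarrow> 'a" assume m: "n \<le> m" "agree m \<omega> \<upsilon>"
    have e: "map \<omega> [0..<n] = map \<upsilon> [0..<n]" using m by (auto simp: agree_def)
    show "norm (F n \<omega> - F n \<upsilon>) \<le> 0 * \<theta> ^ m" unfolding F_def e by simp
  qed
  have lim: "(\<lambda>n. F n \<omega>) \<longlonglongrightarrow> f \<omega>" if "\<omega> \<in> X" for \<omega>
    unfolding F_def by (rule ucont_seq[OF f that]) (use rep_map[OF that] in auto)
  have Llim: "(\<lambda>n. Lop (F n) \<omega>) \<longlonglongrightarrow> Lop f \<omega>" for \<omega>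
    by (rule Lop_dominated[OF Fb lim])
  have Lb: "bd (K * B) (Lop (F n))" for n by (rule bd_Lop[OF Fb])
  have "(\<lambda>n. \<integral>\<omega>. F n \<omega> \<partial>nu) \<longlonglongrightarrow> (\<integral>\<omega>. f \<omega> \<partial>nu)"
    by (rule integral_dominated_convergence[where w = "\<lambda>_. B"])
      (use Fb lim ucont_measurable[OF f] ucont_measurable[OF lip_ucont[OF Fl]] in \<open>auto simp: bd_def\<close>)
  then have 1: "(\<lambda>n. \<rho> * (\<integral>\<omega>. F n \<omega> \<partial>nu)) \<longlonglongrightarrow> \<rho> * (\<integral>\<omega>. f \<omega> \<partial>nu)" by (rule tendsto_mult_left)
  have "(\<lambda>n. \<integral>\<omega>. Lop (F n) \<omega> \<partial>nu) \<longlonglongrightarrow> (\<integral>\<omega>. Lop f \<omega> \<partial>nu)"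
    by (rule integral_dominated_convergence[where w = "\<lambda>_. K * B"])
      (use Lb Llim ucont_measurable[OF Lop_ucont[OF B f]] ucont_measurable[OF Lop_ucont[OF Fb lip_ucont[OF Fl]]] in \<open>auto simp: bd_def\<close>)
  then have 2: "(\<lambda>n. \<rho> * (\<integral>\<omega>. F n \<omega> \<partial>nu)) \<longlonglongrightarrow> (\<integral>\<omega>. Lop f \<omega> \<partial>nu)"
    unfolding eigenmeasure_lip[OF Fb Fl] .
  from LIMSEQ_unique[OF 2 1] show ?thesis .
qed

theorem eigenmeasure:
  assumes "f \<in> Cb_space \<theta> X"
  shows "(\<integral>\<omega>. Lop f \<omega> \<partial>nu) = of_real \<rho> * (\<integral>\<omega>. f \<omega> \<partial>nu)"
proof -
  obtain B where B: "bd B f" and f: "ucont f" using assms by (auto simp: Cb_iff bd_def)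
  let ?R = "\<lambda>\<omega>. Re (f \<omega>)" and ?I = "\<lambda>\<omega>. Im (f \<omega>)"
  have bR: "bd B ?R" and bI: "bd B ?I"
    using B abs_Re_le_cmod abs_Im_le_cmod by (auto simp: bd_def intro: order_trans)
  have cR: "ucont ?R" and cI: "ucont ?I"
    using f abs_Re_le_cmod abs_Im_le_cmod unfolding ucont_def real_norm_def minus_complex.simps[symmetric]
    by (meson le_less_trans)+
  have L: "Lop f \<omega> = of_real (Lop ?R \<omega>) + \<i> * of_real (Lop ?I \<omega>)" for \<omega>
  proof -
    have b1: "bd B (\<lambda>\<omega>. complex_of_real (?R \<omega>))" and b2: "bd B (\<lambda>\<omega>. complex_of_real (?I \<omega>))"
      using bR bI by (auto simp: bd_def)
    have "Lop f \<omega> = Lop (\<lambda>\<omega>. complex_of_real (?R \<omega>) + \<i> * complex_of_real (?I \<omega>)) \<omega>"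
      by (simp add: complex_eq[symmetric])
    also have "\<dots> = Lop (\<lambda>\<omega>. complex_of_real (?R \<omega>)) \<omega> + \<i> * Lop (\<lambda>\<omega>. complex_of_real (?I \<omega>)) \<omega>"
      using Lop_add[OF b1 bd_cmult[OF b2, of \<i>]] by (simp add: Lop_cmult)
    finally show ?thesis by (simp add: Lop_of_real[OF bR] Lop_of_real[OF bI])
  qed
  have m: "integrable nu ?R" "integrable nu ?I" "integrable nu (Lop ?R)" "integrable nu (Lop ?I)"
    by (intro bd_integrable[OF bR] bd_integrable[OF bI] bd_integrable[OF bd_Lop[OF bR]]
        bd_integrable[OF bd_Lop[OF bI]] ucont_measurable Lop_ucont[OF bR] Lop_ucont[OF bI] cR cI)+
  have "(\<integral>\<omega>. Lop f \<omega> \<partial>nu) = of_real (\<integral>\<omega>. Lop ?R \<omega> \<partial>nu) + \<i> * of_real (\<integral>\<omega>. Lop ?I \<omega> \<partial>nu)"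
    unfolding L using m by (subst Bochner_Integration.integral_add) auto
  also have "\<dots> = of_real \<rho> * (of_real (\<integral>\<omega>. ?R \<omega> \<partial>nu) + \<i> * of_real (\<integral>\<omega>. ?I \<omega> \<partial>nu))"
    by (simp add: eigenmeasure_ucont[OF bR cR] eigenmeasure_ucont[OF bI cI] algebra_simps)
  also have "of_real (\<integral>\<omega>. ?R \<omega> \<partial>nu) + \<i> * of_real (\<integral>\<omega>. ?I \<omega> \<partial>nu) =
      (\<integral>\<omega>. of_real (?R \<omega>) + \<i> * of_real (?I \<omega>) \<partial>nu)"
    using m by (subst Bochner_Integration.integral_add) auto
  also have "\<dots> = (\<integral>\<omega>. f \<omega> \<partial>nu)" by (simp add: complex_eq[symmetric])
  finally show ?thesis .
qed

end

section \<open>Spectral radius\<close>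

lemma (in fun_space) eigenvalue_in_spectrum:
  assumes T: "blin T" and "eigenvalue V T p" shows "p \<in> spectrum V N T"
proof (rule ccontr)
  assume "p \<notin> spectrum V N T"
  then obtain R where R: "\<forall>f\<in>V. R (cscale p f - T f) = f"
    unfolding spectrum_def by blast
  obtain g where g: "g \<in> V" "g \<noteq> 0" "T g = cscale p g"
    using assms(2) by (auto simp: eigenvalue_def eigenspace_def)
  have "T (cscale 0 0) = cscale 0 (T 0)" by (rule blinD(3)[OF T zero_mem])
  then have "T 0 = 0" by (simp add: cfun.scale_zero_left)
  then have "R 0 = 0" using bspec[OF R zero_mem] by simp
  moreover have "R 0 = g" using bspec[OF R g(1)] g(3) by simp
  ultimately show False using g(2) by simp
qed

text \<open>Beyond \<open>r\<close> the Neumann series converges by the growth bounds, and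
  \<open>r\<close> itself is an eigenvalue; so the supremum of the moduli is attained at
  \<open>r\<close>.\<close>

lemma (in fun_space) spectral_radius_eq:
  assumes T: "blin T" and g: "g \<in> V" "g \<noteq> 0" "T g = cscale (of_real r) g" and r: "0 \<le> r"
    and c: "\<And>i f. f \<in> V \<Longrightarrow> N ((T ^^ i) f) \<le> c i * N f"
    and growth: "\<And>x. r < x \<Longrightarrow> \<exists>C. \<forall>i. c i \<le> C * x ^ i"
  shows "spectral_radius V N T = r"
proof -
  have "cmod z \<le> r" if z: "z \<in> spectrum V N T" for z
  proof (rule ccontr)
    assume "\<not> cmod z \<le> r"
    then obtain x where x: "r < x" "x < cmod z" using dense not_le by blast
    obtain C where C: "\<And>i. c i \<le> C * x ^ i" using growth[OF x(1)] by blast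
    have x0: "0 < x" using x r by linarith
    have "z \<notin> spectrum V N T"
    proof (rule not_in_spectrum_power[OF T])
      show "N ((T ^^ i) f) \<le> C * x ^ i * N f" if "f \<in> V" for i f
        using c[OF that, of i] mult_right_mono[OF C[of i] N_nonneg[OF that]] by linarith
      have nz: "0 < cmod z" using x x0 by linarith
      have "summable (\<lambda>i. C * (x / cmod z) ^ i)"
        using x x0 by (intro summable_mult summable_geometric) (simp add: pos_divide_less_eq[OF nz])
      then show "summable (\<lambda>i. C * x ^ i / cmod z ^ i)" by (simp add: power_divide)
      show "z \<noteq> 0" using x x0 by auto
    qed
    with z show False by blast
  qed
  moreover have "of_real r \<in> spectrum V N T"
    by (rule eigenvalue_in_spectrum[OF T]) (use g T in \<open>auto simp: eigenvalue_def eigenspace_def\<close>)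
  ultimately show ?thesis
    unfolding spectral_radius_def using r by (intro cSup_eq_maximum) force+
qed

context transfer_setup
begin

sublocale Cb: fun_space "Cb_space \<theta> X" "sup_norm X" by (rule Cb_fun_space)
sublocale Fb: fun_space "Fb_space \<theta> X k" "Fb_norm \<theta> X k" by (rule Fb_fun_space)

lemma Cb_bd: "f \<in> Cb_space \<theta> X \<Longrightarrow> bd (sup_norm X f) f"
  by (simp add: bd_def Cb_sup_norm)

lemma Fb_bd: "f \<in> Fb_space \<theta> X k \<Longrightarrow> bd (sup_norm X f) f"
  by (rule Cb_bd[OF Fb_Cb])

lemma Lop_linear:
  fixes f g :: "(nat \<Rightarrow> 's) \<Rightarrow> complex"
  shows "bd B f \<Longrightarrow> bd C g \<Longrightarrow> Lop (f + g) = Lop f + Lop g" "Lop (cscale c f) = cscale c (Lop f)"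
proof -
  show "Lop (f + g) = Lop f + Lop g" if "bd B f" "bd C g"
    unfolding plus_fun_def using Lop_add[OF that] by (intro ext)
  show "Lop (cscale c f) = cscale c (Lop f)" unfolding cscale_def by (intro ext Lop_cmult)
qed

lemma Cb_pow_le: "f \<in> Cb_space \<theta> X \<Longrightarrow> sup_norm X ((Lop ^^ i) f) \<le> b i * sup_norm X f"
  using bdD[OF bd_pow_b[OF Cb_bd]] by (intro sup_norm_le)

lemma Fb_norm_parts:
  assumes "f \<in> Fb_space \<theta> X k"
  shows "sup_norm X f \<le> Fb_norm \<theta> X k f" "0 \<le> sup_norm X f"
  using sup_norm_nonneg[OF Fb_Cb[OF assms]] by (auto simp: Fb_norm_def)

lemma Fb_pow_le:
  assumes f: "f \<in> Fb_space \<theta> X k"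
  shows "Fb_norm \<theta> X k ((Lop ^^ i) f) \<le> (1 + c1 * exp c1) * b i * Fb_norm \<theta> X k f"
proof -
  let ?B = "sup_norm X f" and ?D = "enn2real (theta_seminorm \<theta> X k f)"
  have "lip (max k (k - i)) (?D * \<theta> ^ i * b i + c1 * exp c1 * (b i * ?B)) ((Lop ^^ i) f)"
    by (rule pow_lip[OF Fb_bd[OF f] Fb_lip[OF f]])
  then have l: "lip k (?D * \<theta> ^ i * b i + c1 * exp c1 * (b i * ?B)) ((Lop ^^ i) f)" by simp
  have "Fb_norm \<theta> X k ((Lop ^^ i) f) \<le> b i * ?B + (?D * \<theta> ^ i * b i + c1 * exp c1 * (b i * ?B))"
    by (rule Fb_norm_le[OF l bdD[OF bd_pow_b[OF Fb_bd[OF f]]]])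
  also have "?D * \<theta> ^ i * b i \<le> ?D * 1 * b i"
    using \<theta>_pow_le_1 b_nonneg by (intro mult_right_mono mult_left_mono) auto
  also have "b i * ?B + (?D * 1 * b i + c1 * exp c1 * (b i * ?B)) \<le> (1 + c1 * exp c1) * b i * (?B + ?D)"
    using c1_nonneg b_nonneg[of i] by (simp add: algebra_simps)
  finally show ?thesis by (simp add: Fb_norm_def)
qed

lemma Cb_blin: "Cb.blin Lop"
  unfolding Cb.blin_def
proof (intro conjI ballI allI)
  show "\<exists>K\<ge>0. \<forall>f\<in>Cb_space \<theta> X. sup_norm X (Lop f) \<le> K * sup_norm X f"
    using Cb_pow_le[of _ 1] b_nonneg[of 1] by (intro exI[of _ "b 1"]) simp
qed (use Cb_Lop Lop_linear Cb_bd in blast)+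

lemma Fb_blin: "Fb.blin Lop"
  unfolding Fb.blin_def
proof (intro conjI ballI allI)
  show "\<exists>K\<ge>0. \<forall>f\<in>Fb_space \<theta> X k. Fb_norm \<theta> X k (Lop f) \<le> K * Fb_norm \<theta> X k f"
    using Fb_pow_le[of _ 1] b_nonneg[of 1] c1_nonneg by (intro exI[of _ "(1 + c1 * exp c1) * b 1"]) simp
qed (use Fb_Lop Lop_linear Fb_bd in blast)+

end

context transfer_limit
begin

text \<open>Divided by its supremum, because a pointwise limit of functions with supremum one may
  have a smaller one when \<open>X\<close> is not compact.\<close>

definition g where "g \<omega> = complex_of_real (g0 \<omega> / (SUP \<omega>\<in>X. g0 \<omega>))"

lemma g0_Sup: "0 < (SUP \<omega>\<in>X. g0 \<omega>)" "\<omega> \<in> X \<Longrightarrow> g0 \<omega> \<le> (SUP \<omega>\<in>X. g0 \<omega>)"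
proof -
  have bdd: "bdd_above (g0 ` X)" using g0_range by (intro bdd_aboveI[of _ 1]) auto
  show le: "\<omega> \<in> X \<Longrightarrow> g0 \<omega> \<le> (SUP \<omega>\<in>X. g0 \<omega>)" for \<omega> by (rule cSUP_upper[OF _ bdd])
  obtain \<omega> where "\<omega> \<in> X" "0 < g0 \<omega>" using g0_nonzero by blast
  then show "0 < (SUP \<omega>\<in>X. g0 \<omega>)" using le[of \<omega>] by linarith
qed

lemma g0_out: "\<omega> \<notin> X \<Longrightarrow> g0 \<omega> = 0" by (simp add: g0_def)

lemma Lop_g: "Lop g = cscale (of_real \<rho>) g"
proof
  fix \<omega>
  have b: "bd 1 g0" using g0_range by (simp add: bd_def)
  have g: "g = (\<lambda>\<omega>. of_real (1 / (SUP \<omega>\<in>X. g0 \<omega>)) * of_real (g0 \<omega>))" by (auto simp: g_def fun_eq_iff)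
  show "Lop g \<omega> = cscale (of_real \<rho>) g \<omega>"
    unfolding cscale_def g Lop_cmult Lop_of_real[OF b] Lop_g0 by simp
qed

lemma lip_g0: "lip k (c1 * exp c1) g0"
  unfolding lip_def
proof (intro allI impI ballI)
  fix n \<omega> \<upsilon> assume n: "k \<le> n" and \<omega>: "\<omega> \<in> X" and \<upsilon>: "\<upsilon> \<in> X" and a: "agree n \<omega> \<upsilon>"
  let ?e = "exp (c1 * \<theta> ^ n)"
  have e: "0 \<le> ?e - 1" using c1_nonneg by simp
  have "g0 \<omega> - g0 \<upsilon> \<le> (?e - 1) * g0 \<upsilon>" "g0 \<upsilon> - g0 \<omega> \<le> (?e - 1) * g0 \<omega>"
    using g0_cone[OF n \<omega> \<upsilon> a] g0_cone[OF n \<upsilon> \<omega> agree_sym[OF a]] by (simp_all add: algebra_simps)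
  moreover have "(?e - 1) * g0 \<upsilon> \<le> ?e - 1" "(?e - 1) * g0 \<omega> \<le> ?e - 1"
    using g0_range \<omega> \<upsilon> e by (intro mult_left_le; simp)+
  ultimately show "norm (g0 \<omega> - g0 \<upsilon>) \<le> c1 * exp c1 * \<theta> ^ n" using exp_cone_le[of n] by simp
qed

lemma lip_g: "lip k (c1 * exp c1 / (SUP \<omega>\<in>X. g0 \<omega>)) g"
  unfolding lip_def
proof (intro allI impI ballI)
  fix n \<omega> \<upsilon> assume n: "k \<le> n" and \<omega>: "\<omega> \<in> X" and \<upsilon>: "\<upsilon> \<in> X" and a: "agree n \<omega> \<upsilon>"
  have "g \<omega> - g \<upsilon> = of_real ((g0 \<omega> - g0 \<upsilon>) / (SUP \<omega>\<in>X. g0 \<omega>))" by (simp add: g_def diff_divide_distrib)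
  then have "norm (g \<omega> - g \<upsilon>) = \<bar>g0 \<omega> - g0 \<upsilon>\<bar> / (SUP \<omega>\<in>X. g0 \<omega>)" using g0_Sup(1) by (simp only: norm_of_real abs_divide)
  also have "\<dots> \<le> c1 * exp c1 * \<theta> ^ n / (SUP \<omega>\<in>X. g0 \<omega>)"
    using lipD[OF lip_g0 n \<omega> \<upsilon> a] g0_Sup(1) by (intro divide_right_mono) auto
  finally show "norm (g \<omega> - g \<upsilon>) \<le> c1 * exp c1 / (SUP \<omega>\<in>X. g0 \<omega>) * \<theta> ^ n" by simp
qed

lemma norm_g: "cmod (g \<omega>) = g0 \<omega> / (SUP \<omega>\<in>X. g0 \<omega>)"
proof -
  have "0 \<le> g0 \<omega>" using g0_range[of \<omega>] g0_out[of \<omega>] by (cases "\<omega> \<in> X") auto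
  then show ?thesis unfolding g_def norm_of_real using g0_Sup(1) by simp
qed

lemma norm_g_le: "\<omega> \<in> X \<Longrightarrow> cmod (g \<omega>) \<le> 1"
  unfolding norm_g using g0_Sup by simp

lemma g_Fb: "g \<in> Fb_space \<theta> X k"
  unfolding Fb_iff using norm_g_le lip_g g0_out by (auto simp: g_def)

lemma g_nonzero: "g \<noteq> 0"
proof
  obtain \<omega> where "\<omega> \<in> X" "0 < g0 \<omega>" using g0_nonzero by blast
  moreover assume "g = 0"
  ultimately show False using norm_g[of \<omega>] g0_Sup(1) by simp
qed

lemma sup_norm_g: "sup_norm X g = 1"
proof -
  let ?s = "SUP \<omega>\<in>X. g0 \<omega>"
  have 1: "sup_norm X g \<le> 1" by (rule sup_norm_le[OF norm_g_le])
  have "?s \<le> ?s * sup_norm X g"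
  proof (rule cSUP_least)
    fix \<omega> assume "\<omega> \<in> X"
    then have "cmod (g \<omega>) \<le> sup_norm X g" using Cb_sup_norm[OF Fb_Cb[OF g_Fb]] by blast
    then show "g0 \<omega> \<le> ?s * sup_norm X g" unfolding norm_g using g0_Sup(1) by (simp add: field_simps)
  qed (rule X_ne)
  then show ?thesis using 1 g0_Sup(1) by simp
qed

lemma g_cone: "g \<in> Lambda_cone \<theta> X k c1"
  unfolding Lambda_cone_def
proof (intro CollectI conjI ballI)
  show "g \<in> C_space \<theta> X" using Fb_Cb[OF g_Fb] by (simp add: Cb_space_def)
  show "g \<omega> \<in> \<real>\<^sub>\<ge>\<^sub>0" if "\<omega> \<in> X" for \<omega>
    using g0_range[OF that] g0_Sup(1) by (simp add: g_def nonneg_Reals_of_real_iff)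
  fix \<upsilon> \<omega> assume \<upsilon>: "\<upsilon> \<in> X" and "\<omega> \<in> cylinder X (map \<upsilon> [0..<k])"
  then have \<omega>: "\<omega> \<in> X" "agree k \<omega> \<upsilon>" by (simp_all add: cylinder_map)
  show "Re (g \<omega>) \<le> exp (c1 * d_theta \<theta> \<omega> \<upsilon>) * Re (g \<upsilon>)"
  proof (cases "\<omega> = \<upsilon>")
    case True
    then show ?thesis by (simp add: d_theta_def)
  next
    case False
    obtain m where m: "k \<le> m" "agree m \<omega> \<upsilon>" "d_theta \<theta> \<omega> \<upsilon> = \<theta> ^ m"
      by (rule d_theta_agree[OF \<omega>(2) False])
    show ?thesis using g0_cone[OF m(1) \<omega>(1) \<upsilon> m(2)] g0_Sup(1)
      unfolding m(3) g_def by (simp add: divide_right_mono)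
  qed
qed

lemma spectral_radius_Cb: "spectral_radius (Cb_space \<theta> X) (sup_norm X) Lop = \<rho>"
  by (rule Cb.spectral_radius_eq[OF Cb_blin Fb_Cb[OF g_Fb] g_nonzero Lop_g _ Cb_pow_le])
    (use \<rho>_pos b_growth in \<open>auto simp: less_imp_le\<close>)

lemma spectral_radius_Fb: "spectral_radius (Fb_space \<theta> X k) (Fb_norm \<theta> X k) Lop = \<rho>"
proof (rule Fb.spectral_radius_eq[OF Fb_blin g_Fb g_nonzero Lop_g _ Fb_pow_le])
  show "0 \<le> \<rho>" using \<rho>_pos by simp
  fix x assume "\<rho> < x"
  then obtain C where C: "\<And>i. b i \<le> C * x ^ i" using b_growth by blast
  have "(1 + c1 * exp c1) * b i \<le> (1 + c1 * exp c1) * C * x ^ i" for i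
    unfolding mult.assoc using C c1_nonneg by (intro mult_left_mono) auto
  then show "\<exists>C. \<forall>i. (1 + c1 * exp c1) * b i \<le> C * x ^ i" by blast
qed

end

section \<open>Pressure\<close>

lemma sum_prod_list:
  fixes e :: "'s \<Rightarrow> real"
  assumes "finite F"
  shows "(\<Sum>w | w \<in> lists F \<and> length w = n. prod_list (map e w)) = (\<Sum>s\<in>F. e s) ^ n"
proof (induction n)
  case 0
  have "{w. w \<in> lists F \<and> length w = 0} = {[]}" by auto
  then show ?case by simp
next
  case (Suc n)
  let ?W = "{w. w \<in> lists F \<and> length w = n}"
  have eq: "{w. w \<in> lists F \<and> length w = Suc n} = (\<lambda>(s, w). s # w) ` (F \<times> ?W)"
    by (auto simp: length_Suc_conv image_iff)
  have "(\<Sum>w | w \<in> lists F \<and> length w = Suc n. prod_list (map e w)) =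
      (\<Sum>p\<in>F \<times> ?W. prod_list (map e (case p of (s, w) \<Rightarrow> s # w)))"
    unfolding eq by (rule sum.reindex_cong[OF _ refl]) (auto simp: inj_on_def)
  also have "\<dots> = (\<Sum>s\<in>F. \<Sum>w\<in>?W. e s * prod_list (map e w))"
    unfolding sum.cartesian_product by (rule sum.cong) auto
  also have "\<dots> = (\<Sum>s\<in>F. e s) * (\<Sum>w\<in>?W. prod_list (map e w))" by (rule sum_product[symmetric])
  finally show ?case using Suc by simp
qed

lemma foldr_prepend_nth: "foldr prepend w \<omega> i = (if i < length w then w ! i else \<omega> (i - length w))"
proof (induction w arbitrary: i)
  case (Cons s w)
  then show ?case by (cases i) auto
qed simp

context transfer_setup
begin

lemma exp_birkhoff_le: "\<omega> \<in> X \<Longrightarrow> exp (birkhoff_sum \<phi> n \<omega>) \<le> (\<Prod>i<n. E (\<omega> i))"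
proof (induction n)
  case (Suc n)
  have "exp (\<phi> ((shift ^^ n) \<omega>)) \<le> E (\<omega> n)"
    using exp_phi_le[OF X_shift_pow[OF Suc.prems, of n]] by (simp add: funpow_shift)
  then show ?case using Suc by (auto simp: birkhoff_sum_def exp_add intro!: mult_mono prod_nonneg)
qed (simp add: birkhoff_sum_def)

lemma sum_E_words:
  assumes G: "finite G" "G \<subseteq> {w. w \<in> lists S \<and> length w = n}"
  shows "(\<Sum>w\<in>G. prod_list (map E w)) \<le> K ^ n"
proof -
  define F where "F = (\<Union>w\<in>G. set w)"
  have F: "finite F" "F \<subseteq> S" using G by (auto simp: F_def)
  have pos: "0 \<le> prod_list (map E w)" for w by (induction w) auto
  have "(\<Sum>w\<in>G. prod_list (map E w)) \<le> (\<Sum>w | w \<in> lists F \<and> length w = n. prod_list (map E w))"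
  proof (rule sum_mono2)
    show "finite {w. w \<in> lists F \<and> length w = n}" using finite_lists_length_eq[OF F(1)] by (simp add: lists_eq_set)
    show "G \<subseteq> {w. w \<in> lists F \<and> length w = n}" using G(2) by (auto simp: F_def)
  qed (rule pos)
  also have "\<dots> = (\<Sum>s\<in>F. E s) ^ n" by (rule sum_prod_list[OF F(1)])
  also have "\<dots> \<le> K ^ n"
  proof (rule power_mono)
    show "(\<Sum>s\<in>F. E s) \<le> K" unfolding K_def by (rule finite_sum_le_infsum[OF E_summable F]) simp
  qed (simp add: sum_nonneg)
  finally show ?thesis .
qed

lemma ind_cone:
  assumes "length w \<le> n" "k \<le> m" "\<omega> \<in> X" "\<upsilon> \<in> X" "agree m \<omega> \<upsilon>"
  shows "(Lop ^^ n) (ind w) \<omega> \<le> exp (c1 * \<theta> ^ m) * (Lop ^^ n) (ind w) \<upsilon>"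
proof (rule cone_pow[where t = n, OF _ bd_ind _ assms(2) _ assms(3-5)])
  fix j \<omega> \<upsilon> assume j: "n \<le> j" "\<omega> \<in> X" "\<upsilon> \<in> X" "agree j \<omega> \<upsilon>"
  then have "ind w \<omega> = ind w \<upsilon>" using assms(1) by (auto simp: indicator_def cylinder_def agree_def)
  then show "ind w \<omega> \<le> exp (c1 * \<theta> ^ j) * ind w \<upsilon>"
    using c1_nonneg by (auto simp: indicator_def)
qed auto

lemma sum_ind_le:
  assumes "finite G" "\<And>w. w \<in> G \<Longrightarrow> length w = n" "\<omega> \<in> X"
  shows "(\<Sum>w\<in>G. (Lop ^^ m) (ind w) \<omega>) \<le> b m"
proof -
  have ps: "(Lop ^^ m) (\<lambda>\<omega>. \<Sum>w\<in>G. ind w \<omega>) = (\<lambda>\<omega>. \<Sum>w\<in>G. (Lop ^^ m) (ind w) \<omega>) \<and>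
      bd (\<Sum>w\<in>G. 1) (\<lambda>\<omega>. \<Sum>w\<in>G. ind w \<omega>)"
    by (rule pow_sum[OF assms(1) bd_ind])
  have le: "(\<Sum>w\<in>G. ind w \<upsilon>) \<le> 1" for \<upsilon>
  proof -
    have "(\<Sum>w\<in>G. ind w \<upsilon>) \<le> (\<Sum>w\<in>G. if map \<upsilon> [0..<n] = w then 1 else 0)"
    proof (rule sum_mono)
      fix w assume "w \<in> G"
      then show "ind w \<upsilon> \<le> (if map \<upsilon> [0..<n] = w then 1 else (0::real))"
        using assms(2) cylinder_prefix[of \<upsilon> X w] by (auto simp: indicator_def)
    qed
    also have "\<dots> \<le> 1" using assms(1) by simp
    finally show ?thesis .
  qed
  have "(Lop ^^ m) (\<lambda>\<omega>. \<Sum>w\<in>G. ind w \<omega>) \<omega> \<le> (Lop ^^ m) (\<lambda>_. 1) \<omega>"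
    by (rule pow_mono[OF le conjunct2[OF ps] bd_one assms(3)])
  then show ?thesis using ps Ln_le_b[OF assms(3), of m] by (simp add: Ln_def)
qed

definition Zset where "Zset n = {w \<in> lists S. length w = n \<and> cylinder XM w \<noteq> {}}"
definition zw where "zw n w = exp (SUP \<omega>\<in>cylinder XM w. birkhoff_sum \<phi> n \<omega>)"
definition Z where "Z n = infsum (zw n) (Zset n)"

lemma birkhoff_bdd: "bdd_above (birkhoff_sum \<phi> n ` cylinder XM w)" 
  and birkhoff_le: "\<omega> \<in> XM \<Longrightarrow> exp (birkhoff_sum \<phi> n \<omega>) \<le> b n"
proof -
  show le: "exp (birkhoff_sum \<phi> n \<omega>) \<le> b n" if \<omega>: "\<omega> \<in> XM" for \<omega>
  proof -
    have "exp (birkhoff_sum \<phi> n \<omega>) * 1 \<le> Ln n ((shift ^^ n) \<omega>)"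
      unfolding Ln_def by (rule pow_ge_term[OF _ bd_one]) (use \<omega> XM_sub XM_iff in auto)
    also have "\<dots> \<le> b n" using Ln_le_b[OF X_shift_pow] \<omega> XM_sub by blast
    finally show ?thesis by simp
  qed
  show "bdd_above (birkhoff_sum \<phi> n ` cylinder XM w)"
  proof (rule bdd_aboveI2)
    fix \<omega> assume "\<omega> \<in> cylinder XM w"
    then have "\<omega> \<in> XM" by (simp add: cylinder_def)
    from le[OF this] show "birkhoff_sum \<phi> n \<omega> \<le> ln (b n)"
      using exp_gt_zero[of "birkhoff_sum \<phi> n \<omega>"] by (subst ln_ge_iff) linarith+
  qed
qed

lemma birkhoff_sum_add: "birkhoff_sum f (m + n) \<omega> = birkhoff_sum f m \<omega> + birkhoff_sum f n ((shift ^^ m) \<omega>)"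
proof (induction n)
  case (Suc n)
  have "(shift ^^ (m + n)) \<omega> = (shift ^^ n) ((shift ^^ m) \<omega>)" by (simp add: fun_eq_iff funpow_shift add_ac)
  then show ?case using Suc by (simp add: birkhoff_sum_def)
qed (simp add: birkhoff_sum_def)

text \<open>The word is cut into \<open>take m w\<close>, treated by the operator, and its last
  \<open>k\<close> letters, treated by the crude bound \<open>E\<close>. Those \<open>k\<close>
  letters fix the base point to depth \<open>k\<close>, so \<open>ind_cone\<close> replaces it by
  \<open>rep (drop m w)\<close> at the cost of \<open>exp c1\<close>, and the bound no longer
  depends on the point of the cylinder.\<close>

lemma zw_le:
  assumes w: "w \<in> Zset (m + k)"
  shows "zw (m + k) w \<le> exp c1 * (prod_list (map E (drop m w)) * (Lop ^^ m) (ind (take m w)) (rep (drop m w)))"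
    and "rep (drop m w) \<in> X"
proof -
  have len: "length w = m + k" using w by (simp add: Zset_def)
  have ne: "cylinder XM w \<noteq> {}" using w by (simp add: Zset_def)
  let ?v = "drop m w" and ?u = "take m w"
  have sv: "(shift ^^ m) \<omega> \<in> cylinder X ?v" if "\<omega> \<in> cylinder XM w" for \<omega>
    using that X_shift_pow[of \<omega> m] XM_sub len by (auto simp: cylinder_def funpow_shift add.commute)
  have r: "rep ?v \<in> cylinder X ?v" using ne rep[OF sv] by blast
  then show rX: "rep ?v \<in> X" by (simp add: cylinder_def)
  let ?B = "exp c1 * (prod_list (map E ?v) * (Lop ^^ m) (ind ?u) (rep ?v))"
  have B: "exp (birkhoff_sum \<phi> (m + k) \<omega>) \<le> ?B" if \<omega>: "\<omega> \<in> cylinder XM w" for \<omega>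
  proof -
    have \<omega>X: "\<omega> \<in> X" "\<omega> \<in> XM" using \<omega> XM_sub by (auto simp: cylinder_def)
    have "ind ?u \<omega> = 1" using \<omega> \<omega>X len by (auto simp: cylinder_def)
    then have 1: "exp (birkhoff_sum \<phi> m \<omega>) \<le> (Lop ^^ m) (ind ?u) ((shift ^^ m) \<omega>)"
      using pow_ge_term[of "ind ?u" 1 \<omega> m] bd_ind \<omega>X by (simp add: XM_iff)
    have "agree (length ?v) ((shift ^^ m) \<omega>) (rep ?v)" by (rule cylinder_agree[OF sv[OF \<omega>] r])
    then have a: "agree k ((shift ^^ m) \<omega>) (rep ?v)" using len by simp
    have "(Lop ^^ m) (ind ?u) ((shift ^^ m) \<omega>) \<le> exp (c1 * \<theta> ^ k) * (Lop ^^ m) (ind ?u) (rep ?v)"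
      by (rule ind_cone[OF _ _ X_shift_pow[OF \<omega>X(1)] rX a]) auto
    also have "\<dots> \<le> exp c1 * (Lop ^^ m) (ind ?u) (rep ?v)"
      using c1_nonneg \<theta>_pow_le_1 pow_nonneg[of "ind ?u", OF _ rX] by (intro mult_right_mono) (auto simp: mult_left_le)
    finally have 2: "exp (birkhoff_sum \<phi> m \<omega>) \<le> exp c1 * (Lop ^^ m) (ind ?u) (rep ?v)" using 1 by simp
    have "(\<Prod>i<k. E ((shift ^^ m) \<omega> i)) = prod_list (map E ?v)"
    proof -
      have "map E ?v = map (\<lambda>i. E ((shift ^^ m) \<omega> i)) [0..<k]"
        using len \<omega> by (auto simp: list_eq_iff_nth_eq cylinder_def funpow_shift add.commute)
      then show ?thesis by (simp add: prod.distinct_set_conv_list[symmetric] atLeast0LessThan)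
    qed
    then have 3: "exp (birkhoff_sum \<phi> k ((shift ^^ m) \<omega>)) \<le> prod_list (map E ?v)"
      using exp_birkhoff_le[OF X_shift_pow[OF \<omega>X(1), of m], of k] by simp
    have "exp (birkhoff_sum \<phi> m \<omega>) * exp (birkhoff_sum \<phi> k ((shift ^^ m) \<omega>)) \<le>
        exp c1 * (Lop ^^ m) (ind ?u) (rep ?v) * prod_list (map E ?v)"
      using 2 3 order.trans[OF less_imp_le[OF exp_gt_zero] 2] by (intro mult_mono) auto
    then show ?thesis by (simp add: birkhoff_sum_add exp_add mult_ac)
  qed
  obtain \<omega> where "\<omega> \<in> cylinder XM w" using ne by blast
  then have B0: "0 < ?B" using B exp_gt_zero less_le_trans by blast
  have "(SUP \<omega>\<in>cylinder XM w. birkhoff_sum \<phi> (m + k) \<omega>) \<le> ln ?B"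
    using ne B B0 by (intro cSUP_least) (auto simp: ln_ge_iff)
  then show "zw (m + k) w \<le> ?B" unfolding zw_def using B0 by (simp add: ln_ge_iff)
qed

text \<open>For a fixed ending the cylinders of the initial parts are disjoint and contribute at
  most \<open>b m\<close> together; the sum over the endings gives \<open>K ^ k\<close>.\<close>

lemma sum_zw_le:
  assumes G: "finite G" "G \<subseteq> Zset (m + k)"
  shows "sum (zw (m + k)) G \<le> exp c1 * K ^ k * b m"
proof -
  let ?U = "take m ` G" and ?V = "drop m ` G"
  let ?f = "\<lambda>u v. exp c1 * (prod_list (map E v) * (Lop ^^ m) (ind u) (rep v))"
  have pos: "0 \<le> prod_list (map E w)" for w by (induction w) auto
  have rX: "rep v \<in> X" if "v \<in> ?V" for v using that zw_le(2) G(2) by auto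
  have "sum (zw (m + k)) G \<le> (\<Sum>w\<in>G. ?f (take m w) (drop m w))"
    using zw_le(1) G(2) by (intro sum_mono) blast
  also have "\<dots> = (\<Sum>p\<in>(\<lambda>w. (drop m w, take m w)) ` G. ?f (snd p) (fst p))"
  proof (subst sum.reindex)
    show "inj_on (\<lambda>w. (drop m w, take m w)) G"
      by (rule inj_onI) (metis Pair_inject append_take_drop_id)
  qed simp
  also have "\<dots> \<le> (\<Sum>p\<in>?V \<times> ?U. ?f (snd p) (fst p))"
    using G(1) rX pos by (intro sum_mono2) (auto intro!: mult_nonneg_nonneg pow_nonneg)
  also have "\<dots> = (\<Sum>v\<in>?V. \<Sum>u\<in>?U. ?f u v)" by (simp add: sum.cartesian_product split_def)
  also have "\<dots> = (\<Sum>v\<in>?V. exp c1 * prod_list (map E v) * (\<Sum>u\<in>?U. (Lop ^^ m) (ind u) (rep v)))"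
    by (simp add: sum_distrib_left mult.assoc)
  also have "\<dots> \<le> (\<Sum>v\<in>?V. exp c1 * prod_list (map E v) * b m)"
  proof (intro sum_mono mult_left_mono)
    fix v assume v: "v \<in> ?V"
    show "(\<Sum>u\<in>?U. (Lop ^^ m) (ind u) (rep v)) \<le> b m"
      by (rule sum_ind_le[OF _ _ rX[OF v]]) (use G in \<open>auto simp: Zset_def\<close>)
  qed (simp add: pos)
  also have "\<dots> = exp c1 * (\<Sum>v\<in>?V. prod_list (map E v)) * b m"
    by (simp add: sum_distrib_left sum_distrib_right)
  also have "\<dots> \<le> exp c1 * K ^ k * b m"
    using G b_nonneg by (intro mult_right_mono mult_left_mono sum_E_words)
      (auto simp: Zset_def dest: in_set_dropD)
  finally show ?thesis .
qed

lemma zw_summable: "zw (m + k) summable_on Zset (m + k)" and Z_le: "Z (m + k) \<le> exp c1 * K ^ k * b m"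
proof -
  show s: "zw (m + k) summable_on Zset (m + k)"
    by (rule nonneg_bdd_above_summable_on)
      (auto simp: zw_def[abs_def] intro!: bdd_aboveI2[where M = "exp c1 * K ^ k * b m"] sum_zw_le[unfolded zw_def[abs_def]])
  show "Z (m + k) \<le> exp c1 * K ^ k * b m"
    unfolding Z_def by (rule infsum_le_finite_sums[OF s]) (rule sum_zw_le)
qed

text \<open>Only one inverse branch meets the cylinder of \<open>w\<close>, namely the one that
  prepends \<open>w\<close>. It contributes its full weight if all transitions are admissible for
  \<open>M\<close>, and then the preimage stays in \<open>XM\<close>; otherwise it contributes
  nothing.\<close>

lemma ind_pow:
  assumes "\<omega> \<in> XM" "w \<in> lists S"
  shows "(Lop ^^ length w) (ind w) \<omega> = 0 \<or> foldr prepend w \<omega> \<in> XM \<and>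
    (Lop ^^ length w) (ind w) \<omega> = exp (birkhoff_sum \<phi> (length w) (foldr prepend w \<omega>))"
  using assms
proof (induction w arbitrary: \<omega> rule: rev_induct)
  case Nil
  then show ?case using XM_sub by (auto simp: birkhoff_sum_def cylinder_def)
next
  case (snoc s w)
  let ?n = "length w"
  have \<omega>: "\<omega> \<in> X" using snoc XM_sub by blast
  have "(Lop ^^ ?n) (ind (w @ [s])) \<upsilon> = (Lop ^^ ?n) (ind w) \<upsilon> * indicator {\<upsilon>. \<upsilon> 0 = s} \<upsilon>" if "\<upsilon> \<in> X" for \<upsilon>
  proof -
    have "(Lop ^^ ?n) (ind (w @ [s])) \<upsilon> = (Lop ^^ ?n) (\<lambda>\<omega>. ind w \<omega> * indicator {\<upsilon>. \<upsilon> 0 = s} ((shift ^^ ?n) \<omega>)) \<upsilon>"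
      by (rule pow_cong[OF _ that])
        (auto simp: indicator_def cylinder_def nth_append funpow_shift less_Suc_eq)
    then show ?thesis unfolding pow_shift .
  qed
  then have "(Lop ^^ Suc ?n) (ind (w @ [s])) \<omega> =
      (\<Sum>\<^sub>\<infinity>a\<in>pre \<omega>. exp (\<phi> (prepend a \<omega>)) * ((Lop ^^ ?n) (ind w) (prepend a \<omega>) * indicator {\<upsilon>. \<upsilon> 0 = s} (prepend a \<omega>)))"
    unfolding funpow.simps o_def Lop_in[OF \<omega>] using pre_X[OF \<omega>] by (intro infsum_cong) simp
  also have "\<dots> = (\<Sum>\<^sub>\<infinity>a\<in>pre \<omega> \<inter> {s}. exp (\<phi> (prepend a \<omega>)) * (Lop ^^ ?n) (ind w) (prepend a \<omega>))"
    by (rule infsum_cong_neutral) auto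
  also have "\<dots> = (if s \<in> pre \<omega> then exp (\<phi> (prepend s \<omega>)) * (Lop ^^ ?n) (ind w) (prepend s \<omega>) else 0)"
    by auto
  finally have eq: "(Lop ^^ Suc ?n) (ind (w @ [s])) \<omega> =
      (if s \<in> pre \<omega> then exp (\<phi> (prepend s \<omega>)) * (Lop ^^ ?n) (ind w) (prepend s \<omega>) else 0)" .
  show ?case
  proof (cases "s \<in> pre \<omega>")
    case True
    have IH: "(Lop ^^ ?n) (ind w) (prepend s \<omega>) = 0 \<or> foldr prepend w (prepend s \<omega>) \<in> XM \<and>
      (Lop ^^ ?n) (ind w) (prepend s \<omega>) = exp (birkhoff_sum \<phi> ?n (foldr prepend w (prepend s \<omega>)))"
      using snoc pre_XM[OF snoc.prems(1) True] by auto
    have "(shift ^^ ?n) (foldr prepend w (prepend s \<omega>)) = prepend s \<omega>"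
      by (simp add: fun_eq_iff funpow_shift foldr_prepend_nth)
    then have "birkhoff_sum \<phi> (Suc ?n) (foldr prepend w (prepend s \<omega>)) =
        birkhoff_sum \<phi> ?n (foldr prepend w (prepend s \<omega>)) + \<phi> (prepend s \<omega>)"
      by (simp add: birkhoff_sum_def)
    then show ?thesis using IH eq True by (auto simp: exp_add)
  qed (use eq in simp)
qed

lemma ind_pow_le:
  assumes \<omega>: "\<omega> \<in> XM" and w: "w \<in> lists S" and n: "length w = n"
  shows "(Lop ^^ n) (ind w) \<omega> \<le> (if w \<in> Zset n then zw n w else 0)"
proof -
  let ?x = "foldr prepend w \<omega>"
  have "?x \<in> cylinder XM w" "(Lop ^^ n) (ind w) \<omega> = exp (birkhoff_sum \<phi> n ?x)" if "(Lop ^^ n) (ind w) \<omega> \<noteq> 0"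
    using ind_pow[OF \<omega> w] n that by (auto simp: cylinder_def foldr_prepend_nth)
  moreover have "exp (birkhoff_sum \<phi> n ?x) \<le> zw n w" if "?x \<in> cylinder XM w"
    unfolding zw_def using cSUP_upper[OF that birkhoff_bdd] by simp
  ultimately show ?thesis using w n
    by (cases "(Lop ^^ n) (ind w) \<omega> = 0") (auto simp: Zset_def zw_def)
qed

end

context transfer_limit
begin

text \<open>At a point of \<open>XM\<close> the iterate of one is a sum over admissible words, each
  term at most the exponential of the supremum over the cylinder in \<open>XM\<close>. Infinitely
  many words are handled by splitting off \<open>tail F n\<close> at a cost of
  \<open>\<epsilon>\<close>.\<close>

lemma Ln_le_Z:
  assumes \<omega>: "\<omega> \<in> XM" and n: "k \<le> n" shows "Ln n \<omega> \<le> Z n"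
proof (rule field_le_epsilon)
  fix \<epsilon> :: real assume "0 < \<epsilon>"
  then obtain F where F: "finite F" "F \<subseteq> S" "\<And>\<omega>. \<omega> \<in> X \<Longrightarrow> (Lop ^^ n) (tail F n) \<omega> \<le> \<epsilon>"
    using tail_small[of \<epsilon> n] by blast
  have \<omega>X: "\<omega> \<in> X" using \<omega> XM_sub by blast
  have s: "zw n summable_on Zset n" using zw_summable[of "n - k"] n by simp
  have ps: "(Lop ^^ n) (\<lambda>\<omega>. \<Sum>w\<in>words F n. ind w \<omega>) = (\<lambda>\<omega>. \<Sum>w\<in>words F n. (Lop ^^ n) (ind w) \<omega>) \<and>
      bd (\<Sum>w\<in>words F n. 1) (\<lambda>\<omega>. \<Sum>w\<in>words F n. ind w \<omega>)"
    by (rule pow_sum[OF finite_words[OF F(1)] bd_ind])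
  have "Ln n \<omega> = (Lop ^^ n) (\<lambda>\<omega>. (\<Sum>w\<in>words F n. ind w \<omega>) + tail F n \<omega>) \<omega>"
    unfolding Ln_def by (rule pow_cong[OF _ \<omega>X]) (simp add: tail_words(1)[OF F(1)])
  also have "\<dots> = (\<Sum>w\<in>words F n. (Lop ^^ n) (ind w) \<omega>) + (Lop ^^ n) (tail F n) \<omega>"
    using pow_add[OF conjunct2[OF ps] bd_tail] ps by simp
  also have "(\<Sum>w\<in>words F n. (Lop ^^ n) (ind w) \<omega>) \<le> (\<Sum>w\<in>words F n. if w \<in> Zset n then zw n w else 0)"
    by (intro sum_mono ind_pow_le[OF \<omega> words_lists[OF F(2)]]) (auto simp: words_def)
  also have "\<dots> = (\<Sum>w\<in>words F n \<inter> Zset n. zw n w)" by (rule sum.inter_restrict[OF finite_words[OF F(1)], symmetric])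
  also have "\<dots> \<le> Z n"
    unfolding Z_def by (rule finite_sum_le_infsum[OF s]) (use finite_words[OF F(1)] in \<open>auto simp: zw_def\<close>)
  finally show "Ln n \<omega> \<le> Z n + \<epsilon>" using F(3)[OF \<omega>X] by simp
qed

lemma ucont_Ln: "ucont (Ln n)"
proof (induction n)
  case 0
  then show ?case by (simp add: Ln_def ucont_def)
next
  case (Suc n)
  then show ?case using Lop_ucont[OF bd_Ln] by (simp add: Ln_def)
qed

lemma integral_Ln: "(\<integral>\<omega>. Ln n \<omega> \<partial>nu) = \<rho> ^ n"
proof (induction n)
  case 0
  then show ?case using nu.prob_space by (simp add: Ln_def)
next
  case (Suc n)
  have "Ln (Suc n) = Lop (Ln n)" by (simp add: Ln_def)
  then show ?case using eigenmeasure_ucont[OF bd_Ln ucont_Ln, of n] Suc by simp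
qed

lemma rho_le_Z: assumes "k \<le> n" shows "\<rho> ^ n \<le> Z n"
proof -
  have "AE \<omega> in nu. \<omega> \<in> XM" by (rule nu.AE_prob_1[OF nu_XM])
  then have "AE \<omega> in nu. Ln n \<omega> \<le> Z n" by eventually_elim (rule Ln_le_Z[OF _ assms])
  then have "(\<integral>\<omega>. Ln n \<omega> \<partial>nu) \<le> (\<integral>\<omega>. Z n \<partial>nu)"
    by (intro integral_mono_AE bd_integrable[OF bd_Ln] ucont_measurable ucont_Ln) auto
  then show ?thesis using integral_Ln nu.prob_space by simp
qed

lemma pressure_limit: "(\<lambda>n. 1 / real n * ln (Z n)) \<longlonglongrightarrow> ln \<rho>"
proof (rule LIMSEQ_I)
  fix e :: real assume e: "e > 0"
  define x where "x = \<rho> * exp (e / 2)"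
  have x: "\<rho> < x" "0 < x" "ln x = ln \<rho> + e / 2" using \<rho>_pos e by (auto simp: x_def ln_mult)
  obtain C where C: "C > 0" "\<And>n. b n \<le> C * x ^ n" using b_growth[OF x(1)] by blast
  \<comment> \<open>The factor \<open>1 / x ^ k\<close> absorbs the shift from \<open>n - k\<close>
    to \<open>n\<close> in \<open>Z_le\<close>.\<close>
  define D where "D = exp c1 * K ^ k * C / x ^ k"
  have D: "0 < D" using C x K_pos by (simp add: D_def)
  have up: "Z n \<le> D * x ^ n" if "k \<le> n" for n
  proof -
    have "Z n \<le> exp c1 * K ^ k * b (n - k)" using Z_le[of "n - k"] that by simp
    also have "\<dots> \<le> exp c1 * K ^ k * (C * x ^ (n - k))" using C(2) K_pos by (intro mult_left_mono) auto
    also have "\<dots> = D * x ^ n" using that x by (simp add: D_def power_diff)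
    finally show ?thesis .
  qed
  have "(\<lambda>n. ln D / real n) \<longlonglongrightarrow> 0" by (rule lim_const_over_n)
  then have "eventually (\<lambda>n. ln D / real n < e / 2) sequentially" by (rule order_tendstoD) (use e in simp)
  then have "eventually (\<lambda>n. norm (1 / real n * ln (Z n) - ln \<rho>) < e) sequentially"
    using eventually_gt_at_top[of 0] eventually_ge_at_top[of k]
  proof eventually_elim
    case (elim n)
    have Zp: "0 < Z n" "\<rho> ^ n \<le> Z n" using rho_le_Z[OF elim(3)] zero_less_power[OF \<rho>_pos, of n] by linarith+
    have "real n * ln \<rho> \<le> ln (Z n)" using Zp \<rho>_pos by (simp add: ln_realpow[symmetric])
    then have l: "ln \<rho> \<le> 1 / real n * ln (Z n)" using elim(2) by (simp add: field_simps)
    have "ln (Z n) \<le> ln (D * x ^ n)" using Zp up[OF elim(3)] D x by (subst ln_le_cancel_iff) auto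
    also have "\<dots> = ln D + real n * ln x" using D x by (simp add: ln_mult ln_realpow)
    finally have "1 / real n * ln (Z n) \<le> ln D / real n + ln x" using elim(2) by (simp add: field_simps)
    then show ?case using l elim(1) x(3) unfolding real_norm_def abs_less_iff by linarith
  qed
  then show "\<exists>no. \<forall>n\<ge>no. norm (1 / real n * ln (Z n) - ln \<rho>) < e" unfolding eventually_sequentially .
qed

lemma pressure_eq: "exp (pressure S XM \<phi>) = \<rho>"
proof -
  have "pressure S XM \<phi> = lim (\<lambda>n. 1 / real n * ln (Z n))"
    unfolding pressure_def Z_def Zset_def zw_def[abs_def] ..
  also have "\<dots> = ln \<rho>" by (rule limI[OF pressure_limit])
  finally show ?thesis using \<rho>_pos by simp
qed

end

section \<open>The essential spectral radius from above\<close>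

lemma (in fun_space) finite_rank_isolated:
  assumes T: "blin T" and W: "finite W" and e: "\<And>w. w \<in> W \<Longrightarrow> e w \<in> V" and l: "\<And>w. bfun (l w)"
    and R: "\<And>f. f \<in> V \<Longrightarrow> N ((T ^^ n) f - (\<Sum>w\<in>W. cscale (l w f) (e w))) \<le> r0 ^ n * N f"
    and r0: "0 < r0" and n: "1 \<le> n" and p: "p \<in> spectrum V N T" "r0 < cmod p"
  shows "isolated_finite_mult_eigenvalue V N T p"
proof -
  obtain h where h: "bij_betw h {0..<card W} W" using ex_bij_betw_nat_finite[OF W] by blast
  define e' where "e' j = (if j < card W then e (h j) else 0)" for j
  have e': "e' j \<in> V" for j using e bij_betwE[OF h] by (auto simp: e'_def)
  have eq: "(\<Sum>w\<in>W. cscale (l w f) (e w)) = (\<Sum>j<card W. cscale (l (h j) f) (e' j))" for f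
    unfolding lessThan_atLeast0 by (subst sum.reindex_bij_betw[OF h, symmetric]) (auto simp: e'_def intro!: sum.cong)
  interpret finite_rank_perturbation V N T "\<lambda>f. (T ^^ n) f - (\<Sum>w\<in>W. cscale (l w f) (e w))" n "card W" r0 e' "\<lambda>j. l (h j)"
  proof unfold_locales
    show "blin (\<lambda>f. (T ^^ n) f - (\<Sum>w\<in>W. cscale (l w f) (e w)))"
      by (intro blin_diff blin_funpow T blin_sum_op W blin_rank1 e l)
    show "(T ^^ n) f = (T ^^ n) f - (\<Sum>w\<in>W. cscale (l w f) (e w)) + (\<Sum>j<card W. cscale (l (h j) f) (e' j))" for f
      unfolding eq by simp
  qed (use T R r0 n e' l in auto)
  show ?thesis by (rule isolated_finite_mult[OF p])
qed

lemma ess_spectral_radius_le: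
  assumes "0 \<le> r" "\<And>z. z \<in> spectrum V N T \<Longrightarrow> r < cmod z \<Longrightarrow> isolated_finite_mult_eigenvalue V N T z"
  shows "ess_spectral_radius V N T \<le> r" and "0 \<le> ess_spectral_radius V N T"
proof -
  let ?A = "{r. 0 \<le> r \<and> (\<forall>z\<in>spectrum V N T. r < cmod z \<longrightarrow> isolated_finite_mult_eigenvalue V N T z)}"
  have r: "r \<in> ?A" using assms by blast
  show "ess_spectral_radius V N T \<le> r" unfolding ess_spectral_radius_def
    by (rule cInf_lower[OF r]) (auto intro: bdd_belowI[of _ 0])
  show "0 \<le> ess_spectral_radius V N T" unfolding ess_spectral_radius_def
    by (rule cInf_greatest) (use r in auto)
qed

context transfer_limit
begin

abbreviation cind :: "'a list \<Rightarrow> (nat \<Rightarrow> 'a) \<Rightarrow> complex" where "cind w \<equiv> indicator (cylinder X w)"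

lemma cind_Fb: "cind w \<in> Fb_space \<theta> X k"
proof -
  have "lip k (1 / \<theta> ^ length w) (cind w)"
    unfolding lip_def
  proof (intro allI impI ballI)
    fix m \<omega> \<upsilon> assume "\<omega> \<in> X" "\<upsilon> \<in> X" and a: "agree m \<omega> \<upsilon>"
    show "norm (cind w \<omega> - cind w \<upsilon>) \<le> 1 / \<theta> ^ length w * \<theta> ^ m"
    proof (cases "length w \<le> m")
      case True
      then have "\<omega> \<in> cylinder X w \<longleftrightarrow> \<upsilon> \<in> cylinder X w"
        using a \<open>\<omega> \<in> X\<close> \<open>\<upsilon> \<in> X\<close> by (auto simp: cylinder_def agree_def)
      then show ?thesis using th0 by (simp add: indicator_def)
    next
      case False
      then have "1 \<le> 1 / \<theta> ^ length w * \<theta> ^ m" using \<theta>_decr[of m "length w"] by simp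
      moreover have "norm (cind w \<omega> - cind w \<upsilon>) \<le> 1" by (simp add: indicator_def)
      ultimately show ?thesis by linarith
    qed
  qed
  moreover have "\<forall>\<omega>\<in>X. cmod (cind w \<omega>) \<le> 1" by (simp add: indicator_def)
  moreover have "\<forall>\<omega>. \<omega> \<notin> X \<longrightarrow> cind w \<omega> = 0" by (simp add: cylinder_def indicator_def)
  ultimately show ?thesis unfolding Fb_iff by blast
qed

text \<open>The finite-rank part is the iterate applied to a step function that samples
  \<open>f\<close> on the words over \<open>F\<close>; \<open>u\<close> is \<open>f\<close> minus
  this step function. It is small on these words by the Lipschitz bound and at most
  \<open>sup_norm X f\<close> on the rest, where \<open>tail\<close> takes over. From depth
  \<open>n\<close> on the step function is constant, so \<open>u\<close> varies no more than
  \<open>f\<close> and the Lasota--Yorke inequality applies with \<open>t = n\<close>.\<close>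

lemma perturbation_bound:
  assumes f: "f \<in> Fb_space \<theta> X k" and n: "k \<le> n" and F: "finite F" "F \<subseteq> S"
    and small: "\<And>\<omega>. \<omega> \<in> X \<Longrightarrow> (Lop ^^ n) (tail F n) \<omega> \<le> \<epsilon>" and \<epsilon>: "0 \<le> \<epsilon>"
  shows "Fb_norm \<theta> X k ((Lop ^^ n) f - (\<Sum>w\<in>words F n. cscale (f (rep w)) ((Lop ^^ n) (cind w))))
    \<le> (2 + c1 * exp c1) * (\<theta> ^ n * b n + \<epsilon>) * Fb_norm \<theta> X k f"
proof -
  let ?B = "sup_norm X f" and ?D = "enn2real (theta_seminorm \<theta> X k f)"
  note bf = Fb_bd[OF f] and lf = Fb_lip[OF f]
  have B0: "0 \<le> ?B" and D0: "0 \<le> ?D" using Fb_norm_parts[OF f] by auto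
  define u where "u \<omega> = f \<omega> - (\<Sum>w\<in>words F n. f (rep w) * cind w \<omega>)" for \<omega>
  have bi: "bd (cmod c * 1) (\<lambda>\<omega>. c * cind w \<omega>)" for c w
    by (rule bd_cmult) (simp add: bd_def indicator_def)
  have ps: "(Lop ^^ n) (\<lambda>\<omega>. \<Sum>w\<in>words F n. f (rep w) * cind w \<omega>) =
      (\<lambda>\<omega>. \<Sum>w\<in>words F n. (Lop ^^ n) (\<lambda>\<omega>. f (rep w) * cind w \<omega>) \<omega>) \<and>
      bd (\<Sum>w\<in>words F n. cmod (f (rep w)) * 1) (\<lambda>\<omega>. \<Sum>w\<in>words F n. f (rep w) * cind w \<omega>)"
    by (rule pow_sum[OF finite_words[OF F(1)] bi])
  have R: "(Lop ^^ n) f - (\<Sum>w\<in>words F n. cscale (f (rep w)) ((Lop ^^ n) (cind w))) = (Lop ^^ n) u"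
  proof
    fix \<omega>
    show "((Lop ^^ n) f - (\<Sum>w\<in>words F n. cscale (f (rep w)) ((Lop ^^ n) (cind w)))) \<omega> = (Lop ^^ n) u \<omega>"
      unfolding u_def pow_diff[OF bf conjunct2[OF ps]] conjunct1[OF ps] fun_diff_def sum_fun_apply
      unfolding pow_cmult cscale_def ..
  qed
  have cval: "(\<Sum>w\<in>words F n. f (rep w) * cind w \<omega>) = (if tail F n \<omega> = 0 then f (rep (map \<omega> [0..<n])) else 0)"
    if \<omega>: "\<omega> \<in> X" for \<omega>
  proof (rule complex_eqI)
    have i: "cind w \<omega> = of_real (ind w \<omega>)" for w by (simp add: indicator_def)
    show "Re (\<Sum>w\<in>words F n. f (rep w) * cind w \<omega>) = Re (if tail F n \<omega> = 0 then f (rep (map \<omega> [0..<n])) else 0)"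
      using tail_words(2)[OF F(1) \<omega>, where c = "\<lambda>w. Re (f (rep w))" and n = n] by (simp add: i)
    show "Im (\<Sum>w\<in>words F n. f (rep w) * cind w \<omega>) = Im (if tail F n \<omega> = 0 then f (rep (map \<omega> [0..<n])) else 0)"
      using tail_words(2)[OF F(1) \<omega>, where c = "\<lambda>w. Im (f (rep w))" and n = n] by (simp add: i)
  qed
  let ?t = "\<lambda>\<omega>. ?D * \<theta> ^ n + ?B * tail F n \<omega>"
  have u_le: "norm (u \<omega>) \<le> ?t \<omega>" if \<omega>: "\<omega> \<in> X" for \<omega>
  proof (cases "tail F n \<omega> = 0")
    case True
    then show ?thesis unfolding u_def cval[OF \<omega>]
      using lipD[OF lf n \<omega>] rep_map[OF \<omega>, of n] by simp
  next
    case False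
    then have "tail F n \<omega> = 1" by (simp add: tail_def split: if_splits)
    then show ?thesis unfolding u_def cval[OF \<omega>] using bdD[OF bf \<omega>] D0 by (simp add: add_increasing)
  qed
  have t1: "bd (norm (?D * \<theta> ^ n) * 1) (\<lambda>\<omega>. ?D * \<theta> ^ n * 1)" and t2: "bd (norm ?B * 1) (\<lambda>\<omega>. ?B * tail F n \<omega>)"
    by (intro bd_cmult bd_one bd_tail)+
  have bt: "bd (norm (?D * \<theta> ^ n) * 1 + norm ?B * 1) ?t" using bd_add[OF t1 t2] by simp
  have bu: "bd (norm (?D * \<theta> ^ n) * 1 + norm ?B * 1) u"
    unfolding bd_def
  proof
    fix \<omega> assume "\<omega> \<in> X"
    from u_le[OF this] bdD[OF bt this]
    show "norm (u \<omega>) \<le> norm (?D * \<theta> ^ n) * 1 + norm ?B * 1" unfolding real_norm_def by linarith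
  qed
  define q where "q = ?D * (\<theta> ^ n * b n) + ?B * \<epsilon>"
  have Pt: "(Lop ^^ n) ?t \<omega> \<le> q" if \<omega>: "\<omega> \<in> X" for \<omega>
  proof -
    have "(Lop ^^ n) ?t \<omega> = ?D * \<theta> ^ n * Ln n \<omega> + ?B * (Lop ^^ n) (tail F n) \<omega>"
      using pow_add[OF t1 t2, of n] unfolding pow_cmult Ln_def by simp
    also have "\<dots> \<le> ?D * \<theta> ^ n * b n + ?B * \<epsilon>"
      using D0 B0 Ln_le_b[OF \<omega>] small[OF \<omega>] by (intro add_mono mult_left_mono) auto
    finally show ?thesis by (simp add: q_def mult.assoc)
  qed
  have sup: "norm ((Lop ^^ n) u \<omega>) \<le> q" if \<omega>: "\<omega> \<in> X" for \<omega>
    using pow_norm_le[OF u_le bt \<omega>, of n] Pt[OF \<omega>] by simp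
  have Pu: "(Lop ^^ n) (\<lambda>\<omega>. norm (u \<omega>)) \<omega> \<le> q" if \<omega>: "\<omega> \<in> X" for \<omega>
    using pow_norm_le[of "\<lambda>\<omega>. norm (u \<omega>)", OF _ bt \<omega>, of n] u_le Pt[OF \<omega>] by simp
  have u_lip: "norm (u \<omega> - u \<upsilon>) \<le> ?D * \<theta> ^ j" if j: "n \<le> j" "\<omega> \<in> X" "\<upsilon> \<in> X" "agree j \<omega> \<upsilon>" for j \<omega> \<upsilon>
  proof -
    have e: "map \<omega> [0..<n] = map \<upsilon> [0..<n]" "tail F n \<omega> = tail F n \<upsilon>" using j by (auto simp: agree_def tail_def)
    have "u \<omega> - u \<upsilon> = f \<omega> - f \<upsilon>" unfolding u_def cval[OF j(2)] cval[OF j(3)] e by simp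
    then show ?thesis using lipD[OF lf _ j(2-4)] j n by simp
  qed
  have "lip k (?D * (\<theta> ^ n * b n) + c1 * exp c1 * q) ((Lop ^^ n) u)"
    unfolding lip_def
  proof (intro allI impI ballI)
    fix m \<omega> \<upsilon> assume m: "k \<le> m" and \<omega>: "\<omega> \<in> X" and \<upsilon>: "\<upsilon> \<in> X" and a: "agree m \<omega> \<upsilon>"
    have "norm ((Lop ^^ n) u \<omega> - (Lop ^^ n) u \<upsilon>) \<le>
      ?D * \<theta> ^ (n + m) * Ln n \<omega> + (exp (c1 * \<theta> ^ m) - 1) * (Lop ^^ n) (\<lambda>\<omega>. norm (u \<omega>)) \<upsilon>"
      by (rule lasota_yorke[OF bu D0 u_lip m _ \<omega> \<upsilon> a]) auto
    also have "\<dots> \<le> ?D * \<theta> ^ (n + m) * b n + (c1 * exp c1 * \<theta> ^ m) * q"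
      using D0 Ln_le_b[OF \<omega>] Pu[OF \<upsilon>] exp_cone_le[of m] c1_nonneg th0 pow_nonneg[of "\<lambda>\<omega>. norm (u \<omega>)", OF _ \<upsilon>, of n]
      by (intro add_mono mult_mono mult_left_mono) auto
    also have "\<dots> = (?D * (\<theta> ^ n * b n) + c1 * exp c1 * q) * \<theta> ^ m" by (simp add: algebra_simps power_add)
    finally show "norm ((Lop ^^ n) u \<omega> - (Lop ^^ n) u \<upsilon>) \<le> (?D * (\<theta> ^ n * b n) + c1 * exp c1 * q) * \<theta> ^ m" .
  qed
  from Fb_norm_le[OF this sup]
  have "Fb_norm \<theta> X k ((Lop ^^ n) u) \<le> q + (?D * (\<theta> ^ n * b n) + c1 * exp c1 * q)" .
  also have "\<dots> \<le> q + (q + c1 * exp c1 * q)" using B0 \<epsilon> by (simp add: q_def)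
  also have "\<dots> = (2 + c1 * exp c1) * q" by (simp add: algebra_simps)
  also have "\<dots> \<le> (2 + c1 * exp c1) * ((\<theta> ^ n * b n + \<epsilon>) * Fb_norm \<theta> X k f)"
  proof (rule mult_left_mono)
    have "q \<le> ?D * (\<theta> ^ n * b n + \<epsilon>) + ?B * (\<theta> ^ n * b n + \<epsilon>)"
      unfolding q_def using D0 B0 \<epsilon> b_nonneg[of n] by (intro add_mono mult_left_mono) auto
    then show "q \<le> (\<theta> ^ n * b n + \<epsilon>) * Fb_norm \<theta> X k f" by (simp add: Fb_norm_def algebra_simps)
  qed (use c1_nonneg in simp)
  finally show ?thesis unfolding R by (simp add: mult.assoc)
qed

text \<open>A rate \<open>x\<close> strictly between \<open>\<rho>\<close> and
  \<open>r0 / \<theta>\<close> turns \<open>\<theta> ^ n * b n\<close> into a geometric term that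
  loses against \<open>r0 ^ n\<close>; \<open>n\<close> is taken large enough to beat the constant
  \<open>2 * c0 * C\<close>, and only then is the alphabet \<open>F\<close> chosen.\<close>

lemma isolated_above:
  assumes r0: "\<rho> * \<theta> < r0" and p: "p \<in> spectrum (Fb_space \<theta> X k) (Fb_norm \<theta> X k) Lop" "r0 < cmod p"
  shows "isolated_finite_mult_eigenvalue (Fb_space \<theta> X k) (Fb_norm \<theta> X k) Lop p"
proof -
  have "\<rho> < r0 / \<theta>" using r0 th0 by (simp add: pos_less_divide_eq)
  then obtain x where x: "\<rho> < x" "x < r0 / \<theta>" using dense by blast
  have x0: "0 < x" and xr: "\<theta> * x < r0" using x th0 \<rho>_pos by (auto simp: pos_less_divide_eq mult.commute)
  then have r0p: "0 < r0" using th0 by (smt (verit) mult_pos_pos)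
  obtain C where C: "0 < C" "\<And>n. b n \<le> C * x ^ n" using b_growth[OF x(1)] by blast
  define c0 where "c0 = 2 + c1 * exp c1"
  have c0: "0 < c0" using c1_nonneg by (simp add: c0_def add_pos_nonneg)
  have "(\<lambda>n. (\<theta> * x / r0) ^ n) \<longlonglongrightarrow> 0" using xr x0 r0p th0 by (intro LIMSEQ_power_zero) simp
  then have "eventually (\<lambda>n. (\<theta> * x / r0) ^ n < 1 / (2 * c0 * C)) sequentially"
    by (rule order_tendstoD) (use c0 C in simp)
  moreover have "eventually (\<lambda>n. k \<le> n) sequentially" by (rule eventually_ge_at_top)
  ultimately have "eventually (\<lambda>n. k \<le> n \<and> (\<theta> * x / r0) ^ n < 1 / (2 * c0 * C)) sequentially"
    by eventually_elim simp
  then obtain n where n: "k \<le> n" "(\<theta> * x / r0) ^ n < 1 / (2 * c0 * C)"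
    by (metis (mono_tags, lifting) eventually_sequentially order_refl)
  \<comment> \<open>Half of the admissible error \<open>r0 ^ n / c0\<close>; the other half goes to
    the term \<open>\<theta> ^ n * b n\<close>.\<close>
  define \<epsilon> where "\<epsilon> = r0 ^ n / (2 * c0)"
  have \<epsilon>: "0 < \<epsilon>" using r0p c0 by (simp add: \<epsilon>_def)
  have bound: "c0 * (\<theta> ^ n * b n + \<epsilon>) \<le> r0 ^ n"
  proof -
    have "\<theta> ^ n * b n \<le> \<theta> ^ n * (C * x ^ n)" using C(2) by (intro mult_left_mono) auto
    also have "\<dots> = C * (\<theta> * x / r0) ^ n * r0 ^ n" using r0p by (simp add: power_mult_distrib power_divide)
    also have "\<dots> \<le> C * (1 / (2 * c0 * C)) * r0 ^ n"
      using n(2) C(1) r0p by (intro mult_right_mono mult_left_mono) auto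
    also have "\<dots> = \<epsilon>" using C(1) by (simp add: \<epsilon>_def)
    finally have "c0 * (\<theta> ^ n * b n + \<epsilon>) \<le> c0 * (\<epsilon> + \<epsilon>)" using c0 by (intro mult_left_mono) auto
    also have "\<dots> = r0 ^ n" using c0 by (simp add: \<epsilon>_def)
    finally show ?thesis .
  qed
  obtain F where F: "finite F" "F \<subseteq> S" "\<And>\<omega>. \<omega> \<in> X \<Longrightarrow> (Lop ^^ n) (tail F n) \<omega> \<le> \<epsilon>"
    using tail_small[OF \<epsilon>, of n] by blast
  show ?thesis
  proof (rule Fb.finite_rank_isolated[OF Fb_blin finite_words[OF F(1), of n] _ _ _ r0p _ p])
    show "(Lop ^^ n) (cind w) \<in> Fb_space \<theta> X k" for w by (rule Fb.blinD(1)[OF Fb.blin_funpow[OF Fb_blin] cind_Fb])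
    show "Fb.bfun (\<lambda>f. f (rep w))" for w by (rule Fb.bfun_eval)
    show "1 \<le> n" using n(1) k1 by simp
    fix f assume f: "f \<in> Fb_space \<theta> X k"
    have "Fb_norm \<theta> X k ((Lop ^^ n) f - (\<Sum>w\<in>words F n. cscale (f (rep w)) ((Lop ^^ n) (cind w))))
      \<le> c0 * (\<theta> ^ n * b n + \<epsilon>) * Fb_norm \<theta> X k f"
      unfolding c0_def using perturbation_bound[OF f n(1) F] \<epsilon> by simp
    also have "\<dots> \<le> r0 ^ n * Fb_norm \<theta> X k f" by (rule mult_right_mono[OF bound Fb.N_nonneg[OF f]])
    finally show "Fb_norm \<theta> X k ((Lop ^^ n) f - (\<Sum>w\<in>words F n. cscale (f (rep w)) ((Lop ^^ n) (cind w))))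
      \<le> r0 ^ n * Fb_norm \<theta> X k f" .
  qed
qed

abbreviation r_ess where "r_ess \<equiv> ess_spectral_radius (Fb_space \<theta> X k) (Fb_norm \<theta> X k) Lop"

lemma r_ess_less: "r_ess < \<rho>"
proof -
  have "\<rho> * \<theta> < \<rho>" using \<rho>_pos th1 by simp
  then obtain r0 where r0: "\<rho> * \<theta> < r0" "r0 < \<rho>" using dense by blast
  have "0 \<le> \<rho> * \<theta>" using \<rho>_pos th0 by simp
  then have "r_ess \<le> r0" using r0 by (intro ess_spectral_radius_le(1) isolated_above[OF r0(1)]) auto
  then show ?thesis using r0 by simp
qed

text \<open>On a finite \<open>X\<close> the space is spanned by point masses, so the operator
  itself has finite rank and the perturbation argument runs with zero remainder for every
  \<open>r0 > 0\<close>.\<close>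

lemma r_ess_finite:
  assumes X: "finite X" shows "r_ess = 0"
proof -
  have "\<exists>n. \<forall>\<omega>\<in>X. \<forall>\<upsilon>\<in>X. agree n \<omega> \<upsilon> \<longrightarrow> \<omega> = \<upsilon>"
  proof -
    have "\<exists>n. \<omega> \<noteq> \<upsilon> \<longrightarrow> \<not> agree n \<omega> \<upsilon>" for \<omega> \<upsilon> :: "nat \<Rightarrow> 'a" using agree_all by blast
    then obtain s where s: "\<And>\<omega> \<upsilon> :: nat \<Rightarrow> 'a. \<omega> \<noteq> \<upsilon> \<Longrightarrow> \<not> agree (s \<omega> \<upsilon>) \<omega> \<upsilon>" by metis
    define n where "n = (\<Sum>\<omega>\<in>X. \<Sum>\<upsilon>\<in>X. s \<omega> \<upsilon>)"
    have "s \<omega> \<upsilon> \<le> n" if "\<omega> \<in> X" "\<upsilon> \<in> X" for \<omega> \<upsilon>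
    proof -
      have "s \<omega> \<upsilon> \<le> (\<Sum>\<upsilon>\<in>X. s \<omega> \<upsilon>)" by (rule member_le_sum) (use that X in auto)
      also have "\<dots> \<le> n" unfolding n_def by (rule member_le_sum) (use that X in auto)
      finally show ?thesis .
    qed
    then show ?thesis using s agree_mono by metis
  qed
  then obtain n where n: "\<And>\<omega> \<upsilon>. \<omega> \<in> X \<Longrightarrow> \<upsilon> \<in> X \<Longrightarrow> agree n \<omega> \<upsilon> \<Longrightarrow> \<omega> = \<upsilon>" by blast
  have \<delta>: "indicator {\<omega>} \<in> Fb_space \<theta> X k" if \<omega>: "\<omega> \<in> X" for \<omega>
  proof -
    have "cylinder X (map \<omega> [0..<n]) = {\<omega>}" using n \<omega> by (auto simp: cylinder_map)
    then show ?thesis using cind_Fb[of "map \<omega> [0..<n]"] by simp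
  qed
  have iso: "isolated_finite_mult_eigenvalue (Fb_space \<theta> X k) (Fb_norm \<theta> X k) Lop p"
    if p: "p \<in> spectrum (Fb_space \<theta> X k) (Fb_norm \<theta> X k) Lop" "0 < cmod p" for p
  proof -
    obtain r0 where r0: "0 < r0" "r0 < cmod p" using dense[OF p(2)] by blast
    show ?thesis
    proof (rule Fb.finite_rank_isolated[OF Fb_blin X _ _ _ r0(1) _ p(1) r0(2), where n = 1 and l = "\<lambda>\<omega> f. f \<omega>"])
      show "Lop (indicator {\<omega>}) \<in> Fb_space \<theta> X k" if "\<omega> \<in> X" for \<omega> by (rule Fb_Lop[OF \<delta>[OF that]])
      show "Fb.bfun (\<lambda>f. f \<omega>)" for \<omega> by (rule Fb.bfun_eval)
      fix f assume f: "f \<in> Fb_space \<theta> X k"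
      have "f = (\<Sum>\<omega>\<in>X. cscale (f \<omega>) (indicator {\<omega>}))"
      proof
        fix \<upsilon>
        have "(\<Sum>\<omega>\<in>X. cscale (f \<omega>) (indicator {\<omega>})) \<upsilon> = (\<Sum>\<omega>\<in>X. if \<upsilon> = \<omega> then f \<omega> else 0)"
          unfolding sum_fun_apply cscale_def by (rule sum.cong) (auto simp: indicator_def)
        also have "\<dots> = f \<upsilon>" using X f by (simp add: Fb_iff)
        finally show "f \<upsilon> = (\<Sum>\<omega>\<in>X. cscale (f \<omega>) (indicator {\<omega>})) \<upsilon>" ..
      qed
      then have "Lop f = Lop (\<Sum>\<omega>\<in>X. cscale (f \<omega>) (indicator {\<omega>}))" by simp
      also have "\<dots> = (\<Sum>\<omega>\<in>X. Lop (cscale (f \<omega>) (indicator {\<omega>})))"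
        by (rule Fb.blin_sum[OF Fb_blin]) (use \<delta> in simp)
      also have "\<dots> = (\<Sum>\<omega>\<in>X. cscale (f \<omega>) (Lop (indicator {\<omega>})))"
        by (rule sum.cong[OF refl]) (rule Lop_linear(2))
      finally have "(Lop ^^ 1) f - (\<Sum>\<omega>\<in>X. cscale (f \<omega>) (Lop (indicator {\<omega>}))) = 0" by simp
      then show "Fb_norm \<theta> X k ((Lop ^^ 1) f - (\<Sum>\<omega>\<in>X. cscale (f \<omega>) (Lop (indicator {\<omega>})))) \<le> r0 ^ 1 * Fb_norm \<theta> X k f"
        using Fb.N_zero Fb.N_nonneg[OF f] r0(1) by simp
    qed simp
  qed
  show ?thesis using ess_spectral_radius_le[OF order_refl, OF iso] by (intro antisym) auto
qed

end

section \<open>Connecting orbits\<close>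

context transfer_setup
begin

definition join :: "nat \<Rightarrow> (nat \<Rightarrow> 's) \<Rightarrow> (nat \<Rightarrow> 's) \<Rightarrow> nat \<Rightarrow> 's" where
  "join j \<omega> \<eta> i = (if i < j then \<omega> i else \<eta> (i - j))"

lemma join_X:
  assumes "\<omega> \<in> X" "\<eta> \<in> X" "\<eta> 0 = \<omega> j"
  shows "join j \<omega> \<eta> \<in> X" "agree j (join j \<omega> \<eta>) \<omega>" "(shift ^^ j) (join j \<omega> \<eta>) = \<eta>"
proof -
  have "A (join j \<omega> \<eta> n) (join j \<omega> \<eta> (Suc n)) = 1" for n
  proof (cases "n < j")
    case True
    then have "join j \<omega> \<eta> n = \<omega> n" "join j \<omega> \<eta> (Suc n) = \<omega> (Suc n)"
      using assms(3) by (auto simp: join_def not_less) (metis Suc_lessI diff_self_eq_0 le_eq_less_or_eq not_less_eq)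
    then show ?thesis using assms(1) by (simp add: X_iff)
  next
    case False
    then show ?thesis using assms(2) by (simp add: join_def X_iff Suc_diff_le)
  qed
  then show "join j \<omega> \<eta> \<in> X" using assms(1,2) by (simp add: X_iff) (simp add: join_def X_iff)
qed (auto simp: join_def agree_def fun_eq_iff funpow_shift)

text \<open>Induction along edges from the letter \<open>\<omega> n\<close>: a point that passes
  through \<open>a\<close> at time \<open>j\<close> is cut there and continued by a point that
  starts with \<open>a\<close> and \<open>b\<close>.\<close>

lemma reach:
  assumes "\<omega> \<in> X" "s \<in> S"
  shows "\<exists>z\<in>X. \<exists>j\<ge>n. agree n z \<omega> \<and> z j = s"
proof -
  have "\<omega> n \<in> S" using assms(1) by (simp add: X_iff)
  then show ?thesis
  proof (rule path_induct_forward[where Q = "\<lambda>s. \<exists>z\<in>X. \<exists>j\<ge>n. agree n z \<omega> \<and> z j = s", OF _ assms(2)])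
    show "\<exists>z\<in>X. \<exists>j\<ge>n. agree n z \<omega> \<and> z j = \<omega> n" using assms(1) by (intro bexI[of _ \<omega>] exI[of _ n]) auto
    fix a b assume ab: "a \<in> S" "b \<in> S" "A a b = 1" and "\<exists>z\<in>X. \<exists>j\<ge>n. agree n z \<omega> \<and> z j = a"
    then obtain z j where z: "z \<in> X" "n \<le> j" "agree n z \<omega>" "z j = a" by blast
    obtain \<eta> where \<eta>: "\<eta> \<in> X" "\<eta> 0 = b" using cylinder_ne[OF ab(2)] by blast
    have p: "prepend a \<eta> \<in> X" using X_prepend[OF \<eta>(1) ab(1)] ab(3) \<eta>(2) by simp
    note jn = join_X[OF z(1) p, of j]
    let ?z = "join j z (prepend a \<eta>)"
    have "?z \<in> X" using jn z(4) by simp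
    moreover have "n \<le> Suc j" using z by simp
    moreover have "agree n ?z \<omega>"
      using agree_trans[OF agree_mono[OF jn(2) z(2)] z(3)] z(4) by simp
    moreover have "?z (Suc j) = b" using \<eta> by (simp add: join_def Suc_diff_le)
    ultimately show "\<exists>z\<in>X. \<exists>j\<ge>n. agree n z \<omega> \<and> z j = b" by blast
  qed
qed

lemma reach_point:
  assumes "\<omega> \<in> X" "\<upsilon> \<in> X"
  obtains z j where "z \<in> X" "agree n z \<omega>" "(shift ^^ j) z = \<upsilon>"
proof -
  have "\<upsilon> 0 \<in> S" using assms(2) by (simp add: X_iff)
  from reach[OF assms(1) this, of n] obtain z j where z: "z \<in> X" "n \<le> j" "agree n z \<omega>" "z j = \<upsilon> 0" by blast
  note jn = join_X[OF z(1) assms(2) z(4)[symmetric]]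
  show ?thesis by (rule that[OF jn(1) agree_trans[OF agree_mono[OF jn(2) z(2)] z(3)] jn(3)])
qed

text \<open>With unique successors, any letter of a point determines the rest of it. Irreducibility
  makes every letter recur along \<open>\<omega>\<close>, so \<open>\<omega>\<close> is periodic and
  every point of \<open>X\<close> is one of its shifts.\<close>

lemma deterministic_orbit:
  assumes det: "\<And>s t t'. s \<in> S \<Longrightarrow> t \<in> S \<Longrightarrow> t' \<in> S \<Longrightarrow> A s t = 1 \<Longrightarrow> A s t' = 1 \<Longrightarrow> t = t'"
  shows "finite_single_orbit X"
proof -
  obtain \<omega> where \<omega>: "\<omega> \<in> X" using X_ne by blast
  have step: "\<upsilon> n = \<omega> (j + n)" if "\<upsilon> \<in> X" "\<upsilon> 0 = \<omega> j" for \<upsilon> n j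
  proof (induction n)
    case (Suc n)
    show ?case
    proof (rule det)
      show "A (\<omega> (j + n)) (\<upsilon> (Suc n)) = 1" using that(1) unfolding Suc[symmetric] by (simp add: X_iff)
      show "A (\<omega> (j + n)) (\<omega> (j + Suc n)) = 1" using \<omega> by (simp add: X_iff)
    qed (use \<omega> that in \<open>simp_all add: X_iff\<close>)
  qed (use that in simp)
  have hit: "\<exists>j\<ge>n. \<omega> j = s" if s: "s \<in> S" for s n
  proof -
    obtain z j where z: "z \<in> X" "n \<le> j" "agree n z \<omega>" "z j = s" using reach[OF \<omega> s] by blast
    \<comment> \<open>\<open>Suc n\<close> ensures that \<open>z'\<close> and
      \<open>\<omega>\<close> share the letter at position \<open>0\<close> even for
      \<open>n = 0\<close>.\<close>
    obtain z' j' where z': "z' \<in> X" "Suc n \<le> j'" "agree (Suc n) z' \<omega>" "z' j' = s" using reach[OF \<omega> s] by blast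
    have "z' j' = \<omega> (0 + j')" by (rule step[OF z'(1)]) (use z'(3) in \<open>simp add: agree_def\<close>)
    then show ?thesis using z' by (intro exI[of _ j']) simp
  qed
  have "\<omega> 0 \<in> S" using \<omega> by (simp add: X_iff)
  then obtain q where q: "1 \<le> q" "\<omega> q = \<omega> 0" using hit[of "\<omega> 0" 1] by blast
  have periodic: "\<omega> n = \<omega> (q + n)" for n by (rule step[OF \<omega>]) (use q in simp)
  have "\<omega> (n + q * m) = \<omega> n" for n m
  proof (induction m)
    case (Suc m)
    have "\<omega> (n + q * Suc m) = \<omega> (q + (n + q * m))" by (simp add: add_ac)
    then show ?case using periodic[of "n + q * m"] Suc by simp
  qed simp
  then have mod: "\<omega> j = \<omega> (j mod q)" for j by (metis mod_mult_div_eq)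
  have "X = {(shift ^^ i) \<omega> | i. i < q}"
  proof (intro set_eqI iffI)
    fix \<upsilon> assume \<upsilon>: "\<upsilon> \<in> X"
    then have "\<upsilon> 0 \<in> S" by (simp add: X_iff)
    then obtain j where "\<omega> j = \<upsilon> 0" using hit by blast
    then have j: "\<upsilon> 0 = \<omega> (j mod q)" using mod[of j] by simp
    have "\<upsilon> = (shift ^^ (j mod q)) \<omega>"
      using step[OF \<upsilon> j] by (simp add: fun_eq_iff funpow_shift add.commute)
    then show "\<upsilon> \<in> {(shift ^^ i) \<omega> | i. i < q}" using q by auto
  qed (use X_shift_pow[OF \<omega>] in auto)
  then show ?thesis unfolding finite_single_orbit_def using q by blast
qed

text \<open>By irreducibility the predecessor map \<open>P\<close> carries \<open>s\<close> to every
  letter. If \<open>t = (P ^^ n) s\<close> and \<open>t' = (P ^^ m) s\<close> both follow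
  \<open>s\<close>, then \<open>s\<close> has the periods \<open>n + 1\<close> and
  \<open>m + 1\<close> under \<open>P\<close>, so \<open>t\<close> and \<open>t'\<close> are both
  the iterate of \<open>s\<close> of order \<open>(m + 1) * (n + 1) - 1\<close>. Thus successors are
  unique as well.\<close>

lemma co_deterministic_orbit:
  assumes det: "\<And>s s' t. s \<in> S \<Longrightarrow> s' \<in> S \<Longrightarrow> t \<in> S \<Longrightarrow> A s t = 1 \<Longrightarrow> A s' t = 1 \<Longrightarrow> s = s'"
  shows "finite_single_orbit X"
proof (rule deterministic_orbit)
  fix s t t' assume s: "s \<in> S" "t \<in> S" "t' \<in> S" "A s t = 1" "A s t' = 1"
  define P where "P t = (SOME s. s \<in> S \<and> A s t = 1)" for t
  have P: "P t = s" if "s \<in> S" "t \<in> S" "A s t = 1" for s t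
    unfolding P_def by (rule some_equality) (use det that in blast)+
  have reach: "\<exists>n. a = (P ^^ n) b" if "a \<in> S" "b \<in> S" for a b
  proof (rule path_induct_back[where Q = "\<lambda>a. \<exists>n. a = (P ^^ n) b", OF that])
    show "\<exists>n. b = (P ^^ n) b" by (rule exI[of _ 0]) simp
    fix a c assume ac: "a \<in> S" "c \<in> S" "A a c = 1" and "\<exists>n. c = (P ^^ n) b"
    then obtain n where "c = (P ^^ n) b" by blast
    then have "a = (P ^^ Suc n) b" using P[OF ac] by simp
    then show "\<exists>n. a = (P ^^ n) b" by blast
  qed
  have Pt: "P t = s" "P t' = s" using P s by auto
  obtain m n where m: "t' = (P ^^ m) s" and n: "t = (P ^^ n) s"
    using reach s by meson
  have cyc: "(P ^^ (m + 1)) s = s" "(P ^^ (n + 1)) s = s" using Pt m n by simp_all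
  have iter: "(P ^^ (c * j)) s = s" if "(P ^^ c) s = s" for c j
    using that by (induction j) (auto simp: funpow_add)
  have "(P ^^ ((m + 1) * n + m)) s = t'"
  proof -
    have "(P ^^ (m + (m + 1) * n)) s = t'" unfolding funpow_add o_def iter[OF cyc(1)] m ..
    then show ?thesis by (simp add: add.commute)
  qed
  moreover have "(P ^^ ((n + 1) * m + n)) s = t"
  proof -
    have "(P ^^ (n + (n + 1) * m)) s = t" unfolding funpow_add o_def iter[OF cyc(2)] n ..
    then show ?thesis by (simp add: add.commute)
  qed
  moreover have "(m + 1) * n + m = (n + 1) * m + n" by (simp add: algebra_simps)
  ultimately show "t = t'" by (simp only:)
qed

text \<open>Along an edge \<open>s \<rightarrow> t\<close> the cylinder \<open>[s]\<close> has at least as many points as \<open>[t]\<close>. If these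
  numbers are finite, irreducibility makes them all equal, which rules out branching.\<close>

lemma infinite_cylinder:
  assumes no: "\<not> finite_single_orbit X" and \<omega>: "\<omega> \<in> X"
  shows "infinite (cylinder X (map \<omega> [0..<n]))"
proof
  assume fin: "finite (cylinder X (map \<omega> [0..<n]))"
  define c where "c s = {\<eta> \<in> X. \<eta> 0 = s}" for s
  have Sn: "\<omega> n \<in> S" using \<omega> by (simp add: X_iff)
  have "join n \<omega> ` c (\<omega> n) \<subseteq> cylinder X (map \<omega> [0..<n])"
    using join_X[OF \<omega>, of _ n] by (auto simp: c_def cylinder_map)
  moreover have "inj_on (join n \<omega>) (c (\<omega> n))"
    using join_X(3)[OF \<omega>, of _ n] by (intro inj_on_inverseI[where g = "shift ^^ n"]) (simp add: c_def)
  ultimately have f0: "finite (c (\<omega> n))" using fin finite_imageD finite_subset by metis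
  have edge: "(prepend a ` c b) \<subseteq> c a" "inj_on (prepend a) (c b)" if "a \<in> S" "A a b = 1" for a b
    using X_prepend that by (auto simp: c_def intro: inj_on_inverseI[where g = shift])
  have cle: "finite (c b) \<and> card (c b) \<le> card (c a)" if "a \<in> S" "b \<in> S" "finite (c a)" for a b
  proof (rule path_induct_forward[where Q = "\<lambda>b. finite (c b) \<and> card (c b) \<le> card (c a)", OF that(1,2)])
    fix d e assume de: "d \<in> S" "e \<in> S" "A d e = 1" and d: "finite (c d) \<and> card (c d) \<le> card (c a)"
    note eg = edge[OF de(1,3)]
    have "finite (c e)" using finite_imageD[OF finite_subset[OF eg(1)] eg(2)] d by blast
    moreover have "card (c e) \<le> card (c d)" using card_inj_on_le[OF eg(2,1)] d by blast
    ultimately show "finite (c e) \<and> card (c e) \<le> card (c a)" using d by simp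
  qed (use that in simp)
  have fin_c: "finite (c s)" if "s \<in> S" for s using cle[OF Sn that f0] by simp
  have "t = t'" if s: "s \<in> S" "t \<in> S" "t' \<in> S" "A s t = 1" "A s t' = 1" for s t t'
  proof (rule ccontr)
    assume ne: "t \<noteq> t'"
    have "prepend s ` c t \<inter> prepend s ` c t' = {}"
    proof (rule ccontr)
      assume "prepend s ` c t \<inter> prepend s ` c t' \<noteq> {}"
      then obtain x y where "x \<in> c t" "y \<in> c t'" "prepend s x = prepend s y" by blast
      then have "x = y" by (metis shift_prepend)
      then show False using \<open>x \<in> c t\<close> \<open>y \<in> c t'\<close> ne by (simp add: c_def)
    qed
    then have "card (prepend s ` c t \<union> prepend s ` c t') = card (c t) + card (c t')"
      using fin_c s edge(2) by (subst card_Un_disjoint) (auto simp: card_image)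
    moreover have "card (prepend s ` c t \<union> prepend s ` c t') \<le> card (c s)"
      using fin_c[OF s(1)] edge(1) s by (intro card_mono) auto
    moreover have "card (c s) \<le> card (c t)" using cle[OF s(2,1) fin_c[OF s(2)]] by simp
    moreover have "0 < card (c t')"
      using cylinder_ne[OF s(3)] fin_c[OF s(3)] by (auto simp: card_gt_0_iff c_def)
    ultimately show False by linarith
  qed
  then have "finite_single_orbit X" by (rule deterministic_orbit)
  with no show False by blast
qed

lemma separated_points:
  assumes "\<not> finite_single_orbit X" "\<omega> \<in> X"
  obtains z :: "nat \<Rightarrow> nat \<Rightarrow> 's" and n where "m \<le> n" "\<And>i. i \<le> N \<Longrightarrow> z i \<in> X \<and> agree m (z i) \<omega>"
    "\<And>i j. i \<le> N \<Longrightarrow> j \<le> N \<Longrightarrow> agree n (z i) (z j) \<Longrightarrow> i = j"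
proof -
  obtain Y where Y: "Y \<subseteq> cylinder X (map \<omega> [0..<m])" "finite Y" "card Y = Suc N"
    using infinite_arbitrarily_large[OF infinite_cylinder[OF assms, of m]] by blast
  obtain z where z: "bij_betw z {0..<Suc N} Y" using ex_bij_betw_nat_finite[OF Y(2)] Y(3) by metis
  have zX: "z i \<in> X \<and> agree m (z i) \<omega>" if "i \<le> N" for i
  proof -
    have "z i \<in> Y" using bij_betwE[OF z] that by simp
    then show ?thesis using Y(1) by (auto simp: cylinder_map)
  qed
  have zi: "i = j" if "i \<le> N" "j \<le> N" "z i = z j" for i j
    using inj_onD[OF bij_betw_imp_inj_on[OF z] that(3)] that by simp
  have "\<exists>n. z i \<noteq> z j \<longrightarrow> \<not> agree n (z i) (z j)" for i j using agree_all by blast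
  then obtain s where s: "\<And>i j. z i \<noteq> z j \<Longrightarrow> \<not> agree (s i j) (z i) (z j)" by metis
  define n where "n = m + (\<Sum>i\<le>N. \<Sum>j\<le>N. s i j)"
  have "s i j \<le> n" if "i \<le> N" "j \<le> N" for i j
  proof -
    have "s i j \<le> (\<Sum>j\<le>N. s i j)" by (rule member_le_sum) (use that in auto)
    also have "\<dots> \<le> (\<Sum>i\<le>N. \<Sum>j\<le>N. s i j)" by (rule member_le_sum[where f = "\<lambda>i. \<Sum>j\<le>N. s i j"]) (use that in auto)
    finally show ?thesis by (simp add: n_def)
  qed
  then have sep: "i = j" if "i \<le> N" "j \<le> N" "agree n (z i) (z j)" for i j
    using s[of i j] agree_mono[OF that(3), of "s i j"] zi[OF that(1,2)] that by blast
  show ?thesis by (rule that[of n z]) (use zX sep in \<open>auto simp: n_def\<close>)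
qed

end

section \<open>Eigenvalues of infinite multiplicity\<close>

context transfer_limit
begin

text \<open>For \<open>F\<close> supported on \<open>{g > 0}\<close> with \<open>L (g F) = 0\<close>, the function
  \<open>g \<cdot> ser (p / \<rho>) F\<close> is an eigenfunction for \<open>p\<close>. The factor \<open>mprod n\<close> does not affect this,
  but it makes the construction injective in \<open>F\<close>.\<close>

definition mfac :: "(nat \<Rightarrow> 'a) \<Rightarrow> complex" where "mfac \<omega> = (if M (\<omega> 0) (\<omega> 1) = 1 then 1 else 0)"

definition mprod :: "nat \<Rightarrow> (nat \<Rightarrow> 'a) \<Rightarrow> complex" where "mprod n \<omega> = (\<Prod>i<n. mfac ((shift ^^ i) \<omega>))"

definition ser :: "complex \<Rightarrow> ((nat \<Rightarrow> 'a) \<Rightarrow> complex) \<Rightarrow> (nat \<Rightarrow> 'a) \<Rightarrow> complex" where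
  "ser q F \<omega> = (\<Sum>n. q ^ n * (mprod n \<omega> * F ((shift ^^ n) \<omega>)))"

lemma norm_mprod: "cmod (mprod n \<omega>) \<le> 1"
  unfolding mprod_def by (rule order.trans[OF norm_prod_le]) (auto intro!: prod_le_1 simp: mfac_def)

lemma ser_term_le:
  assumes "bd B F" "\<omega> \<in> X"
  shows "norm (q ^ n * (mprod n \<omega> * F ((shift ^^ n) \<omega>))) \<le> B * cmod q ^ n"
proof -
  have "cmod (mprod n \<omega>) * cmod (F ((shift ^^ n) \<omega>)) \<le> 1 * B"
    using bdD[OF assms(1) X_shift_pow[OF assms(2)], of n] norm_mprod by (intro mult_mono) auto
  then have "cmod q ^ n * (cmod (mprod n \<omega>) * cmod (F ((shift ^^ n) \<omega>))) \<le> cmod q ^ n * B"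
    by (intro mult_left_mono) auto
  then show ?thesis by (simp add: norm_mult norm_power mult.commute)
qed

lemma ser_summable:
  assumes "bd B F" "\<omega> \<in> X" "cmod q < 1"
  shows "summable (\<lambda>n. q ^ n * (mprod n \<omega> * F ((shift ^^ n) \<omega>)))"
  by (rule summable_comparison_test'[of "\<lambda>n. B * cmod q ^ n" 0])
    (use ser_term_le[OF assms(1,2)] assms(3) in \<open>auto intro: summable_mult summable_geometric\<close>)

lemma ser_bd:
  assumes "bd B F" "cmod q < 1" shows "bd (B / (1 - cmod q)) (ser q F)"
  unfolding bd_def
proof
  fix \<omega> assume \<omega>: "\<omega> \<in> X"
  have s: "summable (\<lambda>n. B * cmod q ^ n)" using assms by (auto intro: summable_mult summable_geometric)
  have "norm (ser q F \<omega>) \<le> (\<Sum>n. B * cmod q ^ n)"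
    unfolding ser_def by (rule norm_suminf_le[OF ser_term_le[OF assms(1) \<omega>] s])
  also have "\<dots> = B / (1 - cmod q)" using assms(2) by (simp add: suminf_mult suminf_geometric summable_geometric)
  finally show "norm (ser q F \<omega>) \<le> B / (1 - cmod q)" .
qed

text \<open>The term \<open>n = 0\<close> is split off. Both the eigenvalue equation and injectivity
  follow from this recursion.\<close>

lemma ser_rec:
  assumes "bd B F" "\<omega> \<in> X" "cmod q < 1"
  shows "ser q F \<omega> = F \<omega> + q * (mfac \<omega> * ser q F (shift \<omega>))"
proof -
  have m: "mprod (Suc n) \<omega> = mfac \<omega> * mprod n (shift \<omega>)" for n
    unfolding mprod_def prod.lessThan_Suc_shift by (simp add: funpow_Suc_right del: funpow.simps)
  note s = ser_summable[OF assms] and s' = ser_summable[OF assms(1) X_shift[OF assms(2)] assms(3)]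
  have "ser q F \<omega> = (\<Sum>n. q ^ Suc n * (mprod (Suc n) \<omega> * F ((shift ^^ Suc n) \<omega>))) + F \<omega>"
    unfolding ser_def using suminf_split_head[OF s] by (simp add: mprod_def)
  also have "(\<Sum>n. q ^ Suc n * (mprod (Suc n) \<omega> * F ((shift ^^ Suc n) \<omega>))) =
      (\<Sum>n. (q * mfac \<omega>) * (q ^ n * (mprod n (shift \<omega>) * F ((shift ^^ n) (shift \<omega>)))))"
    unfolding m by (simp add: funpow_Suc_right mult_ac del: funpow.simps)
  also have "\<dots> = (q * mfac \<omega>) * ser q F (shift \<omega>)" unfolding ser_def by (rule suminf_mult[OF s'])
  finally show ?thesis by (simp add: mult.assoc)
qed

text \<open>For agreement to depth \<open>m\<close>, the terms with \<open>n < m\<close> still agree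
  to depth \<open>m - n\<close> after shifting, and the others are small. Either way a factor
  \<open>(cmod q / \<theta>) ^ n * \<theta> ^ m\<close> appears; its summability over
  \<open>n\<close> is the condition \<open>cmod q < \<theta>\<close> and fixes the radius
  \<open>\<rho> * \<theta>\<close> of the disc.\<close>

lemma ser_lip:
  assumes B: "bd B F" and l: "lip 0 D F" and q: "cmod q < \<theta>"
  shows "\<exists>C. lip 0 C (ser q F)"
proof -
  have B0: "0 \<le> B" and D0: "0 \<le> D" using bd_nonneg[OF B] lip_nonneg[OF l] by auto
  let ?r = "cmod q / \<theta>"
  have r: "norm ?r < 1" using q th0 by simp
  have q1: "cmod q < 1" using q th1 by simp
  have qr: "cmod q ^ n = ?r ^ n * \<theta> ^ n" for n using th0 by (simp add: power_divide)
  have r0: "0 \<le> ?r ^ n" for n using th0 by simp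
  have t: "lip 0 ((D + 2 * B) * ?r ^ n) (\<lambda>\<omega>. q ^ n * (mprod n \<omega> * F ((shift ^^ n) \<omega>)))" for n
    unfolding lip_def
  proof (intro allI impI ballI)
    fix m \<omega> \<upsilon> assume \<omega>: "\<omega> \<in> X" and \<upsilon>: "\<upsilon> \<in> X" and a: "agree m \<omega> \<upsilon>"
    let ?t = "\<lambda>\<omega>. q ^ n * (mprod n \<omega> * F ((shift ^^ n) \<omega>))"
    show "norm (?t \<omega> - ?t \<upsilon>) \<le> (D + 2 * B) * ?r ^ n * \<theta> ^ m"
    proof (cases "n < m")
      case True
      have m: "mprod n \<omega> = mprod n \<upsilon>"
        unfolding mprod_def mfac_def using a True
        by (intro prod.cong) (auto simp: funpow_shift agree_def)
      have ag: "agree (m - n) ((shift ^^ n) \<omega>) ((shift ^^ n) \<upsilon>)" using a by (auto simp: agree_def funpow_shift)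
      have "norm (?t \<omega> - ?t \<upsilon>) = cmod q ^ n * (cmod (mprod n \<upsilon>) * cmod (F ((shift ^^ n) \<omega>) - F ((shift ^^ n) \<upsilon>)))"
        unfolding m right_diff_distrib[symmetric] norm_mult norm_power ..
      also have "\<dots> \<le> cmod q ^ n * (1 * (D * \<theta> ^ (m - n)))"
        using lipD[OF l _ X_shift_pow[OF \<omega>] X_shift_pow[OF \<upsilon>] ag] norm_mprod by (intro mult_left_mono mult_mono) auto
      also have "\<dots> = D * ?r ^ n * (\<theta> ^ n * \<theta> ^ (m - n))" unfolding qr by simp
      also have "\<theta> ^ n * \<theta> ^ (m - n) = \<theta> ^ m" using True by (simp add: power_add[symmetric])
      also have "D * ?r ^ n * \<theta> ^ m \<le> (D + 2 * B) * ?r ^ n * \<theta> ^ m"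
        using B0 r0[of n] by (intro mult_right_mono) auto
      finally show ?thesis .
    next
      case False
      have "norm (?t \<omega> - ?t \<upsilon>) \<le> 2 * (B * cmod q ^ n)"
        using norm_triangle_ineq4[of "?t \<omega>" "?t \<upsilon>"] ser_term_le[OF B \<omega>, of q n] ser_term_le[OF B \<upsilon>, of q n] by linarith
      also have "\<dots> = 2 * B * ?r ^ n * \<theta> ^ n" unfolding qr by simp
      also have "\<dots> \<le> 2 * B * ?r ^ n * \<theta> ^ m" using False \<theta>_decr[of m n] B0 r0[of n] by (intro mult_left_mono) auto
      also have "\<dots> \<le> (D + 2 * B) * ?r ^ n * \<theta> ^ m" using D0 r0[of n] by (intro mult_right_mono) auto
      finally show ?thesis .
    qed
  qed
  have "lip 0 (\<Sum>n. (D + 2 * B) * ?r ^ n) (\<lambda>\<omega>. \<Sum>n. q ^ n * (mprod n \<omega> * F ((shift ^^ n) \<omega>)))"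
    by (rule lip_suminf[OF t _ ser_term_le[OF B]])
      (use r q1 in \<open>auto intro!: summable_mult summable_geometric\<close>)
  then show ?thesis unfolding ser_def[abs_def] by blast
qed

lemma lip_0_mono: "lip 0 C f \<Longrightarrow> lip k C f"
  by (simp add: lip_def)

text \<open>Lipschitz control is asked from level \<open>0\<close> on, because shifting by
  \<open>n\<close> can use up almost all of the agreement. The support condition makes
  \<open>F\<close> recoverable from \<open>g\<close> times the series.\<close>

definition seed :: "((nat \<Rightarrow> 'a) \<Rightarrow> complex) \<Rightarrow> bool" where
  "seed F \<longleftrightarrow> (\<exists>B. bd B F) \<and> (\<exists>D. lip 0 D F) \<and> (\<forall>\<omega>\<in>X. g0 \<omega> = 0 \<longrightarrow> F \<omega> = 0) \<and>
    (\<forall>\<omega>\<in>X. Lop (\<lambda>\<omega>. g \<omega> * F \<omega>) \<omega> = 0)"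

lemma g_bd: "bd 1 g" using norm_g_le by (simp add: bd_def)

lemma bd_mult:
  fixes f h :: "(nat \<Rightarrow> 'a) \<Rightarrow> complex"
  assumes "bd B f" "bd C h" shows "bd (B * C) (\<lambda>\<omega>. f \<omega> * h \<omega>)"
  unfolding bd_def
proof
  fix \<omega> assume \<omega>: "\<omega> \<in> X"
  show "norm (f \<omega> * h \<omega>) \<le> B * C" unfolding norm_mult
    using bdD[OF assms(1) \<omega>] bdD[OF assms(2) \<omega>] bd_nonneg[OF assms(1)] by (intro mult_mono) auto
qed

lemma g_out: "\<omega> \<notin> X \<Longrightarrow> g \<omega> = 0" by (simp add: g_def g0_out)

text \<open>With \<open>q = p / \<rho>\<close>, \<open>ser_rec\<close> and \<open>Lop_shift\<close>
  send \<open>g\<close> times the series to \<open>Lop (g F)\<close>, which is zero, plus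
  \<open>q\<close> times \<open>Lop g\<close> times the series, which is \<open>p\<close> times the
  original function. The factor \<open>mfac\<close> equals one at every preimage that the operator
  sees.\<close>

lemma seed_eigenfunction:
  assumes F: "seed F" and p: "cmod p < \<rho> * \<theta>"
  shows "(\<lambda>\<omega>. g \<omega> * ser (p / \<rho>) F \<omega>) \<in> eigenspace (Fb_space \<theta> X k) Lop p"
proof -
  obtain B D where B: "bd B F" and D: "lip 0 D F" using F by (auto simp: seed_def)
  let ?q = "p / \<rho>"
  have q: "cmod ?q < \<theta>" using p \<rho>_pos by (simp add: norm_divide pos_divide_less_eq mult.commute)
  then have q1: "cmod ?q < 1" using th1 by simp
  obtain C where C: "lip 0 C (ser ?q F)" using ser_lip[OF B D q] by blast
  note sb = ser_bd[OF B q1]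
  have "lip k (c1 * exp c1 / (SUP \<omega>\<in>X. g0 \<omega>) * (B / (1 - cmod ?q)) + 1 * C) (\<lambda>\<omega>. g \<omega> * ser ?q F \<omega>)"
    by (rule lip_mult[OF lip_g lip_0_mono[OF C] norm_g_le bdD[OF sb]])
  then have mem: "(\<lambda>\<omega>. g \<omega> * ser ?q F \<omega>) \<in> Fb_space \<theta> X k"
    using bd_mult[OF g_bd sb] g_out by (auto simp: Fb_iff bd_def)
  have "Lop (\<lambda>\<omega>. g \<omega> * ser ?q F \<omega>) \<omega> = p * (g \<omega> * ser ?q F \<omega>)" if \<omega>: "\<omega> \<in> X" for \<omega>
  proof -
    have mg: "Lop (\<lambda>\<omega>. ?q * mfac \<omega> * g \<omega>) \<omega> = ?q * (\<rho> * g \<omega>)"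
    proof -
      have "Lop (\<lambda>\<omega>. ?q * mfac \<omega> * g \<omega>) \<omega> = Lop (\<lambda>\<omega>. ?q * g \<omega>) \<omega>"
        unfolding Lop_in[OF \<omega>] by (rule infsum_cong) (simp add: mfac_def pre_def)
      also have "\<dots> = ?q * (\<rho> * g \<omega>)" unfolding Lop_cmult Lop_g cscale_def by simp
      finally show ?thesis .
    qed
    have bm: "bd (cmod ?q * 1 * 1 * (B / (1 - cmod ?q))) (\<lambda>\<omega>. ?q * mfac \<omega> * g \<omega> * ser ?q F (shift \<omega>))"
    proof (intro bd_mult g_bd)
      show "bd (cmod ?q) (\<lambda>\<omega>. ?q)" by simp
      show "bd 1 mfac" by (simp add: bd_def mfac_def)
      show "bd (B / (1 - cmod ?q)) (\<lambda>\<omega>. ser ?q F (shift \<omega>))" using sb X_shift by (simp add: bd_def)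
    qed
    have "Lop (\<lambda>\<omega>. g \<omega> * ser ?q F \<omega>) = Lop (\<lambda>\<omega>. g \<omega> * F \<omega> + ?q * mfac \<omega> * g \<omega> * ser ?q F (shift \<omega>))"
    proof (rule Lop_cong)
      fix \<omega> assume "\<omega> \<in> X"
      from ser_rec[OF B this q1] show "g \<omega> * ser ?q F \<omega> = g \<omega> * F \<omega> + ?q * mfac \<omega> * g \<omega> * ser ?q F (shift \<omega>)"
        by (simp only: ring_distribs mult_ac)
    qed
    then have "Lop (\<lambda>\<omega>. g \<omega> * ser ?q F \<omega>) \<omega> = Lop (\<lambda>\<omega>. g \<omega> * F \<omega>) \<omega> + Lop (\<lambda>\<omega>. ?q * mfac \<omega> * g \<omega> * ser ?q F (shift \<omega>)) \<omega>"
      using Lop_add[OF bd_mult[OF g_bd B] bm] by simp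
    also have "Lop (\<lambda>\<omega>. ?q * mfac \<omega> * g \<omega> * ser ?q F (shift \<omega>)) \<omega> = ?q * (\<rho> * g \<omega>) * ser ?q F \<omega>"
      using Lop_shift[of "\<lambda>\<omega>. ?q * mfac \<omega> * g \<omega>" "ser ?q F" \<omega>] unfolding mg .
    also have "Lop (\<lambda>\<omega>. g \<omega> * F \<omega>) \<omega> = 0" using F \<omega> by (simp add: seed_def)
    finally show ?thesis using \<rho>_pos by simp
  qed
  then have "Lop (\<lambda>\<omega>. g \<omega> * ser ?q F \<omega>) = cscale p (\<lambda>\<omega>. g \<omega> * ser ?q F \<omega>)"
    unfolding cscale_def using g_out by (intro ext) (metis Lop_out mult_zero_left mult_zero_right)
  with mem show ?thesis by (simp add: eigenspace_def)
qed

text \<open>The eigenvalue equation at \<open>shift \<omega>\<close> contains the positive term of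
  the preimage \<open>\<omega>\<close>.\<close>

lemma g0_forward:
  assumes \<omega>: "\<omega> \<in> X" and "0 < g0 \<omega>" "M (\<omega> 0) (\<omega> 1) = 1" shows "0 < g0 (shift \<omega>)"
proof -
  have "exp (\<phi> \<omega>) * g0 \<omega> \<le> Lop g0 (shift \<omega>)"
    by (rule Lop_ge_term[OF _ _ \<omega> assms(3), where B = 1]) (use g0_range in \<open>auto simp: bd_def\<close>)
  moreover have "0 < exp (\<phi> \<omega>) * g0 \<omega>" using assms(2) by simp
  ultimately have "0 < \<rho> * g0 (shift \<omega>)" unfolding Lop_g0 by linarith
  then show ?thesis using \<rho>_pos by (simp add: zero_less_mult_iff)
qed

lemma g_zero_iff: "g \<omega> = 0 \<longleftrightarrow> g0 \<omega> = 0" using g0_Sup(1) by (simp add: g_def)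

text \<open>Where \<open>g\<close> is positive the series vanishes. If the first transition is
  admissible, \<open>g\<close> is positive at the shifted point too, so the series vanishes there;
  if not, \<open>mfac\<close> cuts the recursion off. In both cases \<open>ser_rec\<close> leaves
  \<open>F \<omega> = 0\<close>.\<close>

lemma ser_injective:
  assumes B: "bd B F" and supp: "\<forall>\<omega>\<in>X. g0 \<omega> = 0 \<longrightarrow> F \<omega> = 0" and q: "cmod q < 1"
    and z: "\<And>\<omega>. \<omega> \<in> X \<Longrightarrow> g \<omega> * ser q F \<omega> = 0" and \<omega>: "\<omega> \<in> X"
  shows "F \<omega> = 0"
proof (cases "g0 \<omega> = 0")
  case False
  have pos: "0 < g0 \<omega>" using False g0_range[OF \<omega>] by linarith
  have "ser q F \<omega> = 0" using z[OF \<omega>] False g_zero_iff by simp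
  moreover have "mfac \<omega> * ser q F (shift \<omega>) = 0"
  proof (cases "M (\<omega> 0) (\<omega> 1) = 1")
    case True
    have "g (shift \<omega>) \<noteq> 0" using g0_forward[OF \<omega> pos True] g_zero_iff by simp
    then show ?thesis using z[OF X_shift[OF \<omega>]] by simp
  qed (simp add: mfac_def)
  ultimately show ?thesis using ser_rec[OF B \<omega> q] by simp
qed (use supp \<omega> in simp)

lemma ser_sum:
  fixes N :: nat
  assumes B: "\<And>i. i \<le> N \<Longrightarrow> bd (B i) (F i)" and \<omega>: "\<omega> \<in> X" and q: "cmod q < 1"
  shows "(\<Sum>i\<le>N. c i * ser q (F i) \<omega>) = ser q (\<lambda>\<omega>. \<Sum>i\<le>N. c i * F i \<omega>) \<omega>"
proof -
  note s = ser_summable[OF B \<omega> q]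
  have "(\<Sum>i\<le>N. c i * ser q (F i) \<omega>) = (\<Sum>i\<le>N. \<Sum>n. c i * (q ^ n * (mprod n \<omega> * F i ((shift ^^ n) \<omega>))))"
    unfolding ser_def by (rule sum.cong) (auto intro!: suminf_mult[symmetric] s)
  also have "\<dots> = (\<Sum>n. \<Sum>i\<le>N. c i * (q ^ n * (mprod n \<omega> * F i ((shift ^^ n) \<omega>))))"
    by (rule suminf_sum[symmetric]) (auto intro!: summable_mult s)
  also have "\<dots> = ser q (\<lambda>\<omega>. \<Sum>i\<le>N. c i * F i \<omega>) \<omega>"
    unfolding ser_def by (simp add: sum_distrib_left mult_ac)
  finally show ?thesis .
qed

text \<open>A combination of seeds inherits the support condition, so \<open>ser_injective\<close>
  turns the vanishing of the combined eigenfunction into that of the combined seed, which is then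
  evaluated at \<open>x j\<close>.\<close>

lemma seeds_combination:
  fixes N :: nat
  assumes F: "\<And>i. i \<le> N \<Longrightarrow> seed (F i)" and x: "\<And>i. i \<le> N \<Longrightarrow> x i \<in> X \<and> F i (x i) \<noteq> 0"
    and xj: "\<And>i j. i \<le> N \<Longrightarrow> j \<le> N \<Longrightarrow> i \<noteq> j \<Longrightarrow> F i (x j) = 0"
    and q: "cmod q < 1" and z: "\<And>\<omega>. \<omega> \<in> X \<Longrightarrow> (\<Sum>i\<le>N. c i * (g \<omega> * ser q (F i) \<omega>)) = 0" and j: "j \<le> N"
  shows "c j = 0"
proof -
  have "\<exists>B. \<forall>i\<le>N. bd (B i) (F i)"
    using F unfolding seed_def by (intro choice[of "\<lambda>i B. i \<le> N \<longrightarrow> bd B (F i)"]) blast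
  then obtain B where B: "\<And>i. i \<le> N \<Longrightarrow> bd (B i) (F i)" by blast
  let ?F = "\<lambda>\<omega>. \<Sum>i\<le>N. c i * F i \<omega>"
  have bF: "bd (\<Sum>i\<le>N. cmod (c i) * B i) ?F"
    unfolding bd_def
  proof
    fix \<omega> assume "\<omega> \<in> X"
    then show "norm (?F \<omega>) \<le> (\<Sum>i\<le>N. cmod (c i) * B i)"
      using bdD[OF B] by (intro order.trans[OF norm_sum] sum_mono) (auto simp: norm_mult intro: mult_left_mono)
  qed
  have "?F (x j) = 0"
  proof (rule ser_injective[OF bF _ q])
    show "\<forall>\<omega>\<in>X. g0 \<omega> = 0 \<longrightarrow> ?F \<omega> = 0" using F by (auto simp: seed_def)
    show "g \<omega> * ser q ?F \<omega> = 0" if "\<omega> \<in> X" for \<omega>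
    proof -
      have "g \<omega> * ser q ?F \<omega> = g \<omega> * (\<Sum>i\<le>N. c i * ser q (F i) \<omega>)"
      proof -
        have "(\<Sum>i\<le>N. c i * ser q (F i) \<omega>) = ser q ?F \<omega>" by (rule ser_sum[OF B that q])
        then show ?thesis by simp
      qed
      also have "\<dots> = (\<Sum>i\<le>N. c i * (g \<omega> * ser q (F i) \<omega>))" by (simp add: sum_distrib_left mult.left_commute)
      finally show ?thesis using z[OF that] by simp
    qed
    show "x j \<in> X" using x j by blast
  qed
  moreover have "?F (x j) = c j * F j (x j)"
  proof -
    have "?F (x j) = (\<Sum>i\<le>N. if j = i then c i * F i (x j) else 0)"
      by (rule sum.cong) (use xj j in auto)
    also have "\<dots> = (if j \<in> {..N} then c j * F j (x j) else 0)" by (rule sum.delta') simp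
    finally show ?thesis using j by simp
  qed
  ultimately show ?thesis using x[OF j] by simp
qed

lemma infinite_multiplicity:
  assumes seeds: "\<And>N. \<exists>F (x :: nat \<Rightarrow> nat \<Rightarrow> 'a). (\<forall>i\<le>N. seed (F i) \<and> x i \<in> X \<and> F i (x i) \<noteq> 0) \<and>
      (\<forall>i\<le>N. \<forall>j\<le>N. i \<noteq> j \<longrightarrow> F i (x j) = 0)"
    and p: "cmod p < \<rho> * \<theta>"
  shows "infinite_mult_eigenvalue (Fb_space \<theta> X k) Lop p"
proof -
  let ?E = "eigenspace (Fb_space \<theta> X k) Lop p" and ?q = "p / \<rho>"
  have q: "cmod ?q < 1"
  proof -
    have "cmod ?q < \<theta>" using p \<rho>_pos by (simp add: norm_divide pos_divide_less_eq mult.commute)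
    then show ?thesis using th1 by simp
  qed
  have fam: "\<exists>A. A \<subseteq> ?E \<and> finite A \<and> card A = Suc N \<and> cfun.independent A" for N
  proof -
    obtain F x where F: "\<And>i. i \<le> N \<Longrightarrow> seed (F i)" and x: "\<And>i. i \<le> N \<Longrightarrow> x i \<in> X \<and> F i (x i) \<noteq> 0"
      and xj: "\<And>i j. i \<le> N \<Longrightarrow> j \<le> N \<Longrightarrow> i \<noteq> j \<Longrightarrow> F i (x j) = 0"
      using seeds[of N] by blast
    define f where "f i \<omega> = g \<omega> * ser ?q (F i) \<omega>" for i \<omega>
    have comb: "c j = 0" if c: "\<And>\<omega>. \<omega> \<in> X \<Longrightarrow> (\<Sum>i\<le>N. c i * f i \<omega>) = 0" and j: "j \<le> N" for c j
    proof (rule seeds_combination[OF _ _ _ q _ j])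
      show "(\<Sum>i\<le>N. c i * (g \<omega> * ser ?q (F i) \<omega>)) = 0" if "\<omega> \<in> X" for \<omega>
        using c[OF that] by (simp add: f_def)
    qed (fact F, fact x, fact xj)
    have inj: "inj_on f {..N}"
    proof (rule inj_onI, rule ccontr)
      fix i j assume ij: "i \<in> {..N}" "j \<in> {..N}" "f i = f j" "i \<noteq> j"
      have "(if i = i then 1 else if i = j then -1 else 0 :: complex) = 0"
      proof (rule comb[of "\<lambda>l. if l = i then 1 else if l = j then -1 else 0"])
        fix \<omega>
        have "(\<Sum>l\<le>N. (if l = i then 1 else if l = j then -1 else 0) * f l \<omega>) =
            (\<Sum>l\<le>N. (if l = i then f i \<omega> else 0) - (if l = j then f j \<omega> else 0))"
          by (rule sum.cong) (use ij in auto)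
        then show "(\<Sum>l\<le>N. (if l = i then 1 else if l = j then -1 else 0) * f l \<omega>) = 0"
          using ij by (simp add: sum_subtractf)
      qed (use ij in auto)
      then show False by simp
    qed
    have "cfun.independent (f ` {..N})"
    proof (rule cfun.independent_if_scalars_zero)
      fix c h assume c: "(\<Sum>h\<in>f ` {..N}. cscale (c h) h) = 0" and "h \<in> f ` {..N}"
      then obtain i where i: "i \<le> N" "h = f i" by auto
      have "(\<Sum>l\<le>N. cscale (c (f l)) (f l)) = 0" using c unfolding sum.reindex[OF inj] by simp
      then have "(\<Sum>l\<le>N. cscale (c (f l)) (f l)) \<omega> = 0" for \<omega> by simp
      then have 0: "(\<Sum>l\<le>N. c (f l) * f l \<omega>) = 0" for \<omega> unfolding sum_fun_apply cscale_def .
      show "c h = 0" unfolding i(2) by (rule comb[of "\<lambda>l. c (f l)"]) (rule 0 i(1))+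
    qed simp
    moreover have "f ` {..N} \<subseteq> ?E" using seed_eigenfunction[OF F p] unfolding f_def[abs_def] by auto
    ultimately show ?thesis using card_image[OF inj] by (intro exI[of _ "f ` {..N}"]) simp
  qed
  have "\<not> finite_dim ?E"
  proof
    assume "finite_dim ?E"
    then obtain B where B: "finite B" "?E \<subseteq> cfun.span B" by (auto simp: finite_dim_def)
    obtain A where A: "A \<subseteq> ?E" "finite A" "card A = Suc (card B)" "cfun.independent A"
      using fam[of "card B"] by blast
    show False using cfun.independent_span_bound[OF B(1) A(4)] A(1,3) B(2) by auto
  qed
  moreover have "eigenvalue (Fb_space \<theta> X k) Lop p"
  proof -
    obtain A where A: "A \<subseteq> ?E" "card A = Suc 0" "cfun.independent A" using fam[of 0] by blast
    then obtain h where "A = {h}" by (auto simp: card_Suc_eq)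
    moreover have "0 \<notin> A" using A(3) cfun.dependent_zero by blast
    ultimately show ?thesis using A(1) unfolding eigenvalue_def by auto
  qed
  ultimately show ?thesis by (simp add: infinite_mult_eigenvalue_def)
qed

text \<open>The whole open disc consists of eigenvalues, so none of its points is isolated in the
  spectrum; a candidate radius \<open>r\<close> below \<open>\<rho> * \<theta>\<close> fails at any
  real \<open>s\<close> between the two.\<close>

lemma r_ess_ge:
  assumes inf: "\<And>p. cmod p < \<rho> * \<theta> \<Longrightarrow> infinite_mult_eigenvalue (Fb_space \<theta> X k) Lop p"
  shows "\<rho> * \<theta> \<le> r_ess"
proof -
  let ?sp = "spectrum (Fb_space \<theta> X k) (Fb_norm \<theta> X k) Lop"
  let ?A = "{r. 0 \<le> r \<and> (\<forall>z\<in>?sp. r < cmod z \<longrightarrow>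
      isolated_finite_mult_eigenvalue (Fb_space \<theta> X k) (Fb_norm \<theta> X k) Lop z)}"
  have sp: "p \<in> ?sp" if "cmod p < \<rho> * \<theta>" for p
    using inf[OF that] Fb.eigenvalue_in_spectrum[OF Fb_blin] by (auto simp: infinite_mult_eigenvalue_def)
  have 0: "0 \<le> \<rho> * \<theta>" using \<rho>_pos th0 by simp
  have "\<rho> * \<theta> + 1 \<in> ?A" using isolated_above[of "\<rho> * \<theta> + 1"] 0 by auto
  then have ne: "?A \<noteq> {}" by blast
  show ?thesis unfolding ess_spectral_radius_def
  proof (rule cInf_greatest[OF ne])
    fix r assume r: "r \<in> ?A"
    show "\<rho> * \<theta> \<le> r"
    proof (rule ccontr)
      assume "\<not> \<rho> * \<theta> \<le> r"
      then obtain s where s: "r < s" "s < \<rho> * \<theta>" using dense not_le by blast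
      have s0: "0 < s" using r s by simp
      have "isolated_finite_mult_eigenvalue (Fb_space \<theta> X k) (Fb_norm \<theta> X k) Lop (of_real s)"
        using r s s0 sp[of "of_real s"] by simp
      then obtain e where e: "e > 0" "?sp \<inter> cball (of_real s) e = {of_real s}"
        unfolding isolated_finite_mult_eigenvalue_def by blast
      obtain t where t: "s < t" "t < min (\<rho> * \<theta>) (s + e)" using dense[of s "min (\<rho> * \<theta>) (s + e)"] s e by auto
      have "complex_of_real t \<in> ?sp" using t s0 by (intro sp) simp
      moreover have "complex_of_real t \<in> cball (of_real s) e"
      proof -
        have "dist (complex_of_real s) (of_real t) = \<bar>s - t\<bar>" unfolding dist_norm of_real_diff[symmetric] norm_of_real ..
        then show ?thesis using t by simp
      qed
      ultimately have "complex_of_real t \<in> {of_real s}" using e(2) by blast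
      then show False using t by simp
    qed
  qed
qed

section \<open>Construction of seeds\<close>

lemma g0_agree:
  assumes "\<omega> \<in> X" "\<upsilon> \<in> X" "agree k \<omega> \<upsilon>" "0 < g0 \<omega>" shows "0 < g0 \<upsilon>"
proof -
  have "0 < exp (c1 * \<theta> ^ k) * g0 \<upsilon>" using g0_cone[OF order_refl assms(1-3)] assms(4) by linarith
  then show ?thesis by (simp add: zero_less_mult_iff)
qed

text \<open>The operator never evaluates at a point whose first transition is forbidden by
  \<open>M\<close>, so every function supported near such an \<open>\<omega>\<close> is annihilated.
  Depth \<open>Suc k\<close> fixes the transition and, through \<open>g0_agree\<close>, the
  positivity of \<open>g\<close>; disjoint cylinders inside give as many seeds as desired.\<close>

lemma seeds_inadmissible:
  assumes no: "\<not> finite_single_orbit X" and \<omega>: "\<omega> \<in> X" "0 < g0 \<omega>" "M (\<omega> 0) (\<omega> 1) \<noteq> 1"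
  shows "\<exists>F (x :: nat \<Rightarrow> nat \<Rightarrow> 'a). (\<forall>i\<le>N. seed (F i) \<and> x i \<in> X \<and> F i (x i) \<noteq> 0) \<and>
      (\<forall>i\<le>N. \<forall>j\<le>N. i \<noteq> j \<longrightarrow> F i (x j) = 0)"
proof -
  obtain z :: "nat \<Rightarrow> nat \<Rightarrow> 'a" and n where n: "Suc k \<le> n"
    and z: "\<And>i. i \<le> N \<Longrightarrow> z i \<in> X \<and> agree (Suc k) (z i) \<omega>"
    and sep: "\<And>i j. i \<le> N \<Longrightarrow> j \<le> N \<Longrightarrow> agree n (z i) (z j) \<Longrightarrow> i = j"
    by (rule separated_points[OF no \<omega>(1), of "Suc k" N]) blast
  define F where "F i = cind (map (z i) [0..<n])" for i
  have F1: "F i \<upsilon> \<noteq> 0 \<longleftrightarrow> \<upsilon> \<in> X \<and> agree n \<upsilon> (z i)" for i \<upsilon>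
    by (simp add: F_def indicator_def cylinder_map)
  have near: "agree (Suc k) \<omega> \<upsilon>" if "i \<le> N" "F i \<upsilon> \<noteq> 0" for i \<upsilon>
  proof -
    have "agree (Suc k) \<upsilon> (z i)" using that F1 agree_mono[OF _ n] by blast
    then show ?thesis using z[OF that(1)] agree_trans agree_sym by blast
  qed
  have seed: "seed (F i)" if i: "i \<le> N" for i
    unfolding seed_def
  proof (intro conjI ballI impI)
    have b: "\<And>\<upsilon>. cmod (F i \<upsilon>) \<le> 1" by (simp add: F_def indicator_def)
    then show "\<exists>B. bd B (F i)" by (auto simp: bd_def)
    show "\<exists>D. lip 0 D (F i)"
      using lip_level0[OF Fb_lip[OF cind_Fb], of _ 1] b unfolding F_def by blast
    show "F i \<upsilon> = 0" if \<upsilon>: "\<upsilon> \<in> X" "g0 \<upsilon> = 0" for \<upsilon>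
    proof (rule ccontr)
      assume "F i \<upsilon> \<noteq> 0"
      from agree_mono[OF near[OF i this], of k] g0_agree[OF \<omega>(1) \<upsilon>(1) _ \<omega>(2)] \<upsilon>(2) show False by simp
    qed
    show "Lop (\<lambda>\<omega>. g \<omega> * F i \<omega>) \<upsilon> = 0" if \<upsilon>: "\<upsilon> \<in> X" for \<upsilon>
      unfolding Lop_in[OF \<upsilon>]
    proof (rule infsum_0)
      fix a assume a: "a \<in> pre \<upsilon>"
      have "F i (prepend a \<upsilon>) = 0"
      proof (rule ccontr)
        assume "F i (prepend a \<upsilon>) \<noteq> 0"
        from near[OF i this] have "\<omega> 0 = a" "\<omega> 1 = \<upsilon> 0" using k1 by (auto simp: agree_def)
        then show False using a \<omega>(3) by (simp add: pre_def)
      qed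
      then show "of_real (exp (\<phi> (prepend a \<upsilon>))) * (g (prepend a \<upsilon>) * F i (prepend a \<upsilon>)) = 0" by simp
    qed
  qed
  have "F i (z j) = 0" if "i \<le> N" "j \<le> N" "i \<noteq> j" for i j
    using F1[of i "z j"] sep[OF that(2,1)] that(3) by blast
  moreover have "F i (z i) \<noteq> 0" if "i \<le> N" for i using F1 z[OF that] by simp
  ultimately show ?thesis using seed z by (intro exI[of _ F] exI[of _ z]) simp
qed

lemma exp_phi_le_K: "\<omega> \<in> X \<Longrightarrow> exp (\<phi> \<omega>) \<le> K"
  unfolding K_def using finite_sum_le_infsum[OF E_summable, of "{\<omega> 0}"] exp_phi_le[of \<omega>] by (simp add: X_iff)

text \<open>The weight of a point in the sum for \<open>Lop g\<close>, up to the normalising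
  constant of \<open>g\<close>; giving each of two preimages the weight of the other, with opposite
  signs, makes their terms cancel.\<close>

definition H where "H \<omega> = exp (\<phi> \<omega>) * g0 \<omega>"

lemma H_bd: "\<omega> \<in> X \<Longrightarrow> 0 \<le> H \<omega> \<and> H \<omega> \<le> K"
proof -
  assume \<omega>: "\<omega> \<in> X"
  then show ?thesis unfolding H_def using g0_range[OF \<omega>] exp_phi_le_K[OF \<omega>] by (auto intro: mult_le_one order.trans[OF mult_mono])
qed

lemma H_lip: "\<exists>C. lip (k + 1) C H"
proof -
  have "lip (k + 1) (K * \<Phi> * exp \<Phi>) (\<lambda>\<omega>. exp (\<phi> \<omega>))"
    unfolding lip_def
  proof (intro allI impI ballI)
    fix n \<omega> \<upsilon> assume n: "k + 1 \<le> n" and \<omega>: "\<omega> \<in> X" and \<upsilon>: "\<upsilon> \<in> X" and a: "agree n \<omega> \<upsilon>"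
    let ?d = "\<Phi> * \<theta> ^ n"
    have d: "0 \<le> ?d" "?d \<le> \<Phi>" using \<Phi>_nonneg th0 \<theta>_pow_le_1[of n] by (auto intro: mult_left_le)
    have "\<bar>exp (\<phi> \<omega>) - exp (\<phi> \<upsilon>)\<bar> \<le> exp (\<phi> \<upsilon>) * (exp ?d - 1)"
      by (rule exp_diff_le) (use lipD[OF lip_phi n \<omega> \<upsilon> a] in simp)
    also have "\<dots> \<le> K * (?d * exp \<Phi>)"
    proof (rule mult_mono)
      show "exp (\<phi> \<upsilon>) \<le> K" by (rule exp_phi_le_K[OF \<upsilon>])
      have "exp ?d - 1 \<le> ?d * exp ?d" using exp_ge_add_one_self[of "- ?d"] by (simp add: exp_minus field_simps)
      also have "\<dots> \<le> ?d * exp \<Phi>" using d by (intro mult_left_mono) auto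
      finally show "exp ?d - 1 \<le> ?d * exp \<Phi>" .
    qed (use K_pos d in auto)
    finally show "norm (exp (\<phi> \<omega>) - exp (\<phi> \<upsilon>)) \<le> K * \<Phi> * exp \<Phi> * \<theta> ^ n" by (simp add: mult_ac)
  qed
  moreover have "lip (k + 1) (c1 * exp c1) g0" using lip_g0 by (simp add: lip_def)
  moreover have "norm (exp (\<phi> \<omega>)) \<le> K" if "\<omega> \<in> X" for \<omega> using exp_phi_le_K[OF that] by simp
  moreover have "norm (g0 \<omega>) \<le> 1" if "\<omega> \<in> X" for \<omega> using g0_range[OF that] by simp
  ultimately show ?thesis unfolding H_def[abs_def] using lip_mult by blast
qed

text \<open>On the cylinders of \<open>a\<close> and \<open>b'\<close> the seeds are chosen such that the two corresponding
  terms of \<open>L (g F)\<close> cancel.\<close>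

lemma seeds_branching:
  assumes no: "\<not> finite_single_orbit X" and \<omega>: "\<omega> \<in> X" and ab: "a \<in> pre \<omega>" "b' \<in> pre \<omega>" "a \<noteq> b'"
    and pos: "0 < g0 (prepend a \<omega>)" "0 < g0 (prepend b' \<omega>)"
  shows "\<exists>F (x :: nat \<Rightarrow> nat \<Rightarrow> 'a). (\<forall>i\<le>N. seed (F i) \<and> x i \<in> X \<and> F i (x i) \<noteq> 0) \<and>
      (\<forall>i\<le>N. \<forall>j\<le>N. i \<noteq> j \<longrightarrow> F i (x j) = 0)"
proof -
  obtain z :: "nat \<Rightarrow> nat \<Rightarrow> 'a" and n where n: "k \<le> n"
    and z: "\<And>i. i \<le> N \<Longrightarrow> z i \<in> X \<and> agree k (z i) \<omega>"
    and sep: "\<And>i j. i \<le> N \<Longrightarrow> j \<le> N \<Longrightarrow> agree n (z i) (z j) \<Longrightarrow> i = j"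
    by (rule separated_points[OF no \<omega>, of k N]) blast
  define F where "F i \<upsilon> = (if \<upsilon> \<in> X \<and> agree n (shift \<upsilon>) (z i) then
      if \<upsilon> 0 = a then complex_of_real (H (prepend b' (shift \<upsilon>))) else
      if \<upsilon> 0 = b' then - complex_of_real (H (prepend a (shift \<upsilon>))) else 0 else 0)" for i \<upsilon>
  have near: "agree k \<omega> \<upsilon>" if "i \<le> N" "agree n \<upsilon> (z i)" for i \<upsilon>
  proof -
    have "agree k \<upsilon> (z i)" using that agree_mono[OF _ n] by blast
    then show ?thesis using z[OF that(1)] agree_trans agree_sym by blast
  qed
  have pre: "a \<in> pre \<upsilon>" "b' \<in> pre \<upsilon>" if "i \<le> N" "agree n \<upsilon> (z i)" for i \<upsilon>
    using pre_agree[OF near[OF that] k1] ab by auto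
  have gpos: "0 < g0 (prepend c \<upsilon>)" if "i \<le> N" "agree n \<upsilon> (z i)" "\<upsilon> \<in> X" "c = a \<or> c = b'" for i \<upsilon> c
  proof (rule g0_agree)
    show "prepend c \<omega> \<in> X" "prepend c \<upsilon> \<in> X" using pre_X[OF \<omega>] pre_X[OF that(3)] pre[OF that(1,2)] ab that(4) by auto
    show "agree k (prepend c \<omega>) (prepend c \<upsilon>)" by (rule agree_mono[OF agree_prepend[OF near[OF that(1,2)]]]) simp
    show "0 < g0 (prepend c \<omega>)" using pos that(4) by auto
  qed
  have Fb: "cmod (F i \<upsilon>) \<le> K" if "i \<le> N" for i \<upsilon>
    using H_bd[OF pre_X[OF X_shift, of \<upsilon> a]] H_bd[OF pre_X[OF X_shift, of \<upsilon> b']] pre[OF that] K_pos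
    by (auto simp: F_def)
  have seed: "seed (F i)" if i: "i \<le> N" for i
    unfolding seed_def
  proof (intro conjI ballI impI)
    show "\<exists>B. bd B (F i)" using Fb[OF i] by (auto simp: bd_def)
    obtain C where C: "lip (k + 1) C H" using H_lip by blast
    have "lip (n + 1) C (F i)"
      unfolding lip_def
    proof (intro allI impI ballI)
      fix m x y assume m: "n + 1 \<le> m" and x: "x \<in> X" and y: "y \<in> X" and xy: "agree m x y"
      have xy0: "x 0 = y 0" using xy m by (auto simp: agree_def)
      have sh: "agree n (shift x) (shift y)" by (rule agree_shift) (use agree_mono[OF xy m] in simp)
      show "norm (F i x - F i y) \<le> C * \<theta> ^ m"
      proof (cases "agree n (shift x) (z i)")
        case True
        have ty: "agree n (shift y) (z i)" using True sh agree_trans agree_sym by blast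
        have d: "norm (H (prepend c (shift x)) - H (prepend c (shift y))) \<le> C * \<theta> ^ m" if "c = a \<or> c = b'" for c
        proof (rule lipD[OF C])
          show "prepend c (shift x) \<in> X" "prepend c (shift y) \<in> X"
            using that pre[OF i True] pre[OF i ty] pre_X[OF X_shift[OF x]] pre_X[OF X_shift[OF y]] by auto
          obtain m' where m': "m = Suc m'" using m by (cases m) auto
          show "agree m (prepend c (shift x)) (prepend c (shift y))"
            using agree_prepend[OF agree_shift[OF xy[unfolded m']]] unfolding m' .
        qed (use m n in simp)
        have "F i x - F i y = of_real (H (prepend b' (shift x)) - H (prepend b' (shift y)))" if "x 0 = a"
          using that xy0 x y True ty by (simp add: F_def)
        moreover have "F i x - F i y = - of_real (H (prepend a (shift x)) - H (prepend a (shift y)))" if "x 0 = b'"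
          using that xy0 x y True ty ab(3) by (simp add: F_def)
        moreover have "F i x - F i y = 0" if "x 0 \<noteq> a" "x 0 \<noteq> b'"
          using that xy0 by (simp add: F_def)
        moreover have "0 \<le> C * \<theta> ^ m" using lip_nonneg[OF C] by simp
        ultimately show ?thesis using d[of a] d[of b']
          by (cases "x 0 = a"; cases "x 0 = b'") (simp_all only: norm_minus_cancel norm_of_real real_norm_def norm_zero simp_thms)
      next
        case False
        then have "\<not> agree n (shift y) (z i)" using sh agree_trans by blast
        then show ?thesis using False lip_nonneg[OF C] by (simp add: F_def)
      qed
    qed
    from lip_level0[OF this Fb[OF i]] show "\<exists>D. lip 0 D (F i)" by blast
    show "F i \<upsilon> = 0" if \<upsilon>: "\<upsilon> \<in> X" "g0 \<upsilon> = 0" for \<upsilon>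
    proof (rule ccontr)
      assume "F i \<upsilon> \<noteq> 0"
      then have "agree n (shift \<upsilon>) (z i)" "\<upsilon> 0 = a \<or> \<upsilon> 0 = b'" by (auto simp: F_def split: if_splits)
      then have "0 < g0 (prepend (\<upsilon> 0) (shift \<upsilon>))" using gpos[OF i _ X_shift[OF \<upsilon>(1)]] by blast
      then show False using \<upsilon>(2) by simp
    qed
    show "Lop (\<lambda>\<omega>. g \<omega> * F i \<omega>) \<upsilon> = 0" if \<upsilon>: "\<upsilon> \<in> X" for \<upsilon>
    proof (cases "agree n \<upsilon> (z i)")
      case True
      note p = pre[OF i True]
      let ?t = "\<lambda>c. of_real (exp (\<phi> (prepend c \<upsilon>))) * (g (prepend c \<upsilon>) * F i (prepend c \<upsilon>))"
      have Fv: "F i (prepend a \<upsilon>) = H (prepend b' \<upsilon>)" "F i (prepend b' \<upsilon>) = - H (prepend a \<upsilon>)"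
        using True pre_X[OF \<upsilon>] p ab(3) by (simp_all add: F_def)
      have "Lop (\<lambda>\<omega>. g \<omega> * F i \<omega>) \<upsilon> = (\<Sum>\<^sub>\<infinity>c\<in>{a, b'}. ?t c)"
        unfolding Lop_in[OF \<upsilon>] by (rule infsum_cong_neutral) (use p in \<open>auto simp: F_def\<close>)
      also have "\<dots> = ?t a + ?t b'" using ab(3) by simp
      also have "\<dots> = 0" unfolding Fv H_def g_def by simp
      finally show ?thesis .
    next
      case False
      then show ?thesis unfolding Lop_in[OF \<upsilon>] by (intro infsum_0) (simp add: F_def)
    qed
  qed
  have zX: "prepend a (z i) \<in> X" "F i (prepend a (z i)) \<noteq> 0" if i: "i \<le> N" for i
  proof -
    note p = pre[OF i agree_refl]
    show x: "prepend a (z i) \<in> X" using pre_X[OF _ p(1)] z[OF i] by blast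
    have "0 < g0 (prepend b' (z i))" using gpos[OF i agree_refl] z[OF i] by blast
    then show "F i (prepend a (z i)) \<noteq> 0" using x by (simp add: F_def H_def)
  qed
  have "F i (prepend a (z j)) = 0" if "i \<le> N" "j \<le> N" "i \<noteq> j" for i j
    using sep[OF that(2,1)] that(3) by (auto simp: F_def)
  then show ?thesis using seed zX by (intro exI[of _ F] exI[of _ "\<lambda>i. prepend a (z i)"]) simp
qed

text \<open>If neither construction applies, then \<open>g\<close> is positive on \<open>X\<close>, all transitions of \<open>A\<close> are
  transitions of \<open>M\<close>, and every letter has only one predecessor.\<close>

lemma seeds_exist:
  assumes no: "\<not> finite_single_orbit X"
  shows "\<exists>F (x :: nat \<Rightarrow> nat \<Rightarrow> 'a). (\<forall>i\<le>N. seed (F i) \<and> x i \<in> X \<and> F i (x i) \<noteq> 0) \<and>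
      (\<forall>i\<le>N. \<forall>j\<le>N. i \<noteq> j \<longrightarrow> F i (x j) = 0)"
proof (rule ccontr)
  assume none: "\<not> ?thesis"
  have adm: "M (\<omega> 0) (\<omega> 1) = 1" if "\<omega> \<in> X" "0 < g0 \<omega>" for \<omega>
    using seeds_inadmissible[OF no that, of N] none by blast
  have uniq: "a = c" if "\<omega> \<in> X" "a \<in> pre \<omega>" "c \<in> pre \<omega>" "0 < g0 (prepend a \<omega>)" "0 < g0 (prepend c \<omega>)" for \<omega> a c
    using seeds_branching[OF no that(1-3) _ that(4,5), of N] none by blast
  have fwd: "0 < g0 ((shift ^^ j) \<omega>)" if "\<omega> \<in> X" "0 < g0 \<omega>" for \<omega> j
  proof (induction j)
    case (Suc j)
    have "(shift ^^ j) \<omega> \<in> X" by (rule X_shift_pow[OF that(1)])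
    then show ?case using g0_forward[OF _ Suc adm[OF _ Suc]] by simp
  qed (use that in simp)
  obtain \<omega> where \<omega>: "\<omega> \<in> X" "0 < g0 \<omega>" using g0_nonzero by blast
  \<comment> \<open>Positivity spreads from \<open>\<omega>\<close> over its cylinder of depth
    \<open>k\<close>, and every point is a shift of a point of that cylinder; \<open>fwd\<close>
    carries positivity along, since all transitions on the way are admissible by
    \<open>adm\<close>.\<close>
  have pos: "0 < g0 \<upsilon>" if \<upsilon>: "\<upsilon> \<in> X" for \<upsilon>
  proof -
    obtain z j where z: "z \<in> X" "agree k z \<omega>" "(shift ^^ j) z = \<upsilon>" by (rule reach_point[OF \<omega>(1) \<upsilon>])
    have "0 < g0 z" by (rule g0_agree[OF \<omega>(1) z(1) agree_sym[OF z(2)] \<omega>(2)])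
    from fwd[OF z(1) this, of j] show ?thesis unfolding z(3) .
  qed
  have "finite_single_orbit X"
  proof (rule co_deterministic_orbit)
    fix s s' t assume s: "s \<in> S" "s' \<in> S" "t \<in> S" "A s t = 1" "A s' t = 1"
    obtain \<eta> where \<eta>: "\<eta> \<in> X" "\<eta> 0 = t" using cylinder_ne[OF s(3)] by blast
    have p: "prepend s \<eta> \<in> X" "prepend s' \<eta> \<in> X" using X_prepend[OF \<eta>(1)] s \<eta>(2) by auto
    have "s \<in> pre \<eta>" "s' \<in> pre \<eta>" using adm[OF p(1) pos[OF p(1)]] adm[OF p(2) pos[OF p(2)]] s by (auto simp: pre_def)
    then show "s = s'" using uniq[OF \<eta>(1)] pos p by blast
  qed
  with no show False by blast
qed

lemma infinite_multiplicity_disc: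
  "\<not> finite_single_orbit X \<Longrightarrow> cmod p < \<rho> * \<theta> \<Longrightarrow> infinite_mult_eigenvalue (Fb_space \<theta> X k) Lop p"
  by (rule infinite_multiplicity[OF seeds_exist])

end

theorem theorem3p1:
  fixes S S0 :: "'s set"
    and A M :: "'s \<Rightarrow> 's \<Rightarrow> nat"
    and \<theta> :: real
    and \<phi> :: "(nat \<Rightarrow> 's) \<Rightarrow> real"
    and k :: nat
  defines "X \<equiv> markov_shift S A"
    and "XM \<equiv> markov_shift S0 M"
  defines "L \<equiv> transfer_op S X M \<phi>"
    and "Cb \<equiv> Cb_space \<theta> X"
    and "Fb \<equiv> Fb_space \<theta> X k"
    and "c1 \<equiv> enn2real (theta_seminorm \<theta> X (k + 1) \<phi>) * \<theta> / (1 - \<theta>)"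
  assumes "countable S"
    and "0 < \<theta>" and "\<theta> < 1"
    and "zero_one_matrix S A"
    and "S0 \<subseteq> S" and "S0 \<noteq> {}"
    and "zero_one_matrix S0 M"
    and "\<forall>i\<in>S0. \<forall>j\<in>S0. M i j \<le> A i j"
    and "\<forall>i j. i \<notin> S0 \<or> j \<notin> S0 \<longrightarrow> M i j = 0"
    and "irreducible_matrix S A"
    and "has_periodic_point XM"
    and "1 \<le> k"
    and "summable_potential S X \<phi>"
    and "theta_seminorm \<theta> X (k + 1) \<phi> < \<infinity>"
  shows "\<exists>lam g \<nu>.
      (lam = exp (pressure S XM \<phi>) \<and> 0 < lam \<and>
       spectral_radius Fb (Fb_norm \<theta> X k) L = lam \<and>
       spectral_radius Cb (sup_norm X) L = lam) \<and>
      (g \<in> Lambda_cone \<theta> X k c1 \<and> sup_norm X g = 1 \<and> L g = cscale (of_real lam) g) \<and>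
      (borel_probability \<theta> X \<nu> \<and> measure \<nu> XM = 1 \<and>
       (\<forall>f\<in>Cb. (\<integral>\<omega>. L f \<omega> \<partial>\<nu>) = of_real lam * (\<integral>\<omega>. f \<omega> \<partial>\<nu>))) \<and>
      (\<not> finite_single_orbit X \<longrightarrow>
        lam * \<theta> \<le> ess_spectral_radius Fb (Fb_norm \<theta> X k) L \<and>
        ess_spectral_radius Fb (Fb_norm \<theta> X k) L < lam \<and>
        (\<exists>E. countable E \<and>
          (\<forall>r\<in>{0..<lam * \<theta>} - E. \<forall>p. cmod p = r \<longrightarrow> infinite_mult_eigenvalue Fb L p))) \<and>
      (finite_single_orbit X \<longrightarrow> ess_spectral_radius Fb (Fb_norm \<theta> X k) L = 0)"
proof -
  interpret ts: transfer_setup S S0 A M \<theta> \<phi> k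
    by unfold_locales (use assms in \<open>simp_all add: X_def XM_def\<close>)
  obtain xs us where lim: "\<And>i. ts.\<rho> < xs i" "xs \<longlonglongrightarrow> ts.\<rho>" "\<And>i. us i \<in> ts.X"
    "(\<lambda>i. 1 / ts.Rx (xs i) (\<lambda>_. 1) (us i)) \<longlonglongrightarrow> (0::real)"
    "\<And>w. w \<in> lists S \<Longrightarrow> convergent (\<lambda>i. ts.ell (xs i) (us i) (indicator (cylinder ts.X w) :: _ \<Rightarrow> real))"
    "\<And>w. w \<in> lists S \<Longrightarrow> cylinder ts.X w \<noteq> {} \<Longrightarrow> convergent (\<lambda>i. ts.Gam (xs i) (ts.rep w))"
    using ts.limit_data by blast
  interpret tl: transfer_limit S S0 A M \<theta> \<phi> k xs us
    by unfold_locales (rule lim, assumption?)+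
  have X: "X = ts.X" and XM: "XM = ts.XM" by (simp_all add: X_def XM_def ts.X_def ts.XM_def)
  have L: "L = ts.Lop" unfolding L_def X by (rule ts.transfer_op_eq)
  have c1: "c1 = ts.c1" by (simp add: c1_def ts.c1_def ts.\<Phi>_def X)
  have fin: "finite ts.X" if "finite_single_orbit ts.X"
    using that by (auto simp: finite_single_orbit_def)
  show ?thesis
    unfolding Cb_def Fb_def L c1 unfolding X XM
  proof (intro exI[of _ ts.\<rho>] exI[of _ tl.g] exI[of _ tl.nu] conjI impI ballI)
    show "ts.\<rho> = exp (pressure S ts.XM \<phi>)" by (rule tl.pressure_eq[symmetric])
    assume no: "\<not> finite_single_orbit ts.X"
    note inf = tl.infinite_multiplicity_disc[OF no]
    show "ts.\<rho> * \<theta> \<le> ess_spectral_radius (Fb_space \<theta> ts.X k) (Fb_norm \<theta> ts.X k) ts.Lop"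
      by (rule tl.r_ess_ge[OF inf])
    show "\<exists>E. countable E \<and> (\<forall>r\<in>{0..<ts.\<rho> * \<theta>} - E. \<forall>p. cmod p = r \<longrightarrow>
        infinite_mult_eigenvalue (Fb_space \<theta> ts.X k) ts.Lop p)"
      \<comment> \<open>The construction reaches every \<open>p\<close> in the open disc, zero
        included, so the empty set serves as the exceptional set.\<close>
      using inf by (intro exI[of _ "{}"]) simp
  qed (use ts.\<rho>_pos tl.spectral_radius_Fb tl.spectral_radius_Cb tl.g_cone tl.sup_norm_g tl.Lop_g
      tl.nu_borel_probability tl.nu_XM tl.eigenmeasure tl.r_ess_less tl.r_ess_finite[OF fin] in blast)+
qed

end
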